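(* Let $d\ge 2$ and let $\pi\in S_d$ be an irreducible permutation. For Lebesgue almost every lengths vector $\underline\lambda\in\Delta_{d-1}$ the following holds for the interval exchange transformation $T=(\underline\lambda,\pi)$: for every roof function $f$ having a single asymmetric logarithmic singularity at the origin, the suspension flow $\{\varphi_t\}_{t\in\mathbb{R}}$ built over $T$ with the help of the roof function $f$ is mixing, i.e. $\lim_{t\to\infty}\mu(\varphi_t(A)\cap B)=\mu(A)\mu(B)$ for each pair of measurable sets $A,B\subset X_f$.
   Context: $\Delta_{d-1}=\{\underline\lambda\in\mathbb{R}^d:\lambda_i>0,\ \sum_i\lambda_i=1\}$. For $\pi\in S_d$ and $\underline\lambda\in\Delta_{d-1}$, the interval exchange transformation (IET) $T=(\underline\lambda,\pi)$ acts on $I^{(0)}=[0,1)$: divide $[0,1)$ into consecutive intervals $I^{(0)}_1,\dots,I^{(0)}_d$ (closed on the left, open on the right) with $|I^{(0)}_j|=\lambda_j$; $T$ translates each $I^{(0)}_j$ so that the images appear from left to right in the order $I^{(0)}_{\pi^{-1}(1)},\dots,I^{(0)}_{\pi^{-1}(d)}$. The permutation $\pi$ is irreducible if $\pi(\{1,\dots,i\})=\{1,\dots,i\}$ implies $i=d$. Roof function: $f\in L^1(I^{(0)},dx)$, $f\ge m_f>0$ for a constant $m_f$, $\int_{I^{(0)}}f(x)\,dx=1$. It has a single asymmetric logarithmic singularity at the origin if $f\in C^2((0,1))$ and there are constants $C^+>0$, $C^->0$, $C^+\ne C^-$, with $\lim_{x\to0^+}x^2f''(x)=C^+$ and $\lim_{x\to1^-}(1-x)^2f''(x)=C^-$.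 Suspension flow: $X_f=\{(x,y): x\in I^{(0)},\ 0\le y<f(x)\}$, $\mu$ is the restriction of Lebesgue measure $dx\,dy$ to $X_f$ (a probability measure). The flow $\varphi_t$ is the one-parameter group of $\mu$-preserving transformations generated by $\varphi_t(x,y)=(x,y+t)$ if $0\le y+t<f(x)$ and $\varphi_{f(x)}(x,0)=(Tx,0)$. *)

theory Defs
  imports "HOL-Analysis.Analysis" "HOL-Combinatorics.Permutations"
begin

section \<open>Length vectors and Lebesgue measure on the simplex\<close>

text \<open>Vectors of \<open>\<real>\<^sup>d\<close> are extensional functions on \<open>{1..d}\<close>.\<close>

definition length_simplex :: "nat \<Rightarrow> (nat \<Rightarrow> real) set" where
  "length_simplex d =
     {l \<in> {1..d} \<rightarrow>\<^sub>E UNIV. (\<forall>i\<in>{1..d}. l i > 0) \<and> (\<Sum>i\<in>{1..d}. l i) = 1}"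

text \<open>
  Lebesgue measure on the \<open>(d-1)\<close>-dimensional simplex is transported from \<open>\<real>\<^sup>d\<^sup>-\<^sup>1\<close> by the
  affine chart that recovers the last coordinate from the first \<open>d - 1\<close>.  It agrees with the
  surface measure up to a positive constant factor, so both have the same null sets.
\<close>

definition simplex_chart :: "nat \<Rightarrow> (nat \<Rightarrow> real) \<Rightarrow> nat \<Rightarrow> real" where
  "simplex_chart d x = x(d := 1 - (\<Sum>i\<in>{1..<d}. x i))"

definition chart_domain :: "nat \<Rightarrow> (nat \<Rightarrow> real) set" where
  "chart_domain d =
     {x \<in> {1..<d} \<rightarrow>\<^sub>E UNIV. (\<forall>i\<in>{1..<d}. x i > 0) \<and> (\<Sum>i\<in>{1..<d}. x i) < 1}"

definition simplex_lebesgue :: "nat \<Rightarrow> (nat \<Rightarrow> real) measure" where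
  "simplex_lebesgue d =
     distr (restrict_space (\<Pi>\<^sub>M i\<in>{1..<d}. lborel) (chart_domain d))
           (restrict_space (\<Pi>\<^sub>M i\<in>{1..d}. borel) (length_simplex d))
           (simplex_chart d)"


section \<open>Interval exchange transformations\<close>

definition irreducible_perm :: "nat \<Rightarrow> (nat \<Rightarrow> nat) \<Rightarrow> bool" where
  "irreducible_perm d \<pi> \<longleftrightarrow> (\<forall>i\<in>{1..d}. \<pi> ` {1..i} = {1..i} \<longrightarrow> i = d)"

definition iet_left :: "(nat \<Rightarrow> real) \<Rightarrow> nat \<Rightarrow> real" where
  "iet_left l j = (\<Sum>i\<in>{1..<j}. l i)"

definition iet_interval :: "(nat \<Rightarrow> real) \<Rightarrow> nat \<Rightarrow> real set" where
  "iet_interval l j = {iet_left l j ..< iet_left l j + l j}"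

text \<open>
  The image of the \<open>j\<close>-th interval stands at position \<open>\<pi> j\<close> among the images, so to its left lie
  exactly the images of the intervals with index \<open>i\<close> such that \<open>\<pi> i < \<pi> j\<close>.
\<close>

definition iet_image_left :: "nat \<Rightarrow> (nat \<Rightarrow> real) \<Rightarrow> (nat \<Rightarrow> nat) \<Rightarrow> nat \<Rightarrow> real" where
  "iet_image_left d l \<pi> j = (\<Sum>i | i \<in> {1..d} \<and> \<pi> i < \<pi> j. l i)"

text \<open>Only the values on \<open>{0..<1}\<close> are meaningful.\<close>

definition iet :: "nat \<Rightarrow> (nat \<Rightarrow> real) \<Rightarrow> (nat \<Rightarrow> nat) \<Rightarrow> real \<Rightarrow> real" where
  "iet d l \<pi> x =
     (let j = (THE j. j \<in> {1..d} \<and> x \<in> iet_interval l j)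
      in x - iet_left l j + iet_image_left d l \<pi> j)"


section \<open>Roof functions\<close>

definition roof_function :: "(real \<Rightarrow> real) \<Rightarrow> bool" where
  "roof_function f \<longleftrightarrow>
     set_integrable lebesgue {0..<1} f \<and>
     (\<exists>m>0. \<forall>x\<in>{0..<1}. f x \<ge> m) \<and>
     (LINT x:{0..<1}|lebesgue. f x) = 1"

text \<open>To be used for open \<open>S\<close> only.\<close>

definition C2_on :: "(real \<Rightarrow> real) \<Rightarrow> real set \<Rightarrow> bool" where
  "C2_on f S \<longleftrightarrow>
     (\<forall>x\<in>S. f differentiable (at x)) \<and>
     (\<forall>x\<in>S. deriv f differentiable (at x)) \<and>
     continuous_on S (deriv (deriv f))"

definition asym_log_singularity :: "(real \<Rightarrow> real) \<Rightarrow> bool" where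
  "asym_log_singularity f \<longleftrightarrow>
     C2_on f {0<..<1} \<and>
     (\<exists>Cp Cm. Cp > 0 \<and> Cm > 0 \<and> Cp \<noteq> Cm \<and>
        ((\<lambda>x. x\<^sup>2 * deriv (deriv f) x) \<longlongrightarrow> Cp) (at_right 0) \<and>
        ((\<lambda>x. (1 - x)\<^sup>2 * deriv (deriv f) x) \<longlongrightarrow> Cm) (at_left 1))"


section \<open>Suspension flows\<close>

definition suspension_space :: "(real \<Rightarrow> real) \<Rightarrow> (real \<times> real) set" where
  "suspension_space f = {(x, y). x \<in> {0..<1} \<and> 0 \<le> y \<and> y < f x}"

definition suspension_measure :: "(real \<Rightarrow> real) \<Rightarrow> (real \<times> real) measure" where
  "suspension_measure f = lebesgue_on (suspension_space f)"

text \<open>Two-sided iterates and Birkhoff sums of a bijection of \<open>{0..<1}\<close>.\<close>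

definition int_iterate :: "(real \<Rightarrow> real) \<Rightarrow> int \<Rightarrow> real \<Rightarrow> real" where
  "int_iterate T n x =
     (if n \<ge> 0 then (T ^^ nat n) x else ((inv_into {0..<1} T) ^^ nat (- n)) x)"

definition birkhoff_sum :: "(real \<Rightarrow> real) \<Rightarrow> (real \<Rightarrow> real) \<Rightarrow> int \<Rightarrow> real \<Rightarrow> real" where
  "birkhoff_sum T f n x =
     (if n \<ge> 0 then (\<Sum>k\<in>{0..<n}. f (int_iterate T k x))
      else - (\<Sum>k\<in>{n..<0}. f (int_iterate T k x)))"

text \<open>
  A point moves up at unit speed, and each passage through the roof applies \<open>T\<close> to the base
  coordinate; after time \<open>t\<close> the number of passages (negative for backward passages) is the unique
  \<open>n\<close> below.  The lemmas \<open>suspension_flow_zero\<close>, \<open>suspension_flow_add\<close>, \<open>suspension_flow_vertical\<close>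
  and \<open>suspension_flow_roof\<close> of locale \<open>suspension_data\<close> show that this is the one-parameter group generated by the vertical
  motion and the identification of \<open>(x, f x)\<close> with \<open>(T x, 0)\<close>, and \<open>suspension_flow_unique\<close> shows
  that no other family has these properties.
\<close>

definition suspension_flow ::
    "(real \<Rightarrow> real) \<Rightarrow> (real \<Rightarrow> real) \<Rightarrow> real \<Rightarrow> real \<times> real \<Rightarrow> real \<times> real" where
  "suspension_flow T f t = (\<lambda>(x, y).
     let n = (THE n. birkhoff_sum T f n x \<le> y + t \<and> y + t < birkhoff_sum T f (n + 1) x)
     in (int_iterate T n x, y + t - birkhoff_sum T f n x))"

definition mixing_flow :: "'a measure \<Rightarrow> (real \<Rightarrow> 'a \<Rightarrow> 'a) \<Rightarrow> bool" where
  "mixing_flow M \<phi> \<longleftrightarrow>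
     (\<forall>A\<in>sets M. \<forall>B\<in>sets M.
        ((\<lambda>t. measure M (\<phi> t ` A \<inter> B)) \<longlongrightarrow> measure M A * measure M B) at_top)"


section \<open>Consistency of the definitions\<close>

subsection \<open>The suspension flow\<close>

locale suspension_data =
  fixes T f :: "real \<Rightarrow> real" and m :: real
  assumes bij: "bij_betw T {0..<1} {0..<1}"
    and m_pos: "m > 0"
    and f_ge: "\<And>x. x \<in> {0..<1} \<Longrightarrow> f x \<ge> m"
begin

abbreviation "It \<equiv> int_iterate T"
abbreviation "S \<equiv> birkhoff_sum T f"
abbreviation "Ti \<equiv> inv_into {0..<1} T"

lemma Ti_in: "x \<in> {0..<1} \<Longrightarrow> Ti x \<in> {0..<1}"
  using bij by (metis bij_betw_imp_surj_on inv_into_into)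

lemma T_Ti: "x \<in> {0..<1} \<Longrightarrow> T (Ti x) = x"
  using bij by (simp add: bij_betw_imp_surj_on f_inv_into_f)

lemma T_in: "x \<in> {0..<1} \<Longrightarrow> T x \<in> {0..<1}"
  using bij by (rule bij_betwE[THEN bspec])

lemma Ti_funpow_in: "x \<in> {0..<1} \<Longrightarrow> (Ti ^^ k) x \<in> {0..<1}"
proof (induction k)
  case (Suc k)
  then show ?case using Ti_in by (metis comp_apply funpow.simps(2))
qed simp

lemma It_in: assumes "x \<in> {0..<1}" shows "It n x \<in> {0..<1}"
proof -
  have "(T ^^ k) x \<in> {0..<1}" for k
    by (induction k) (use assms T_in in auto)
  then show ?thesis using Ti_funpow_in[OF assms] by (simp add: int_iterate_def)
qed

lemma It_0: "It 0 x = x" by (simp add: int_iterate_def)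

lemma It_step: assumes x: "x \<in> {0..<1}" shows "It (n + 1) x = T (It n x)"
proof (cases "n \<ge> 0")
  case True
  then have "nat (n + 1) = Suc (nat n)" by simp
  with True show ?thesis by (simp add: int_iterate_def del: nat_1_add_1)
next
  case False
  define k where "k = nat (- n - 1)"
  have n: "n = - int (Suc k)" using False by (simp add: k_def)
  have "(Ti ^^ k) x \<in> {0..<1}"
    using Ti_funpow_in[OF x] .
  then have "T (It n x) = (Ti ^^ k) x"
    unfolding n using T_Ti by (simp add: int_iterate_def nat_add_distrib)
  moreover have "It (n + 1) x = (Ti ^^ k) x"
    by (cases k) (simp_all add: n int_iterate_def nat_add_distrib)
  ultimately show ?thesis by simp
qed

lemma S_0: "S 0 x = 0" by (simp add: birkhoff_sum_def)

lemma S_step: "S (n + 1) x = S n x + f (It n x)"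
proof (cases "n \<ge> 0")
  case True
  then have "{0..<n + 1} = insert n {0..<n}" by auto
  with True show ?thesis by (simp add: birkhoff_sum_def)
next
  case False
  then have "{n..<0} = insert n {n + 1..<0}" by auto
  with False show ?thesis by (auto simp: birkhoff_sum_def)
qed

lemma cocycle:
  assumes x: "x \<in> {0..<1}"
  shows "It (n + k) x = It n (It k x) \<and> S (n + k) x = S k x + S n (It k x)"
proof (induction n rule: int_induct[where k = 0])
  case base
  then show ?case by (simp add: It_0 S_0)
next
  case (step1 i)
  have "i + 1 + k = (i + k) + 1" by simp
  then show ?case using step1
    by (simp only: It_step[OF x] It_step[OF It_in[OF x]] S_step) simp
next
  case (step2 i)
  have e: "It (i + k) x = T (It (i - 1 + k) x)" "S (i + k) x = S (i - 1 + k) x + f (It (i - 1 + k) x)"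
    using It_step[OF x, of "i - 1 + k"] S_step[of "i - 1 + k" x] by (simp_all add: algebra_simps)
  have e': "It i (It k x) = T (It (i - 1) (It k x))"
      "S i (It k x) = S (i - 1) (It k x) + f (It (i - 1) (It k x))"
    using It_step[OF It_in[OF x], of "i - 1"] S_step[of "i - 1" "It k x"] by simp_all
  have "It (i - 1 + k) x = It (i - 1) (It k x)"
    using bij e(1) e'(1) step2 It_in[OF x] It_in[OF It_in[OF x]]
    by (metis bij_betw_inv_into_left)
  then show ?case using e(2) e'(2) step2 by simp
qed

lemma S_mono: assumes x: "x \<in> {0..<1}" and "n \<le> k" shows "S k x \<ge> S n x + m * of_int (k - n)"
  using \<open>n \<le> k\<close>
proof (induction k rule: int_ge_induct)
  case (step i)
  then show ?case using f_ge[OF It_in[OF x, of i]] S_step[of i x] by (simp add: algebra_simps)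
qed simp

lemma level_unique:
  assumes x: "x \<in> {0..<1}"
  shows "\<exists>!n. S n x \<le> u \<and> u < S (n + 1) x"
proof -
  have bound: "n \<le> max 0 \<lfloor>u / m\<rfloor>" if "S n x \<le> u" for n
  proof (cases "n \<ge> 0")
    case True
    have "of_int n * m \<le> u" using S_mono[OF x True] that by (simp add: S_0 mult.commute)
    then have "of_int n \<le> u / m" using m_pos by (simp add: field_simps)
    then show ?thesis by (simp add: le_floor_iff max_def)
  qed simp
  define n0 where "n0 = min 0 \<lfloor>u / m\<rfloor>"
  have "of_int n0 \<le> u / m" unfolding n0_def by linarith
  then have "m * of_int n0 \<le> u" using m_pos by (simp add: field_simps)
  moreover have "S n0 x \<le> m * of_int n0"
    using S_mono[OF x, of n0 0] by (simp add: S_0 n0_def algebra_simps)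
  ultimately have n0: "S n0 x \<le> u" by simp
  define A where "A = {n. n0 \<le> n \<and> S n x \<le> u}"
  have fin: "finite A"
    by (rule finite_subset[of _ "{n0..max 0 \<lfloor>u / m\<rfloor>}"]) (use bound in \<open>auto simp: A_def\<close>)
  have ne: "n0 \<in> A" using n0 by (simp add: A_def)
  define n where "n = Max A"
  have nA: "n \<in> A" unfolding n_def using fin ne by (intro Max_in) auto
  have "n + 1 \<notin> A"
  proof
    assume "n + 1 \<in> A"
    then have "n + 1 \<le> n" unfolding n_def using fin by (intro Max_ge)
    then show False by simp
  qed
  then have ex: "S n x \<le> u \<and> u < S (n + 1) x" using nA by (auto simp: A_def)
  have smono: "S i x \<le> S j x" if "i \<le> j" for i j
    using S_mono[OF x that] m_pos that by (smt (verit) mult_nonneg_nonneg of_int_nonneg)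
  show ?thesis
  proof (rule ex1I, rule ex)
    fix k assume k: "S k x \<le> u \<and> u < S (k + 1) x"
    show "k = n"
    proof (rule ccontr)
      assume "k \<noteq> n"
      then consider "k + 1 \<le> n" | "n + 1 \<le> k" by linarith
      then show False using smono ex k by cases fastforce+
    qed
  qed
qed

lemma flow_eq:
  assumes x: "x \<in> {0..<1}" and "S n x \<le> y + t" "y + t < S (n + 1) x"
  shows "suspension_flow T f t (x, y) = (It n x, y + t - S n x)"
proof -
  have "(THE n. S n x \<le> y + t \<and> y + t < S (n + 1) x) = n"
    using level_unique[OF x] assms by (intro the1_equality) auto
  then show ?thesis by (simp add: suspension_flow_def)
qed

lemma suspension_flow_vertical:
  assumes "(x, y) \<in> suspension_space f" "0 \<le> y + t" "y + t < f x"
  shows "suspension_flow T f t (x, y) = (x, y + t)"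
  using flow_eq[of x 0 y t] S_step[of 0 x] assms
  by (auto simp: suspension_space_def S_0 It_0)

lemma suspension_flow_roof:
  assumes x: "x \<in> {0..<1}"
  shows "suspension_flow T f (f x) (x, 0) = (T x, 0)"
proof -
  have "f (T x) > 0" using f_ge[OF T_in[OF x]] m_pos by simp
  moreover have "It 1 x = T x" "S 1 x = f x" "S (1 + 1) x = f x + f (T x)"
    using It_step[OF x, of 0] S_step[of 0 x] S_step[of 1 x] by (simp_all add: It_0 S_0)
  ultimately show ?thesis using flow_eq[OF x, of 1 0 "f x"] by simp
qed

lemma suspension_flow_zero:
  "p \<in> suspension_space f \<Longrightarrow> suspension_flow T f 0 p = p"
  using suspension_flow_vertical by (cases p) (auto simp: suspension_space_def)

lemma suspension_flow_in:
  assumes "p \<in> suspension_space f"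
  shows "suspension_flow T f t p \<in> suspension_space f"
proof -
  obtain x y where p: "p = (x, y)" "x \<in> {0..<1}" using assms by (auto simp: suspension_space_def)
  obtain n where "S n x \<le> y + t" "y + t < S (n + 1) x" using level_unique[OF p(2)] by blast
  then show ?thesis
    using flow_eq[OF p(2)] It_in[OF p(2), of n] S_step[of n x]
    by (simp add: p suspension_space_def)
qed

lemma suspension_flow_add:
  assumes "p \<in> suspension_space f"
  shows "suspension_flow T f (s + t) p = suspension_flow T f s (suspension_flow T f t p)"
proof -
  obtain x y where p: "p = (x, y)" "x \<in> {0..<1}" using assms by (auto simp: suspension_space_def)
  obtain n where n: "S n x \<le> y + t" "y + t < S (n + 1) x" using level_unique[OF p(2)] by blast
  obtain k where k: "S k (It n x) \<le> y + t - S n x + s" "y + t - S n x + s < S (k + 1) (It n x)"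
    using level_unique[OF It_in[OF p(2)]] by blast
  have "suspension_flow T f s (suspension_flow T f t p) = (It k (It n x), y + t - S n x + s - S k (It n x))"
    using flow_eq[OF p(2) n] flow_eq[OF It_in[OF p(2)] k] by (simp add: p)
  moreover have "S (k + n + 1) x = S n x + S (k + 1) (It n x)"
    using cocycle[OF p(2), of "k + 1" n] by (simp add: algebra_simps)
  then have "suspension_flow T f (s + t) p = (It (k + n) x, y + (s + t) - S (k + n) x)"
    unfolding p(1) using cocycle[OF p(2), of k n] k by (intro flow_eq[OF p(2)]) auto
  ultimately show ?thesis using cocycle[OF p(2), of k n] by simp
qed

lemma suspension_flow_unique:
  fixes \<phi> :: "real \<Rightarrow> real \<times> real \<Rightarrow> real \<times> real"
  assumes add: "\<And>s t p. p \<in> suspension_space f \<Longrightarrow> \<phi> (s + t) p = \<phi> s (\<phi> t p)"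
    and vert: "\<And>x y t. (x, y) \<in> suspension_space f \<Longrightarrow> 0 \<le> y + t \<Longrightarrow> y + t < f x
                 \<Longrightarrow> \<phi> t (x, y) = (x, y + t)"
    and roof: "\<And>x. x \<in> {0..<1} \<Longrightarrow> \<phi> (f x) (x, 0) = (T x, 0)"
    and p: "p \<in> suspension_space f"
  shows "\<phi> t p = suspension_flow T f t p"
proof -
  have bottom: "(x, 0) \<in> suspension_space f" if "x \<in> {0..<1}" for x
    using f_ge[OF that] m_pos that by (simp add: suspension_space_def)
  have zero: "\<phi> 0 q = q" if "q \<in> suspension_space f" for q
    using that vert[of "fst q" "snd q" 0] by (auto simp: suspension_space_def)
  have S1: "\<phi> (S n x) (x, 0) = (It n x, 0)" if x: "x \<in> {0..<1}" for n x
  proof (induction n rule: int_induct[where k = 0])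
    case base
    show ?case using zero[OF bottom[OF x]] by (simp add: It_0 S_0)
  next
    case (step1 i)
    show ?case
      using add[OF bottom[OF x], of "f (It i x)" "S i x"] step1 roof[OF It_in[OF x, of i]]
      by (simp only: S_step It_step[OF x] add.commute[of "f (It i x)"])
  next
    case (step2 i)
    define z where "z = It (i - 1) x"
    have z: "z \<in> {0..<1}" "T z = It i x" "S (i - 1) x = - f z + S i x"
      using It_in[OF x] It_step[OF x, of "i - 1"] S_step[of "i - 1" x] by (simp_all add: z_def)
    have "\<phi> (S (i - 1) x) (x, 0) = \<phi> (- f z) (T z, 0)"
      unfolding z(3) add[OF bottom[OF x]] step2 z(2) ..
    also have "\<dots> = \<phi> (- f z + f z) (z, 0)"
      unfolding add[OF bottom[OF z(1)]] roof[OF z(1)] ..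
    finally show ?case using zero[OF bottom[OF z(1)]] by (simp add: z_def)
  qed
  obtain x y where xy: "p = (x, y)" "x \<in> {0..<1}" "0 \<le> y" "y < f x"
    using p by (auto simp: suspension_space_def)
  obtain n where n: "S n x \<le> y + t" "y + t < S (n + 1) x" using level_unique[OF xy(2)] by blast
  have "\<phi> t p = \<phi> (t + y) (x, 0)"
    using add[OF bottom[OF xy(2)], of t y] vert[OF bottom[OF xy(2)], of y] xy by simp
  also have "\<dots> = \<phi> (t + y - S n x) (It n x, 0)"
    using add[OF bottom[OF xy(2)], of "t + y - S n x" "S n x"] S1[OF xy(2)] by simp
  also have "\<dots> = (It n x, y + t - S n x)"
    using vert[OF bottom[OF It_in[OF xy(2)]], of "t + y - S n x" n] n S_step[of n x]
    by (simp add: algebra_simps)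
  finally show ?thesis using flow_eq[OF xy(2) n] xy by simp
qed

end


subsection \<open>Interval exchange transformations permute the unit interval\<close>

lemma iet_partition:
  fixes w :: "nat \<Rightarrow> real"
  assumes "\<And>i. i \<in> {1..d} \<Longrightarrow> w i > 0" "x \<in> {0..<\<Sum>i\<in>{1..d}. w i}"
  shows "\<exists>!j. j \<in> {1..d} \<and> x \<in> iet_interval w j"
proof -
  have step: "iet_left w (Suc j) = iet_left w j + w j" if "j \<ge> 1" for j
    using that by (simp add: iet_left_def)
  have mono: "iet_left w j \<le> iet_left w k" if "1 \<le> j" "j \<le> k" "k \<le> Suc d" for j k
    unfolding iet_left_def using that assms(1)
    by (intro sum_mono2) (auto intro: less_imp_le)
  define A where "A = {j \<in> {1..d}. iet_left w j \<le> x}"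
  have d: "d \<ge> 1" using assms(2) by (cases d) auto
  have A: "finite A" "1 \<in> A" using assms(2) d by (auto simp: A_def iet_left_def)
  define j where "j = Max A"
  have jA: "j \<in> A" unfolding j_def using A by (intro Max_in) auto
  have "x < iet_left w (Suc j)"
  proof (cases "j = d")
    case True
    then show ?thesis using assms(2) by (simp add: iet_left_def atLeastLessThanSuc_atLeastAtMost)
  next
    case False
    have "Suc j \<notin> A" using A Max_ge[OF A(1)] j_def by (metis not_less_eq_eq order_refl)
    then show ?thesis using jA False by (auto simp: A_def)
  qed
  then have ex: "j \<in> {1..d} \<and> x \<in> iet_interval w j"
    using jA step[of j] by (auto simp: A_def iet_interval_def)
  show ?thesis
  proof (rule ex1I, rule ex)
    fix k assume k: "k \<in> {1..d} \<and> x \<in> iet_interval w k"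
    show "k = j"
    proof (rule ccontr)
      assume "k \<noteq> j"
      then consider "Suc k \<le> j" | "Suc j \<le> k" by linarith
      then show False
        using k ex step[of k] step[of j] mono[of "Suc k" j] mono[of "Suc j" k]
        by cases (auto simp: iet_interval_def)
    qed
  qed
qed

lemma iet_apply:
  assumes "l \<in> length_simplex d" "j \<in> {1..d}" "x \<in> iet_interval l j"
  shows "iet d l \<pi> x = x - iet_left l j + iet_image_left d l \<pi> j"
proof -
  have l: "\<And>i. i \<in> {1..d} \<Longrightarrow> l i > 0" "(\<Sum>i\<in>{1..d}. l i) = 1"
    using assms(1) by (auto simp: length_simplex_def)
  have "iet_left l j \<ge> 0" unfolding iet_left_def
    using l assms(2) by (intro sum_nonneg) (auto intro: less_imp_le)
  moreover have "iet_left l j + l j = (\<Sum>i\<in>{1..<Suc j}. l i)"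
    using assms(2) by (simp add: iet_left_def)
  moreover have "\<dots> \<le> (\<Sum>i\<in>{1..d}. l i)"
    using l assms(2) by (intro sum_mono2) (auto intro: less_imp_le)
  ultimately have "x \<in> {0..<\<Sum>i\<in>{1..d}. l i}"
    using assms(3) l(2) by (auto simp: iet_interval_def)
  from the1_equality[OF iet_partition[OF l(1) this]] assms(2,3)
  have "(THE j. j \<in> {1..d} \<and> x \<in> iet_interval l j) = j" by auto
  then show ?thesis by (simp add: iet_def)
qed

lemma iet_image_left_eq:
  assumes \<pi>: "\<pi> permutes {1..d}" and j: "j \<in> {1..d}"
  shows "iet_image_left d l \<pi> j = iet_left (l \<circ> inv \<pi>) (\<pi> j)"
proof -
  have "\<pi> j \<in> {1..d}" using permutes_in_image[OF \<pi>] j by simp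
  have "inv \<pi> ` {1..<\<pi> j} = {i. i \<in> {1..d} \<and> \<pi> i < \<pi> j}"
  proof (intro set_eqI iffI)
    fix i assume "i \<in> inv \<pi> ` {1..<\<pi> j}"
    then obtain q where q: "q \<in> {1..<\<pi> j}" "i = inv \<pi> q" by blast
    then have "q \<in> {1..d}" using \<open>\<pi> j \<in> {1..d}\<close> by simp
    then have "i \<in> {1..d}" using q(2) permutes_in_image[OF permutes_inv[OF \<pi>]] by blast
    moreover have "\<pi> i = q" using q(2) permutes_inverses(1)[OF \<pi>] by blast
    ultimately show "i \<in> {i. i \<in> {1..d} \<and> \<pi> i < \<pi> j}" using q(1) by simp
  next
    fix i assume i: "i \<in> {i. i \<in> {1..d} \<and> \<pi> i < \<pi> j}"
    then have "\<pi> i \<in> {1..d}" using permutes_in_image[OF \<pi>] by blast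
    then have "\<pi> i \<in> {1..<\<pi> j}" using i by simp
    moreover have "i = inv \<pi> (\<pi> i)" using permutes_inverses(2)[OF \<pi>] by simp
    ultimately show "i \<in> inv \<pi> ` {1..<\<pi> j}" by blast
  qed
  moreover have "inj_on (inv \<pi>) {1..<\<pi> j}"
    by (rule inj_on_subset[OF permutes_inj[OF permutes_inv[OF \<pi>]]]) simp
  ultimately show ?thesis
    using sum.reindex[of "inv \<pi>" "{1..<\<pi> j}" l] by (simp add: iet_image_left_def iet_left_def)
qed

lemma bij_betw_iet:
  assumes \<pi>: "\<pi> permutes {1..d}" and l: "l \<in> length_simplex d"
  shows "bij_betw (iet d l \<pi>) {0..<1} {0..<1}"
proof -
  have pos: "\<And>i. i \<in> {1..d} \<Longrightarrow> l i > 0" and one: "(\<Sum>i\<in>{1..d}. l i) = 1"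
    using l by (auto simp: length_simplex_def)
  define w where "w = l \<circ> inv \<pi>"
  have wpos: "\<And>i. i \<in> {1..d} \<Longrightarrow> w i > 0"
    using pos permutes_in_image[OF permutes_inv[OF \<pi>]] by (simp add: w_def)
  have wone: "(\<Sum>i\<in>{1..d}. w i) = 1"
    unfolding w_def using one by (simp only: sum.permute[OF permutes_inv[OF \<pi>], symmetric])
  have part: "\<exists>!j. j \<in> {1..d} \<and> x \<in> iet_interval l j" if "x \<in> {0..<1}" for x
    using iet_partition[of d l x] pos one that by simp
  have wpart: "\<exists>!j. j \<in> {1..d} \<and> x \<in> iet_interval w j" if "x \<in> {0..<1}" for x
    using iet_partition[of d w x] wpos wone that by simp
  have sub: "iet_interval v j \<subseteq> {0..<1}"
    if "\<And>i. i \<in> {1..d} \<Longrightarrow> v i > 0" "(\<Sum>i\<in>{1..d}. v i) = 1" "j \<in> {1..d}" for v :: "nat \<Rightarrow> real" and j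
  proof -
    have "iet_left v j \<ge> 0" unfolding iet_left_def
      using that by (intro sum_nonneg) (auto intro: less_imp_le)
    moreover have "iet_left v j + v j = (\<Sum>i\<in>{1..<Suc j}. v i)"
      using that by (simp add: iet_left_def)
    moreover have "\<dots> \<le> (\<Sum>i\<in>{1..d}. v i)"
      using that by (intro sum_mono2) (auto intro: less_imp_le)
    ultimately show ?thesis using that(2) by (auto simp: iet_interval_def)
  qed
  have wj: "w (\<pi> j) = l j" for j using permutes_inverses[OF \<pi>] by (simp add: w_def)
  have val: "iet d l \<pi> x = x - iet_left l j + iet_left w (\<pi> j)"
    if "j \<in> {1..d}" "x \<in> iet_interval l j" for j x
    using iet_apply[OF l that] iet_image_left_eq[OF \<pi> that(1)] by (simp add: w_def)
  have img: "iet d l \<pi> x \<in> iet_interval w (\<pi> j)"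
    if "j \<in> {1..d}" "x \<in> iet_interval l j" for j x
    using val[OF that] that(2) wj[of j] by (auto simp: iet_interval_def)
  have \<pi>in: "\<pi> j \<in> {1..d}" if "j \<in> {1..d}" for j using permutes_in_image[OF \<pi>] that by simp
  show ?thesis
  proof (rule bij_betwI')
    fix x y assume x: "x \<in> {0..<1::real}" and y: "y \<in> {0..<1::real}"
    obtain j k where j: "j \<in> {1..d}" "x \<in> iet_interval l j" and k: "k \<in> {1..d}" "y \<in> iet_interval l k"
      using part[OF x] part[OF y] by blast
    show "(iet d l \<pi> x = iet d l \<pi> y) = (x = y)"
    proof
      assume eq: "iet d l \<pi> x = iet d l \<pi> y"
      have "iet d l \<pi> x \<in> {0..<1}" using img[OF j] sub[OF wpos wone \<pi>in[OF j(1)]] by blast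
      then have "\<pi> j = \<pi> k"
        using wpart[of "iet d l \<pi> x"] img[OF j] img[OF k] \<pi>in[OF j(1)] \<pi>in[OF k(1)] unfolding eq by blast
      then have "j = k" using permutes_inj[OF \<pi>] by (simp add: inj_eq)
      then show "x = y" using eq val[OF j] val[OF k] by simp
    qed simp
  next
    fix x assume x: "x \<in> {0..<1::real}"
    obtain j where j: "j \<in> {1..d}" "x \<in> iet_interval l j" using part[OF x] by blast
    show "iet d l \<pi> x \<in> {0..<1}" using img[OF j] sub[OF wpos wone \<pi>in[OF j(1)]] by blast
  next
    fix y assume y: "y \<in> {0..<1::real}"
    obtain q where q: "q \<in> {1..d}" "y \<in> iet_interval w q" using wpart[OF y] by blast
    define j where "j = inv \<pi> q"
    have j: "j \<in> {1..d}" "\<pi> j = q"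
      using q(1) permutes_in_image[OF permutes_inv[OF \<pi>]] permutes_inverses(1)[OF \<pi>] by (simp_all add: j_def)
    define x where "x = y - iet_left w q + iet_left l j"
    have "x \<in> iet_interval l j" using q(2) wj[of j] j(2) by (auto simp: x_def iet_interval_def)
    then have "iet d l \<pi> x = y" "x \<in> {0..<1}"
      using val[OF j(1)] j sub[OF pos one j(1)] by (auto simp: x_def)
    then show "\<exists>x\<in>{0..<1}. y = iet d l \<pi> x" by blast
  qed
qed


subsection \<open>The measure on the simplex\<close>

lemma simplex_chart_in:
  assumes "d \<ge> 1" "x \<in> chart_domain d"
  shows "simplex_chart d x \<in> length_simplex d"
proof -
  have "{1..d} = insert d {1..<d}" using assms(1) by auto
  moreover have "(\<Sum>i\<in>{1..<d}. simplex_chart d x i) = (\<Sum>i\<in>{1..<d}. x i)"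
    by (intro sum.cong) (auto simp: simplex_chart_def)
  ultimately have "(\<Sum>i\<in>{1..d}. simplex_chart d x i) = 1"
    by (simp add: simplex_chart_def)
  moreover have "simplex_chart d x \<in> {1..d} \<rightarrow>\<^sub>E UNIV"
    using assms by (auto simp: simplex_chart_def chart_domain_def PiE_def extensional_def)
  ultimately show ?thesis
    using assms by (auto simp: length_simplex_def simplex_chart_def chart_domain_def)
qed

lemma measurable_simplex_chart:
  assumes "d \<ge> 1"
  shows "simplex_chart d \<in> restrict_space (\<Pi>\<^sub>M i\<in>{1..<d}. lborel) (chart_domain d)
           \<rightarrow>\<^sub>M restrict_space (\<Pi>\<^sub>M i\<in>{1..d}. borel) (length_simplex d)"
proof (rule measurable_restrict_space2)
  show "simplex_chart d \<in> space (restrict_space (\<Pi>\<^sub>M i\<in>{1..<d}. lborel) (chart_domain d))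
      \<rightarrow> length_simplex d"
    using simplex_chart_in[OF assms] by (auto simp: space_restrict_space)
  have "simplex_chart d \<in> (\<Pi>\<^sub>M i\<in>{1..<d}. lborel) \<rightarrow>\<^sub>M (\<Pi>\<^sub>M i\<in>{1..d}. borel)"
  proof (rule measurable_PiM_single')
    fix i assume i: "i \<in> {1..d}"
    show "(\<lambda>x. simplex_chart d x i) \<in> (\<Pi>\<^sub>M i\<in>{1..<d}. lborel) \<rightarrow>\<^sub>M borel"
    proof (cases "i = d")
      case True
      have "(\<lambda>x. 1 - (\<Sum>i\<in>{1..<d}. x i)) \<in> borel_measurable (\<Pi>\<^sub>M i\<in>{1..<d}. lborel :: real measure)"
        by (intro borel_measurable_diff borel_measurable_sum measurable_const
            measurable_component_singleton[THEN measurable_compose, OF _ measurable_ident_sets]) simp_all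
      then show ?thesis by (simp add: simplex_chart_def True)
    next
      case False
      then have "i \<in> {1..<d}" using i by auto
      then have "(\<lambda>x. x i) \<in> borel_measurable (\<Pi>\<^sub>M i\<in>{1..<d}. lborel :: real measure)"
        using measurable_component_singleton[of i "{1..<d}" "\<lambda>_. lborel :: real measure"] by simp
      then show ?thesis using False by (simp add: simplex_chart_def)
    qed
  next
    show "(\<lambda>x i. simplex_chart d x i) \<in> space (\<Pi>\<^sub>M i\<in>{1..<d}. lborel) \<rightarrow> ({1..d} \<rightarrow>\<^sub>E space borel)"
      using assms by (auto simp: simplex_chart_def space_PiM PiE_def extensional_def)
  qed
  then show "simplex_chart d \<in> restrict_space (\<Pi>\<^sub>M i\<in>{1..<d}. lborel) (chart_domain d)
      \<rightarrow>\<^sub>M (\<Pi>\<^sub>M i\<in>{1..d}. borel)"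
    by (rule measurable_restrict_space1)
qed

lemma chart_domain_measurable:
  "chart_domain d \<in> sets (\<Pi>\<^sub>M i\<in>{1..<d}. lborel)"
proof -
  let ?M = "\<Pi>\<^sub>M i\<in>{1..<d}. lborel :: real measure"
  have comp: "(\<lambda>x. x i) \<in> borel_measurable ?M" if "i \<in> {1..<d}" for i
    using measurable_component_singleton[of i "{1..<d}" "\<lambda>_. lborel :: real measure"] that by simp
  have "{x \<in> space ?M. x i > 0} \<in> sets ?M" if "i \<in> {1..<d}" for i
    using comp[OF that] by simp
  then have "{x \<in> space ?M. \<forall>i\<in>{1..<d}. x i > 0} \<in> sets ?M"
    by (intro sets.sets_Collect_finite_All) simp_all
  moreover have "{x \<in> space ?M. (\<Sum>i\<in>{1..<d}. x i) < 1} \<in> sets ?M"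
    using borel_measurable_sum[of "{1..<d}" "\<lambda>i x. x i" ?M, OF comp] by simp
  moreover have "chart_domain d =
      {x \<in> space ?M. \<forall>i\<in>{1..<d}. x i > 0} \<inter> {x \<in> space ?M. (\<Sum>i\<in>{1..<d}. x i) < 1}"
    by (auto simp: chart_domain_def space_PiM)
  ultimately show ?thesis by simp
qed

lemma emeasure_simplex_lebesgue_pos:
  assumes "d \<ge> 1"
  shows "emeasure (simplex_lebesgue d) (space (simplex_lebesgue d)) > 0"
proof -
  let ?M = "\<Pi>\<^sub>M i\<in>{1..<d}. lborel :: real measure"
  let ?R = "restrict_space ?M (chart_domain d)"
  let ?N = "restrict_space (\<Pi>\<^sub>M i\<in>{1..d}. borel :: real measure) (length_simplex d)"
  interpret product_sigma_finite "\<lambda>_ :: nat. lborel :: real measure"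
    by standard
  define B where "B = ({1..<d} \<rightarrow>\<^sub>E {0<..<1 / real d})"
  have "emeasure ?M B = (\<Prod>i\<in>{1..<d}. emeasure lborel {0<..<1 / real d})"
    unfolding B_def by (rule emeasure_PiM) simp_all
  then have pos: "emeasure ?M B > 0"
    using assms by (simp add: ennreal_power[symmetric] zero_less_iff_neq_zero)
  have "(\<Sum>i\<in>{1..<d}. x i) < 1" if "x \<in> B" for x
  proof -
    have "(\<Sum>i\<in>{1..<d}. x i) \<le> (\<Sum>i\<in>{1..<d}. 1 / real d)"
      using that by (intro sum_mono less_imp_le) (simp only: B_def PiE_iff greaterThanLessThan_iff)
    also have "\<dots> < 1" using assms by (simp add: field_simps)
    finally show ?thesis .
  qed
  then have "B \<subseteq> chart_domain d" by (auto simp: B_def chart_domain_def)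
  then have "emeasure ?M B \<le> emeasure ?M (chart_domain d)"
    by (intro emeasure_mono chart_domain_measurable)
  also have "\<dots> = emeasure ?R (space ?R)"
    using chart_domain_measurable[of d] sets.sets_into_space[OF chart_domain_measurable[of d]]
    by (subst emeasure_restrict_space) (auto simp: space_restrict_space Int_absorb2)
  also have "\<dots> = emeasure (distr ?R ?N (simplex_chart d)) (space ?N)"
  proof -
    have "simplex_chart d -` space ?N \<inter> space ?R = space ?R"
      using measurable_space[OF measurable_simplex_chart[OF assms]] by blast
    then show ?thesis
      using emeasure_distr[OF measurable_simplex_chart[OF assms] sets.top] by simp
  qed
  finally show ?thesis using pos by (simp add: simplex_lebesgue_def)
qed

end

theory Submission
 imports Defs "HOL-Probability.Probability" "HOL-Real_Asymp.Real_Asymp"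
begin

text \<open>
 Run on independent exponentially distributed lengths, Rauzy induction is a Markov chain on the
 vectors of rates. A martingale argument shows that blocks of steps that mix all the intervals occur
 at every scale, with an exponentially small probability of failure, so by Borel and Cantelli
 almost every length vector has such a block between the scales \<open>X\<close> and \<open>X powr (1 + \<epsilon>)\<close> for all
 large \<open>X\<close>. The towers built from these blocks then show that every orbit segment of length at
 least \<open>\<delta> powr (- 1 - \<epsilon>)\<close> visits every interval of length at least \<open>\<delta>\<close> with the right frequency.

 It follows that for most points the derivative of the Birkhoff sum \<open>S\<^sub>r f\<close> is close to
 \<open>(Cm - Cp) * r * ln r\<close>, where the asymmetry makes the factor nonzero. Hence on a short interval
 the Birkhoff sums are nearly affine with a large slope, and the flow stretches the interval
 uniformly over many levels, whose positions in the base are equidistributed. This bounds the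
 upper limit of \<open>\<mu>(\<phi>\<^sub>t A \<inter> B)\<close> by \<open>\<mu>(A) * \<mu>(B)\<close> for rectangles, hence for all measurable sets;
 together with the same bound for the complement of \<open>B\<close> this is mixing.
\<close>

section \<open>Rauzy induction on pairs of rows\<close>

text \<open>Lebesgue measure on the simplex is distorted by the normalised induction without a
  uniform bound. Exponential laws avoid distortion estimates: being memoryless, the lengths given
  any finite history are again independent and exponential, so every bound that is uniform in the
  rates can be restarted at any time. The rates change by the same matrices as the tower heights;
  started from 1 they are the heights.

  On the side of the flow the obstacle is that f' has size 1/x near the ends and is not integrable:
  every dyadic distance from an end contributes equally to its Birkhoff sums, so equidistribution is
  needed down to distances of about \<open>t powr (\<epsilon> - 1)\<close>. Closer visits are
  controlled only in measure and cost a share of order \<epsilon>. The window \<open>ww t\<close> is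
  so long that the stretch \<open>ww t * t * ln t\<close> is unbounded, yet so short that orbit
  segments of length of order \<open>t\<close> from most points stay more than
  \<open>2 * ww t\<close> away from discontinuities and ends.\<close>

fun insert_after :: "'a \<Rightarrow> 'a \<Rightarrow> 'a list \<Rightarrow> 'a list" where
 "insert_after a z [] = []"
| "insert_after a z (x # xs) = (if x = a then a # z # xs else x # insert_after a z xs)"

lemma insert_after_split: "a \<notin> set xs \<Longrightarrow> insert_after a z (xs @ a # ys) = xs @ a # z # ys"
 by (induction xs) auto

text \<open>
 A state consists of the two rows in which the letters name the exchanged intervals before and
 after the exchange.  The flag is true when the last letter of the first row wins.
\<close>

type_synonym rows = "nat list \<times> nat list"
type_synonym weights = "nat \<Rightarrow> real"

definition winner :: "bool \<Rightarrow> rows \<Rightarrow> nat" where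
 "winner c s = (if c then last (fst s) else last (snd s))"

definition loser :: "bool \<Rightarrow> rows \<Rightarrow> nat" where
 "loser c s = (if c then last (snd s) else last (fst s))"

definition rstep :: "bool \<Rightarrow> rows \<Rightarrow> rows" where
 "rstep c s =
   (if c then (fst s, insert_after (last (fst s)) (last (snd s)) (butlast (snd s)))
   else (insert_after (last (snd s)) (last (fst s)) (butlast (fst s)), snd s))"

definition ends :: "rows \<Rightarrow> nat set" where
 "ends s = {last (fst s), last (snd s)}"

text \<open>This is the inverse transpose of the change of lengths \<open>red1\<close>. The semiring
  type lets one action serve both the real rates of the Markov chain and the natural numbers that
  are tower heights.\<close>

definition act1 :: "bool \<Rightarrow> rows \<Rightarrow> (nat \<Rightarrow> 'a::semiring_1) \<Rightarrow> nat \<Rightarrow> 'a" where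
 "act1 c s v = v(loser c s := v (loser c s) + v (winner c s))"

fun st :: "rows \<Rightarrow> bool list \<Rightarrow> rows" where
 "st s [] = s"
| "st s (c # w) = st (rstep c s) w"

fun act :: "rows \<Rightarrow> bool list \<Rightarrow> (nat \<Rightarrow> 'a::semiring_1) \<Rightarrow> nat \<Rightarrow> 'a" where
 "act s [] v = v"
| "act s (c # w) v = act (rstep c s) w (act1 c s v)"

lemma st_append: "st s (u @ w) = st (st s u) w"
 by (induction u arbitrary: s) auto

lemma act_append: "act s (u @ w) v = act (st s u) w (act s u v)"
 by (induction u arbitrary: s v) auto

text \<open>The condition on proper initial parts is irreducibility. It is symmetric in the rows, so
  that combinatorial facts about one kind of step carry over to the other by exchanging the
  rows.\<close>

definition valid_rows :: "nat \<Rightarrow> rows \<Rightarrow> bool" where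
 "valid_rows d s \<longleftrightarrow> distinct (fst s) \<and> distinct (snd s) \<and> set (fst s) = {1..d} \<and> set (snd s) = {1..d} \<and>
   (\<forall>k. 0 < k \<and> k < d \<longrightarrow> set (take k (fst s)) \<noteq> set (take k (snd s)))"

lemma valid_rows_swap: "valid_rows d (prod.swap s) \<longleftrightarrow> valid_rows d s"
 by (auto simp: valid_rows_def)

lemma rstep_swap: "rstep c (prod.swap s) = prod.swap (rstep (\<not> c) s)"
 by (auto simp: rstep_def)

locale rauzy =
 fixes d :: nat
 assumes d2: "d \<ge> 2"
begin

abbreviation "valid \<equiv> valid_rows d"

lemma valid_length: "valid s \<Longrightarrow> length (fst s) = d \<and> length (snd s) = d"
 unfolding valid_rows_def by (metis card_atLeastAtMost diff_Suc_1 distinct_card)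

lemma valid_ne: "valid s \<Longrightarrow> fst s \<noteq> [] \<and> snd s \<noteq> []"
 using valid_length[of s] d2 by auto

lemma valid_last_ne: assumes "valid s" shows "last (fst s) \<noteq> last (snd s)"
proof
 assume eq: "last (fst s) = last (snd s)"
 have len: "length (fst s) = d" "length (snd s) = d" using valid_length[OF assms] by auto
 have "set (butlast xs) = {1..d} - {last xs}" if "xs \<noteq> []" "distinct xs" "set xs = {1..d}" for xs :: "nat list"
 proof -
  have "xs = butlast xs @ [last xs]" using that(1) by simp
  then have "distinct (butlast xs @ [last xs])" "set (butlast xs @ [last xs]) = {1..d}"
   using that by simp_all
  then show ?thesis by auto
 qed
 then have "set (butlast (fst s)) = set (butlast (snd s))"
  using assms eq valid_ne[OF assms] unfolding valid_rows_def by metis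
 then have "set (take (d - 1) (fst s)) = set (take (d - 1) (snd s))"
  using len by (simp add: butlast_conv_take)
 then show False using assms d2 unfolding valid_rows_def by (auto dest: spec[of _ "d - 1"])
qed

lemma winner_neq_loser: "valid s \<Longrightarrow> winner c s \<noteq> loser c s"
 using valid_last_ne[of s] by (auto simp: winner_def loser_def)

lemma last_in: "valid s \<Longrightarrow> last (fst s) \<in> {1..d} \<and> last (snd s) \<in> {1..d}"
 using valid_ne[of s] last_in_set unfolding valid_rows_def by metis

lemma winner_in: "valid s \<Longrightarrow> winner c s \<in> {1..d}"
 using last_in[of s] by (auto simp: winner_def)

lemma loser_in: "valid s \<Longrightarrow> loser c s \<in> {1..d}"
 using last_in[of s] by (auto simp: loser_def)

text \<open>Normal form for a step won by the first row: \<open>z\<close> leaves the end of the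
  second row and is put behind \<open>a\<close>. The letter \<open>a\<close> lies inside the second
  row because the two ends differ.\<close>

lemma top_split:
 assumes "valid s"
 obtains t a b1 b2 z where "s = (t @ [a], b1 @ a # b2 @ [z])" "a \<noteq> z"
  "a \<notin> set b1" "a \<notin> set b2" "z \<notin> set b1" "z \<notin> set b2"
  "rstep True s = (t @ [a], b1 @ a # z # b2)"
proof -
 define a z where "a = last (fst s)" and "z = last (snd s)"
 have az: "a \<noteq> z" using valid_last_ne[OF assms] by (simp add: a_def z_def)
 have ne: "fst s \<noteq> []" "snd s \<noteq> []" using valid_ne[OF assms] by auto
 have "a \<in> set (snd s)" using assms last_in_set[OF ne(1)] unfolding valid_rows_def a_def by auto
 moreover have bl: "snd s = butlast (snd s) @ [z]" using ne by (simp add: z_def)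
 ultimately have "a \<in> set (butlast (snd s))" using az
  by (metis Un_iff empty_iff insert_iff list.set(1) list.simps(15) set_append)
 then obtain b1 b2 where b: "butlast (snd s) = b1 @ a # b2" by (meson split_list)
 have s: "s = (butlast (fst s) @ [a], b1 @ a # b2 @ [z])"
  using bl b ne by (metis a_def append.assoc append_Cons append_butlast_last_id prod.collapse)
 have dist: "distinct (b1 @ a # b2 @ [z])"
  using assms arg_cong[OF s, of snd] unfolding valid_rows_def by simp
 then have nin: "a \<notin> set b1" "a \<notin> set b2" "z \<notin> set b1" "z \<notin> set b2" by auto
 have "rstep True s = (fst s, b1 @ a # z # b2)"
  using b nin by (simp add: rstep_def a_def[symmetric] z_def[symmetric] insert_after_split)
 then show ?thesis using that[OF s az nin] arg_cong[OF s, of fst] by simp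
qed

text \<open>An initial part of the new second row either lies before \<open>a\<close>, where nothing
  has changed, or contains \<open>a\<close>, which no proper initial part of the first row
  does.\<close>

lemma valid_step_top: assumes "valid s" shows "valid (rstep True s)"
proof -
 obtain t a b1 b2 z where s: "s = (t @ [a], b1 @ a # b2 @ [z])" and az: "a \<noteq> z"
  and r: "rstep True s = (t @ [a], b1 @ a # z # b2)" and nin: "a \<notin> set b1" "a \<notin> set b2" "z \<notin> set b1" "z \<notin> set b2"
  using top_split[OF assms] by metis
 have len: "length t + 1 = d" "length (b1 @ a # b2 @ [z]) = d"
  using valid_length[OF assms] s by auto
 have v: "distinct (t @ [a])" "distinct (b1 @ a # b2 @ [z])" "set (t @ [a]) = {1..d}"
  "set (b1 @ a # b2 @ [z]) = {1..d}"
  and irr: "\<And>k. 0 < k \<Longrightarrow> k < d \<Longrightarrow> set (take k (t @ [a])) \<noteq> set (take k (b1 @ a # b2 @ [z]))"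
  using assms s unfolding valid_rows_def by auto
 have "set (take k (t @ [a])) \<noteq> set (take k (b1 @ a # z # b2))" if k: "0 < k" "k < d" for k
 proof (cases "k \<le> length b1")
  case True
  then show ?thesis using irr[OF k] by simp
 next
  case False
  then have "a \<in> set (take k (b1 @ a # z # b2))" by (cases "k - length b1") auto
  moreover have "a \<notin> set (take k (t @ [a]))"
   using v(1) k len by (auto dest: in_set_takeD)
  ultimately show ?thesis by blast
 qed
 moreover have "distinct (b1 @ a # z # b2)" using v(2) by auto
 moreover have "set (b1 @ a # z # b2) = {1..d}" using v(4) by auto
 ultimately show ?thesis using v unfolding r valid_rows_def by simp
qed

lemma valid_step: assumes "valid s" shows "valid (rstep c s)"
proof (cases c)
 case True
 then show ?thesis using valid_step_top[OF assms] by simp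
next
 case False
 have "valid (rstep True (prod.swap s))" using valid_step_top assms valid_rows_swap by blast
 then have "valid (prod.swap (rstep False s))" using rstep_swap[of True s] by simp
 then show ?thesis using False valid_rows_swap by simp
qed

lemma valid_st: "valid s \<Longrightarrow> valid (st s w)"
 by (induction w arbitrary: s) (simp_all add: valid_step)

lemma finite_valid: "finite {s. valid s}"
proof (rule finite_subset)
 show "{s. valid s} \<subseteq> {xs. set xs \<subseteq> {1..d} \<and> length xs = d} \<times> {xs. set xs \<subseteq> {1..d} \<and> length xs = d}"
 proof
  fix s assume "s \<in> {s. valid s}"
  then have "valid s" by simp
  then show "s \<in> {xs. set xs \<subseteq> {1..d} \<and> length xs = d} \<times> {xs. set xs \<subseteq> {1..d} \<and> length xs = d}"
   using valid_length[of s] unfolding valid_rows_def by (cases s) simp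
 qed
qed (intro finite_cartesian_product finite_lists_length_eq; simp)

text \<open>The letters behind the last occurrence of a letter of \<open>S\<close> in the row. In
  the application \<open>S\<close> consists of the letters that can never come to an end.\<close>

definition tail_letters :: "nat set \<Rightarrow> nat list \<Rightarrow> nat set" where
 "tail_letters S xs = set (takeWhile (\<lambda>x. x \<notin> S) (rev xs))"

lemma tail_letters_disjoint: "tail_letters S xs \<inter> S = {}"
 unfolding tail_letters_def by (auto dest: set_takeWhileD)

lemma tail_letters_subset: "tail_letters S xs \<subseteq> set xs"
 unfolding tail_letters_def by (auto dest: set_takeWhileD)

lemma last_in_tail: "xs \<noteq> [] \<Longrightarrow> last xs \<notin> S \<Longrightarrow> last xs \<in> tail_letters S xs"
 unfolding tail_letters_def by (cases xs rule: rev_cases) auto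

text \<open>The moved letter is put behind \<open>a\<close>. If \<open>a\<close> stands behind the
  last letter of \<open>S\<close>, the moved letter stays in the tail; otherwise it drops out. No
  letter ever enters.\<close>

lemma tail_letters_shrink:
 assumes "valid s" "last (fst s) \<notin> S" "last (snd s) \<notin> S"
 shows "tail_letters S (snd (rstep True s)) \<subseteq> tail_letters S (snd s)"
  and "last (fst s) \<notin> tail_letters S (snd s) \<Longrightarrow>
     card (tail_letters S (snd (rstep True s))) < card (tail_letters S (snd s))"
proof -
 obtain t a b1 b2 z where s: "s = (t @ [a], b1 @ a # b2 @ [z])" and az: "a \<noteq> z"
  and r: "rstep True s = (t @ [a], b1 @ a # z # b2)" and nin: "a \<notin> set b1" "a \<notin> set b2" "z \<notin> set b1" "z \<notin> set b2"
  using top_split[OF assms(1)] by metis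
 have aS: "a \<notin> S" and zS: "z \<notin> S" using assms s by auto
 let ?P = "\<lambda>x. x \<notin> S"
 show sub: "tail_letters S (snd (rstep True s)) \<subseteq> tail_letters S (snd s)"
 proof (cases "set b2 \<inter> S = {}")
  case True
  then have "\<And>xs. takeWhile ?P (rev b2 @ xs) = rev b2 @ takeWhile ?P xs"
   by (intro takeWhile_append2) auto
  then show ?thesis unfolding r unfolding s tail_letters_def using aS zS by auto
 next
  case False
  then obtain x where "x \<in> set (rev b2)" "x \<in> S" by auto
  then have "\<And>xs. takeWhile ?P (rev b2 @ xs) = takeWhile ?P (rev b2)"
   by (intro takeWhile_append1) auto
  then show ?thesis unfolding r unfolding s tail_letters_def using aS zS by auto
 qed
 assume "last (fst s) \<notin> tail_letters S (snd s)"
 then have an: "a \<notin> tail_letters S (snd s)" using s by simp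
 have "set b2 \<inter> S \<noteq> {}"
 proof
  assume "set b2 \<inter> S = {}"
  then have "\<And>xs. takeWhile ?P (rev b2 @ xs) = rev b2 @ takeWhile ?P xs"
   by (intro takeWhile_append2) auto
  then have "a \<in> tail_letters S (snd s)" unfolding s tail_letters_def using aS zS by auto
  then show False using an by simp
 qed
 then obtain x where "x \<in> set (rev b2)" "x \<in> S" by auto
 then have e: "\<And>xs. takeWhile ?P (rev b2 @ xs) = takeWhile ?P (rev b2)"
  by (intro takeWhile_append1) auto
 have "z \<notin> tail_letters S (snd (rstep True s))" unfolding r tail_letters_def using nin
  by (auto simp: e dest!: set_takeWhileD)
 moreover have "z \<in> tail_letters S (snd s)" unfolding s tail_letters_def using zS by auto
 ultimately have "tail_letters S (snd (rstep True s)) \<subset> tail_letters S (snd s)" using sub by blast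
 then show "card (tail_letters S (snd (rstep True s))) < card (tail_letters S (snd s))"
  by (intro psubset_card_mono) (auto simp: tail_letters_def)
qed

text \<open>
 Letters that never reach an end stay behind the letters that do; the tails they leave free can
 only shrink, and when they have stopped shrinking both consist of all the other letters, so that
 the two rows have a common initial part.
\<close>

lemma letter_reaches_end:
 assumes s: "valid s" and j: "j \<in> {1..d}"
 shows "\<exists>w. j \<in> ends (st s w)"
proof (rule ccontr)
 assume none: "\<not> ?thesis"
 define NE where "NE s = {j \<in> {1..d}. \<forall>w. j \<notin> ends (st s w)}" for s
 have NE_mono: "NE s \<subseteq> NE (st s w)" for s w
  unfolding NE_def by (auto simp: st_append[symmetric])
 have finNE: "finite (NE s)" for s unfolding NE_def by simp
 have cNE: "card (NE s) \<le> d" for s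
 proof -
  have "NE s \<subseteq> {1..d}" unfolding NE_def by blast
  from card_mono[OF _ this] show ?thesis by simp
 qed
 \<comment> \<open>Letters that can no longer reach an end accumulate along a path. Where their
   number is maximal, their set \<open>S\<close> stays the same under every continuation.\<close>
 obtain w1 where w1: "\<And>w. card (NE (st s w)) \<le> card (NE (st s w1))"
  using ex_has_greatest_nat[of "\<lambda>_. True" "[]" "\<lambda>w. card (NE (st s w))" "Suc d"] cNE
  by (metis less_Suc_eq_le)
 define s1 where "s1 = st s w1"
 define S where "S = NE s1"
 have v1: "valid s1" using valid_st[OF s] by (simp add: s1_def)
 have NEs1: "NE (st s1 w) = S" for w
  using card_subset_eq[OF finNE NE_mono[of s1 w]] w1[of "w1 @ w"] card_mono[OF finNE NE_mono[of s1 w]]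
  by (simp add: s1_def S_def st_append)
 have "j \<in> NE s" using none j by (simp add: NE_def)
 then have jS: "j \<in> S" using NE_mono[of s w1] by (auto simp: S_def s1_def)
 let ?f = "\<lambda>s. card (tail_letters S (fst s)) + card (tail_letters S (snd s))"
 obtain w2 where w2: "\<And>w. ?f (st s1 w2) \<le> ?f (st s1 w)"
  using ex_has_least_nat[of "\<lambda>_. True" "[]" "\<lambda>w. ?f (st s1 w)"] by metis
 define s2 where "s2 = st s1 w2"
 have v2: "valid s2" using valid_st[OF v1] by (simp add: s2_def)
 have NE2: "NE (st s2 w) = S" for w using NEs1[of "w2 @ w"] by (simp add: s2_def st_append)
 have min: "?f s2 \<le> ?f (st s2 w)" for w using w2[of "w2 @ w"] by (simp add: s2_def st_append)
 have ends: "last (fst r) \<notin> S" "last (snd r) \<notin> S" if "r = st s2 w" for r w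
 proof -
  have "x \<notin> S" if "x \<in> ends r" for x
  proof
   assume "x \<in> S"
   then have "x \<notin> ends (st r [])" using NE2[of w] \<open>r = st s2 w\<close> unfolding NE_def by blast
   then show False using that by simp
  qed
  then show "last (fst r) \<notin> S" "last (snd r) \<notin> S" by (auto simp: ends_def)
 qed
 have inv: "tail_letters S (fst (st s2 w)) = tail_letters S (fst s2) \<and>
   tail_letters S (snd (st s2 w)) = tail_letters S (snd s2) \<and>
   last (fst (st s2 w)) \<in> tail_letters S (snd s2) \<and> last (snd (st s2 w)) \<in> tail_letters S (fst s2)" for w
 proof (induction w rule: rev_induct)
  case Nil
  show ?case
  proof -
   have e: "last (fst s2) \<notin> S" "last (snd s2) \<notin> S" using ends[of s2 "[]"] by auto
   have "last (fst s2) \<in> tail_letters S (snd s2)"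
   proof (rule ccontr)
    assume "\<not> ?thesis"
    from tail_letters_shrink(2)[OF v2 e this]
    have "?f (rstep True s2) < ?f s2" by (simp add: rstep_def)
    then show False using min[of "[True]"] by simp
   qed
   moreover have "last (snd s2) \<in> tail_letters S (fst s2)"
   proof (rule ccontr)
    assume "\<not> ?thesis"
    with tail_letters_shrink(2)[of "prod.swap s2" S] e v2 valid_rows_swap
    have "?f (rstep False s2) < ?f s2" by (simp add: rstep_def)
    then show False using min[of "[False]"] by simp
   qed
   ultimately show ?thesis by simp
  qed
 next
  case (snoc c w)
  define r where "r = st s2 w"
  have vr: "valid r" using valid_st[OF v2] by (simp add: r_def)
  have e: "last (fst r) \<notin> S" "last (snd r) \<notin> S" using ends[OF r_def] by auto
  have step: "st s2 (w @ [c]) = rstep c r" by (simp add: st_append r_def)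
  have ih: "tail_letters S (fst r) = tail_letters S (fst s2)" "tail_letters S (snd r) = tail_letters S (snd s2)"
   using snoc by (simp_all add: r_def)
  have fin: "finite (tail_letters S xs)" for xs by (simp add: tail_letters_def)
  have eq: "tail_letters S (fst (rstep c r)) = tail_letters S (fst s2) \<and>
   tail_letters S (snd (rstep c r)) = tail_letters S (snd s2)"
  proof (cases c)
   case True
   have "tail_letters S (snd (rstep True r)) \<subseteq> tail_letters S (snd r)"
    by (rule tail_letters_shrink(1)[OF vr e])
   moreover have "card (tail_letters S (snd r)) \<le> card (tail_letters S (snd (rstep True r)))"
    using min[of "w @ [c]"] ih True unfolding step by (simp add: rstep_def)
   ultimately have "tail_letters S (snd (rstep True r)) = tail_letters S (snd r)"
    using card_seteq[OF fin] by metis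
   then show ?thesis using True ih by (simp add: rstep_def)
  next
   case False
   have "tail_letters S (fst (rstep False r)) \<subseteq> tail_letters S (fst r)"
    using tail_letters_shrink(1)[of "prod.swap r" S] vr e valid_rows_swap by (simp add: rstep_def)
   moreover have "card (tail_letters S (fst r)) \<le> card (tail_letters S (fst (rstep False r)))"
    using min[of "w @ [c]"] ih False unfolding step by (simp add: rstep_def)
   ultimately have "tail_letters S (fst (rstep False r)) = tail_letters S (fst r)"
    using card_seteq[OF fin] by metis
   then show ?thesis using False ih by (simp add: rstep_def)
  qed
  define r' where "r' = rstep c r"
  have r': "r' = st s2 (w @ [c])" by (simp add: step r'_def)
  have vr': "valid r'" using valid_step[OF vr] by (simp add: r'_def)
  have e': "last (fst r') \<notin> S" "last (snd r') \<notin> S" using ends[OF r'] by auto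
  have eq': "tail_letters S (fst r') = tail_letters S (fst s2)" "tail_letters S (snd r') = tail_letters S (snd s2)"
   using eq by (simp_all add: r'_def)
  have "last (fst r') \<in> tail_letters S (snd r')"
  proof (rule ccontr)
   assume "\<not> ?thesis"
   from tail_letters_shrink(2)[OF vr' e' this]
   have "?f (rstep True r') < ?f r'" by (simp add: rstep_def)
   then show False using min[of "w @ [c] @ [True]"] eq' by (simp add: st_append r_def r'_def)
  qed
  moreover have "last (snd r') \<in> tail_letters S (fst r')"
  proof (rule ccontr)
   assume "\<not> ?thesis"
   with tail_letters_shrink(2)[of "prod.swap r'" S] e' vr' valid_rows_swap
   have "?f (rstep False r') < ?f r'" by (simp add: rstep_def)
   then show False using min[of "w @ [c] @ [False]"] eq' by (simp add: st_append r_def r'_def)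
  qed
  ultimately show ?case using eq' r' by simp
 qed
 let ?X = "tail_letters S (fst s2)" and ?Y = "tail_letters S (snd s2)"
 \<comment> \<open>A letter outside \<open>S\<close> comes to an end at some time. It is then in the
   tail of its own row, by minimality also in that of the other row, and the tails no longer
   change.\<close>
 have cover: "x \<in> ?X \<inter> ?Y" if x: "x \<in> {1..d}" "x \<notin> S" for x
 proof -
  have "x \<notin> NE s2" using NE2[of "[]"] x by simp
  then obtain w where w: "x \<in> ends (st s2 w)" using x by (auto simp: NE_def)
  define r where "r = st s2 w"
  have vr: "valid r" using valid_st[OF v2] by (simp add: r_def)
  have "last (fst r) \<in> ?X" "last (snd r) \<in> ?Y"
   using last_in_tail valid_ne[OF vr] ends[OF r_def] inv[of w] by (metis r_def)+
  then show ?thesis using w inv[of w] by (auto simp: ends_def r_def)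
 qed
 have X: "?X = {1..d} - S" "?Y = {1..d} - S"
  using cover tail_letters_disjoint[of S] tail_letters_subset[of S] v2 unfolding valid_rows_def by blast+
 have SA: "S \<subseteq> {1..d}" by (auto simp: S_def NE_def)
 define k where "k = card S"
 have pre: "set (take k xs) = S" if "distinct xs" "set xs = {1..d}" "tail_letters S xs = {1..d} - S" for xs
 proof -
  have len: "length xs = d" using that by (metis card_atLeastAtMost diff_Suc_1 distinct_card)
  define tw where "tw = takeWhile (\<lambda>x. x \<notin> S) (rev xs)"
  obtain r where r: "rev xs = tw @ r" by (metis takeWhile_dropWhile_id tw_def)
  have dist: "distinct (tw @ r)" using that(1) r by (metis distinct_rev)
  have stw: "set tw = {1..d} - S" using that(3) by (simp add: tail_letters_def tw_def)
  then have "card (set tw) = d - k" using SA by (simp add: k_def card_Diff_subset finite_subset)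
  then have ltw: "length tw = d - k" using dist by (simp add: distinct_card)
  have xs: "xs = rev r @ rev tw" using r by (metis rev_append rev_rev_ident)
  have "k \<le> d" using card_mono[OF _ SA] by (simp add: k_def)
  then have "length (rev r) = k" using len ltw arg_cong[OF xs, of length] by simp
  then have "take k xs = rev r" using xs by simp
  moreover have "set r = S"
   using dist stw that(2) SA arg_cong[OF r, of set] by auto
  ultimately show ?thesis by simp
 qed
 have "set (take k (fst s2)) = set (take k (snd s2))"
  using pre[of "fst s2"] pre[of "snd s2"] X v2 unfolding valid_rows_def by simp
 moreover have "0 < k" using jS SA by (auto simp: k_def card_gt_0_iff finite_subset)
 moreover have "k < d"
 proof -
  have "last (fst s2) \<in> {1..d} - S" using ends[of s2 "[]"] last_in[OF v2] by simp
  then have "S \<subset> {1..d}" using SA by blast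
  then show ?thesis using psubset_card_mono[of "{1..d}" S] by (simp add: k_def)
 qed
 ultimately show False using v2 unfolding valid_rows_def by blast
qed

end

section \<open>Words with positive matrices\<close>

context rauzy
begin

lemma winner_stays: "winner c s \<in> ends (rstep c s)"
 by (simp add: winner_def ends_def rstep_def)

lemma ends_eq: "ends s = {winner c s, loser c s}"
 by (auto simp: winner_def loser_def ends_def)

text \<open>Since the winner remains an end, the two ends cannot leave \<open>P\<close> together: at
  the first exit one is inside and the other outside, and the flag \<open>c\<close> can be chosen so
  that the inner one wins.\<close>

lemma leaves_set:
 assumes "ends s \<subseteq> P" "\<not> ends (st s w) \<subseteq> P"
 shows "\<exists>w c. winner c (st s w) \<in> P \<and> loser c (st s w) \<notin> P"
 using assms
proof (induction w arbitrary: s)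
 case (Cons c w)
 show ?case
 proof (cases "ends (rstep c s) \<subseteq> P")
  case True
  then obtain w' c' where "winner c' (st (rstep c s) w') \<in> P" "loser c' (st (rstep c s) w') \<notin> P"
   using Cons by (metis st.simps(2))
  then have "winner c' (st s (c # w')) \<in> P \<and> loser c' (st s (c # w')) \<notin> P" by simp
  then show ?thesis by blast
 next
  case False
  have w: "winner c s \<in> P" using Cons.prems(1) ends_eq[of s c] by simp
  obtain c' where "winner c' (rstep c s) = winner c s"
   using winner_stays[of c s] ends_eq[of "rstep c s" True]
   by (metis ends_eq insert_iff singletonD winner_def loser_def)
  then have "winner c' (st s [c]) \<in> P \<and> loser c' (st s [c]) \<notin> P"
   using False w ends_eq[of "rstep c s" c'] by auto
  then show ?thesis by blast
 qed
qed simp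

lemma mixed_ends:
 assumes s: "valid s" and P: "j \<in> P" "\<beta> \<notin> P" "j \<in> {1..d}" "\<beta> \<in> {1..d}"
 shows "\<exists>w c. winner c (st s w) \<in> P \<and> loser c (st s w) \<notin> P"
proof -
 have "ends s \<subseteq> P \<or> ends s \<subseteq> - P \<or> (\<exists>c. winner c s \<in> P \<and> loser c s \<notin> P)"
  by (auto simp: ends_def winner_def loser_def intro: exI[of _ True] exI[of _ False])
 then consider "ends s \<subseteq> P" | "ends s \<subseteq> - P" | c where "winner c s \<in> P" "loser c s \<notin> P" by blast
 then show ?thesis
 proof cases
  case 1
  obtain w where "\<beta> \<in> ends (st s w)" using letter_reaches_end[OF s P(4)] by blast
  then show ?thesis using leaves_set[OF 1, of w] P by blast
 next
  case 2
  obtain w where "j \<in> ends (st s w)" using letter_reaches_end[OF s P(3)] by blast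
  then obtain w c where "winner c (st s w) \<notin> P" "loser c (st s w) \<in> P"
   using leaves_set[OF 2, of w] P by blast
  then have "winner (\<not> c) (st s w) \<in> P \<and> loser (\<not> c) (st s w) \<notin> P"
   by (auto simp: winner_def loser_def)
  then show ?thesis by blast
 next
  case 3
  then have "winner c (st s []) \<in> P \<and> loser c (st s []) \<notin> P" by simp
  then show ?thesis by blast
 qed
qed

text \<open>Before the visit all contests are between letters outside \<open>S\<close>. When these
  letters have comparable rates, the path has a probability bounded from below.\<close>

definition first_visit :: "nat set \<Rightarrow> rows \<Rightarrow> bool list \<Rightarrow> bool" where
 "first_visit S s w \<longleftrightarrow> ends (st s w) \<inter> S \<noteq> {} \<and> (\<forall>u c v. w = u @ c # v \<longrightarrow> ends (st s u) \<inter> S = {})"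

lemma first_visit_exists:
 assumes "valid s" "S \<subseteq> {1..d}" "S \<noteq> {}"
 shows "\<exists>w. first_visit S s w"
proof -
 obtain j where "j \<in> S" using assms by blast
 then obtain w where "ends (st s w) \<inter> S \<noteq> {}" using letter_reaches_end[OF assms(1)] assms(2) by blast
 then obtain w where w: "ends (st s w) \<inter> S \<noteq> {}"
  and min: "\<And>w'. ends (st s w') \<inter> S \<noteq> {} \<Longrightarrow> length w \<le> length w'"
  using ex_has_least_nat[of "\<lambda>w. ends (st s w) \<inter> S \<noteq> {}" w length] by blast
 have "ends (st s u) \<inter> S = {}" if "w = u @ c # v" for u c v
  using min[of u] that by (cases "ends (st s u) \<inter> S = {}") auto
 then show ?thesis using w unfolding first_visit_def by blast
qed

text \<open>There are finitely many states and letter sets, so one length serves them all; this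
  keeps the later constants independent of the state.\<close>

lemma first_visit_bounded:
 "\<exists>N. \<forall>s S. valid s \<and> S \<subseteq> {1..d} \<and> S \<noteq> {} \<longrightarrow> (\<exists>w. length w \<le> N \<and> first_visit S s w)"
proof -
 let ?X = "{s. valid s} \<times> Pow {1..d}"
 define W where "W = (\<lambda>(s, S). SOME w. first_visit S s w)"
 have fin: "finite ?X" using finite_valid by simp
 show ?thesis
 proof (rule exI[of _ "Max ((length \<circ> W) ` ?X)"], intro allI impI)
  fix s S assume a: "valid s \<and> S \<subseteq> {1..d} \<and> S \<noteq> {}"
  have "first_visit S s (W (s, S))"
   unfolding W_def using first_visit_exists[of s S] a by (auto intro: someI_ex)
  moreover have "length (W (s, S)) \<le> Max ((length \<circ> W) ` ?X)"
   using fin a by (intro Max_ge) auto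
  ultimately show "\<exists>w. length w \<le> Max ((length \<circ> W) ` ?X) \<and> first_visit S s w" by blast
 qed
qed

definition nonneg :: "(nat \<Rightarrow> real) \<Rightarrow> bool" where
 "nonneg v \<longleftrightarrow> (\<forall>j\<in>{1..d}. 0 \<le> v j)"

lemma act1_ge: "valid s \<Longrightarrow> nonneg v \<Longrightarrow> v j \<le> act1 c s v j"
 using winner_in[of s c] by (auto simp: act1_def nonneg_def)

lemma act1_nonneg: "valid s \<Longrightarrow> nonneg v \<Longrightarrow> nonneg (act1 c s v)"
 using act1_ge unfolding nonneg_def by (meson order_trans)

lemma act_ge: "valid s \<Longrightarrow> nonneg v \<Longrightarrow> v j \<le> act s w v j"
proof (induction w arbitrary: s v)
 case (Cons c w)
 then show ?case using act1_ge[of s v j c] act1_nonneg[of s v c] valid_step[of s c] by fastforce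
qed simp

lemma act_nonneg: "valid s \<Longrightarrow> nonneg v \<Longrightarrow> nonneg (act s w v)"
 using act_ge unfolding nonneg_def by (meson order_trans)

lemma act_pos: "valid s \<Longrightarrow> \<forall>j\<in>{1..d}. 0 < v j \<Longrightarrow> j \<in> {1..d} \<Longrightarrow> 0 < (act s w v j :: real)"
 using act_ge[of s v j w] by (force simp: nonneg_def)

lemma act1_le: "valid s \<Longrightarrow> \<forall>j\<in>{1..d}. v j \<le> M \<Longrightarrow> 0 \<le> M \<Longrightarrow> j \<in> {1..d} \<Longrightarrow> act1 c s v j \<le> 2 * (M :: real)"
 using winner_in[of s c] loser_in[of s c]
 by (smt (verit, ccfv_threshold) act1_def fun_upd_apply)

lemma act_le:
 "valid s \<Longrightarrow> \<forall>j\<in>{1..d}. v j \<le> M \<Longrightarrow> 0 \<le> M \<Longrightarrow> j \<in> {1..d} \<Longrightarrow> act s w v j \<le> 2 ^ length w * (M :: real)"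
proof (induction w arbitrary: s v M)
 case (Cons c w)
 have "act (rstep c s) w (act1 c s v) j \<le> 2 ^ length w * (2 * M)"
  using Cons.prems act1_le[of s v M] valid_step by (intro Cons.IH) auto
 then show ?case by simp
qed simp

lemma act_linear:
 "act s w (\<lambda>x. a * u x + b * v x) = (\<lambda>x. a * act s w u x + b * (act s w v x :: real))"
proof (induction w arbitrary: s u v)
 case (Cons c w)
 have "act1 c s (\<lambda>x. a * u x + b * v x) = (\<lambda>x. a * act1 c s u x + b * act1 c s v x)"
  by (auto simp: act1_def algebra_simps)
 then show ?case using Cons.IH by simp
qed simp

lemma act_of_nat: "act s w (\<lambda>x. of_nat (v x)) = (\<lambda>x. of_nat (act s w v x) :: real)"
proof (induction w arbitrary: s v)
 case (Cons c w)
 have "act1 c s (\<lambda>x. of_nat (v x)) = (\<lambda>x. of_nat (act1 c s v x) :: real)"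
  by (auto simp: act1_def)
 then show ?case using Cons.IH by simp
qed simp

text \<open>All entries of the matrix of \<open>w\<close> are at least 1, expressed through the
  action on nonnegative vectors.\<close>

definition positive_word :: "rows \<Rightarrow> bool list \<Rightarrow> bool" where
 "positive_word s w \<longleftrightarrow> (\<forall>v. nonneg v \<longrightarrow> (\<forall>j\<in>{1..d}. \<forall>\<beta>\<in>{1..d}. v j \<le> act s w v \<beta>))"

text \<open>\<open>P w\<close> is the set of letters that have received the entry of
  \<open>j\<close>. It never shrinks, and as long as it is proper, \<open>mixed_ends\<close>
  supplies a contest in which a member beats an outsider, who thereby joins.\<close>

lemma letter_spreads:
 assumes s: "valid s" and j: "j \<in> {1..d}"
 shows "\<exists>w. \<forall>v. nonneg v \<longrightarrow> (\<forall>\<beta>\<in>{1..d}. v j \<le> act s w v \<beta>)"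
proof -
 define P where "P w = {\<beta> \<in> {1..d}. \<forall>v. nonneg v \<longrightarrow> v j \<le> act s w v \<beta>}" for w
 have sub: "P w \<subseteq> {1..d}" for w unfolding P_def by blast
 have card: "card (P w) \<le> d" for w using card_mono[OF _ sub[of w]] by simp
 have fin: "finite (P w)" for w using finite_subset[OF sub] by simp
 obtain w where w: "\<And>w'. card (P w') \<le> card (P w)"
  using ex_has_greatest_nat[of "\<lambda>_. True" "[]" "\<lambda>w. card (P w)" "Suc d"] card
  by (metis less_Suc_eq_le)
 have "P w = {1..d}"
 proof (rule ccontr)
  assume "P w \<noteq> {1..d}"
  then obtain \<beta> where \<beta>: "\<beta> \<in> {1..d}" "\<beta> \<notin> P w" using sub by blast
  have "j \<in> P w" unfolding P_def using act_ge[OF s] j by blast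
  then obtain u c where u: "winner c (st (st s w) u) \<in> P w" "loser c (st (st s w) u) \<notin> P w"
   using mixed_ends[OF valid_st[OF s, of w]] j \<beta> by metis
  define r where "r = st s (w @ u)"
  have r: "valid r" "winner c r \<in> P w" "loser c r \<notin> P w" using u valid_st[OF s, of "w @ u"] by (simp_all add: r_def st_append)
  have "insert (loser c r) (P w) \<subseteq> P (w @ u @ [c])"
  proof
   fix \<beta> assume b: "\<beta> \<in> insert (loser c r) (P w)"
   have bd: "\<beta> \<in> {1..d}" using b sub loser_in[OF r(1)] by blast
   have "v j \<le> act s (w @ u @ [c]) v \<beta>" if v: "nonneg v" for v
   proof -
    let ?x = "act s w v" and ?y = "act s (w @ u) v"
    have y: "?y = act (st s w) u ?x" by (simp add: act_append)
    have nx: "nonneg ?x" and ny: "nonneg ?y" using act_nonneg[OF s v] by auto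
    have xy: "?x \<gamma> \<le> ?y \<gamma>" for \<gamma> unfolding y using act_ge[OF valid_st[OF s] nx] .
    have z: "act s (w @ u @ [c]) v = act1 c r ?y" by (simp add: act_append r_def st_append)
    show ?thesis
    proof (cases "\<beta> = loser c r")
     case True
     have "v j \<le> ?x (winner c r)" using r(2) v unfolding P_def by blast
     also have "\<dots> \<le> ?y (winner c r)" by (rule xy)
     also have "\<dots> \<le> act1 c r ?y \<beta>"
      using True ny loser_in[OF r(1), of c] by (simp add: act1_def nonneg_def)
     finally show ?thesis by (simp add: z)
    next
     case False
     then have "v j \<le> ?x \<beta>" using b v unfolding P_def by blast
     also have "\<dots> \<le> ?y \<beta>" by (rule xy)
     also have "\<dots> \<le> act1 c r ?y \<beta>" by (rule act1_ge[OF r(1) ny])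
     finally show ?thesis by (simp add: z)
    qed
   qed
   then show "\<beta> \<in> P (w @ u @ [c])" using bd unfolding P_def by blast
  qed
  then have "card (insert (loser c r) (P w)) \<le> card (P (w @ u @ [c]))" by (intro card_mono fin)
  then show False using w[of "w @ u @ [c]"] r(3) fin[of w] by simp
 qed
 then show ?thesis unfolding P_def by blast
qed

text \<open>Words for the single letters are concatenated. Entries of a nonnegative vector never
  decrease, so what one word has achieved survives the others.\<close>

lemma positive_word_exists:
 assumes s: "valid s" shows "\<exists>w. positive_word s w"
proof -
 have "\<exists>w. \<forall>v. nonneg v \<longrightarrow> (\<forall>j\<in>set L. \<forall>\<beta>\<in>{1..d}. v j \<le> act s w v \<beta>)" if "set L \<subseteq> {1..d}" for L
  using that
 proof (induction L)
  case (Cons j L)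
  then have "set L \<subseteq> {1..d}" by simp
  from Cons.IH[OF this] obtain w where
   w: "\<And>v \<gamma> \<beta>. nonneg v \<Longrightarrow> \<gamma> \<in> set L \<Longrightarrow> \<beta> \<in> {1..d} \<Longrightarrow> v \<gamma> \<le> act s w v \<beta>" by blast
  have v': "valid (st s w)" by (rule valid_st[OF s])
  obtain u where u: "\<And>v \<beta>. nonneg v \<Longrightarrow> \<beta> \<in> {1..d} \<Longrightarrow> v j \<le> act (st s w) u v \<beta>"
   using letter_spreads[OF v', of j] Cons.prems by force
  have "v \<gamma> \<le> act s (w @ u) v \<beta>" if v: "nonneg v" and g: "\<gamma> \<in> set (j # L)" and b: "\<beta> \<in> {1..d}" for v \<gamma> \<beta>
  proof -
   have n: "nonneg (act s w v)" by (rule act_nonneg[OF s v])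
   show ?thesis
   proof (cases "\<gamma> = j")
    case True
    have "v j \<le> act s w v j" by (rule act_ge[OF s v])
    also have "\<dots> \<le> act (st s w) u (act s w v) \<beta>" by (rule u[OF n b])
    finally show ?thesis using True by (simp add: act_append)
   next
    case False
    then have "v \<gamma> \<le> act s w v \<beta>" using w[OF v _ b] g by simp
    also have "\<dots> \<le> act (st s w) u (act s w v) \<beta>" by (rule act_ge[OF v' n])
    finally show ?thesis by (simp add: act_append)
   qed
  qed
  then show ?case by blast
 qed simp
 from this[of "sorted_list_of_set {1..d}"] show ?thesis
  unfolding positive_word_def by simp
qed

lemma positive_word_bounded:
 "\<exists>N. \<forall>s. valid s \<longrightarrow> (\<exists>w. length w \<le> N \<and> positive_word s w)"
proof -
 define W where "W s = (SOME w. positive_word s w)" for s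
 show ?thesis
 proof (rule exI[of _ "Max ((length \<circ> W) ` {s. valid s})"], intro allI impI)
  fix s assume s: "valid s"
  have "positive_word s (W s)"
   unfolding W_def using positive_word_exists[OF s] by (rule someI_ex)
  moreover have "length (W s) \<le> Max ((length \<circ> W) ` {s. valid s})"
   using finite_valid s by (intro Max_ge) auto
  ultimately show "\<exists>w. length w \<le> Max ((length \<circ> W) ` {s. valid s}) \<and> positive_word s w" by blast
 qed
qed

section \<open>The Markov chain of Rauzy induction\<close>

text \<open>
 If the lengths are independent and exponentially distributed with rates \<open>q\<close>, then the
 winner is decided with the probabilities below, and given the outcome the new lengths are again
 independent and exponentially distributed, with rates \<open>act1 c s q\<close>.
\<close>

definition prb :: "bool \<Rightarrow> rows \<Rightarrow> weights \<Rightarrow> real" where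
 "prb c s q = q (loser c s) / (q (loser c s) + q (winner c s))"

text \<open>The probability that within \<open>n\<close> steps the word of outcomes satisfies \<phi>
  at some time, the present included. The recursion replaces a probability space of paths; \<phi>
  sees the whole past, because the outcomes already decided are put in front of its
  argument.\<close>

fun hit :: "nat \<Rightarrow> (bool list \<Rightarrow> bool) \<Rightarrow> rows \<Rightarrow> weights \<Rightarrow> real" where
 "hit 0 \<phi> s q = (if \<phi> [] then 1 else 0)"
| "hit (Suc n) \<phi> s q = (if \<phi> [] then 1 else
   prb True s q * hit n (\<lambda>u. \<phi> (True # u)) (rstep True s) (act1 True s q) +
   prb False s q * hit n (\<lambda>u. \<phi> (False # u)) (rstep False s) (act1 False s q))"

definition pos :: "(nat \<Rightarrow> real) \<Rightarrow> bool" where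
 "pos q \<longleftrightarrow> (\<forall>j\<in>{1..d}. 0 < q j)"

abbreviation hit_after :: "nat \<Rightarrow> (bool list \<Rightarrow> bool) \<Rightarrow> bool \<Rightarrow> rows \<Rightarrow> weights \<Rightarrow> real" where
 "hit_after n \<phi> c s q \<equiv> hit n (\<lambda>u. \<phi> (c # u)) (rstep c s) (act1 c s q)"

lemma pos_nonneg: "pos q \<Longrightarrow> nonneg q"
 by (auto simp: pos_def nonneg_def intro: less_imp_le)

lemma pos_act: "valid s \<Longrightarrow> pos q \<Longrightarrow> pos (act s w q)"
 using act_pos unfolding pos_def by blast

lemma pos_act1: "valid s \<Longrightarrow> pos q \<Longrightarrow> pos (act1 c s q)"
 using pos_act[of s q "[c]"] by simp

lemma prb_nonneg: "valid s \<Longrightarrow> pos q \<Longrightarrow> 0 \<le> prb c s q"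
 using winner_in[of s c] loser_in[of s c] unfolding prb_def pos_def by (simp add: less_imp_le)

lemma prb_sum: "valid s \<Longrightarrow> pos q \<Longrightarrow> prb True s q + prb False s q = 1"
proof -
 assume "valid s" "pos q"
 then have "0 < q (last (fst s))" "0 < q (last (snd s))" using last_in[of s] by (auto simp: pos_def)
 then show ?thesis unfolding prb_def winner_def loser_def
  by (simp add: add_divide_distrib[symmetric] add.commute)
qed

lemma prb_cases: "valid s \<Longrightarrow> pos q \<Longrightarrow> prb (\<not> c) s q = 1 - prb c s q"
 using prb_sum[of s q] by (cases c) auto

lemma convex_ge:
 assumes "valid s" "pos q" "x \<le> (a :: real)" "x \<le> b"
 shows "x \<le> prb True s q * a + prb False s q * b"
proof -
 have "x = prb True s q * x + prb False s q * x"
  using prb_sum[OF assms(1,2)] by (simp add: distrib_right[symmetric])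
 also have "\<dots> \<le> prb True s q * a + prb False s q * b"
  by (intro add_mono mult_left_mono assms prb_nonneg)
 finally show ?thesis .
qed

lemma convex_mono:
 assumes "valid s" "pos q" "a \<le> (a' :: real)" "b \<le> b'"
 shows "prb True s q * a + prb False s q * b \<le> prb True s q * a' + prb False s q * b'"
 by (intro add_mono mult_left_mono assms prb_nonneg)

lemma hit_le1: "valid s \<Longrightarrow> pos q \<Longrightarrow> hit n \<phi> s q \<le> 1"
proof (induction n arbitrary: s q \<phi>)
 case (Suc n)
 have "prb True s q * hit_after n \<phi> True s q +
   prb False s q * hit_after n \<phi> False s q
   \<le> prb True s q * 1 + prb False s q * 1"
  using Suc by (intro convex_mono Suc.IH valid_step pos_act1)
 then show ?case using prb_sum[OF Suc.prems] by simp
qed simp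

lemma hit_nonneg: "valid s \<Longrightarrow> pos q \<Longrightarrow> 0 \<le> hit n \<phi> s q"
proof (induction n arbitrary: s q \<phi>)
 case (Suc n)
 then show ?case using convex_ge[OF Suc.prems, of 0] valid_step pos_act1 by simp
qed simp

lemma hit_mono:
 assumes "valid s" "pos q" "n \<le> m" "\<And>u. \<phi> u \<Longrightarrow> \<psi> u"
 shows "hit n \<phi> s q \<le> hit m \<psi> s q"
 using assms
proof (induction n arbitrary: s q m \<phi> \<psi>)
 case 0
 then show ?case using hit_nonneg[of s q m \<psi>] by (cases m) auto
next
 case (Suc n)
 then obtain m' where m: "m = Suc m'" "n \<le> m'" by (cases m) auto
 show ?case
 proof (cases "\<psi> []")
  case False
  then have "\<not> \<phi> []" using Suc.prems by blast
  have "hit_after n \<phi> c s q \<le> hit m' (\<lambda>u. \<psi> (c # u)) (rstep c s) (act1 c s q)" for c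
   using Suc.prems m(2) by (intro Suc.IH valid_step pos_act1) auto
  then show ?thesis using False \<open>\<not> \<phi> []\<close> m(1) by (simp add: convex_mono[OF Suc.prems(1,2)])
 next
  case True
  then have "hit m \<psi> s q = 1" using m by simp
  then show ?thesis using hit_le1[OF Suc.prems(1,2), of "Suc n" \<phi>] by linarith
 qed
qed

lemma hit_false: "(\<And>u. \<not> \<phi> u) \<Longrightarrow> hit n \<phi> s q = 0"
 by (induction n arbitrary: s q \<phi>) auto

lemma hit_start: "\<phi> [] \<Longrightarrow> hit n \<phi> s q = 1"
 by (cases n) auto

text \<open>Strong Markov property as an inequality: reach \<psi>, then succeed with probability at
  least \<open>b\<close> from the state found there. The two outcomes of a step may need different
  numbers of further steps, of which the larger is taken.\<close>

lemma hit_compose: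
 assumes "valid s" "pos q" "0 \<le> b" "b \<le> 1"
  and "\<And>u. \<psi> u \<Longrightarrow> \<exists>m. b \<le> hit m (\<lambda>v. \<phi> (u @ v)) (st s u) (act s u q)"
 shows "\<exists>m. b * hit n \<psi> s q \<le> hit m \<phi> s q"
 using assms
proof (induction n arbitrary: s q \<phi> \<psi>)
 case 0
 show ?case
 proof (cases "\<psi> []")
  case True
  then show ?thesis using "0.prems"(5)[OF True] by simp
 next
  case False
  then show ?thesis using hit_nonneg[OF "0.prems"(1,2), of 0 \<phi>] by (intro exI[of _ 0]) simp
 qed
next
 case (Suc n)
 show ?case
 proof (cases "\<psi> []")
  case True
  then show ?thesis using Suc.prems(5)[OF True] by simp
 next
  case False
  have "\<exists>m. b * hit_after n \<psi> c s q \<le> hit_after m \<phi> c s q" for c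
  proof (rule Suc.IH)
   fix u assume "\<psi> (c # u)"
   from Suc.prems(5)[OF this]
   show "\<exists>m. b \<le> hit m (\<lambda>v. \<phi> (c # u @ v)) (st (rstep c s) u) (act (rstep c s) u (act1 c s q))" by simp
  qed (use Suc.prems valid_step pos_act1 in auto)
  then obtain M where M: "\<And>c. b * hit_after n \<psi> c s q
    \<le> hit_after (M c) \<phi> c s q" by metis
  define m where "m = max (M True) (M False)"
  have Mm: "hit_after (M c) \<phi> c s q \<le> hit_after m \<phi> c s q" for c
   by (intro hit_mono valid_step pos_act1 Suc.prems) (cases c; auto simp: m_def)
  have le: "b * hit_after n \<psi> c s q \<le> hit_after m \<phi> c s q" for c
   using M[of c] Mm[of c] by linarith
  have "b * hit (Suc n) \<psi> s q \<le> hit (Suc m) \<phi> s q"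
  proof (cases "\<phi> []")
   case True
   show ?thesis using True hit_le1[OF Suc.prems(1,2), of "Suc n" \<psi>] hit_nonneg[OF Suc.prems(1,2), of "Suc n" \<psi>] Suc.prems(3,4)
    by (simp del: hit.simps(2) add: hit_start mult_le_one)
  next
   case F: False
   have "b * hit (Suc n) \<psi> s q = prb True s q * (b * hit_after n \<psi> True s q) +
    prb False s q * (b * hit_after n \<psi> False s q)"
    using False by (simp add: algebra_simps)
   also have "\<dots> \<le> hit (Suc m) \<phi> s q"
    using F by (simp add: convex_mono[OF Suc.prems(1,2) le le])
   finally show ?thesis .
  qed
  then show ?thesis by blast
 qed
qed

end

lemma prod_ratio_ge2:
 assumes "finite B" "b \<in> B" "2 * u b \<le> (q b :: real)" "\<And>b. b \<in> B \<Longrightarrow> 0 < u b \<and> u b \<le> q b"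
 shows "2 \<le> (\<Prod>b\<in>B. q b / u b)"
proof -
 have "2 \<le> q b / u b" using assms(2-4) by (simp add: field_simps)
 moreover have "1 \<le> (\<Prod>b\<in>B - {b}. q b / u b)" using assms(4) by (intro prod_ge_1) simp
 ultimately have "2 * 1 \<le> q b / u b * (\<Prod>b\<in>B - {b}. q b / u b)" by (intro mult_mono) auto
 then show ?thesis using prod.remove[OF assms(1,2), of "\<lambda>b. q b / u b"] by simp
qed

context rauzy
begin

text \<open>The first attempt \<psi> can only succeed while all rates are at most \<open>M\<close>.
  Once a rate exceeds \<open>M\<close> it is lost, since rates never decrease; but at that moment
  all rates are still at most \<open>2 * M\<close>, as a step at most doubles the maximum, and a
  second attempt succeeds with probability at least \<open>f\<close>.\<close>

lemma hit_mixture: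
 assumes "valid s" "pos q" "\<forall>j\<in>{1..d}. q j \<le> 2 * M" "0 \<le> f" "f \<le> 1"
  and "\<And>u. \<psi> u \<Longrightarrow> \<phi> u"
  and "\<And>u. \<psi> u \<Longrightarrow> \<forall>j\<in>{1..d}. act s u q j \<le> M"
  and "\<And>u. \<forall>j\<in>{1..d}. act s u q j \<le> 2 * M \<Longrightarrow>
      \<exists>m. f \<le> hit m (\<lambda>v. \<phi> (u @ v)) (st s u) (act s u q)"
 shows "\<exists>m. hit n \<psi> s q + (1 - hit n \<psi> s q) * f \<le> hit m \<phi> s q"
 using assms
proof (induction n arbitrary: s q \<phi> \<psi>)
 case 0
 show ?case
 proof (cases "\<psi> []")
  case True
  then show ?thesis using "0.prems"(6) by (intro exI[of _ 0]) simp
 next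
  case False
  then show ?thesis using "0.prems"(8)[of "[]"] "0.prems"(3) by simp
 qed
next
 case (Suc n)
 have base: ?case if "hit (Suc n) \<psi> s q = 0"
  unfolding that using Suc.prems(8)[of "[]"] Suc.prems(3) by simp
 show ?case
 proof (cases "\<forall>j\<in>{1..d}. q j \<le> M")
  case False
  then obtain j where j: "j \<in> {1..d}" "q j > M" by force
  have "\<not> \<psi> u" for u
   using Suc.prems(7)[of u] act_ge[OF Suc.prems(1) pos_nonneg[OF Suc.prems(2)], of j u] j by force
  then show ?thesis by (intro base hit_false)
 next
  case True
  show ?thesis
  proof (cases "\<psi> []")
   case True
   then show ?thesis using Suc.prems(6)[OF True] by (intro exI[of _ 0]) simp
  next
   case False
   obtain j where "j \<in> {1..d}" "0 < q j" using Suc.prems(2) d2 unfolding pos_def by force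
   then have M0: "0 \<le> M" using True by (meson less_imp_le order_trans)
   have "\<exists>m. hit_after n \<psi> c s q +
     (1 - hit_after n \<psi> c s q) * f
     \<le> hit_after m \<phi> c s q" for c
   proof (rule Suc.IH)
    show "\<forall>j\<in>{1..d}. act1 c s q j \<le> 2 * M"
     using act1_le[OF Suc.prems(1) True M0] by blast
    show "\<forall>j\<in>{1..d}. act (rstep c s) u (act1 c s q) j \<le> M" if "\<psi> (c # u)" for u
     using Suc.prems(7)[OF that] by simp
    show "\<exists>m. f \<le> hit m (\<lambda>v. \<phi> (c # u @ v)) (st (rstep c s) u) (act (rstep c s) u (act1 c s q))"
     if "\<forall>j\<in>{1..d}. act (rstep c s) u (act1 c s q) j \<le> 2 * M" for u
     using Suc.prems(8)[of "c # u"] that by simp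
   qed (use Suc.prems valid_step pos_act1 in auto)
   then obtain m' where m': "\<And>c. hit_after n \<psi> c s q +
     (1 - hit_after n \<psi> c s q) * f
     \<le> hit_after (m' c) \<phi> c s q" by metis
   define m where "m = max (m' True) (m' False)"
   have mm: "hit_after (m' c) \<phi> c s q \<le> hit_after m \<phi> c s q" for c
    by (intro hit_mono valid_step pos_act1 Suc.prems(1,2)) (cases c; auto simp: m_def)
   have le: "hit_after n \<psi> c s q +
     (1 - hit_after n \<psi> c s q) * f
     \<le> hit_after m \<phi> c s q" for c
    using m'[of c] mm[of c] by linarith
   have "hit (Suc n) \<psi> s q + (1 - hit (Suc n) \<psi> s q) * f \<le> hit (Suc m) \<phi> s q"
   proof (cases "\<phi> []")
    case True
    have "(1 - hit (Suc n) \<psi> s q) * f \<le> (1 - hit (Suc n) \<psi> s q) * 1"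
     using hit_le1[OF Suc.prems(1,2), of "Suc n" \<psi>] Suc.prems(5) by (intro mult_left_mono) auto
    then show ?thesis unfolding hit_start[where \<phi> = \<phi>, OF True, of "Suc m" s q] mult_1_right
     by linarith
   next
    case F: False
    have p: "prb False s q = 1 - prb True s q" using prb_cases[OF Suc.prems(1,2), of True] by simp
    have "hit (Suc n) \<psi> s q + (1 - hit (Suc n) \<psi> s q) * f =
      prb True s q * (hit_after n \<psi> True s q +
       (1 - hit_after n \<psi> True s q) * f) +
      prb False s q * (hit_after n \<psi> False s q +
       (1 - hit_after n \<psi> False s q) * f)"
     using False by (simp add: p algebra_simps)
    also have "\<dots> \<le> hit (Suc m) \<phi> s q"
     using F by (simp add: convex_mono[OF Suc.prems(1,2) le le])
    finally show ?thesis .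
   qed
   then show ?thesis by blast
  qed
 qed
qed

lemma hit_path:
 assumes "valid s" "pos q" "0 \<le> \<rho>" "\<rho> \<le> 1" "\<phi> w"
  and "\<And>u c v. w = u @ c # v \<Longrightarrow> \<rho> \<le> prb c (st s u) (act s u q)"
 shows "\<rho> ^ length w \<le> hit (length w) \<phi> s q"
 using assms
proof (induction w arbitrary: s q \<phi>)
 case (Cons c w)
 show ?case
 proof (cases "\<phi> []")
  case True
  then show ?thesis using Cons.prems(3,4) by (simp add: power_le_one mult_le_one)
 next
  case False
  have ih: "\<rho> ^ length w \<le> hit_after (length w) \<phi> c s q"
  proof (rule Cons.IH)
   fix u c' v assume "w = u @ c' # v"
   then show "\<rho> \<le> prb c' (st (rstep c s) u) (act (rstep c s) u (act1 c s q))"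
    using Cons.prems(6)[of "c # u" c' v] by simp
  qed (use Cons.prems valid_step pos_act1 in auto)
  have p: "\<rho> \<le> prb c s q" using Cons.prems(6)[of "[]" c w] by simp
  have "\<rho> * \<rho> ^ length w \<le> prb c s q * hit_after (length w) \<phi> c s q"
   using p ih Cons.prems(3) by (intro mult_mono) auto
  moreover have "0 \<le> prb (\<not> c) s q * hit (length w) (\<lambda>u. \<phi> ((\<not> c) # u)) (rstep (\<not> c) s) (act1 (\<not> c) s q)"
   using Cons.prems by (intro mult_nonneg_nonneg prb_nonneg hit_nonneg valid_step pos_act1)
  ultimately show ?thesis using False by (cases c) simp_all
 qed
qed simp

section \<open>How the rates of all letters become comparable\<close>

lemma sum_act1_ge:
 assumes "valid s" "\<forall>j\<in>{1..d}. \<mu> \<le> q j"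
 shows "(\<Sum>j\<in>{1..d}. q j) + \<mu> \<le> (\<Sum>j\<in>{1..d}. act1 c s q j :: real)"
proof -
 have l: "loser c s \<in> {1..d}" by (rule loser_in[OF assms(1)])
 have "(\<Sum>j\<in>{1..d}. act1 c s q j) = act1 c s q (loser c s) + (\<Sum>j\<in>{1..d} - {loser c s}. act1 c s q j)"
  by (rule sum.remove) (use l in auto)
 also have "(\<Sum>j\<in>{1..d} - {loser c s}. act1 c s q j) = (\<Sum>j\<in>{1..d} - {loser c s}. q j)"
  by (intro sum.cong) (auto simp: act1_def)
 also have "act1 c s q (loser c s) = q (loser c s) + q (winner c s)" by (simp add: act1_def)
 finally have "(\<Sum>j\<in>{1..d}. act1 c s q j) = (\<Sum>j\<in>{1..d}. q j) + q (winner c s)"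
  using sum.remove[OF _ l, of q] by simp
 then show ?thesis using assms(2) winner_in[OF assms(1), of c] by force
qed

lemma act1_lower: "valid s \<Longrightarrow> pos q \<Longrightarrow> \<forall>j\<in>{1..d}. \<mu> \<le> q j \<Longrightarrow> \<forall>j\<in>{1..d}. \<mu> \<le> act1 c s q j"
 using act1_ge[of s q _ c] pos_nonneg[of q] by (meson order_trans)

text \<open>
 As long as small letters only beat big ones,
 \<open>\<Prod>b\<in>B. q b\<close> is a martingale, so the probability that some big rate doubles before a
 small letter has lost against a big one (and thereby becomes big) is at most \<open>1/2\<close>.
\<close>

lemma small_letter_grows:
 assumes "B \<subseteq> {1..d}" "\<And>b. b \<in> B \<Longrightarrow> \<theta> \<le> u0 b \<and> u0 b \<le> U" "0 < \<theta>" "\<theta> \<le> U" "0 < \<mu>"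
  and "valid s" "pos q" "\<forall>j\<in>{1..d}. \<mu> \<le> q j"
  and "\<forall>b\<in>B. u0 b \<le> q b" "\<forall>j\<in>{1..d} - B. q j < \<theta>" "ends s \<inter> ({1..d} - B) \<noteq> {}"
  and "\<And>u. \<exists>j\<in>{1..d} - B. \<theta> \<le> act s u q j \<Longrightarrow> \<forall>b\<in>B. u0 b \<le> act s u q b \<Longrightarrow>
      \<forall>j\<in>{1..d}. act s u q j \<le> 3 * U \<Longrightarrow> \<phi> u"
  and "real d * (2 * U) - (\<Sum>j\<in>{1..d}. q j) \<le> real n * \<mu>"
 shows "1 - (\<Prod>b\<in>B. q b / u0 b) / 2 \<le> hit n \<phi> s q"
 using assms(6-)
proof (induction n arbitrary: s q \<phi>)
 case (0 s q \<phi>)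
 note s = 0(1) note q = 0(2)
 have finB: "finite B" using assms(1) finite_subset by blast
 have upos: "0 < u0 b" if "b \<in> B" for b using assms(2)[OF that] assms(3) by linarith
 show ?case
 proof (cases "\<exists>b\<in>B. 2 * u0 b \<le> q b")
  case True
  then obtain b where b: "b \<in> B" "2 * u0 b \<le> q b" by blast
  have "2 \<le> (\<Prod>b\<in>B. q b / u0 b)"
   by (rule prod_ratio_ge2[where u = u0 and q = q, OF finB b]) (use upos 0(4) in auto)
  then show ?thesis using hit_nonneg[OF s q, of 0 \<phi>] by linarith
 next
  case False
  \<comment> \<open>If no big rate has doubled, all rates are below \<open>2 * U\<close>. But the
    sum of the rates gains at least \<mu> in each step, and with \<open>n = 0\<close> it has already
    reached \<open>real d * (2 * U)\<close>.\<close>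
  have "q j < 2 * U" if "j \<in> {1..d}" for j
  proof (cases "j \<in> B")
   case True
   then show ?thesis using False assms(2)[OF True] by force
  next
   case F: False
   then have "q j < \<theta>" using 0(5) that by blast
   then show ?thesis using assms(3,4) by linarith
  qed
  then have "(\<Sum>j\<in>{1..d}. q j) < (\<Sum>j\<in>{1..d}. 2 * U)" using d2 by (intro sum_strict_mono) auto
  then show ?thesis using 0(8) by simp
 qed
next
 case (Suc n s q \<phi>)
 note s = Suc.prems(1) note q = Suc.prems(2) note succ = Suc.prems(7)
 have finB: "finite B" using assms(1) finite_subset by blast
 have upos: "0 < u0 b" if "b \<in> B" for b using assms(2)[OF that] assms(3) by linarith
 have ppos: "0 \<le> (\<Prod>b\<in>B. q b / u0 b)"
  using q assms(1) upos unfolding pos_def by (intro prod_nonneg) (force intro: less_imp_le)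
 show ?case
 proof (cases "\<exists>b\<in>B. 2 * u0 b \<le> q b")
  case True
  then obtain b where b: "b \<in> B" "2 * u0 b \<le> q b" by blast
  have "2 \<le> (\<Prod>b\<in>B. q b / u0 b)"
   by (rule prod_ratio_ge2[where u = u0 and q = q, OF finB b]) (use upos Suc.prems(4) in auto)
  then show ?thesis using hit_nonneg[OF s q, of "Suc n" \<phi>] by linarith
 next
  case nb: False
  have big: "q b < 2 * U" if "b \<in> B" for b using nb assms(2)[OF that] that by force
  have le2: "q j \<le> 2 * U" if "j \<in> {1..d}" for j
   using big[of j] Suc.prems(5) assms(3,4) that by (cases "j \<in> B") force+
  show ?thesis
  proof (cases "\<phi> []")
   case True
   then show ?thesis using ppos by simp
  next
   case False
   define h where "h c = hit_after n \<phi> c s q" for c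
   have hit_eq: "hit (Suc n) \<phi> s q = prb c s q * h c + prb (\<not> c) s q * h (\<not> c)" for c
    using False by (cases c) (simp_all add: h_def)
   have succ1: "h c = 1" if "loser c s \<notin> B" "\<theta> \<le> act1 c s q (loser c s)" "act1 c s q (loser c s) \<le> 3 * U" for c
    unfolding h_def
   proof (intro hit_start succ)
    have ge: "q j \<le> act1 c s q j" for j by (rule act1_ge[OF s pos_nonneg[OF q]])
    show "\<exists>j\<in>{1..d} - B. \<theta> \<le> act s [c] q j" using that loser_in[OF s, of c] by auto
    show "\<forall>b\<in>B. u0 b \<le> act s [c] q b" using Suc.prems(4) ge by (auto intro: order_trans)
    show "\<forall>j\<in>{1..d}. act s [c] q j \<le> 3 * U"
     using that le2 assms(3,4) by (force simp: act1_def)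
   qed
   have rec: "1 - (\<Prod>b\<in>B. act1 c s q b / u0 b) / 2 \<le> h c"
    if "\<forall>j\<in>{1..d} - B. act1 c s q j < \<theta>" "winner c s \<notin> B" for c
    unfolding h_def
   proof (rule Suc.IH)
    show "\<forall>j\<in>{1..d}. \<mu> \<le> act1 c s q j" by (rule act1_lower[OF s q Suc.prems(3)])
    show "\<forall>b\<in>B. u0 b \<le> act1 c s q b"
     using Suc.prems(4) act1_ge[OF s pos_nonneg[OF q]] by (meson order_trans)
    show "ends (rstep c s) \<inter> ({1..d} - B) \<noteq> {}"
     using that(2) winner_stays[of c s] winner_in[OF s, of c] by blast
    show "real d * (2 * U) - (\<Sum>j\<in>{1..d}. act1 c s q j) \<le> real n * \<mu>"
     using sum_act1_ge[OF s Suc.prems(3), of c] Suc.prems(8) by (simp add: algebra_simps)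
    show "\<phi> (c # u)" if "\<exists>j\<in>{1..d} - B. \<theta> \<le> act (rstep c s) u (act1 c s q) j"
     "\<forall>b\<in>B. u0 b \<le> act (rstep c s) u (act1 c s q) b"
     "\<forall>j\<in>{1..d}. act (rstep c s) u (act1 c s q) j \<le> 3 * U" for u
     using succ[of "c # u"] that by simp
   qed (use s q that valid_step pos_act1 in auto)
   have small: "q j < \<theta>" if "j \<in> {1..d}" "j \<notin> B" for j using Suc.prems(5) that by blast
   have "winner True s \<notin> B \<or> winner False s \<notin> B"
    using Suc.prems(6) by (auto simp: winner_def ends_def)
   then obtain c where c: "winner c s \<notin> B" by blast
   show ?thesis
   proof (cases "loser c s \<in> B")
    case lB: False
    \<comment> \<open>Two small letters meet: the product does not change, and the loser either
      stays below \<theta> or has become big, which is success.\<close>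
    have "1 - (\<Prod>b\<in>B. q b / u0 b) / 2 \<le> h c'" for c'
    proof -
     have w: "winner c' s \<notin> B" "loser c' s \<notin> B" using c lB
      by (cases c; cases c'; simp add: winner_def loser_def)+
     have l: "act1 c' s q (loser c' s) < 2 * \<theta>"
      using small[OF winner_in[OF s] w(1)] small[OF loser_in[OF s] w(2)] by (simp add: act1_def)
     show ?thesis
     proof (cases "\<theta> \<le> act1 c' s q (loser c' s)")
      case True
      then have "h c' = 1" using l w assms(3,4) by (intro succ1) auto
      then show ?thesis using ppos by simp
     next
      case F: False
      have "(\<Prod>b\<in>B. act1 c' s q b / u0 b) = (\<Prod>b\<in>B. q b / u0 b)"
       using w by (intro prod.cong) (auto simp: act1_def)
      moreover have "\<forall>j\<in>{1..d} - B. act1 c' s q j < \<theta>"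
       using F Suc.prems(5) by (auto simp: act1_def)
      ultimately show ?thesis using rec[of c'] w by simp
     qed
    qed
    then show ?thesis unfolding hit_eq[of True] using convex_ge[OF s q] by simp
   next
    case lB: True
    let ?b = "loser c s" and ?w = "winner c s"
    have flip: "loser (\<not> c) s = ?w" "winner (\<not> c) s = ?b" by (auto simp: winner_def loser_def)
    have qw: "0 < q ?w" "q ?w < \<theta>" using q winner_in[OF s, of c] small c by (auto simp: pos_def)
    have qb: "0 < q ?b" "\<theta> \<le> q ?b" "q ?b < 2 * U"
     using q loser_in[OF s, of c] big[OF lB] Suc.prems(4) assms(2)[OF lB] lB by (force simp: pos_def)+
    \<comment> \<open>Here the small letter loses against the big one, adds the big rate to its own
      and is thereby big.\<close>
    have "h (\<not> c) = 1"
     using flip c qb qw assms(3,4) by (intro succ1) (auto simp: act1_def)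
    moreover have "1 - (\<Prod>b\<in>B. act1 c s q b / u0 b) / 2 \<le> h c"
     using c lB Suc.prems(5) by (intro rec) (auto simp: act1_def)
    moreover have "(\<Prod>b\<in>B. act1 c s q b / u0 b) = (q ?b + q ?w) / q ?b * (\<Prod>b\<in>B. q b / u0 b)"
    proof -
     have "(\<Prod>b\<in>B. act1 c s q b / u0 b) = act1 c s q ?b / u0 ?b * (\<Prod>b\<in>B - {?b}. act1 c s q b / u0 b)"
      by (rule prod.remove[OF finB lB])
     also have "(\<Prod>b\<in>B - {?b}. act1 c s q b / u0 b) = (\<Prod>b\<in>B - {?b}. q b / u0 b)"
      by (intro prod.cong) (auto simp: act1_def)
     also have "act1 c s q ?b / u0 ?b = (q ?b + q ?w) / q ?b * (q ?b / u0 ?b)"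
      using qb by (simp add: act1_def)
     finally show ?thesis using prod.remove[OF finB lB, of "\<lambda>b. q b / u0 b"] by simp
    qed
    ultimately have "prb c s q * (1 - (q ?b + q ?w) / q ?b * (\<Prod>b\<in>B. q b / u0 b) / 2) + prb (\<not> c) s q * 1
      \<le> hit (Suc n) \<phi> s q"
     unfolding hit_eq[of c] using prb_nonneg[OF s q, of c] by (simp add: mult_left_mono)
    \<comment> \<open>The martingale identity: the small letter wins with probability
      \<open>q ?b / (q ?b + q ?w)\<close>, the reciprocal of the factor by which the product then
      grows.\<close>
    moreover have "prb c s q * ((q ?b + q ?w) / q ?b * P) = P" for P
    proof -
     have "prb c s q = q ?b / (q ?b + q ?w)" by (simp add: prb_def)
     then show ?thesis using qb qw by simp
    qed
    moreover have "prb c s q * (1 - X / 2) + prb (\<not> c) s q * 1 = 1 - prb c s q * X / 2" for X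
     using prb_cases[OF s q, of c] by (simp add: algebra_simps)
    ultimately show ?thesis by metis
   qed
  qed
 qed
qed

lemma enough_steps: "0 < \<mu> \<Longrightarrow> \<exists>n. (x :: real) \<le> real n * \<mu>"
 using reals_Archimedean3[of \<mu>] by (meson less_imp_le)

lemma pos_lower: assumes "pos q" obtains \<mu> where "0 < \<mu>" "\<forall>j\<in>{1..d}. \<mu> \<le> q j"
proof (rule that[of "Min (q ` {1..d})"])
 show "0 < Min (q ` {1..d})" using assms d2 unfolding pos_def by (subst Min_gr_iff) auto
 show "\<forall>j\<in>{1..d}. Min (q ` {1..d}) \<le> q j" by auto
qed

abbreviation rates_ge :: "nat \<Rightarrow> real \<Rightarrow> rows \<Rightarrow> weights \<Rightarrow> real \<Rightarrow> bool list \<Rightarrow> bool" where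
 "rates_ge k C s q \<theta> u \<equiv> \<exists>B\<subseteq>{1..d}. card B = k \<and> (\<forall>b\<in>B. \<theta> \<le> act s u q b) \<and> (\<forall>j\<in>{1..d}. act s u q j \<le> C * \<theta>)"

text \<open>The parameter \<theta> is the present maximal rate; the point is that \<open>c\<close>
  depends neither on the state nor on the rates nor on the scale.\<close>

abbreviation likely :: "real \<Rightarrow> (rows \<Rightarrow> weights \<Rightarrow> real \<Rightarrow> bool list \<Rightarrow> bool) \<Rightarrow> bool" where
 "likely c P \<equiv> \<forall>s q \<theta>. valid s \<longrightarrow> (\<forall>j\<in>{1..d}. 0 < q j \<and> q j \<le> \<theta>) \<longrightarrow> (\<exists>j\<in>{1..d}. q j = \<theta>) \<longrightarrow>
   (\<exists>n. c \<le> hit n (P s q \<theta>) s q)"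

text \<open>Induction on the number of letters whose rates are comparable to \<theta>. A short word
  brings a further letter to an end through contests among big letters only, each with probability
  at least \<rho>. Then \<open>small_letter_grows\<close>, started with product 1, makes one more
  letter big with probability at least \<open>1 / 2\<close>.\<close>

lemma balanced_subset:
 assumes "1 \<le> k" "k \<le> d"
 shows "\<exists>C\<ge>1. \<exists>c>0. c \<le> 1 \<and> likely c (rates_ge k C)"
 using assms
proof (induction k rule: nat_induct_at_least)
 case base
 have "\<exists>n. 1 \<le> hit n (rates_ge 1 1 s q \<theta>) s q"
  if q: "\<forall>j\<in>{1..d}. 0 < q j \<and> q j \<le> \<theta>" and ex: "\<exists>j\<in>{1..d}. q j = \<theta>" for s q and \<theta> :: real
 proof -
  obtain j where "j \<in> {1..d}" "q j = \<theta>" using ex by blast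
  then show ?thesis using q by (intro exI[of _ 0], subst hit_start) (auto intro!: exI[of _ "{j}"])
 qed
 then show ?case by (intro exI[of _ "1::real"] conjI allI impI) simp_all
next
 case (Suc k)
 then have "k \<le> d" by simp
 from Suc.IH[OF this] obtain C c where C: "C \<ge> 1" and c: "0 < c" "c \<le> 1" and ih: "likely c (rates_ge k C)" by blast
 from first_visit_bounded obtain N where
  N: "\<forall>s S. valid s \<and> S \<subseteq> {1..d} \<and> S \<noteq> {} \<longrightarrow> (\<exists>w. length w \<le> N \<and> first_visit S s w)" ..
 define \<rho> where "\<rho> = 1 / (2 * 2 ^ N * C)"
 define C' where "C' = 3 * 2 ^ N * C"
 define c' where "c' = \<rho> ^ N / 2 * c"
 have N1: "(1::real) \<le> 2 ^ N" by simp
 have C1: "1 \<le> 2 ^ N * C" using mult_mono[OF N1 C] by simp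
 have \<rho>: "0 < \<rho>" "\<rho> \<le> 1" using C C1 by (auto simp: \<rho>_def field_simps)
 have C': "1 \<le> C'" using C1 by (simp add: C'_def)
 have c': "0 < c'" "c' \<le> 1"
 proof -
  show "0 < c'" using \<rho> c by (simp add: c'_def)
  have "\<rho> ^ N / 2 \<le> 1" using \<rho> power_le_one[of \<rho> N] by simp
  then show "c' \<le> 1" unfolding c'_def using c \<rho> by (intro mult_le_one) auto
 qed
 have "\<exists>n. c' \<le> hit n (rates_ge (Suc k) C' s q \<theta>) s q"
  if s: "valid s" and q: "\<forall>j\<in>{1..d}. 0 < q j \<and> q j \<le> \<theta>" and ex: "\<exists>j\<in>{1..d}. q j = \<theta>" for s q \<theta>
 proof -
  have posq: "pos q" using q by (auto simp: pos_def)
  have th: "0 < \<theta>" using q ex by blast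
  let ?\<psi> = "rates_ge k C s q \<theta>"
  let ?\<phi> = "rates_ge (Suc k) C' s q \<theta>"
  obtain n where n: "c \<le> hit n ?\<psi> s q" using ih s q ex by blast
  have "\<exists>m. \<rho> ^ N / 2 * hit n ?\<psi> s q \<le> hit m ?\<phi> s q"
  proof (rule hit_compose[OF s posq])
   show "0 \<le> \<rho> ^ N / 2" "\<rho> ^ N / 2 \<le> 1" using \<rho> power_le_one[of \<rho> N] by auto
   fix u assume "?\<psi> u"
   then obtain B where B: "B \<subseteq> {1..d}" "card B = k" "\<forall>b\<in>B. \<theta> \<le> act s u q b"
    and le: "\<forall>j\<in>{1..d}. act s u q j \<le> C * \<theta>" by blast
   define s1 q1 where "s1 = st s u" and "q1 = act s u q"
   have v1: "valid s1" and p1: "pos q1" using valid_st[OF s] pos_act[OF s posq] by (auto simp: s1_def q1_def)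
   have "{1..d} - B \<noteq> {}"
   proof
    assume "{1..d} - B = {}"
    then have "B = {1..d}" using B(1) by blast
    then show False using B(2) Suc.prems by simp
   qed
   then obtain w where w: "length w \<le> N" "first_visit ({1..d} - B) s1 w"
    using N v1 by blast
   define s2 q2 where "s2 = st s1 w" and "q2 = act s1 w q1"
   have v2: "valid s2" and p2: "pos q2" using valid_st[OF v1] pos_act[OF v1 p1] by (auto simp: s2_def q2_def)
   have bd: "act s1 v q1 j \<le> 2 ^ N * C * \<theta>" if "length v \<le> N" "j \<in> {1..d}" for v j
   proof -
    have "act s1 v q1 j \<le> 2 ^ length v * (C * \<theta>)"
     using le C th that by (intro act_le[OF v1]) (auto simp: q1_def)
    also have "\<dots> \<le> 2 ^ N * (C * \<theta>)"
     using that C th by (intro mult_right_mono power_increasing) auto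
    finally show ?thesis by (simp add: mult.assoc)
   qed
   have lb: "\<theta> \<le> act s1 v q1 b" if "b \<in> B" for v b
    using act_ge[OF v1 pos_nonneg[OF p1], of b v] B(3) that by (force simp: q1_def)
   have "\<rho> ^ length w \<le> hit (length w) (\<lambda>v. v = w) s1 q1"
   proof (rule hit_path[OF v1 p1])
    show "0 \<le> \<rho>" "\<rho> \<le> 1" "w = w" using \<rho> by auto
    fix v c v' assume e: "w = v @ c # v'"
    have vv: "valid (st s1 v)" by (rule valid_st[OF v1])
    have "ends (st s1 v) \<inter> ({1..d} - B) = {}" using w(2) e unfolding first_visit_def by blast
    then have "loser c (st s1 v) \<in> B" "winner c (st s1 v) \<in> B"
     using ends_eq[of "st s1 v" c] loser_in[OF vv, of c] winner_in[OF vv, of c] by auto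
    then have l: "\<theta> \<le> act s1 v q1 (loser c (st s1 v))" using lb by blast
    have m: "act s1 v q1 (loser c (st s1 v)) + act s1 v q1 (winner c (st s1 v)) \<le> 2 * (2 ^ N * C * \<theta>)"
     using bd[OF _ loser_in[OF vv], of v c] bd[OF _ winner_in[OF vv], of v c] w(1) e by simp
    have wp: "0 < act s1 v q1 (winner c (st s1 v))"
     using pos_act[OF v1 p1] winner_in[OF vv] unfolding pos_def by blast
    have "\<rho> = \<theta> / (2 * (2 ^ N * C * \<theta>))" using th by (simp add: \<rho>_def)
    also have "\<dots> \<le> prb c (st s1 v) (act s1 v q1)"
     unfolding prb_def using l m wp th by (intro frac_le) auto
    finally show "\<rho> \<le> prb c (st s1 v) (act s1 v q1)" .
   qed
   moreover have "\<rho> ^ N \<le> \<rho> ^ length w" using \<rho> w(1) by (intro power_decreasing) auto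
   ultimately have hw: "\<rho> ^ N \<le> hit (length w) (\<lambda>v. v = w) s1 q1" by linarith
   have "\<exists>m. 1 / 2 \<le> hit m (\<lambda>x. ?\<phi> (u @ w @ x)) s2 q2"
   proof -
    obtain \<mu> where \<mu>: "0 < \<mu>" "\<forall>j\<in>{1..d}. \<mu> \<le> q2 j" using pos_lower[OF p2] .
    have good: "?\<phi> (u @ w @ x)" if a1: "\<exists>j\<in>{1..d} - B. \<theta> \<le> act s2 x q2 j"
     and a2: "\<forall>b\<in>B. q2 b \<le> act s2 x q2 b"
     and a3: "\<forall>j\<in>{1..d}. act s2 x q2 j \<le> 3 * (2 ^ N * C * \<theta>)" for x
    proof -
     obtain j where j: "j \<in> {1..d} - B" "\<theta> \<le> act s2 x q2 j" using a1 by blast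
     have e: "act s (u @ w @ x) q = act s2 x q2"
      by (simp add: act_append s2_def q2_def s1_def q1_def st_append)
     have "insert j B \<subseteq> {1..d}" "card (insert j B) = Suc k"
      using B j finite_subset[OF B(1)] by auto
     moreover have "\<forall>b\<in>insert j B. \<theta> \<le> act s (u @ w @ x) q b"
      unfolding e using j a2 lb[of _ w] by (force simp: q2_def)
     moreover have "\<forall>j\<in>{1..d}. act s (u @ w @ x) q j \<le> C' * \<theta>"
      unfolding e using a3 by (simp add: C'_def mult.assoc)
     ultimately show ?thesis by blast
    qed
    show ?thesis
    proof (cases "\<exists>j\<in>{1..d} - B. \<theta> \<le> q2 j")
     case True
     have X: "0 \<le> 2 ^ N * C * \<theta>" using th C by simp
     have "q2 j \<le> 3 * (2 ^ N * C * \<theta>)" if "j \<in> {1..d}" for j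
      using bd[OF w(1) that] X unfolding q2_def by linarith
     then have "?\<phi> (u @ w @ [])" using True by (intro good) simp_all
     then have h: "hit 0 (\<lambda>x. ?\<phi> (u @ w @ x)) s2 q2 = 1" by (simp only: hit.simps if_True)
     have "1 / 2 \<le> hit 0 (\<lambda>x. ?\<phi> (u @ w @ x)) s2 q2" unfolding h by simp
     then show ?thesis by blast
    next
     case False
     obtain n' where n': "real d * (2 * (2 ^ N * C * \<theta>)) - (\<Sum>j\<in>{1..d}. q2 j) \<le> real n' * \<mu>"
      using enough_steps[OF \<mu>(1)] by blast
     have "1 - (\<Prod>b\<in>B. q2 b / q2 b) / 2 \<le> hit n' (\<lambda>x. ?\<phi> (u @ w @ x)) s2 q2"
     proof (rule small_letter_grows[OF B(1) _ th _ \<mu>(1) v2 p2 \<mu>(2)])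
      show "\<theta> \<le> q2 b \<and> q2 b \<le> 2 ^ N * C * \<theta>" if "b \<in> B" for b
       using lb[OF that, of w] bd[OF w(1), of b] that B(1) by (auto simp: q2_def)
      show "\<theta> \<le> 2 ^ N * C * \<theta>" using mult_right_mono[OF C1, of \<theta>] th by simp
      show "\<forall>j\<in>{1..d} - B. q2 j < \<theta>" using False by force
      show "ends s2 \<inter> ({1..d} - B) \<noteq> {}" using w(2) by (simp add: first_visit_def s2_def)
     qed (use n' good in auto)
     moreover have "(\<Prod>b\<in>B. q2 b / q2 b) = 1"
      using p2 B(1) unfolding pos_def by (intro prod.neutral) force
     ultimately show ?thesis by auto
    qed
   qed
   then obtain m where m: "1 / 2 \<le> hit m (\<lambda>x. ?\<phi> (u @ w @ x)) s2 q2" by blast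
   have "\<exists>m. 1 / 2 * hit (length w) (\<lambda>v. v = w) s1 q1 \<le> hit m (\<lambda>v. ?\<phi> (u @ v)) s1 q1"
   proof (rule hit_compose[OF v1 p1])
    fix v assume "v = w"
    then show "\<exists>m. 1 / 2 \<le> hit m (\<lambda>x. ?\<phi> (u @ (v @ x))) (st s1 v) (act s1 v q1)"
     using m by (auto simp: s2_def q2_def)
   qed auto
   then obtain m where "1 / 2 * hit (length w) (\<lambda>v. v = w) s1 q1 \<le> hit m (\<lambda>v. ?\<phi> (u @ v)) s1 q1" by blast
   then have "\<rho> ^ N / 2 \<le> hit m (\<lambda>v. ?\<phi> (u @ v)) s1 q1" using hw by linarith
   then show "\<exists>m. \<rho> ^ N / 2 \<le> hit m (\<lambda>v. ?\<phi> (u @ v)) (st s u) (act s u q)"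
    unfolding s1_def q1_def by blast
  qed
  then obtain m where m: "\<rho> ^ N / 2 * hit n ?\<psi> s q \<le> hit m ?\<phi> s q" by blast
  have "c' \<le> \<rho> ^ N / 2 * hit n ?\<psi> s q" unfolding c'_def using n \<rho> by (intro mult_left_mono) auto
  then show ?thesis using m order_trans by blast
 qed
 then show ?case using C' c' by blast
qed

end

section \<open>Mixing blocks at every scale\<close>

context rauzy
begin

abbreviation "cnt s w \<equiv> act s w (\<lambda>_. 1)"

text \<open>Besides mixing all letters, \<open>v\<close> keeps all rates before and after it
  comparable up to \<open>C\<close>. When the rates are tower heights, such a block contracts the
  spread of ratios by a factor that depends on \<open>C\<close> only.\<close>

definition mixing_block :: "real \<Rightarrow> rows \<Rightarrow> weights \<Rightarrow> bool list \<Rightarrow> bool list \<Rightarrow> bool" where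
 "mixing_block C s q u v \<longleftrightarrow> positive_word (st s u) v \<and>
   (\<forall>j\<in>{1..d}. \<forall>\<beta>\<in>{1..d}. act s (u @ v) q j \<le> C * act s u q \<beta>)"

lemma mixing_block_shift:
 "mixing_block C (st s u) (act s u q) v w \<longleftrightarrow> mixing_block C s q (u @ v) w"
 by (simp add: mixing_block_def st_append act_append)

abbreviation mixed :: "real \<Rightarrow> real \<Rightarrow> rows \<Rightarrow> weights \<Rightarrow> bool list \<Rightarrow> bool" where
 "mixed C M s q w \<equiv> \<exists>u v. w = u @ v \<and> mixing_block C s q u v \<and> (\<forall>j\<in>{1..d}. act s w q j \<le> M)"

abbreviation blocks_likely :: "real \<Rightarrow> real \<Rightarrow> real \<Rightarrow> bool" where
 "blocks_likely c C0 C \<equiv> \<forall>s q \<theta>. valid s \<longrightarrow> 0 < \<theta> \<longrightarrow> (\<forall>j\<in>{1..d}. \<theta> \<le> q j \<and> q j \<le> C0 * \<theta>) \<longrightarrow>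
   (\<exists>n. c \<le> hit n (\<lambda>v. mixing_block C s q [] v \<and> (\<forall>j\<in>{1..d}. act s v q j \<le> C * \<theta>)) s q)"

lemma block_from_balanced:
 assumes "C0 \<ge> 1"
 shows "\<exists>C\<ge>C0. \<exists>c>0. c \<le> 1 \<and> blocks_likely c C0 C"
proof -
 from positive_word_bounded obtain N where
  N: "\<forall>s. valid s \<longrightarrow> (\<exists>w. length w \<le> N \<and> positive_word s w)" ..
 define C where "C = 2 ^ N * C0"
 define \<rho> where "\<rho> = 1 / (2 * C)"
 have "1 * C0 \<le> 2 ^ N * C0" using assms by (intro mult_right_mono) auto
 then have C: "C0 \<le> C" by (simp add: C_def)
 with assms have C: "C0 \<le> C" "1 \<le> C" by linarith+
 have \<rho>: "0 < \<rho>" "\<rho> \<le> 1" using C by (auto simp: \<rho>_def)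
 have "\<exists>n. \<rho> ^ N \<le> hit n (\<lambda>v. mixing_block C s q [] v \<and> (\<forall>j\<in>{1..d}. act s v q j \<le> C * \<theta>)) s q"
  if s: "valid s" and th: "0 < \<theta>" and q: "\<forall>j\<in>{1..d}. \<theta> \<le> q j \<and> q j \<le> C0 * \<theta>" for s q \<theta>
 proof -
  obtain w where w: "length w \<le> N" "positive_word s w" using N s by blast
  have p: "pos q" using q th by (force simp: pos_def)
  have lb: "\<theta> \<le> act s v q j" if "j \<in> {1..d}" for v j
   using act_ge[OF s pos_nonneg[OF p], of j v] q that by force
  have bd: "act s v q j \<le> C * \<theta>" if "length v \<le> N" "j \<in> {1..d}" for v j
  proof -
   have "act s v q j \<le> 2 ^ length v * (C0 * \<theta>)"
    using q assms th that by (intro act_le[OF s]) auto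
   also have "\<dots> \<le> 2 ^ N * (C0 * \<theta>)"
    using that assms th by (intro mult_right_mono power_increasing) auto
   finally show ?thesis by (simp add: C_def mult.assoc)
  qed
  have good: "mixing_block C s q [] w \<and> (\<forall>j\<in>{1..d}. act s w q j \<le> C * \<theta>)"
  proof -
   have "act s w q j \<le> C * q \<beta>" if "j \<in> {1..d}" "\<beta> \<in> {1..d}" for j \<beta>
   proof -
    have "C * \<theta> \<le> C * q \<beta>" using q that C by (intro mult_left_mono) auto
    then show ?thesis using bd[OF w(1) that(1)] by linarith
   qed
   then show ?thesis using w bd[OF w(1)] by (simp add: mixing_block_def)
  qed
  have "\<rho> ^ length w \<le> hit (length w) (\<lambda>v. mixing_block C s q [] v \<and> (\<forall>j\<in>{1..d}. act s v q j \<le> C * \<theta>)) s q"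
  proof (rule hit_path[OF s p])
   show "mixing_block C s q [] w \<and> (\<forall>j\<in>{1..d}. act s w q j \<le> C * \<theta>)" by (rule good)
   show "0 \<le> \<rho>" "\<rho> \<le> 1" using \<rho> by auto
   fix v c v' assume e: "w = v @ c # v'"
   have vv: "valid (st s v)" by (rule valid_st[OF s])
   have l: "\<theta> \<le> act s v q (loser c (st s v))" "\<theta> \<le> act s v q (winner c (st s v))"
    using lb loser_in[OF vv] winner_in[OF vv] by blast+
   have m: "act s v q (loser c (st s v)) + act s v q (winner c (st s v)) \<le> 2 * (C * \<theta>)"
    using bd[OF _ loser_in[OF vv], of v c] bd[OF _ winner_in[OF vv], of v c] w(1) e by simp
   have "\<rho> = \<theta> / (2 * (C * \<theta>))" using th by (simp add: \<rho>_def)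
   also have "\<dots> \<le> prb c (st s v) (act s v q)"
    unfolding prb_def using l m th by (intro frac_le) auto
   finally show "\<rho> \<le> prb c (st s v) (act s v q)" .
  qed
  moreover have "\<rho> ^ N \<le> \<rho> ^ length w" using \<rho> w(1) by (intro power_decreasing) auto
  ultimately show ?thesis using order_trans by blast
 qed
 moreover have "0 < \<rho> ^ N" "\<rho> ^ N \<le> 1" using \<rho> power_le_one[of \<rho> N] by auto
 ultimately show ?thesis using C(1) by blast
qed

lemma block_trial:
 "\<exists>C\<ge>1. \<exists>c>0. c \<le> 1 \<and> likely c (\<lambda>s q \<theta>. mixed C (C * \<theta>) s q)"
proof -
 have "1 \<le> d" using d2 by simp
 from balanced_subset[OF this order_refl] obtain C0 c0 where C0: "C0 \<ge> 1" and c0: "0 < c0" "c0 \<le> 1"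
  and bal: "likely c0 (rates_ge d C0)" by blast
 from block_from_balanced[OF C0] obtain C c where C: "C \<ge> C0" and c: "0 < c" "c \<le> 1"
  and blk: "blocks_likely c C0 C" by blast
 have "\<exists>n. c * c0 \<le> hit n (mixed C (C * \<theta>) s q) s q"
  if s: "valid s" and q: "\<forall>j\<in>{1..d}. 0 < q j \<and> q j \<le> \<theta>" and ex: "\<exists>j\<in>{1..d}. q j = \<theta>" for s q \<theta>
 proof -
  have p: "pos q" and th: "0 < \<theta>" using q ex by (auto simp: pos_def)
  let ?\<psi> = "rates_ge d C0 s q \<theta>"
  let ?\<phi> = "mixed C (C * \<theta>) s q"
  obtain n where n: "c0 \<le> hit n ?\<psi> s q" using bal s q ex by blast
  have "\<exists>m. c * hit n ?\<psi> s q \<le> hit m ?\<phi> s q"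
  proof (rule hit_compose[OF s p])
   fix u assume "?\<psi> u"
   then obtain B where B: "B \<subseteq> {1..d}" "card B = d" "\<forall>b\<in>B. \<theta> \<le> act s u q b"
    and le: "\<forall>j\<in>{1..d}. act s u q j \<le> C0 * \<theta>" by blast
   have "B = {1..d}" using card_subset_eq[OF _ B(1)] B(2) by simp
   then have "\<forall>j\<in>{1..d}. \<theta> \<le> act s u q j \<and> act s u q j \<le> C0 * \<theta>" using B le by blast
   then obtain m where m: "c \<le> hit m (\<lambda>v. mixing_block C (st s u) (act s u q) [] v \<and>
     (\<forall>j\<in>{1..d}. act (st s u) v (act s u q) j \<le> C * \<theta>)) (st s u) (act s u q)"
    using blk valid_st[OF s, of u] th by blast
   also have "\<dots> \<le> hit m (\<lambda>v. ?\<phi> (u @ v)) (st s u) (act s u q)"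
   proof (rule hit_mono[OF valid_st[OF s] pos_act[OF s p] order_refl])
    fix v assume "mixing_block C (st s u) (act s u q) [] v \<and> (\<forall>j\<in>{1..d}. act (st s u) v (act s u q) j \<le> C * \<theta>)"
    then have "mixing_block C s q u v \<and> (\<forall>j\<in>{1..d}. act s (u @ v) q j \<le> C * \<theta>)"
     by (simp add: mixing_block_shift act_append)
    then show "?\<phi> (u @ v)" by blast
   qed
   finally show "\<exists>m. c \<le> hit m (\<lambda>v. ?\<phi> (u @ v)) (st s u) (act s u q)" by blast
  qed (use c in auto)
  moreover have "c * c0 \<le> c * hit n ?\<psi> s q" using n c by (intro mult_left_mono) auto
  ultimately show ?thesis using order_trans by blast
 qed
 moreover have "0 < c * c0" "c * c0 \<le> 1" using c c0 by (auto intro: mult_le_one)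
 moreover have "1 \<le> C" using C0 C by linarith
 ultimately show ?thesis by blast
qed

text \<open>A trial either succeeds with rates at most \<open>C * \<theta>'\<close> or is abandoned
  with rates at most \<open>2 * C * \<theta>'\<close>. So \<open>K\<close> trials fit below
  \<open>(2 * C) ^ K * \<theta>\<close>, and all of them fail with probability at most
  \<open>(1 - c) ^ K\<close>.\<close>

lemma block_within_scales:
 assumes C: "C \<ge> 1" and c: "0 < c" "c \<le> 1"
  and trial: "likely c (\<lambda>s q \<theta>. mixed C (C * \<theta>) s q)"
  and "valid s" "\<forall>j\<in>{1..d}. 0 < q j \<and> q j \<le> \<theta>"
 shows "\<exists>n. 1 - (1 - c) ^ K \<le>
   hit n (mixed C ((2 * C) ^ K * \<theta>) s q) s q"
 using assms(5-)
proof (induction K arbitrary: s q \<theta>)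
 case 0
 have "pos q" using 0 by (auto simp: pos_def)
 from hit_nonneg[OF 0(1) this] show ?case by auto
next
 case (Suc K)
 note s = Suc.prems(1)
 have p: "pos q" using Suc.prems by (auto simp: pos_def)
 \<comment> \<open>The hypothesis \<open>trial\<close> is normalised by a rate that is attained, so
   the actual maximum replaces the bound \<theta>.\<close>
 define \<theta>' where "\<theta>' = Max (q ` {1..d})"
 have ne: "q ` {1..d} \<noteq> {}" using d2 by auto
 have "\<theta>' \<in> q ` {1..d}" unfolding \<theta>'_def using ne by (intro Max_in) auto
 then have ex: "\<exists>j\<in>{1..d}. q j = \<theta>'" and le: "\<theta>' \<le> \<theta>" and pos': "0 < \<theta>'" using Suc.prems(2) by auto
 have q': "\<forall>j\<in>{1..d}. 0 < q j \<and> q j \<le> \<theta>'" using Suc.prems(2) by (auto simp: \<theta>'_def)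
 let ?\<psi> = "mixed C (C * \<theta>') s q"
 let ?\<phi> = "mixed C ((2 * C) ^ Suc K * \<theta>) s q"
 obtain n where n: "c \<le> hit n ?\<psi> s q" using trial s q' ex by blast
 define f where "f = 1 - (1 - c) ^ K"
 have f: "0 \<le> f" "f \<le> 1" using c power_le_one[of "1 - c" K] by (auto simp: f_def)
 have "\<exists>m. hit n ?\<psi> s q + (1 - hit n ?\<psi> s q) * f \<le> hit m ?\<phi> s q"
 proof (rule hit_mixture[OF s p, where M = "C * \<theta>'"])
  have c1: "1 * \<theta>' \<le> C * \<theta>'" using C pos' by (intro mult_right_mono) auto
  show "\<forall>j\<in>{1..d}. q j \<le> 2 * (C * \<theta>')"
  proof
   fix j assume "j \<in> {1..d}"
   then have "q j \<le> \<theta>'" using q' by blast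
   then show "q j \<le> 2 * (C * \<theta>')" using c1 pos' by linarith
  qed
  show "0 \<le> f" "f \<le> 1" by (fact f)+
  show "\<forall>j\<in>{1..d}. act s w q j \<le> C * \<theta>'" if "?\<psi> w" for w using that by blast
  have b: "C * \<theta>' \<le> (2 * C) ^ Suc K * \<theta>"
  proof (rule mult_mono[OF _ le])
   have "(2 * C) ^ 1 \<le> (2 * C) ^ Suc K" using C by (intro power_increasing) auto
   then show "C \<le> (2 * C) ^ Suc K" using C by simp
  qed (use C pos' in auto)
  show "?\<phi> w" if "?\<psi> w" for w using that b order_trans by blast
  show "\<exists>m. f \<le> hit m (\<lambda>v. ?\<phi> (u @ v)) (st s u) (act s u q)"
   if u: "\<forall>j\<in>{1..d}. act s u q j \<le> 2 * (C * \<theta>')" for u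
  proof -
   let ?s = "st s u" and ?q = "act s u q"
   have v: "valid ?s" and pq: "pos ?q" using valid_st[OF s] pos_act[OF s p] by auto
   have "\<forall>j\<in>{1..d}. 0 < ?q j \<and> ?q j \<le> 2 * C * \<theta>'"
    using u pq by (auto simp: pos_def mult.assoc)
   from Suc.IH[OF v this] obtain m where
    m: "f \<le> hit m (\<lambda>w. \<exists>u v. w = u @ v \<and> mixing_block C ?s ?q u v \<and>
       (\<forall>j\<in>{1..d}. act ?s w ?q j \<le> (2 * C) ^ K * (2 * C * \<theta>'))) ?s ?q" unfolding f_def by blast
   also have "\<dots> \<le> hit m (\<lambda>v. ?\<phi> (u @ v)) ?s ?q"
   proof (rule hit_mono[OF v pq order_refl])
    fix w assume "\<exists>u v. w = u @ v \<and> mixing_block C ?s ?q u v \<and>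
       (\<forall>j\<in>{1..d}. act ?s w ?q j \<le> (2 * C) ^ K * (2 * C * \<theta>'))"
    then obtain u' v where uv: "w = u' @ v" "mixing_block C s q (u @ u') v"
     and le': "\<forall>j\<in>{1..d}. act s (u @ w) q j \<le> (2 * C) ^ K * (2 * C * \<theta>')"
     by (auto simp: mixing_block_shift act_append)
    have "(2 * C) ^ K * (2 * C * \<theta>') \<le> (2 * C) ^ K * (2 * C * \<theta>)"
     using le C by (intro mult_left_mono) auto
    also have "\<dots> = (2 * C) ^ Suc K * \<theta>" by simp
    finally have "\<forall>j\<in>{1..d}. act s (u @ w) q j \<le> (2 * C) ^ Suc K * \<theta>" using le' by (meson order_trans)
    then show "?\<phi> (u @ w)" using uv by (intro exI[of _ "u @ u'"] exI[of _ v]) simp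
   qed
   finally show ?thesis by blast
  qed
 qed
 then obtain m where m: "hit n ?\<psi> s q + (1 - hit n ?\<psi> s q) * f \<le> hit m ?\<phi> s q" by blast
 have "1 - (1 - c) ^ Suc K = c + (1 - c) * f" by (simp add: f_def algebra_simps)
 also have "\<dots> = f + c * (1 - f)" by (simp add: algebra_simps)
 also have "\<dots> \<le> f + hit n ?\<psi> s q * (1 - f)" using n f by (intro add_left_mono mult_right_mono) auto
 also have "\<dots> = hit n ?\<psi> s q + (1 - hit n ?\<psi> s q) * f" by (simp add: algebra_simps)
 also note m
 finally show ?case by blast
qed

text \<open>The scale \<open>X\<close> is reached with certainty because each step adds at least
  \<mu> to the sum of the rates; it is overshot by a factor of at most 2.\<close>

lemma rate_reaches:
 assumes "0 < \<mu>" "valid s" "\<forall>j\<in>{1..d}. \<mu> \<le> q j \<and> q j \<le> 2 * X"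
  and "real d * X - (\<Sum>j\<in>{1..d}. q j) \<le> real n * \<mu>"
  and "\<And>u. \<exists>j\<in>{1..d}. X \<le> act s u q j \<Longrightarrow> \<forall>j\<in>{1..d}. act s u q j \<le> 2 * X \<Longrightarrow> \<phi> u"
 shows "hit n \<phi> s q = 1"
 using assms(2-)
proof (induction n arbitrary: s q \<phi>)
 case (0 s q \<phi>)
 have "\<exists>j\<in>{1..d}. X \<le> q j"
 proof (rule ccontr)
  assume "\<not> ?thesis"
  then have "(\<Sum>j\<in>{1..d}. q j) < (\<Sum>j\<in>{1..d}. X)" using d2 by (intro sum_strict_mono) (auto simp: not_le)
  then show False using 0(3) by simp
 qed
 then have "\<phi> []" using 0(2,4) by auto
 then show ?case by simp
next
 case (Suc n s q \<phi>)
 note s = Suc.prems(1)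
 have p: "pos q" using Suc.prems(2) assms(1) by (force simp: pos_def)
 show ?case
 proof (cases "\<exists>j\<in>{1..d}. X \<le> q j")
  case True
  then have "\<phi> []" using Suc.prems(2,4) by auto
  then show ?thesis by simp
 next
  case False
  have "hit n (\<lambda>u. \<phi> (c # u)) (rstep c s) (act1 c s q) = 1" for c
  proof (rule Suc.IH)
   show "valid (rstep c s)" by (rule valid_step[OF s])
   have lt: "\<forall>j\<in>{1..d}. q j \<le> X" using False by force
   obtain j where "j \<in> {1..d}" "0 < q j" using p d2 unfolding pos_def by force
   then have "0 \<le> X" using lt by (meson less_imp_le order_trans)
   moreover have "\<forall>j\<in>{1..d}. \<mu> \<le> act1 c s q j"
    using Suc.prems(2) by (intro act1_lower[OF s p]) blast
   ultimately show "\<forall>j\<in>{1..d}. \<mu> \<le> act1 c s q j \<and> act1 c s q j \<le> 2 * X"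
    using act1_le[OF s lt] by blast
   show "real d * X - (\<Sum>j\<in>{1..d}. act1 c s q j) \<le> real n * \<mu>"
    using sum_act1_ge[OF s, of \<mu> q c] Suc.prems(2,3) by (simp add: algebra_simps)
   show "\<phi> (c # u)" if "\<exists>j\<in>{1..d}. X \<le> act (rstep c s) u (act1 c s q) j"
    "\<forall>j\<in>{1..d}. act (rstep c s) u (act1 c s q) j \<le> 2 * X" for u
    using Suc.prems(4)[of "c # u"] that by simp
  qed
  then show ?thesis using prb_sum[OF s p] by simp
 qed
qed

definition block_between :: "real \<Rightarrow> rows \<Rightarrow> real \<Rightarrow> real \<Rightarrow> bool list \<Rightarrow> bool" where
 "block_between C s X Y w \<longleftrightarrow> (\<exists>u v. w = u @ v \<and> mixing_block C s (\<lambda>_. 1) u v \<and>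
   (\<exists>j\<in>{1..d}. X \<le> cnt s u j) \<and> (\<forall>j\<in>{1..d}. cnt s w j \<le> Y))"

lemma hit_block_between:
 "\<exists>C\<ge>1. \<exists>c>0. c \<le> 1 \<and> (\<forall>s X K. valid s \<longrightarrow> 1 \<le> X \<longrightarrow>
   (\<exists>n. 1 - (1 - c) ^ K \<le> hit n (block_between C s X ((2 * C) ^ K * (2 * X))) s (\<lambda>_. 1)))"
proof -
 from block_trial obtain C c where C: "C \<ge> 1" and c: "0 < c" "c \<le> 1" and
  trial: "likely c (\<lambda>s q \<theta>. mixed C (C * \<theta>) s q)"
  by blast
 have "\<exists>n. 1 - (1 - c) ^ K \<le> hit n (block_between C s X ((2 * C) ^ K * (2 * X))) s (\<lambda>_. 1)"
  if s: "valid s" and X: "1 \<le> X" for s X K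
 proof -
  let ?q = "\<lambda>_ :: nat. 1 :: real"
  let ?\<psi> = "\<lambda>u. (\<exists>j\<in>{1..d}. X \<le> act s u ?q j) \<and> (\<forall>j\<in>{1..d}. act s u ?q j \<le> 2 * X)"
  let ?b = "1 - (1 - c) ^ K"
  have p: "pos ?q" by (simp add: pos_def)
  obtain n where n: "real d * X - (\<Sum>j\<in>{1..d}. ?q j) \<le> real n * 1"
   using enough_steps[of 1 "real d * X - (\<Sum>j\<in>{1..d}. ?q j)"] by auto
  have h: "hit n ?\<psi> s ?q = 1"
   by (rule rate_reaches[OF _ s _ n]) (use X in auto)
  have "\<exists>m. ?b * hit n ?\<psi> s ?q \<le> hit m (block_between C s X ((2 * C) ^ K * (2 * X))) s ?q"
  proof (rule hit_compose[OF s p])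
   show "0 \<le> ?b" "?b \<le> 1" using c power_le_one[of "1 - c" K] by auto
   fix u assume u: "?\<psi> u"
   have v: "valid (st s u)" and pq: "pos (act s u ?q)" using valid_st[OF s] pos_act[OF s p] by auto
   have "\<forall>j\<in>{1..d}. 0 < act s u ?q j \<and> act s u ?q j \<le> 2 * X" using u pq by (auto simp: pos_def)
   from block_within_scales[OF C c trial v this] obtain m where
    m: "?b \<le> hit m (\<lambda>w. \<exists>u' v. w = u' @ v \<and> mixing_block C (st s u) (act s u ?q) u' v \<and>
      (\<forall>j\<in>{1..d}. act (st s u) w (act s u ?q) j \<le> (2 * C) ^ K * (2 * X))) (st s u) (act s u ?q)" by blast
   also have "\<dots> \<le> hit m (\<lambda>v. block_between C s X ((2 * C) ^ K * (2 * X)) (u @ v)) (st s u) (act s u ?q)"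
   proof (rule hit_mono[OF v pq order_refl])
    fix w assume "\<exists>u' v. w = u' @ v \<and> mixing_block C (st s u) (act s u ?q) u' v \<and>
      (\<forall>j\<in>{1..d}. act (st s u) w (act s u ?q) j \<le> (2 * C) ^ K * (2 * X))"
    then obtain u' v where uv: "w = u' @ v" "mixing_block C s ?q (u @ u') v"
     and le: "\<forall>j\<in>{1..d}. act s (u @ w) ?q j \<le> (2 * C) ^ K * (2 * X)"
     by (auto simp: mixing_block_shift act_append)
    obtain j where j: "j \<in> {1..d}" "X \<le> act s u ?q j" using u by blast
    have "act s u ?q j \<le> act s (u @ u') ?q j"
     unfolding act_append by (rule act_ge[OF valid_st[OF s] pos_nonneg[OF pos_act[OF s p]]])
    then have "\<exists>j\<in>{1..d}. X \<le> act s (u @ u') ?q j" using j by (meson order_trans)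
    then show "block_between C s X ((2 * C) ^ K * (2 * X)) (u @ w)"
     unfolding block_between_def using uv le by (intro exI[of _ "u @ u'"] exI[of _ v]) simp
   qed
   finally show "\<exists>m. ?b \<le> hit m (\<lambda>v. block_between C s X ((2 * C) ^ K * (2 * X)) (u @ v)) (st s u) (act s u ?q)"
    by blast
  qed
  then show ?thesis unfolding h by simp
 qed
 then show ?thesis using C c by blast
qed

end

section \<open>Exponentially distributed lengths\<close>

abbreviation leb :: "nat set \<Rightarrow> (nat \<Rightarrow> real) measure" where
 "leb I \<equiv> \<Pi>\<^sub>M i\<in>I. lborel"

lemma measurable_upd:
 assumes "i \<in> I" "h \<in> borel_measurable (leb I)"
 shows "(\<lambda>x. x(i := h x)) \<in> leb I \<rightarrow>\<^sub>M leb I"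
proof (rule measurable_PiM_single')
 fix j assume "j \<in> I"
 then show "(\<lambda>x. (x(i := h x)) j) \<in> leb I \<rightarrow>\<^sub>M lborel"
  using assms by (cases "j = i") (simp_all add: measurable_component_singleton)
next
 show "(\<lambda>x j. (x(i := h x)) j) \<in> space (leb I) \<rightarrow> (\<Pi>\<^sub>E i\<in>I. space lborel)"
  using assms(1) by (auto simp: space_PiM PiE_def extensional_def)
qed

lemma measurable_insert_upd:
 assumes "x \<in> space (leb J)"
 shows "(\<lambda>y. x(i := y)) \<in> borel \<rightarrow>\<^sub>M leb (insert i J)"
proof (rule measurable_PiM_single')
 fix j assume "j \<in> insert i J"
 then show "(\<lambda>y. (x(i := y)) j) \<in> borel \<rightarrow>\<^sub>M lborel" by (cases "j = i") simp_all
next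
 show "(\<lambda>y j. (x(i := y)) j) \<in> space borel \<rightarrow> (\<Pi>\<^sub>E i\<in>insert i J. space lborel)"
  using assms by (auto simp: space_PiM PiE_def extensional_def)
qed

lemma measurable_component: "i \<in> I \<Longrightarrow> (\<lambda>x. x i) \<in> borel_measurable (leb I)"
 using measurable_component_singleton[of i I "\<lambda>_. lborel :: real measure"] by simp

text \<open>Adding to one coordinate a function of the others is a translation on every line
  parallel to that axis. The inverse of a Rauzy step on lengths has this form.\<close>

lemma nn_integral_shear:
 assumes I: "finite I" "i \<in> I" and F: "F \<in> borel_measurable (leb I)"
  and g: "g \<in> borel_measurable (leb I)" "\<And>x y. g (x(i := y)) = g x"
 shows "(\<integral>\<^sup>+x. F (x(i := x i + g x)) \<partial>leb I) = (\<integral>\<^sup>+x. F x \<partial>leb I)"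
proof -
 interpret product_sigma_finite "\<lambda>_ :: nat. lborel :: real measure" by standard
 define J where "J = I - {i}"
 have J: "finite J" "i \<notin> J" "insert i J = I" using I by (auto simp: J_def)
 have m: "(\<lambda>x. F (x(i := x i + g x))) \<in> borel_measurable (leb I)"
  by (rule measurable_compose[OF measurable_upd F]) (use I g measurable_component[of i I] in auto)
 have "(\<integral>\<^sup>+x. F (x(i := x i + g x)) \<partial>leb I) = (\<integral>\<^sup>+x. (\<integral>\<^sup>+y. F (x(i := y + g x)) \<partial>lborel) \<partial>leb J)"
  using product_nn_integral_insert[OF J(1,2), of "\<lambda>x. F (x(i := x i + g x))"] m
  by (simp add: J(3) g(2))
 also have "\<dots> = (\<integral>\<^sup>+x. (\<integral>\<^sup>+y. F (x(i := y)) \<partial>lborel) \<partial>leb J)"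
 proof (rule nn_integral_cong)
  fix x assume x: "x \<in> space (leb J)"
  have "(\<lambda>y. F (x(i := y))) \<in> borel_measurable borel"
   using measurable_compose[OF measurable_insert_upd[OF x]] F J(3) by metis
  from nn_integral_real_affine[OF this, of 1 "g x"]
  show "(\<integral>\<^sup>+y. F (x(i := y + g x)) \<partial>lborel) = (\<integral>\<^sup>+y. F (x(i := y)) \<partial>lborel)"
   by (simp add: add.commute)
 qed
 also have "\<dots> = (\<integral>\<^sup>+x. F x \<partial>leb I)"
  using product_nn_integral_insert[OF J(1,2), of F] F by (simp add: J(3))
 finally show ?thesis .
qed

lemma nn_integral_scale:
 assumes "finite I" "F \<in> borel_measurable (leb I)" "0 < k"
 shows "(\<integral>\<^sup>+x. F x \<partial>leb I) = ennreal (k ^ card I) * (\<integral>\<^sup>+x. F (\<lambda>j\<in>I. k * x j) \<partial>leb I)"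
 using assms(1,2)
proof (induction I arbitrary: F rule: finite_induct)
 case empty
 interpret product_sigma_finite "\<lambda>_ :: nat. lborel :: real measure" by standard
 show ?case by (simp add: PiM_empty nn_integral_count_space_finite restrict_def)
next
 case (insert i I)
 interpret product_sigma_finite "\<lambda>_ :: nat. lborel :: real measure" by standard
 interpret I: finite_product_sigma_finite "\<lambda>_ :: nat. lborel :: real measure" I by standard fact
 interpret pair_sigma_finite "leb I" "lborel :: real measure" ..
 have upd: "(\<lambda>(x, y). x(i := y)) \<in> leb I \<Otimes>\<^sub>M lborel \<rightarrow>\<^sub>M leb (insert i I)"
  by (rule measurable_add_dim)
 have FU: "(\<lambda>p. F ((fst p)(i := snd p))) \<in> borel_measurable (leb I \<Otimes>\<^sub>M lborel)"
  using measurable_compose[OF upd insert.prems] by (simp add: split_beta' fun_upd_def)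
 have m2: "(\<lambda>x. \<integral>\<^sup>+y. F (x(i := y)) \<partial>lborel) \<in> borel_measurable (leb I)"
  using lborel.borel_measurable_nn_integral_fst[OF FU] by simp
 have sc: "(\<lambda>x. \<lambda>j\<in>insert i I. k * x j) \<in> leb (insert i I) \<rightarrow>\<^sub>M leb (insert i I)"
  by (rule measurable_restrict) (use measurable_component[of _ "insert i I"] in auto)
 have m3: "(\<lambda>x. F (\<lambda>j\<in>insert i I. k * x j)) \<in> borel_measurable (leb (insert i I))"
  by (rule measurable_compose[OF sc insert.prems])
 have m4: "(\<lambda>x. \<integral>\<^sup>+y. F ((\<lambda>j\<in>I. k * x j)(i := k * y)) \<partial>lborel) \<in> borel_measurable (leb I)"
 proof -
  have "(\<lambda>p. ((\<lambda>j\<in>I. k * fst p j), k * snd p)) \<in> leb I \<Otimes>\<^sub>M lborel \<rightarrow>\<^sub>M leb I \<Otimes>\<^sub>M lborel"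
  proof (rule measurable_Pair)
   show "(\<lambda>p. \<lambda>j\<in>I. k * fst p j) \<in> leb I \<Otimes>\<^sub>M lborel \<rightarrow>\<^sub>M leb I"
    by (rule measurable_restrict) (use measurable_compose[OF measurable_fst measurable_component] in auto)
   show "(\<lambda>p. k * snd p) \<in> leb I \<Otimes>\<^sub>M lborel \<rightarrow>\<^sub>M lborel" by simp
  qed
  from measurable_compose[OF this FU] show ?thesis
   using lborel.borel_measurable_nn_integral_fst by simp
 qed
 have "(\<integral>\<^sup>+x. F x \<partial>leb (insert i I)) = (\<integral>\<^sup>+x. (\<integral>\<^sup>+y. F (x(i := y)) \<partial>lborel) \<partial>leb I)"
  by (rule product_nn_integral_insert[OF insert.hyps insert.prems])
 also have "\<dots> = ennreal (k ^ card I) * (\<integral>\<^sup>+x. (\<integral>\<^sup>+y. F ((\<lambda>j\<in>I. k * x j)(i := y)) \<partial>lborel) \<partial>leb I)"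
  by (rule insert.IH[OF m2])
 also have "(\<integral>\<^sup>+x. (\<integral>\<^sup>+y. F ((\<lambda>j\<in>I. k * x j)(i := y)) \<partial>lborel) \<partial>leb I) =
   (\<integral>\<^sup>+x. ennreal k * (\<integral>\<^sup>+y. F ((\<lambda>j\<in>I. k * x j)(i := k * y)) \<partial>lborel) \<partial>leb I)"
 proof (rule nn_integral_cong)
  fix x assume x: "x \<in> space (leb I)"
  have s: "(\<lambda>j\<in>I. k * x j) \<in> space (leb I)" by (simp add: space_PiM)
  have "(\<lambda>y. F ((\<lambda>j\<in>I. k * x j)(i := y))) \<in> borel_measurable borel"
   by (rule measurable_compose[OF measurable_insert_upd[OF s] insert.prems])
  from nn_integral_real_affine[OF this, of k 0] assms(3)
  show "(\<integral>\<^sup>+y. F ((\<lambda>j\<in>I. k * x j)(i := y)) \<partial>lborel) =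
    ennreal k * (\<integral>\<^sup>+y. F ((\<lambda>j\<in>I. k * x j)(i := k * y)) \<partial>lborel)" by simp
 qed
 also have "\<dots> = ennreal k * (\<integral>\<^sup>+x. (\<integral>\<^sup>+y. F ((\<lambda>j\<in>I. k * x j)(i := k * y)) \<partial>lborel) \<partial>leb I)"
  by (rule nn_integral_cmult[OF m4])
 also have "(\<integral>\<^sup>+x. (\<integral>\<^sup>+y. F ((\<lambda>j\<in>I. k * x j)(i := k * y)) \<partial>lborel) \<partial>leb I) =
   (\<integral>\<^sup>+x. (\<integral>\<^sup>+y. F (\<lambda>j\<in>insert i I. k * (x(i := y)) j) \<partial>lborel) \<partial>leb I)"
 proof (intro nn_integral_cong arg_cong[where f = F])
  fix x :: "nat \<Rightarrow> real" and y :: real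
  show "(\<lambda>j\<in>I. k * x j)(i := k * y) = (\<lambda>j\<in>insert i I. k * (x(i := y)) j)"
   using insert.hyps(2) by (auto simp: restrict_def)
 qed
 also have "\<dots> = (\<integral>\<^sup>+x. F (\<lambda>j\<in>insert i I. k * x j) \<partial>leb (insert i I))"
  by (rule product_nn_integral_insert[OF insert.hyps m3, symmetric])
 finally have "(\<integral>\<^sup>+x. F x \<partial>leb (insert i I)) =
   ennreal (k ^ card I) * (ennreal k * (\<integral>\<^sup>+x. F (\<lambda>j\<in>insert i I. k * x j) \<partial>leb (insert i I)))" .
 moreover have "ennreal (k ^ card (insert i I)) = ennreal (k ^ card I) * ennreal k"
  using insert.hyps assms(3) by (simp add: ennreal_mult[symmetric] mult.commute)
 ultimately show ?case by (simp only: mult.assoc)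
qed

text \<open>Equal lengths at the two ends are where the induction stops.\<close>

lemma tie_null:
 assumes "finite I" "a \<in> I" "b \<in> I" "a \<noteq> b"
 shows "{x \<in> space (leb I). x a = x b} \<in> null_sets (leb I)"
proof -
 interpret product_sigma_finite "\<lambda>_ :: nat. lborel :: real measure" by standard
 define J where "J = I - {a}"
 have J: "finite J" "a \<notin> J" "insert a J = I" "b \<in> J" using assms by (auto simp: J_def)
 let ?T = "{x \<in> space (leb I). x a = x b}"
 have T: "?T \<in> sets (leb I)"
  using measurable_component[OF assms(2)] measurable_component[OF assms(3)] by measurable
 have "emeasure (leb I) ?T = (\<integral>\<^sup>+x. indicator ?T x \<partial>leb I)" using T by simp
 also have "\<dots> = (\<integral>\<^sup>+x. (\<integral>\<^sup>+y. indicator ?T (x(a := y)) \<partial>lborel) \<partial>leb J)"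
  using product_nn_integral_insert[OF J(1,2), of "indicator ?T"] T by (simp add: J(3))
 also have "\<dots> = (\<integral>\<^sup>+x. 0 \<partial>leb J)"
 proof (rule nn_integral_cong)
  fix x :: "nat \<Rightarrow> real"
  have "(\<integral>\<^sup>+y. indicator ?T (x(a := y)) \<partial>lborel) \<le> (\<integral>\<^sup>+y. indicator {x b} y \<partial>lborel)"
   using assms(4) by (intro nn_integral_mono) (auto split: split_indicator)
  also have "\<dots> = 0" by simp
  finally show "(\<integral>\<^sup>+y. indicator ?T (x(a := y)) \<partial>lborel) = 0" by simp
 qed
 finally show ?thesis using T by auto
qed

definition exp_dens :: "nat set \<Rightarrow> weights \<Rightarrow> weights \<Rightarrow> ennreal" where
 "exp_dens I q x = (\<Prod>i\<in>I. ennreal (exponential_density (q i) (x i)))"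

lemma exp_dens_measurable: "exp_dens I q \<in> borel_measurable (leb I)"
 unfolding exp_dens_def
 by (intro borel_measurable_prod_ennreal measurable_compose[OF measurable_component]) simp_all

lemma exp_dens_total:
 assumes "finite I" "\<forall>i\<in>I. 0 < q i"
 shows "(\<integral>\<^sup>+x. exp_dens I q x \<partial>leb I) = 1"
proof -
 interpret product_sigma_finite "\<lambda>_ :: nat. lborel :: real measure" by standard
 have 1: "(\<integral>\<^sup>+x. ennreal (exponential_density l x) \<partial>lborel) = 1" if "0 < l" for l
 proof -
  interpret prob_space "density lborel (exponential_density l)"
   by (rule prob_space_exponential_density[OF that])
  show ?thesis using emeasure_space_1 by (simp add: emeasure_density)
 qed
 have "(\<integral>\<^sup>+x. exp_dens I q x \<partial>leb I) = (\<Prod>i\<in>I. \<integral>\<^sup>+x. ennreal (exponential_density (q i) x) \<partial>lborel)"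
  unfolding exp_dens_def using assms(1) by (intro product_nn_integral_prod) auto
 also have "\<dots> = 1" using assms(2) 1 by (intro prod.neutral) auto
 finally show ?thesis .
qed

text \<open>Memorylessness: given the outcome, the excess of the winner is again exponential with
  rate \<open>q w\<close>, and the loser, being the minimum, is exponential with rate
  \<open>q l + q w\<close>. The factor in front is the probability of the outcome.\<close>

lemma exp_dens_shear:
 assumes I: "finite I" "w \<in> I" "l \<in> I" "w \<noteq> l" and q: "\<forall>i\<in>I. 0 < q i" and x: "0 < x w"
 shows "exp_dens I q (x(w := x w + x l)) =
  ennreal (q l / (q l + q w)) * exp_dens I (q(l := q l + q w)) x"
proof -
 let ?q = "q(l := q l + q w)" and ?x = "x(w := x w + x l)"
 let ?e = "\<lambda>q x i. ennreal (exponential_density (q i) (x i))"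
 have split: "prod f I = f w * (f l * prod f (I - {w} - {l}))" for f :: "nat \<Rightarrow> ennreal"
  using I by (simp add: prod.remove[of I w f] prod.remove[of "I - {w}" l f])
 have rest: "prod (?e q ?x) (I - {w} - {l}) = prod (?e ?q x) (I - {w} - {l})"
  by (intro prod.cong) auto
 have qq: "0 < q w" "0 < q l" using q I by auto
 have "exponential_density (q w) (x w + x l) * exponential_density (q l) (x l) =
   q l / (q l + q w) * (exponential_density (q w) (x w) * exponential_density (q l + q w) (x l))"
 proof (cases "x l < 0")
  case False
  then show ?thesis using x qq
   by (simp add: exponential_density_def field_simps exp_add[symmetric])
 qed (simp add: exponential_density_def)
 then have "?e q ?x w * ?e q ?x l = ennreal (q l / (q l + q w)) * (?e ?q x w * ?e ?q x l)"
  using I(4) qq by (simp add: ennreal_mult[symmetric] exponential_density_nonneg)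
 then show ?thesis unfolding exp_dens_def split rest by (simp add: mult.assoc[symmetric])
qed

section \<open>From the Markov chain to Lebesgue measure\<close>

context rauzy
begin

abbreviation "LL \<equiv> leb {1..d}"

definition red1 :: "bool \<Rightarrow> rows \<Rightarrow> weights \<Rightarrow> nat \<Rightarrow> real" where
 "red1 c s x = x(winner c s := x (winner c s) - x (loser c s))"

text \<open>The induction started with lengths \<open>x\<close> takes the path \<open>w\<close>. The
  inequality is strict, so a path ends at a tie.\<close>

fun cyl :: "rows \<Rightarrow> bool list \<Rightarrow> weights \<Rightarrow> bool" where
 "cyl s [] x = True"
| "cyl s (c # w) x = (x (loser c s) < x (winner c s) \<and> cyl (rstep c s) w (red1 c s x))"

lemma red1_measurable: "valid s \<Longrightarrow> red1 c s \<in> LL \<rightarrow>\<^sub>M LL"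
 unfolding red1_def using winner_in[of s c] loser_in[of s c] measurable_component[of _ "{1..d}"]
 by (intro measurable_upd borel_measurable_diff) auto

lemma cyl_sets: "valid s \<Longrightarrow> {x \<in> space LL. cyl s w x} \<in> sets LL"
proof (induction w arbitrary: s)
 case (Cons c w)
 have "{x \<in> space LL. x (loser c s) < x (winner c s)} \<in> sets LL"
  using winner_in[OF Cons.prems, of c] loser_in[OF Cons.prems, of c] measurable_component[of _ "{1..d}"]
  by (intro borel_measurable_less) auto
 moreover have "red1 c s -` {x \<in> space LL. cyl (rstep c s) w x} \<inter> space LL \<in> sets LL"
  by (rule measurable_sets[OF red1_measurable[OF Cons.prems] Cons.IH[OF valid_step[OF Cons.prems]]])
 moreover have "{x \<in> space LL. cyl s (c # w) x} = {x \<in> space LL. x (loser c s) < x (winner c s)} \<inter>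
   (red1 c s -` {x \<in> space LL. cyl (rstep c s) w x} \<inter> space LL)"
  using measurable_space[OF red1_measurable[OF Cons.prems], of _ c] by auto
 ultimately show ?case by auto
qed simp

lemma red1_cong:
 "valid s \<Longrightarrow> \<forall>i\<in>{1..d}. x i = y i \<Longrightarrow> i \<in> {1..d} \<Longrightarrow> red1 c s x i = red1 c s y i"
 using winner_in[of s c] loser_in[of s c] by (auto simp: red1_def)

lemma cyl_cong: "valid s \<Longrightarrow> \<forall>i\<in>{1..d}. x i = y i \<Longrightarrow> cyl s w x = cyl s w y"
proof (induction w arbitrary: s x y)
 case (Cons c w)
 have "cyl (rstep c s) w (red1 c s x) = cyl (rstep c s) w (red1 c s y)"
  using Cons.prems red1_cong valid_step by (intro Cons.IH) blast+
 then show ?case using Cons.prems winner_in[of s c] loser_in[of s c] by simp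
qed simp

lemma cyl_scale: "0 < k \<Longrightarrow> cyl s w (\<lambda>i. k * x i) = cyl s w x"
proof (induction w arbitrary: s x)
 case (Cons c w)
 have "red1 c s (\<lambda>i. k * x i) = (\<lambda>i. k * red1 c s x i)" by (auto simp: red1_def algebra_simps)
 then show ?case using Cons by simp
qed simp

definition hitset :: "nat \<Rightarrow> (bool list \<Rightarrow> bool) \<Rightarrow> rows \<Rightarrow> (nat \<Rightarrow> real) set" where
 "hitset n \<phi> s = {x \<in> space LL. \<exists>w. length w \<le> n \<and> \<phi> w \<and> cyl s w x}"

lemma hitset_sets: "valid s \<Longrightarrow> hitset n \<phi> s \<in> sets LL"
proof -
 assume s: "valid s"
 have "hitset n \<phi> s = (\<Union>w\<in>{w. length w \<le> n \<and> \<phi> w}. {x \<in> space LL. cyl s w x})"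
  by (auto simp: hitset_def)
 also have "\<dots> \<in> sets LL" using cyl_sets[OF s] by (intro sets.countable_UN') auto
 finally show ?thesis .
qed

definition prob_exp :: "(nat \<Rightarrow> real) \<Rightarrow> (nat \<Rightarrow> real) set \<Rightarrow> ennreal" where
 "prob_exp q A = (\<integral>\<^sup>+x. exp_dens {1..d} q x * indicator A x \<partial>LL)"

text \<open>Expressing the old lengths through the new ones is a shear. Under it the event becomes a
  part of \<open>A\<close> in which the winner is positive, and \<open>exp_dens_shear\<close> splits
  off the factor.\<close>

lemma prob_exp_step:
 assumes s: "valid s" and q: "pos q" and A: "A \<in> sets LL"
 shows "prob_exp q {x \<in> space LL. x (loser c s) < x (winner c s) \<and> red1 c s x \<in> A}
  \<le> ennreal (prb c s q) * prob_exp (act1 c s q) A"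
proof -
 let ?w = "winner c s" and ?l = "loser c s"
 let ?E = "{x \<in> space LL. x ?l < x ?w \<and> red1 c s x \<in> A}"
 have wl: "?w \<in> {1..d}" "?l \<in> {1..d}" "?w \<noteq> ?l"
  using winner_in[OF s] loser_in[OF s] winner_neq_loser[OF s] by auto
 have E: "?E \<in> sets LL"
 proof -
  have "{x \<in> space LL. x ?l < x ?w} \<in> sets LL"
   using wl measurable_component[of _ "{1..d}"] by (intro borel_measurable_less) auto
  moreover have "red1 c s -` A \<inter> space LL \<in> sets LL" by (rule measurable_sets[OF red1_measurable[OF s] A])
  moreover have "?E = {x \<in> space LL. x ?l < x ?w} \<inter> (red1 c s -` A \<inter> space LL)" by auto
  ultimately show ?thesis by auto
 qed
 have "prob_exp q ?E = (\<integral>\<^sup>+x. exp_dens {1..d} q (x(?w := x ?w + x ?l)) * indicator ?E (x(?w := x ?w + x ?l)) \<partial>LL)"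
  unfolding prob_exp_def
  using nn_integral_shear[of "{1..d}" ?w "\<lambda>x. exp_dens {1..d} q x * indicator ?E x" "\<lambda>x. x ?l"]
   wl E exp_dens_measurable[of "{1..d}" q] measurable_component[OF wl(2)] by simp
 also have "\<dots> \<le> (\<integral>\<^sup>+x. ennreal (prb c s q) * (exp_dens {1..d} (act1 c s q) x * indicator A x) \<partial>LL)"
 proof (intro nn_integral_mono)
  fix x assume "x \<in> space LL"
  show "exp_dens {1..d} q (x(?w := x ?w + x ?l)) * indicator ?E (x(?w := x ?w + x ?l))
    \<le> ennreal (prb c s q) * (exp_dens {1..d} (act1 c s q) x * indicator A x)"
  proof (cases "x(?w := x ?w + x ?l) \<in> ?E")
   case True
   then have "0 < x ?w" "x \<in> A" using wl by (auto simp: red1_def)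
   moreover have "exp_dens {1..d} q (x(?w := x ?w + x ?l)) = ennreal (prb c s q) * exp_dens {1..d} (act1 c s q) x"
    unfolding prb_def act1_def
    by (rule exp_dens_shear) (use wl q \<open>0 < x ?w\<close> in \<open>auto simp: pos_def\<close>)
   moreover have "indicator ?E (x(?w := x ?w + x ?l)) = (1 :: ennreal)" "indicator A x = (1 :: ennreal)"
    using True \<open>x \<in> A\<close> by (simp_all only: indicator_simps)
   ultimately show ?thesis by (simp only: mult_1_right mult.assoc order_refl)
  next
   case False
   then have "indicator ?E (x(?w := x ?w + x ?l)) = (0 :: ennreal)" by (rule indicator_simps(2))
   then show ?thesis by (simp only: mult_zero_right zero_le)
  qed
 qed
 also have "\<dots> = ennreal (prb c s q) * prob_exp (act1 c s q) A"
  unfolding prob_exp_def using A exp_dens_measurable[of "{1..d}" "act1 c s q"]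
  by (intro nn_integral_cmult) auto
 finally show ?thesis .
qed

lemma prob_exp_le1: "pos q \<Longrightarrow> prob_exp q A \<le> 1"
proof -
 assume q: "pos q"
 have "prob_exp q A \<le> (\<integral>\<^sup>+x. exp_dens {1..d} q x \<partial>LL)"
  unfolding prob_exp_def by (intro nn_integral_mono) (auto split: split_indicator)
 also have "\<dots> = 1" using q by (intro exp_dens_total) (auto simp: pos_def)
 finally show ?thesis .
qed

lemma prob_exp_mono_null:
 assumes "A \<subseteq> N \<union> B \<union> C" "N \<in> null_sets LL" "B \<in> sets LL" "C \<in> sets LL"
 shows "prob_exp q A \<le> prob_exp q B + prob_exp q C"
proof -
 have "prob_exp q A \<le> (\<integral>\<^sup>+x. exp_dens {1..d} q x * indicator B x + exp_dens {1..d} q x * indicator C x \<partial>LL)"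
  unfolding prob_exp_def
 proof (rule nn_integral_mono_AE)
  have "AE x in LL. x \<notin> N" using assms(2) by (rule AE_not_in)
  then show "AE x in LL. exp_dens {1..d} q x * indicator A x
    \<le> exp_dens {1..d} q x * indicator B x + exp_dens {1..d} q x * indicator C x"
   by eventually_elim (use assms(1) in \<open>auto split: split_indicator\<close>)
 qed
 also have "\<dots> = prob_exp q B + prob_exp q C"
  unfolding prob_exp_def using assms(3,4) exp_dens_measurable[of "{1..d}" q] by (intro nn_integral_add) auto
 finally show ?thesis .
qed

text \<open>This gives the recursively defined \<open>hit\<close> its meaning for actual lengths: a
  point that misses either has a tie, or misses after its first step, where the law is again
  exponential with the new rates.\<close>

lemma prob_exp_miss:
 "valid s \<Longrightarrow> pos q \<Longrightarrow> prob_exp q (space LL - hitset n \<phi> s) \<le> ennreal (1 - hit n \<phi> s q)"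
proof (induction n arbitrary: s q \<phi>)
 case (0 s q \<phi>)
 show ?case
 proof (cases "\<phi> []")
  case True
  then have "space LL - hitset 0 \<phi> s = {}" by (auto simp: hitset_def)
  then show ?thesis by (simp only: prob_exp_def) simp
 next
  case False
  then show ?thesis using prob_exp_le1[OF 0(2)] by simp
 qed
next
 case (Suc n s q \<phi>)
 show ?case
 proof (cases "\<phi> []")
  case True
  then have "space LL - hitset (Suc n) \<phi> s = {}" by (auto simp: hitset_def intro!: exI[of _ "[]"])
  then show ?thesis by (simp only: prob_exp_def) simp
 next
  case False
  let ?M = "\<lambda>c. space LL - hitset n (\<lambda>u. \<phi> (c # u)) (rstep c s)"
  let ?E = "\<lambda>c. {x \<in> space LL. x (loser c s) < x (winner c s) \<and> red1 c s x \<in> ?M c}"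
  let ?h = "\<lambda>c. hit_after n \<phi> c s q"
  let ?T = "{x \<in> space LL. x (winner True s) = x (loser True s)}"
  have v: "valid (rstep c s)" and p: "pos (act1 c s q)" for c
   using valid_step[OF Suc.prems(1)] pos_act1[OF Suc.prems] by auto
  have M: "?M c \<in> sets LL" for c using hitset_sets[OF v] by auto
  have E: "?E c \<in> sets LL" for c
  proof -
   have "{x \<in> space LL. x (loser c s) < x (winner c s)} \<in> sets LL"
    using winner_in[OF Suc.prems(1), of c] loser_in[OF Suc.prems(1), of c] measurable_component[of _ "{1..d}"]
    by (intro borel_measurable_less) auto
   moreover have "red1 c s -` ?M c \<inter> space LL \<in> sets LL"
    by (rule measurable_sets[OF red1_measurable[OF Suc.prems(1)] M])
   moreover have "?E c = {x \<in> space LL. x (loser c s) < x (winner c s)} \<inter> (red1 c s -` ?M c \<inter> space LL)"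
    by auto
   ultimately show ?thesis by auto
  qed
  have T: "?T \<in> null_sets LL"
   using winner_in[OF Suc.prems(1)] loser_in[OF Suc.prems(1)] winner_neq_loser[OF Suc.prems(1)]
   by (intro tie_null) auto
  have sub: "space LL - hitset (Suc n) \<phi> s \<subseteq> ?T \<union> ?E True \<union> ?E False"
  proof
   fix x assume x: "x \<in> space LL - hitset (Suc n) \<phi> s"
   have "red1 c s x \<in> ?M c" if "x (loser c s) < x (winner c s)" for c
   proof -
    have "red1 c s x \<in> space LL" using measurable_space[OF red1_measurable[OF Suc.prems(1)]] x by blast
    moreover have "red1 c s x \<notin> hitset n (\<lambda>u. \<phi> (c # u)) (rstep c s)"
    proof
     assume "red1 c s x \<in> hitset n (\<lambda>u. \<phi> (c # u)) (rstep c s)"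
     then obtain w where "length w \<le> n" "\<phi> (c # w)" "cyl (rstep c s) w (red1 c s x)"
      by (auto simp: hitset_def)
     then have "length (c # w) \<le> Suc n \<and> \<phi> (c # w) \<and> cyl s (c # w) x" using that by simp
     then have "x \<in> hitset (Suc n) \<phi> s" using x unfolding hitset_def by blast
     then show False using x by blast
    qed
    ultimately show ?thesis by blast
   qed
   moreover have "x (winner True s) = x (loser True s) \<or> x (loser True s) < x (winner True s) \<or>
     x (loser False s) < x (winner False s)" by (auto simp: winner_def loser_def)
   ultimately show "x \<in> ?T \<union> ?E True \<union> ?E False" using x by blast
  qed
  have "prob_exp q (space LL - hitset (Suc n) \<phi> s) \<le> prob_exp q (?E True) + prob_exp q (?E False)"
   by (rule prob_exp_mono_null[OF sub T E E])
  also have "\<dots> \<le> ennreal (prb True s q) * prob_exp (act1 True s q) (?M True) +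
    ennreal (prb False s q) * prob_exp (act1 False s q) (?M False)"
   by (intro add_mono prob_exp_step Suc.prems M)
  also have "\<dots> \<le> ennreal (prb True s q) * ennreal (1 - ?h True) + ennreal (prb False s q) * ennreal (1 - ?h False)"
   by (intro add_mono mult_left_mono Suc.IH v p) auto
  also have "\<dots> = ennreal (prb True s q * (1 - ?h True) + prb False s q * (1 - ?h False))"
   using prb_nonneg[OF Suc.prems] hit_le1[OF v p] by (simp add: ennreal_mult ennreal_plus)
  also have "prb True s q * (1 - ?h True) + prb False s q * (1 - ?h False) = 1 - hit (Suc n) \<phi> s q"
   using False prb_sum[OF Suc.prems] by (simp add: algebra_simps)
  finally show ?thesis .
 qed
qed

end

text \<open>The two roundings and the subtracted 1 together cost at most 3 in the exponent; what
  remains is geometric in \<open>m\<close>.\<close>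

lemma geometric_div_summable:
 assumes "0 \<le> r" "r < 1" "0 < a" "0 < L"
 shows "summable (\<lambda>m. r ^ ((m div a - 1) div L) :: real)"
proof -
 \<comment> \<open>Negative powers are taken below, so \<open>r = 0\<close>, which arises for
   \<open>c = 1\<close>, has to be avoided.\<close>
 define r' where "r' = max r (1 / 2)"
 have r': "0 < r'" "r' < 1" "r \<le> r'" using assms by (auto simp: r'_def)
 define p where "p = real (a * L)"
 have p: "0 < p" using assms by (simp add: p_def)
 define \<rho> where "\<rho> = r' powr (1 / p)"
 have \<rho>: "0 < \<rho>" "\<rho> < 1"
 proof -
  show "0 < \<rho>" using r' by (simp add: \<rho>_def)
  have "r' powr (1 / p) < 1 powr (1 / p)" using r' p by (intro powr_less_mono2) auto
  then show "\<rho> < 1" by (simp add: \<rho>_def)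
 qed
 have "summable (\<lambda>m. \<rho> ^ m * r' powr - 3)" using \<rho> by (intro summable_mult2 summable_geometric) auto
 moreover have "norm (r ^ ((m div a - 1) div L)) \<le> \<rho> ^ m * r' powr - 3" for m
 proof -
  define K where "K = (m div a - 1) div L"
  have fl: "real (n div k) \<ge> real n / real k - 1" for n k
  proof -
   have "\<lfloor>real n / real k\<rfloor> = int (n div k)" by (rule floor_divide_of_nat_eq)
   then show ?thesis using floor_correct[of "real n / real k"] by simp
  qed
  have "real (m div a - 1) \<ge> real m / real a - 2" using fl[of m a] by linarith
  then have "real (m div a - 1) / real L \<ge> (real m / real a - 2) / real L"
   by (intro divide_right_mono) auto
  moreover have "(real m / real a - 2) / real L = real m / p - 2 / real L"
   using assms by (simp add: p_def field_simps)
  moreover have "2 / real L \<le> 2" using assms by (simp add: field_simps)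
  ultimately have "real K \<ge> real m / p - 3" using fl[of "m div a - 1" L] unfolding K_def by linarith
  then have "r' powr real K \<le> r' powr (real m / p - 3)" using r' by (intro powr_mono') auto
  also have "\<dots> = r' powr (1 / p * real m) * r' powr - 3" by (simp add: powr_add[symmetric])
  also have "r' powr (1 / p * real m) = \<rho> powr real m" by (simp only: \<rho>_def powr_powr)
  also have "\<rho> powr real m = \<rho> ^ m" using \<rho> by (simp add: powr_realpow)
  finally have "r' ^ K \<le> \<rho> ^ m * r' powr - 3" using r' by (simp add: powr_realpow)
  moreover have "r ^ K \<le> r' ^ K" using r' assms by (intro power_mono) auto
  ultimately show ?thesis using assms(1) unfolding K_def by simp
 qed
 ultimately show ?thesis by (rule summable_comparison_test'[where N = 0])
qed

context rauzy
begin

text \<open>Only dyadic scales and countably many exponents occur, so this is a countable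
  combination of cylinders; moreover it is invariant under scaling.\<close>

definition good_lengths :: "real \<Rightarrow> rows \<Rightarrow> weights \<Rightarrow> bool" where
 "good_lengths C s x \<longleftrightarrow> (\<forall>e. \<exists>m0. \<forall>m\<ge>m0. \<exists>w. cyl s w x \<and>
   block_between C s (2 ^ m) (2 powr (real m * (1 + 1 / real (Suc e)))) w)"

lemma block_between_mono: "block_between C s X Y w \<Longrightarrow> Y \<le> Y' \<Longrightarrow> block_between C s X Y' w"
proof -
 assume "block_between C s X Y w" and Y: "Y \<le> Y'"
 then obtain u v where "w = u @ v" "mixing_block C s (\<lambda>_. 1) u v"
  "\<exists>j\<in>{1..d}. X \<le> cnt s u j" and le: "\<forall>j\<in>{1..d}. cnt s w j \<le> Y"
  unfolding block_between_def by blast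
 moreover have "\<forall>j\<in>{1..d}. cnt s w j \<le> Y'" using le Y by (meson order_trans)
 ultimately show ?thesis unfolding block_between_def by blast
qed

lemma good_lengths_scale: "0 < k \<Longrightarrow> good_lengths C s (\<lambda>i. k * x i) = good_lengths C s x"
 by (simp add: good_lengths_def cyl_scale)

lemma good_lengths_cong: "valid s \<Longrightarrow> \<forall>i\<in>{1..d}. x i = y i \<Longrightarrow> good_lengths C s x = good_lengths C s y"
 using cyl_cong[of s x y] by (simp add: good_lengths_def)

lemma good_lengths_sets:
 assumes s: "valid s" shows "{x \<in> space LL. good_lengths C s x} \<in> sets LL"
proof -
 have c: "{x \<in> space LL. cyl s w x \<and> P} \<in> sets LL" for w P
  using cyl_sets[OF s, of w] by (cases P) auto
 show ?thesis unfolding good_lengths_def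
  by (intro sets.sets_Collect_countable_All sets.sets_Collect_countable_Ex sets.sets_Collect_imp
    sets.sets_Collect_const c)
qed

text \<open>Between \<open>2 ^ m\<close> and \<open>2 powr (m * (1 + 1 / Suc e))\<close> there is
  room for about \<open>m / (Suc e * L)\<close> trials. The failure probabilities are therefore
  summable in \<open>m\<close>, and Borel-Cantelli applies for each \<open>e\<close>.\<close>

lemma AE_good_lengths_cone:
 "\<exists>C\<ge>1. \<forall>s. valid s \<longrightarrow> (AE x in LL. (\<forall>i\<in>{1..d}. 0 < x i) \<longrightarrow> good_lengths C s x)"
proof -
 from hit_block_between obtain C c where C: "C \<ge> 1" and c: "0 < c" "c \<le> 1" and
  hb: "\<forall>s X K. valid s \<longrightarrow> 1 \<le> X \<longrightarrow>
   (\<exists>n. 1 - (1 - c) ^ K \<le> hit n (block_between C s X ((2 * C) ^ K * (2 * X))) s (\<lambda>_. 1))" by blast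
 \<comment> \<open>One trial costs at most \<open>L\<close> binary orders of magnitude.\<close>
 obtain L where L: "2 * C < 2 ^ L" using real_arch_pow[of 2 "2 * C"] by auto
 have L0: "0 < L" using L C by (cases L) auto
 have "AE x in LL. (\<forall>i\<in>{1..d}. 0 < x i) \<longrightarrow> good_lengths C s x" if s: "valid s" for s
 proof -
  define q where "q = (\<lambda>_ :: nat. 1 :: real)"
  have p: "pos q" by (simp add: pos_def q_def)
  define N where "N = density LL (exp_dens {1..d} q)"
  have spN: "space N = space LL" "sets N = sets LL" by (simp_all add: N_def)
  define P where "P e m x \<longleftrightarrow> (\<exists>w. cyl s w x \<and>
   block_between C s (2 ^ m) (2 powr (real m * (1 + 1 / real (Suc e)))) w)" for e m x
  have "AE x in N. \<exists>m0. \<forall>m\<ge>m0. P e m x" for e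
  proof -
   define A where "A m = space LL - {x \<in> space LL. P e m x}" for m
   have Pset: "{x \<in> space LL. P e m x} \<in> sets LL" for m
   proof -
    have "{x \<in> space LL. cyl s w x \<and> Q} \<in> sets LL" for w Q
     using cyl_sets[OF s, of w] by (cases Q) auto
    moreover have "{x \<in> space LL. P e m x} = (\<Union>w. {x \<in> space LL. cyl s w x \<and>
      block_between C s (2 ^ m) (2 powr (real m * (1 + 1 / real (Suc e)))) w})"
     by (auto simp: P_def)
    ultimately show ?thesis by auto
   qed
   then have A: "A m \<in> sets N" for m by (auto simp: A_def spN)
   have eA: "emeasure N (A m) = prob_exp q (A m)" for m
    unfolding N_def prob_exp_def using A[of m] spN exp_dens_measurable by (intro emeasure_density) auto
   have bound: "emeasure N (A m) \<le> ennreal ((1 - c) ^ ((m div Suc e - 1) div L))" if m: "m \<ge> Suc e" for m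
   proof -
    \<comment> \<open>The subtracted 1 pays for the factor 2 by which the scale \<open>2 ^ m\<close>
      may be overshot.\<close>
    define K where "K = (m div Suc e - 1) div L"
    have "L * K \<le> m div Suc e - 1" by (simp add: K_def)
    moreover have "1 \<le> m div Suc e" using m by (metis div_greater_zero_iff less_eq_Suc_le One_nat_def zero_less_Suc)
    ultimately have "L * K + 1 \<le> m div Suc e" by simp
    moreover have "real (m div Suc e) \<le> real m / real (Suc e)" by (rule of_nat_div_le_of_nat)
    ultimately have ex: "real (L * K + 1) \<le> real m / real (Suc e)"
     by (meson of_nat_mono order_trans)
    have "(2 * C) ^ K * (2 * 2 ^ m) \<le> (2 ^ L) ^ K * (2 * 2 ^ m)"
     using L C by (intro mult_right_mono power_mono) auto
    also have "\<dots> = 2 ^ (L * K + 1 + m)" by (simp add: power_add power_mult)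
    also have "\<dots> = 2 powr real (L * K + 1 + m)" by (rule powr_realpow[symmetric]) simp
    also have "\<dots> \<le> 2 powr (real m * (1 + 1 / real (Suc e)))"
     using ex by (intro powr_mono) (auto simp: algebra_simps)
    finally have Y: "(2 * C) ^ K * (2 * 2 ^ m) \<le> 2 powr (real m * (1 + 1 / real (Suc e)))" .
    have "(1::real) \<le> 2 ^ m" by simp
    then obtain n where n: "1 - (1 - c) ^ K \<le> hit n (block_between C s (2 ^ m) ((2 * C) ^ K * (2 * 2 ^ m))) s q"
     unfolding q_def using hb s by blast
    let ?H = "hitset n (block_between C s (2 ^ m) ((2 * C) ^ K * (2 * 2 ^ m))) s"
    have "A m \<subseteq> space LL - ?H"
     using block_between_mono[OF _ Y, of C s "2 ^ m"] unfolding A_def P_def hitset_def by blast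
    then have "prob_exp q (A m) \<le> prob_exp q (space LL - ?H)"
     unfolding prob_exp_def by (intro nn_integral_mono mult_left_mono) (auto split: split_indicator)
    also have "\<dots> \<le> ennreal (1 - hit n (block_between C s (2 ^ m) ((2 * C) ^ K * (2 * 2 ^ m))) s q)"
     by (rule prob_exp_miss[OF s p])
    also have "\<dots> \<le> ennreal ((1 - c) ^ K)" using n by (intro ennreal_leI) auto
    finally show ?thesis by (simp add: eA K_def)
   qed
   have "AE x in N. eventually (\<lambda>m. x \<in> space N - A m) sequentially"
   proof (rule borel_cantelli_AE1[OF A])
    show fin: "emeasure N (A m) < \<infinity>" for m
     using prob_exp_le1[OF p, of "A m"] by (simp add: eA order_le_less_trans)
    have "summable (\<lambda>m. (1 - c) ^ ((m div Suc e - 1) div L))"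
     using c L0 by (intro geometric_div_summable) auto
    moreover have "norm (measure N (A m)) \<le> (1 - c) ^ ((m div Suc e - 1) div L)" if "m \<ge> Suc e" for m
     using bound[OF that] c by (simp add: measure_def enn2real_leI)
    ultimately show "summable (\<lambda>m. measure N (A m))" by (rule summable_comparison_test')
   qed
   then show ?thesis
    by eventually_elim (auto simp: A_def spN eventually_sequentially)
  qed
  then have "AE x in N. \<forall>e. \<exists>m0. \<forall>m\<ge>m0. P e m x" by (subst AE_all_countable) blast
  then have "AE x in N. good_lengths C s x" unfolding good_lengths_def P_def .
  \<comment> \<open>The density is positive wherever all lengths are, so its null sets within the
    positive cone are Lebesgue null.\<close>
  then have "AE x in LL. 0 < exp_dens {1..d} q x \<longrightarrow> good_lengths C s x"
   unfolding N_def using exp_dens_measurable by (subst (asm) AE_density) auto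
  then show ?thesis
  proof eventually_elim
   case (elim x)
   then show ?case
    by (auto simp: exp_dens_def exponential_density_def q_def zero_less_iff_neq_zero)
  qed
 qed
 then show ?thesis using C by blast
qed

text \<open>By Fubini almost every slice of the cone with fixed total length meets the exceptional
  set in a null set. One such slice is enough, because the property is invariant under
  scaling.\<close>

lemma AE_good_lengths_simplex:
 "\<exists>C\<ge>1. \<forall>s. valid s \<longrightarrow> (AE x in simplex_lebesgue d. good_lengths C s x)"
proof -
 obtain C where C: "C \<ge> 1" and
  cone: "\<And>s. valid s \<Longrightarrow> (AE x in LL. (\<forall>i\<in>{1..d}. 0 < x i) \<longrightarrow> good_lengths C s x)"
  using AE_good_lengths_cone by blast
 have "AE x in simplex_lebesgue d. good_lengths C s x" if s: "valid s" for s
 proof -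
  interpret product_sigma_finite "\<lambda>_ :: nat. lborel :: real measure" by standard
  define J where "J = {1..<d}"
  have J: "finite J" "d \<notin> J" "insert d J = {1..d}" using d2 by (auto simp: J_def)
  define N where "N = {x \<in> space LL. (\<forall>i\<in>{1..d}. 0 < x i) \<and> \<not> good_lengths C s x}"
  have posx: "{x \<in> space LL. \<forall>i\<in>{1..d}. 0 < x i} \<in> sets LL"
   using measurable_component[of _ "{1..d}"] by (intro sets.sets_Collect_finite_All) auto
  have "N = {x \<in> space LL. \<forall>i\<in>{1..d}. 0 < x i} - {x \<in> space LL. good_lengths C s x}"
   by (auto simp: N_def)
  then have N: "N \<in> sets LL" using posx good_lengths_sets[OF s] by auto
  have "emeasure LL N = 0"
   by (rule AE_iff_measurable[OF N, THEN iffD1, OF _ cone[OF s]]) (auto simp: N_def)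
  then have N0: "(\<integral>\<^sup>+x. indicator N x \<partial>LL) = 0" using N by simp
  \<comment> \<open>The shear by \<open>g\<close> lets the last coordinate stand for the total
    length, so that the slices become coordinate slices.\<close>
  define g where "g x = - (\<Sum>i\<in>J. x i)" for x :: "nat \<Rightarrow> real"
  have g: "g \<in> borel_measurable LL" unfolding g_def
   using measurable_component[of _ "{1..d}"] J by (intro borel_measurable_uminus borel_measurable_sum) auto
  have gi: "g (x(d := y)) = g x" for x y unfolding g_def using J(2) by (auto intro!: sum.cong)
  let ?F = "\<lambda>x. indicator N (x(d := x d + g x)) :: ennreal"
  have Fm: "?F \<in> borel_measurable LL"
   using N g measurable_component[of d "{1..d}"] d2
   by (intro measurable_compose[OF measurable_upd[of d "{1..d}" "\<lambda>x. x d + g x"] borel_measurable_indicator]) auto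
  have "(\<integral>\<^sup>+x. ?F x \<partial>LL) = 0"
   using nn_integral_shear[of "{1..d}" d "indicator N" g] N0 g gi N d2 by simp
  then have "(\<integral>\<^sup>+y. (\<integral>\<^sup>+x. ?F (x(d := y)) \<partial>leb J) \<partial>lborel) = 0"
   using product_nn_integral_insert_rev[OF J(1,2), of ?F] Fm by (simp add: J(3))
  moreover have "(\<lambda>y. \<integral>\<^sup>+x. ?F (x(d := y)) \<partial>leb J) \<in> borel_measurable lborel"
  proof -
   interpret J: finite_product_sigma_finite "\<lambda>_ :: nat. lborel :: real measure" J by standard (rule J(1))
   interpret pair_sigma_finite "leb J" "lborel :: real measure" ..
   have "(\<lambda>(x, y). x(d := y)) \<in> leb J \<Otimes>\<^sub>M lborel \<rightarrow>\<^sub>M LL" using measurable_add_dim[of d J "\<lambda>_. lborel"] J(3) by simp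
   then have "(\<lambda>p. ?F ((\<lambda>(x, y). x(d := y)) p)) \<in> borel_measurable (leb J \<Otimes>\<^sub>M lborel)"
    by (rule measurable_compose) (rule Fm)
   then have "(\<lambda>p. ?F ((snd p)(d := fst p))) \<in> borel_measurable (lborel \<Otimes>\<^sub>M leb J)"
    by (subst measurable_pair_swap_iff) (simp add: split_beta' fun_upd_def)
   from J.borel_measurable_nn_integral_fst[OF this] show ?thesis by simp
  qed
  ultimately have "AE y in lborel. (\<integral>\<^sup>+x. ?F (x(d := y)) \<partial>leb J) = 0"
   by (subst (asm) nn_integral_0_iff_AE) auto
  moreover have "\<not> (AE y in lborel. \<not> (0 < y \<and> y < (1::real)))"
  proof
   assume "AE y in lborel. \<not> (0 < y \<and> y < (1::real))"
   then have "emeasure lborel {0<..<1::real} = 0"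
    by (rule AE_iff_measurable[THEN iffD1, rotated 2]) auto
   then show False by simp
  qed
  ultimately obtain k where k: "0 < k" and k0: "(\<integral>\<^sup>+x. ?F (x(d := k)) \<partial>leb J) = 0"
  proof -
   assume *: "\<And>k. 0 < k \<Longrightarrow> (\<integral>\<^sup>+x. ?F (x(d := k)) \<partial>leb J) = 0 \<Longrightarrow> thesis"
   show thesis
   proof (rule ccontr)
    assume "\<not> thesis"
    then have "\<And>y. (\<integral>\<^sup>+x. ?F (x(d := y)) \<partial>leb J) = 0 \<Longrightarrow> \<not> (0 < y \<and> y < 1)" using * by blast
    then have "AE y in lborel. \<not> (0 < y \<and> y < (1::real))"
     using \<open>AE y in lborel. (\<integral>\<^sup>+x. ?F (x(d := y)) \<partial>leb J) = 0\<close> by (auto elim: AE_mp)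
    then show False using \<open>\<not> (AE y in lborel. \<not> (0 < y \<and> y < (1::real)))\<close> by blast
   qed
  qed
  let ?G = "\<lambda>x. ?F (x(d := k))"
  have upd: "(\<lambda>x. x(d := k)) \<in> leb J \<rightarrow>\<^sub>M LL"
  proof -
   have "(\<lambda>x. (x, k)) \<in> leb J \<rightarrow>\<^sub>M leb J \<Otimes>\<^sub>M lborel" by simp
   from measurable_compose[OF this measurable_add_dim[of d J "\<lambda>_. lborel"]] J(3) show ?thesis
    by (simp add: fun_upd_def)
  qed
  have Gm: "?G \<in> borel_measurable (leb J)" by (rule measurable_compose[OF upd Fm])
  have sc: "(\<lambda>x. \<lambda>j\<in>J. k * x j) \<in> leb J \<rightarrow>\<^sub>M leb J"
   by (rule measurable_restrict) (use measurable_component[of _ J] in auto)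
  have "ennreal (k ^ card J) * (\<integral>\<^sup>+x. ?G (\<lambda>j\<in>J. k * x j) \<partial>leb J) = 0"
   using nn_integral_scale[OF J(1) Gm k] k0 by simp
  then have "(\<integral>\<^sup>+x. ?G (\<lambda>j\<in>J. k * x j) \<partial>leb J) = 0" using k by simp
  then have "AE x in leb J. ?G (\<lambda>j\<in>J. k * x j) = 0"
   by (subst (asm) nn_integral_0_iff_AE) (use measurable_compose[OF sc Gm] in auto)
  then have ae: "AE x in leb J. x \<in> chart_domain d \<longrightarrow> good_lengths C s (simplex_chart d x)"
  proof eventually_elim
   case (elim x)
   show ?case
   proof
    assume x: "x \<in> chart_domain d"
    define z where "z = simplex_chart d x"
    have z: "z \<in> length_simplex d" using simplex_chart_in[of d x] x d2 by (simp add: z_def)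
    define y where "y = (\<lambda>j\<in>J. k * x j)(d := k + g (\<lambda>j\<in>J. k * x j))"
    have "(\<lambda>j\<in>J. k * x j)(d := k, d := k + g ((\<lambda>j\<in>J. k * x j)(d := k))) = y"
     by (simp add: y_def gi)
    then have "y \<notin> N" using elim by (auto simp: indicator_eq_0_iff y_def gi)
    moreover have y: "y i = k * z i" if "i \<in> {1..d}" for i
    proof (cases "i = d")
     case True
     have "g (\<lambda>j\<in>J. k * x j) = - (k * (\<Sum>j\<in>J. x j))" by (simp add: g_def sum_distrib_left)
     then show ?thesis using True by (simp add: y_def z_def simplex_chart_def J_def algebra_simps)
    next
     case False
     then have "i \<in> J" using that by (auto simp: J_def)
     then show ?thesis using False by (simp add: y_def z_def simplex_chart_def)
    qed
    moreover have "y \<in> space LL"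
     using J(3) by (auto simp: y_def space_PiM PiE_def extensional_def)
    moreover have "0 < y i" if "i \<in> {1..d}" for i
     using y[OF that] k z that by (simp add: length_simplex_def)
    ultimately have "good_lengths C s y" by (simp add: N_def)
    then have "good_lengths C s (\<lambda>i. k * z i)" using good_lengths_cong[OF s, of y "\<lambda>i. k * z i"] y by simp
    then show "good_lengths C s (simplex_chart d x)" using good_lengths_scale[OF k] by (simp add: z_def)
   qed
  qed
  have d1: "d \<ge> 1" using d2 by simp
  let ?R = "restrict_space (leb J) (chart_domain d)"
  let ?S = "restrict_space (\<Pi>\<^sub>M i\<in>{1..d}. borel :: real measure) (length_simplex d)"
  have ms: "simplex_chart d \<in> ?R \<rightarrow>\<^sub>M ?S" using measurable_simplex_chart[OF d1] by (simp add: J_def)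
  have "sets LL = sets (\<Pi>\<^sub>M i\<in>{1..d}. borel :: real measure)" by (intro sets_PiM_cong) simp_all
  moreover have "{x \<in> space ?S. good_lengths C s x} = length_simplex d \<inter> {x \<in> space LL. good_lengths C s x}"
   by (auto simp: space_restrict_space space_PiM)
  ultimately have gs: "{x \<in> space ?S. good_lengths C s x} \<in> sets ?S"
   using good_lengths_sets[OF s, of C] by (auto simp: sets_restrict_space)
  have "AE x in ?R. good_lengths C s (simplex_chart d x)"
  proof (subst AE_restrict_space_iff)
   show "chart_domain d \<inter> space (leb J) \<in> sets (leb J)"
    using chart_domain_measurable[of d] by (simp add: J_def)
  qed (use ae in simp)
  then show ?thesis
   unfolding simplex_lebesgue_def J_def[symmetric] using AE_distr_iff[OF ms gs] by simp
 qed
 then show ?thesis using C by blast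
qed

end

section \<open>Rauzy induction as first return map\<close>

fun lft :: "nat list \<Rightarrow> weights \<Rightarrow> nat \<Rightarrow> real" where
 "lft [] x j = 0"
| "lft (\<beta> # xs) x j = (if \<beta> = j then 0 else x \<beta> + lft xs x j)"

definition len :: "nat list \<Rightarrow> weights \<Rightarrow> real" where
 "len xs x = sum_list (map x xs)"

definition ivl :: "nat list \<Rightarrow> weights \<Rightarrow> nat \<Rightarrow> real set" where
 "ivl xs x j = {lft xs x j ..< lft xs x j + x j}"

lemma len_simps: "len [] x = 0" "len (\<beta> # xs) x = x \<beta> + len xs x" "len (xs @ ys) x = len xs x + len ys x"
 by (simp_all add: len_def)

lemma lft_append: "lft (xs @ ys) x j = (if j \<in> set xs then lft xs x j else len xs x + lft ys x j)"
 by (induction xs) (auto simp: len_simps)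

lemma lft_cong: "\<forall>\<beta>\<in>set xs. x \<beta> = y \<beta> \<Longrightarrow> lft xs x j = lft xs y j"
 by (induction xs) auto

lemma len_cong: "\<forall>\<beta>\<in>set xs. x \<beta> = y \<beta> \<Longrightarrow> len xs x = len xs y"
 by (induction xs) (auto simp: len_simps)

lemma len_eq_sum: "distinct xs \<Longrightarrow> len xs x = sum x (set xs)"
 unfolding len_def by (rule sum_list_distinct_conv_sum_set)

lemma lft_upd: "\<beta> \<notin> set xs \<Longrightarrow> lft xs (x(\<beta> := v)) j = lft xs x j"
 by (rule lft_cong) auto

lemma len_upd: "\<beta> \<notin> set xs \<Longrightarrow> len xs (x(\<beta> := v)) = len xs x"
 by (rule len_cong) auto

lemma len_nonneg: "\<forall>\<beta>\<in>set xs. 0 < x \<beta> \<Longrightarrow> 0 \<le> len xs x"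
 by (induction xs) (auto simp: len_simps intro: less_imp_le add_nonneg_nonneg)

lemma lft_bounds: "\<forall>\<beta>\<in>set xs. 0 < x \<beta> \<Longrightarrow> j \<in> set xs \<Longrightarrow> 0 \<le> lft xs x j \<and> lft xs x j + x j \<le> len xs x"
proof (induction xs)
 case (Cons \<beta> xs)
 then show ?case using len_nonneg[of xs x] by (auto simp: len_simps intro: less_imp_le add_nonneg_nonneg)
qed simp

lemma ivl_subset: "\<forall>\<beta>\<in>set xs. 0 < x \<beta> \<Longrightarrow> j \<in> set xs \<Longrightarrow> ivl xs x j \<subseteq> {0..<len xs x}"
 using lft_bounds[of xs x j] by (auto simp: ivl_def)

lemma ivl_cover: "\<forall>\<beta>\<in>set xs. 0 < x \<beta> \<Longrightarrow> 0 \<le> y \<Longrightarrow> y < len xs x \<Longrightarrow> distinct xs \<Longrightarrow> \<exists>j\<in>set xs. y \<in> ivl xs x j"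
proof (induction xs arbitrary: y)
 case (Cons \<beta> xs)
 show ?case
 proof (cases "y < x \<beta>")
  case True
  then show ?thesis using Cons.prems by (auto simp: ivl_def)
 next
  case False
  then obtain j where a: "j \<in> set xs" "y - x \<beta> \<in> ivl xs x j"
   using Cons.IH[of "y - x \<beta>"] Cons.prems by (auto simp: len_simps)
  then have "\<beta> \<noteq> j" using Cons.prems by auto
  then have "y \<in> ivl (\<beta> # xs) x j" using a by (auto simp: ivl_def)
  then show ?thesis using a by auto
 qed
qed (simp add: len_simps)

lemma ivl_unique:
 "\<forall>\<beta>\<in>set xs. 0 < x \<beta> \<Longrightarrow> distinct xs \<Longrightarrow> j \<in> set xs \<Longrightarrow> \<gamma> \<in> set xs \<Longrightarrow>
  y \<in> ivl xs x j \<Longrightarrow> y \<in> ivl xs x \<gamma> \<Longrightarrow> j = \<gamma>"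
proof (induction xs arbitrary: y)
 case (Cons \<beta> xs)
 have pos: "\<forall>\<beta>\<in>set xs. 0 < x \<beta>" using Cons.prems by simp
 show ?case
 proof (cases "j = \<beta> \<or> \<gamma> = \<beta>")
  case True
  then show ?thesis using Cons.prems lft_bounds[OF pos, of j] lft_bounds[OF pos, of \<gamma>]
   by (auto simp: ivl_def split: if_splits)
 next
  case False
  then have "y - x \<beta> \<in> ivl xs x j" "y - x \<beta> \<in> ivl xs x \<gamma>" "j \<in> set xs" "\<gamma> \<in> set xs"
   using Cons.prems by (auto simp: ivl_def)
  then show ?thesis using Cons.IH[OF pos] Cons.prems by auto
 qed
qed simp

text \<open>
 A stage of the induction: the map induced by \<open>T\<close> on \<open>{0..<len (fst s) x}\<close> is the exchange given
 by \<open>s\<close> and \<open>x\<close>, the \<open>j\<close>-th interval returns after \<open>h j\<close> steps, \<open>T\<close> acts on it by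
 translations until then, and these towers fill the unit interval.
\<close>

definition stage :: "(real \<Rightarrow> real) \<Rightarrow> rows \<Rightarrow> weights \<Rightarrow> (nat \<Rightarrow> nat) \<Rightarrow> bool" where
 "stage T s x h \<longleftrightarrow>
   (\<forall>j\<in>set (fst s). 0 < h j \<and> 0 < x j) \<and>
   (\<forall>j\<in>set (fst s). \<forall>y\<in>ivl (fst s) x j. (T ^^ h j) y = y - lft (fst s) x j + lft (snd s) x j) \<and>
   (\<forall>j\<in>set (fst s). \<forall>k<h j. \<exists>c. \<forall>y\<in>ivl (fst s) x j. (T ^^ k) y = y + c) \<and>
   (\<forall>j\<in>set (fst s). \<forall>k. 0 < k \<and> k < h j \<longrightarrow> (\<forall>y\<in>ivl (fst s) x j. (T ^^ k) y \<notin> {0..<len (fst s) x})) \<and>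
   (\<forall>y\<in>{0..<1}. \<exists>j\<in>set (fst s). \<exists>z\<in>ivl (fst s) x j. \<exists>k<h j. y = (T ^^ k) z)"

lemma funpow_add_apply: "(T ^^ (m + n)) y = (T ^^ n) ((T ^^ m) y)"
 by (metis add.commute comp_apply funpow_add)

text \<open>
 Both kinds of steps put the tower over \<open>a\<close> on top of the part of the tower over \<open>z\<close> whose
 base returns to the right of the new interval; the new tower carries the letter \<open>l\<close>.
\<close>

lemma stage_stack:
 assumes st: "stage T s x h"
  and fst': "set (fst s') = set (fst s)"
  and az: "a \<in> set (fst s)" "z \<in> set (fst s)" and l: "l \<in> set (fst s)"
  and h': "h' = h(l := h z + h a)"
  and x': "\<forall>j\<in>set (fst s). 0 < x' j"
  and other: "\<And>j. j \<in> set (fst s) \<Longrightarrow> j \<noteq> l \<Longrightarrow> ivl (fst s') x' j \<subseteq> ivl (fst s) x j \<and>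
    lft (snd s') x' j - lft (fst s') x' j = lft (snd s) x j - lft (fst s) x j"
  and sub: "ivl (fst s') x' l \<subseteq> ivl (fst s) x z"
  and tr1: "\<And>y. y \<in> ivl (fst s') x' l \<Longrightarrow> y - lft (fst s) x z + lft (snd s) x z \<in> ivl (fst s) x a"
  and tr2: "lft (snd s') x' l - lft (fst s') x' l =
    lft (snd s) x z - lft (fst s) x z + (lft (snd s) x a - lft (fst s) x a)"
  and len': "len (fst s') x' \<le> len (fst s) x"
  and out: "\<And>y. y \<in> ivl (fst s') x' l \<Longrightarrow> len (fst s') x' \<le> y - lft (fst s) x z + lft (snd s) x z"
  and cov: "\<And>j y. j \<in> set (fst s) \<Longrightarrow> y \<in> ivl (fst s) x j \<Longrightarrow>
    (\<exists>\<beta>\<in>set (fst s). y \<in> ivl (fst s') x' \<beta> \<and> h j \<le> h' \<beta>) \<or>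
    (j = a \<and> (\<exists>u\<in>ivl (fst s') x' l. y = u - lft (fst s) x z + lft (snd s) x z))"
 shows "stage T s' x' h' \<and> (\<forall>j\<in>set (fst s). \<forall>y\<in>ivl (fst s') x' j.
   if j = l then y \<in> ivl (fst s) x z \<and> (T ^^ h z) y \<in> ivl (fst s) x a else y \<in> ivl (fst s) x j)"
proof -
 have pos: "0 < h j" if "j \<in> set (fst s)" for j using st that unfolding stage_def by blast
 have ret: "(T ^^ h j) y = y - lft (fst s) x j + lft (snd s) x j"
  if "j \<in> set (fst s)" "y \<in> ivl (fst s) x j" for j y using st that unfolding stage_def by blast
 have tr: "\<exists>c. \<forall>y\<in>ivl (fst s) x j. (T ^^ k) y = y + c" if "j \<in> set (fst s)" "k < h j" for j k
  using st that unfolding stage_def by blast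
 have no: "(T ^^ k) y \<notin> {0..<len (fst s) x}" if "j \<in> set (fst s)" "0 < k" "k < h j" "y \<in> ivl (fst s) x j" for j k y
  using st that unfolding stage_def by blast
 have fill: "\<exists>j\<in>set (fst s). \<exists>z\<in>ivl (fst s) x j. \<exists>k<h j. y = (T ^^ k) z" if "y \<in> {0..<1}" for y
  using st that unfolding stage_def by blast
 have sub_len: "{0..<len (fst s') x'} \<subseteq> {0..<len (fst s) x}" using len' by auto
 have two: "(T ^^ (h z + k)) y = (T ^^ k) (y - lft (fst s) x z + lft (snd s) x z)"
  if "y \<in> ivl (fst s') x' l" for y k
  using ret[OF az(2)] sub that by (simp add: funpow_add_apply subset_iff)
 have "stage T s' x' h'"
  unfolding stage_def fst'
 proof (intro conjI ballI allI impI)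
  fix j assume "j \<in> set (fst s)"
  then show "0 < h' j" "0 < x' j" using pos pos[OF az(2)] x' by (auto simp: h')
 next
  fix j y assume a: "j \<in> set (fst s)" and y: "y \<in> ivl (fst s') x' j"
  show "(T ^^ h' j) y = y - lft (fst s') x' j + lft (snd s') x' j"
  proof (cases "j = l")
   case True
   then show ?thesis using two[of y "h a"] ret[OF az(1) tr1, of y] tr2 y by (simp add: h')
  next
   case False
   then show ?thesis using ret[OF a, of y] other[OF a False] y by (auto simp: h')
  qed
 next
  fix j k assume a: "j \<in> set (fst s)" and k: "k < h' j"
  show "\<exists>c. \<forall>y\<in>ivl (fst s') x' j. (T ^^ k) y = y + c"
  proof (cases "j = l")
   case True
   show ?thesis
   proof (cases "k < h z")
    case True
    from tr[OF az(2) this] obtain c where "\<forall>y\<in>ivl (fst s) x z. (T ^^ k) y = y + c" by blast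
    then show ?thesis using sub \<open>j = l\<close> by blast
   next
    case False
    then obtain i where i: "k = h z + i" using le_Suc_ex not_less by blast
    then have "i < h a" using k True by (simp add: h')
    from tr[OF az(1) this] obtain c where c: "\<forall>y\<in>ivl (fst s) x a. (T ^^ i) y = y + c" by blast
    show ?thesis
     by (rule exI[of _ "c - lft (fst s) x z + lft (snd s) x z"])
      (use True two[of _ i] c tr1 i in auto)
   qed
  next
   case False
   then show ?thesis using tr[OF a, of k] other[OF a False] k by (auto simp: h' subset_iff)
  qed
 next
  fix j k y assume a: "j \<in> set (fst s)" and k: "0 < k \<and> k < h' j" and y: "y \<in> ivl (fst s') x' j"
  show "(T ^^ k) y \<notin> {0..<len (fst s') x'}"
  proof (cases "j = l")
   case True
   \<comment> \<open>Before time \<open>h z\<close> the orbit is inside the tower over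
     \<open>z\<close>, afterwards inside that over \<open>a\<close>. At time \<open>h z\<close>
     itself it is in the old base but, by \<open>out\<close>, to the right of the new one.\<close>
   consider "k < h z" | "k = h z" | i where "k = h z + i" "0 < i" "i < h a"
    using k True by (metis (no_types, lifting) add_diff_inverse_nat add_less_cancel_left fun_upd_same h' nat_neq_iff zero_less_diff)
   then show ?thesis
   proof cases
    case 1
    then show ?thesis using no[OF az(2) _ 1, of y] k y True sub sub_len by blast
   next
    case 2
    then show ?thesis using two[of y 0] out[of y] y True by auto
   next
    case 3
    then show ?thesis using two[of y i] no[OF az(1) 3(2,3) tr1, of y] y True sub_len by auto
   qed
  next
   case False
   then show ?thesis using no[OF a, of k y] other[OF a False] k y sub_len by (auto simp: h')
  qed
 next
  fix y :: real assume "y \<in> {0..<1}"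
  then obtain j u k where a: "j \<in> set (fst s)" "u \<in> ivl (fst s) x j" "k < h j" "y = (T ^^ k) u"
   using fill by blast
  from cov[OF a(1,2)] show "\<exists>j\<in>set (fst s). \<exists>z\<in>ivl (fst s') x' j. \<exists>k<h' j. y = (T ^^ k) z"
  proof (elim disjE bexE conjE)
   fix \<beta> assume b: "\<beta> \<in> set (fst s)" "u \<in> ivl (fst s') x' \<beta>" "h j \<le> h' \<beta>"
   then have "k < h' \<beta>" using a(3) by simp
   then show ?thesis using a(4) b by blast
  next
   fix v assume v: "j = a" "v \<in> ivl (fst s') x' l" "u = v - lft (fst s) x z + lft (snd s) x z"
   then have "y = (T ^^ (h z + k)) v" using two[OF v(2), of k] a(4) by simp
   moreover have "h z + k < h' l" using a(3) v(1) by (simp add: h')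
   ultimately show ?thesis using l v(2) by blast
  qed
 qed
 moreover have "if j = l then y \<in> ivl (fst s) x z \<and> (T ^^ h z) y \<in> ivl (fst s) x a else y \<in> ivl (fst s) x j"
  if "j \<in> set (fst s)" "y \<in> ivl (fst s') x' j" for j y
  using that sub tr1 ret[OF az(2), of y] other[of j] by auto
 ultimately show ?thesis by blast
qed

text \<open>The itinerary of the new bases through the old towers; it is what carries bounds for
  additive functions from one stage to the next.\<close>

definition stacked :: "(real \<Rightarrow> real) \<Rightarrow> rows \<Rightarrow> weights \<Rightarrow> (nat \<Rightarrow> nat) \<Rightarrow> rows \<Rightarrow> weights \<Rightarrow> nat \<Rightarrow> bool" where
 "stacked T s x h s' x' l \<longleftrightarrow> (\<forall>j\<in>set (fst s). \<forall>y\<in>ivl (fst s') x' j.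
   if j = l then y \<in> ivl (fst s) x (last (snd s)) \<and> (T ^^ h (last (snd s))) y \<in> ivl (fst s) x (last (fst s))
   else y \<in> ivl (fst s) x j)"

context rauzy
begin

text \<open>The loser \<open>z\<close> keeps its interval, and \<open>a\<close> gives up on its
  right the part onto which the induced map carries \<open>z\<close>.\<close>

lemma stage_step_top:
 assumes s: "valid s" and st: "stage T s x h" and lt: "x (loser True s) < x (winner True s)"
 shows "stage T (rstep True s) (red1 True s x) (act1 True s h) \<and>
  stacked T s x h (rstep True s) (red1 True s x) (loser True s)"
proof -
 obtain t a b1 b2 z where e: "s = (t @ [a], b1 @ a # b2 @ [z])" and az: "a \<noteq> z"
  and nin: "a \<notin> set b1" "a \<notin> set b2" "z \<notin> set b1" "z \<notin> set b2"
  and r: "rstep True s = (t @ [a], b1 @ a # z # b2)"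
  using top_split[OF s] by metis
 have wl: "winner True s = a" "loser True s = z" by (simp_all add: winner_def loser_def e)
 have dist: "distinct (t @ [a])" "distinct (b1 @ a # b2 @ [z])"
  and sets: "set (t @ [a]) = {1..d}" "set (b1 @ a # b2 @ [z]) = {1..d}"
  using s unfolding valid_rows_def e by auto
 have zt: "z \<in> set t" using az sets by auto
 have at: "a \<notin> set t" using dist by simp
 have xpos: "\<forall>j\<in>set (t @ [a]). 0 < x j" using st by (simp add: stage_def e)
 let ?x = "x(a := x a - x z)"
 have x': "red1 True s x = ?x" by (simp add: red1_def wl)
 have h': "act1 True s h = h(z := h z + h a)" by (simp add: act1_def wl)
 have lens: "len (t @ [a]) ?x = len t x + x a - x z" "len (t @ [a]) x = len t x + x a"
  using at by (simp_all add: len_simps len_upd)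
 have lenb: "len b1 x + x a + len b2 x + x z = len t x + x a"
  using len_eq_sum[OF dist(1), of x] len_eq_sum[OF dist(2), of x] sets by (simp add: len_simps)
 have lt': "x z < x a" using lt wl by simp
 have tops: "lft (t @ [a]) ?x j = lft (t @ [a]) x j" if "j \<in> set (fst s)" for j
  using at that by (auto simp: e lft_append lft_upd len_upd)
 have zs: "z \<in> set (fst s)" using zt by (simp add: e)
 have xz: "0 < x z" using xpos zt by simp
 have bot: "lft (b1 @ a # z # b2) ?x j = lft (b1 @ a # b2 @ [z]) x j" if "j \<in> set (t @ [a])" "j \<noteq> z" for j
 proof -
  have "j \<in> set (b1 @ a # b2 @ [z])" using that(1) unfolding sets .
  then show ?thesis using that(2) az nin by (auto simp: lft_append lft_upd len_upd)
 qed
 have botz: "lft (b1 @ a # z # b2) ?x z = len b1 x + x a - x z" "lft (b1 @ a # b2 @ [z]) x z = len b1 x + x a + len b2 x"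
  "lft (b1 @ a # b2 @ [z]) x a = len b1 x"
  using az nin by (simp_all add: lft_append lft_upd len_upd len_simps)
 have la: "lft (t @ [a]) x a = len t x" using at by (simp add: lft_append)
 have last: "last (snd s) = z" "last (fst s) = a" by (simp_all add: e)
 let ?t = "fst (rstep True s)" and ?b = "snd (rstep True s)"
 show ?thesis
  unfolding x' h' stacked_def wl last
 proof (rule stage_stack[OF st, where a = a and z = z and l = z])
  show "set ?t = set (fst s)" unfolding r unfolding e by simp
  show "a \<in> set (fst s)" "z \<in> set (fst s)" "z \<in> set (fst s)" using zt by (auto simp: e)
  show "\<forall>j\<in>set (fst s). 0 < ?x j" using xpos lt' by (auto simp: e)
  show "ivl ?t ?x j \<subseteq> ivl (fst s) x j \<and>
    lft ?b ?x j - lft ?t ?x j = lft (snd s) x j - lft (fst s) x j"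
   if "j \<in> set (fst s)" "j \<noteq> z" for j
   using that bot[of j] tops[OF that(1)] xz unfolding r unfolding e by (auto simp: ivl_def)
  show "ivl ?t ?x z \<subseteq> ivl (fst s) x z"
   using tops[OF zs] az unfolding r unfolding e by (auto simp: ivl_def)
  have inz: "y \<in> ivl ?t ?x z \<longleftrightarrow> lft (t @ [a]) x z \<le> y \<and> y < lft (t @ [a]) x z + x z" for y
   using tops[OF zs] az unfolding r by (auto simp: ivl_def)
  show "y - lft (fst s) x z + lft (snd s) x z \<in> ivl (fst s) x a" if "y \<in> ivl ?t ?x z" for y
   using that lenb lt' unfolding inz by (auto simp: e ivl_def botz la)
  show "lft ?b ?x z - lft ?t ?x z =
    lft (snd s) x z - lft (fst s) x z + (lft (snd s) x a - lft (fst s) x a)"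
   using tops[OF zs] lenb unfolding r unfolding e by (simp add: botz la)
  show "len ?t ?x \<le> len (fst s) x"
   using lens xz unfolding r unfolding e by simp
  show "len ?t ?x \<le> y - lft (fst s) x z + lft (snd s) x z"
   if "y \<in> ivl ?t ?x z" for y
   using that lenb lens unfolding inz unfolding r unfolding e by (simp add: botz)
  show "(\<exists>\<beta>\<in>set (fst s). y \<in> ivl ?t ?x \<beta> \<and> h j \<le> (h(z := h z + h a)) \<beta>) \<or>
    (j = a \<and> (\<exists>u\<in>ivl ?t ?x z. y = u - lft (fst s) x z + lft (snd s) x z))"
   if a': "j \<in> set (fst s)" and y: "y \<in> ivl (fst s) x j" for j y
  proof (cases "j = a \<and> len t x + x a - x z \<le> y")
   case True
   let ?u = "y + lft (t @ [a]) x z - lft (b1 @ a # b2 @ [z]) x z"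
   have "?u \<in> ivl ?t ?x z"
    unfolding inz using True y lenb by (auto simp: e ivl_def la botz)
   then show ?thesis using True by (intro disjI2 conjI bexI[of _ ?u]) (auto simp: e)
  next
   case False
   then have "y \<in> ivl ?t ?x j"
    using y tops[OF a'] unfolding r by (auto simp: e ivl_def la split: if_splits)
   then show ?thesis using a' by (intro disjI1 bexI[of _ j]) auto
  qed
 qed simp
qed

text \<open>Exchanging the rows yields the combinatorics but would invert the map, so the geometry
  is done anew: the interval of \<open>z\<close> is cut, and its right part, which the induced map
  carries onto the old interval of \<open>a\<close>, becomes the new interval of
  \<open>a\<close>.\<close>

lemma stage_step_bottom:
 assumes s: "valid s" and st: "stage T s x h" and lt: "x (loser False s) < x (winner False s)"
 shows "stage T (rstep False s) (red1 False s x) (act1 False s h) \<and>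
  stacked T s x h (rstep False s) (red1 False s x) (loser False s)"
proof -
 have "valid (prod.swap s)" using s valid_rows_swap by blast
 then obtain b z t1 t2 a where e': "prod.swap s = (b @ [z], t1 @ z # t2 @ [a])" and az: "z \<noteq> a"
  and nin: "z \<notin> set t1" "z \<notin> set t2" "a \<notin> set t1" "a \<notin> set t2"
  and r': "rstep True (prod.swap s) = (b @ [z], t1 @ z # a # t2)"
  using top_split by metis
 have e: "s = (t1 @ z # t2 @ [a], b @ [z])" using e' by (metis swap_simp swap_swap)
 have r: "rstep False s = (t1 @ z # a # t2, b @ [z])"
  using r' rstep_swap[of True s] by (metis swap_simp swap_swap)
 have wl: "winner False s = z" "loser False s = a" by (simp_all add: winner_def loser_def e)
 have dist: "distinct (b @ [z])" "distinct (t1 @ z # t2 @ [a])"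
  and sets: "set (b @ [z]) = {1..d}" "set (t1 @ z # t2 @ [a]) = {1..d}"
  using s unfolding valid_rows_def e by auto
 have zb: "z \<notin> set b" using dist by simp
 have xpos: "\<forall>j\<in>set (t1 @ z # t2 @ [a]). 0 < x j" using st by (simp add: stage_def e)
 let ?x = "x(z := x z - x a)"
 have x': "red1 False s x = ?x" by (simp add: red1_def wl)
 have h': "act1 False s h = h(a := h z + h a)" by (simp add: act1_def wl add.commute)
 have lens: "len (t1 @ z # a # t2) ?x = len t1 x + x z + len t2 x"
  "len (t1 @ z # t2 @ [a]) x = len t1 x + x z + len t2 x + x a"
  using nin az by (simp_all add: len_simps len_upd)
 have lenb: "len b x + x z = len t1 x + x z + len t2 x + x a"
  using len_eq_sum[OF dist(1), of x] len_eq_sum[OF dist(2), of x] sets by (simp add: len_simps)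
 have lt': "x a < x z" using lt wl by simp
 have xa: "0 < x a" using xpos by simp
 have as: "a \<in> set (fst s)" by (simp add: e)
 have bots: "lft (b @ [z]) ?x j = lft (b @ [z]) x j" if "j \<in> set (fst s)" for j
 proof -
  have "set (fst s) = {1..d}" using sets(2) by (simp only: e fst_conv)
  then have "j \<in> set (b @ [z])" using that unfolding sets by blast
  then show ?thesis using zb by (auto simp: lft_append lft_upd len_upd)
 qed
 have top: "lft (t1 @ z # a # t2) ?x j = lft (t1 @ z # t2 @ [a]) x j"
  if "j \<in> set (t1 @ z # t2 @ [a])" "j \<noteq> a" for j
  using that az nin by (auto simp: lft_append lft_upd len_upd)
 have topa: "lft (t1 @ z # a # t2) ?x a = len t1 x + x z - x a"
  "lft (t1 @ z # t2 @ [a]) x a = len t1 x + x z + len t2 x" "lft (t1 @ z # t2 @ [a]) x z = len t1 x"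
  using az nin by (simp_all add: lft_append lft_upd len_upd len_simps)
 have lz: "lft (b @ [z]) x z = len b x" using zb by (simp add: lft_append)
 have last: "last (snd s) = z" "last (fst s) = a" by (simp_all add: e)
 let ?t = "fst (rstep False s)" and ?b = "snd (rstep False s)"
 show ?thesis
  unfolding x' h' stacked_def wl last
 proof (rule stage_stack[OF st, where a = a and z = z and l = a])
  show "set ?t = set (fst s)" unfolding r unfolding e by auto
  show "a \<in> set (fst s)" "z \<in> set (fst s)" "a \<in> set (fst s)" by (auto simp: e)
  show "\<forall>j\<in>set (fst s). 0 < ?x j" using xpos lt' by (auto simp: e)
  show "ivl ?t ?x j \<subseteq> ivl (fst s) x j \<and>
    lft ?b ?x j - lft ?t ?x j = lft (snd s) x j - lft (fst s) x j"
   if "j \<in> set (fst s)" "j \<noteq> a" for j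
   using that top[of j] bots[OF that(1)] xa unfolding r unfolding e by (auto simp: ivl_def)
  have ina: "y \<in> ivl ?t ?x a \<longleftrightarrow> len t1 x + x z - x a \<le> y \<and> y < len t1 x + x z" for y
   using topa(1) az unfolding r by (auto simp: ivl_def)
  show "ivl ?t ?x a \<subseteq> ivl (fst s) x z"
  proof
   fix y assume "y \<in> ivl ?t ?x a"
   then show "y \<in> ivl (fst s) x z" unfolding ina using lt' by (auto simp: e ivl_def topa)
  qed
  show "y - lft (fst s) x z + lft (snd s) x z \<in> ivl (fst s) x a" if "y \<in> ivl ?t ?x a" for y
   using that lenb unfolding ina by (auto simp: e ivl_def topa lz)
  show "lft ?b ?x a - lft ?t ?x a =
    lft (snd s) x z - lft (fst s) x z + (lft (snd s) x a - lft (fst s) x a)"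
   using bots[OF as] lenb unfolding r unfolding e by (simp add: topa lz)
  show "len ?t ?x \<le> len (fst s) x"
   using lens xa unfolding r unfolding e by simp
  show "len ?t ?x \<le> y - lft (fst s) x z + lft (snd s) x z"
   if "y \<in> ivl ?t ?x a" for y
   using that lenb lens unfolding ina unfolding r unfolding e by (simp add: topa lz)
  show "(\<exists>\<beta>\<in>set (fst s). y \<in> ivl ?t ?x \<beta> \<and> h j \<le> (h(a := h z + h a)) \<beta>) \<or>
    (j = a \<and> (\<exists>u\<in>ivl ?t ?x a. y = u - lft (fst s) x z + lft (snd s) x z))"
   if a': "j \<in> set (fst s)" and y: "y \<in> ivl (fst s) x j" for j y
  proof -
   consider "j = a" | "j = z" "len t1 x + x z - x a \<le> y" | "j = z" "y < len t1 x + x z - x a"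
    | "j \<noteq> a" "j \<noteq> z" by linarith
   then show ?thesis
   proof cases
    case 1
    let ?u = "y + lft (fst s) x z - lft (snd s) x z"
    have "?u \<in> ivl ?t ?x a"
     unfolding ina using 1 y lenb by (auto simp: e ivl_def topa lz)
    then show ?thesis using 1 by (intro disjI2 conjI bexI[of _ ?u]) auto
   next
    case 2
    then have "y \<in> ivl ?t ?x a"
     unfolding ina using y by (auto simp: e ivl_def topa)
    then show ?thesis using 2 by (intro disjI1 bexI[of _ a]) (auto simp: e)
   next
    case 3
    then have "y \<in> ivl ?t ?x z"
     using y top[of z] az unfolding r by (auto simp: e ivl_def topa)
    then show ?thesis using 3 az by (intro disjI1 bexI[of _ z]) (auto simp: e)
   next
    case 4
    then have "y \<in> ivl ?t ?x j"
     using y top[of j] a' unfolding r by (auto simp: e ivl_def)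
    then show ?thesis using 4 a' by (intro disjI1 bexI[of _ j]) auto
   qed
  qed
 qed simp
qed

lemma stage_step:
 "valid s \<Longrightarrow> stage T s x h \<Longrightarrow> x (loser c s) < x (winner c s) \<Longrightarrow>
  stage T (rstep c s) (red1 c s x) (act1 c s h) \<and> stacked T s x h (rstep c s) (red1 c s x) (loser c s)"
 using stage_step_top stage_step_bottom by (cases c) auto

fun redw :: "rows \<Rightarrow> bool list \<Rightarrow> weights \<Rightarrow> nat \<Rightarrow> real" where
 "redw s [] x = x"
| "redw s (c # w) x = redw (rstep c s) w (red1 c s x)"

lemma redw_append: "redw s (u @ w) x = redw (st s u) w (redw s u x)"
 by (induction u arbitrary: s x) auto

lemma stage_word:
 "valid s \<Longrightarrow> stage T s x h \<Longrightarrow> cyl s w x \<Longrightarrow> stage T (st s w) (redw s w x) (act s w h)"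
proof (induction w arbitrary: s x h)
 case (Cons c w)
 have "stage T (rstep c s) (red1 c s x) (act1 c s h)"
  using stage_step Cons.prems by simp
 then show ?case using Cons valid_step by simp
qed simp

lemma cyl_append: "cyl s (u @ w) x \<longleftrightarrow> cyl s u x \<and> cyl (st s u) w (redw s u x)"
 by (induction u arbitrary: s x) auto

text \<open>Strict inequality leaves only one outcome at each step, so all paths of the same lengths
  lie on one path.\<close>

lemma cyl_prefix: "cyl s u x \<Longrightarrow> cyl s w x \<Longrightarrow> length u \<le> length w \<Longrightarrow> \<exists>v. w = u @ v"
proof (induction u arbitrary: s w x)
 case (Cons c u)
 then obtain c' w' where w: "w = c' # w'" by (cases w) auto
 have "c' = c"
 proof (rule ccontr)
  assume "c' \<noteq> c"
  then have "c' = (\<not> c)" by auto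
  then show False using Cons.prems(1,2) w by (auto simp: winner_def loser_def split: if_splits)
 qed
 then obtain v where "w' = u @ v"
  using Cons.IH[of "rstep c s" "red1 c s x" w'] Cons.prems w by auto
 then show ?case using w \<open>c' = c\<close> by auto
qed simp

text \<open>\<open>red1\<close> and \<open>act1\<close> are dual. With \<open>v\<close> constantly 1
  the identity says that the towers always have the same total area.\<close>

lemma sum_weight_invariant:
 assumes "valid s"
 shows "(\<Sum>j\<in>{1..d}. redw s w x j * act s w v j) = (\<Sum>j\<in>{1..d}. x j * v j)"
 using assms
proof (induction w arbitrary: s x v)
 case (Cons c w)
 let ?w = "winner c s" and ?l = "loser c s"
 have wl: "?w \<in> {1..d}" "?l \<in> {1..d} - {?w}"
  using winner_in loser_in winner_neq_loser[of s c] Cons.prems by auto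
 have split: "(\<Sum>j\<in>{1..d}. f j) = f ?w + (f ?l + (\<Sum>j\<in>{1..d} - {?w} - {?l}. f j))" for f :: "nat \<Rightarrow> real"
  using sum.remove[OF _ wl(1), of f] sum.remove[OF _ wl(2), of f] by simp
 have ne: "?w \<noteq> ?l" using wl by auto
 have "(\<Sum>j\<in>{1..d}. red1 c s x j * act1 c s v j) = (\<Sum>j\<in>{1..d}. x j * v j)"
 proof -
  have "(\<Sum>j\<in>{1..d} - {?w} - {?l}. red1 c s x j * act1 c s v j) = (\<Sum>j\<in>{1..d} - {?w} - {?l}. x j * v j)"
   by (intro sum.cong) (auto simp: red1_def act1_def)
  then show ?thesis unfolding split using ne by (simp add: red1_def act1_def algebra_simps)
 qed
 then show ?case using Cons.IH[OF valid_step[OF Cons.prems]] by simp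
qed simp

end

section \<open>Equidistribution of orbits in short intervals\<close>

definition visits :: "(real \<Rightarrow> real) \<Rightarrow> real set \<Rightarrow> nat \<Rightarrow> real \<Rightarrow> real" where
 "visits T J N y = (\<Sum>k<N. of_bool ((T ^^ k) y \<in> J))"

lemma visits_add: "visits T J (m + n) y = visits T J m y + visits T J n ((T ^^ m) y)"
 by (induction n) (simp_all add: visits_def funpow_add_apply)

lemma visits_nonneg: "0 \<le> visits T J n y"
 unfolding visits_def by (intro sum_nonneg) auto

lemma visits_eq_card: "visits T J n y = real (card {k. k < n \<and> (T ^^ k) y \<in> J})"
proof -
 have "{..<n} \<inter> {k. (T ^^ k) y \<in> J} = {k. k < n \<and> (T ^^ k) y \<in> J}" by auto
 then show ?thesis unfolding visits_def of_bool_def by (simp add: sum.If_cases)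
qed

lemma funpow_in: "bij_betw T A A \<Longrightarrow> y \<in> A \<Longrightarrow> (T ^^ k) y \<in> A"
 by (induction k) (auto dest: bij_betwE)

lemma funpow_inj: "bij_betw T A A \<Longrightarrow> y \<in> A \<Longrightarrow> z \<in> A \<Longrightarrow> (T ^^ k) y = (T ^^ k) z \<Longrightarrow> y = z"
proof (induction k)
 case (Suc k)
 have "(T ^^ k) y \<in> A" "(T ^^ k) z \<in> A" using funpow_in[OF Suc.prems(1)] Suc.prems(2,3) by blast+
 then have "(T ^^ k) y = (T ^^ k) z" using Suc.prems(1,4) by (simp add: bij_betw_def inj_on_def)
 then show ?case using Suc by blast
qed simp

section \<open>Towers, their levels and orbit segments\<close>

context rauzy
begin

lemma set_fst: "valid s \<Longrightarrow> set (fst s) = {1..d}"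
 by (simp add: valid_rows_def)

lemma stage_pos: "valid s \<Longrightarrow> stage T s x h \<Longrightarrow> j \<in> {1..d} \<Longrightarrow> 0 < x j \<and> 0 < h j"
 using set_fst[of s] unfolding stage_def by simp

lemma stage_fill:
 assumes "valid s" "stage T s x h" "y \<in> {0..<1}"
 obtains j z k where "j \<in> {1..d}" "z \<in> ivl (fst s) x j" "k < h j" "y = (T ^^ k) z"
proof -
 have "\<exists>j\<in>set (fst s). \<exists>z\<in>ivl (fst s) x j. \<exists>k<h j. y = (T ^^ k) z"
  using assms(2,3) unfolding stage_def by simp
 then show ?thesis using that set_fst[OF assms(1)] by auto
qed

lemma stage_len: "valid s \<Longrightarrow> len (fst s) x = (\<Sum>j\<in>{1..d}. x j)"
 using len_eq_sum[of "fst s" x] by (simp add: valid_rows_def)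

lemma stage_len_snd: "valid s \<Longrightarrow> len (snd s) x = len (fst s) x"
 using len_eq_sum[of "fst s" x] len_eq_sum[of "snd s" x] by (simp add: valid_rows_def)

lemma stage_return:
 assumes s: "valid s" and st: "stage T s x h" and a: "j \<in> {1..d}" and y: "y \<in> ivl (fst s) x j"
 shows "(T ^^ h j) y \<in> {0..<len (fst s) x}"
proof -
 have pos: "\<forall>\<beta>\<in>set (snd s). 0 < x \<beta>" using stage_pos[OF s st] s by (auto simp: valid_rows_def)
 have "j \<in> set (snd s)" using s a by (simp add: valid_rows_def)
 from lft_bounds[OF pos this] have "0 \<le> lft (snd s) x j" "lft (snd s) x j + x j \<le> len (fst s) x"
  using stage_len_snd[OF s] by auto
 moreover have "(T ^^ h j) y = y - lft (fst s) x j + lft (snd s) x j"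
  using st a y set_fst[OF s] unfolding stage_def by blast
 ultimately show ?thesis using y by (auto simp: ivl_def)
qed

lemma additive_bound_step:
 assumes S: "\<And>m n y. S (m + n) y = S m y + S n ((T ^^ m) y)"
  and s: "valid s" and st: "stage T s x h" and lt: "x (loser c s) < x (winner c s)"
  and b: "\<forall>j\<in>{1..d}. \<forall>y\<in>ivl (fst s) x j. S (h j) y \<le> (n j :: real)"
 shows "\<forall>j\<in>{1..d}. \<forall>y\<in>ivl (fst (rstep c s)) (red1 c s x) j. S (act1 c s h j) y \<le> act1 c s n j"
proof (intro ballI)
 fix j y assume a: "j \<in> {1..d}" and y: "y \<in> ivl (fst (rstep c s)) (red1 c s x) j"
 have "stacked T s x h (rstep c s) (red1 c s x) (loser c s)" using stage_step[OF s st lt] by blast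
 then have "if j = loser c s then y \<in> ivl (fst s) x (last (snd s)) \<and> (T ^^ h (last (snd s))) y \<in> ivl (fst s) x (last (fst s))
   else y \<in> ivl (fst s) x j" using a y set_fst[OF s] unfolding stacked_def by blast
 then consider "j \<noteq> loser c s" "y \<in> ivl (fst s) x j"
  | "j = loser c s" "y \<in> ivl (fst s) x (last (snd s))" "(T ^^ h (last (snd s))) y \<in> ivl (fst s) x (last (fst s))"
  by (auto split: if_splits)
 then show "S (act1 c s h j) y \<le> act1 c s n j"
 proof cases
  case 1
  then show ?thesis using b a by (simp add: act1_def)
 next
  case 2
  have e: "act1 c s h j = h (last (snd s)) + h (last (fst s))"
   "act1 c s n j = n (last (snd s)) + n (last (fst s))"
   using 2(1) by (auto simp: act1_def winner_def loser_def)
  show ?thesis unfolding e S using b 2 last_in[OF s] by (intro add_mono) auto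
 qed
qed

text \<open>New towers are old towers stacked, so bounds for an additive function along the towers
  evolve by the same matrices as the heights.\<close>

lemma additive_bound:
 assumes S: "\<And>m n y. S (m + n) y = S m y + S n ((T ^^ m) y)"
 shows "valid s \<Longrightarrow> stage T s x h \<Longrightarrow> cyl s w x \<Longrightarrow>
  \<forall>j\<in>{1..d}. \<forall>y\<in>ivl (fst s) x j. S (h j) y \<le> (n j :: real) \<Longrightarrow>
  \<forall>j\<in>{1..d}. \<forall>y\<in>ivl (fst (st s w)) (redw s w x) j. S (act s w h j) y \<le> act s w n j"
proof (induction w arbitrary: s x h n)
 case (Cons c w)
 have lt: "x (loser c s) < x (winner c s)" using Cons.prems(3) by simp
 have "\<forall>j\<in>{1..d}. \<forall>y\<in>ivl (fst (st (rstep c s) w)) (redw (rstep c s) w (red1 c s x)) j.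
   S (act (rstep c s) w (act1 c s h) j) y \<le> act (rstep c s) w (act1 c s n) j"
  using Cons.prems stage_step[OF Cons.prems(1,2) lt]
   additive_bound_step[where S = S and T = T, OF S Cons.prems(1,2) lt Cons.prems(4)]
  by (intro Cons.IH valid_step) auto
 then show ?case by simp
qed simp

lemma additive_bound_below:
 assumes S: "\<And>m n y. S (m + n) y = S m y + S n ((T ^^ m) y)"
  and s: "valid s" and st: "stage T s x h" and c: "cyl s w x"
  and b: "\<forall>j\<in>{1..d}. \<forall>y\<in>ivl (fst s) x j. (n j :: real) \<le> S (h j) y"
 shows "\<forall>j\<in>{1..d}. \<forall>y\<in>ivl (fst (st s w)) (redw s w x) j. act s w n j \<le> S (act s w h j) y"
proof -
 have "\<forall>j\<in>{1..d}. \<forall>y\<in>ivl (fst (st s w)) (redw s w x) j.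
   - S (act s w h j) y \<le> act s w (\<lambda>j. (-1) * n j + 0 * n j) j"
  by (rule additive_bound[where S = "\<lambda>n y. - S n y" and T = T]) (use S s st c b in auto)
 then show ?thesis unfolding act_linear by simp
qed

text \<open>
 Since the levels are disjoint and cover the unit interval, counting those that meet, or lie in,
 an interval measures it up to the size of a level.
\<close>

lemma level_interval:
 assumes s: "valid s" and st: "stage T s x h" and a: "j \<in> {1..d}" and k: "k < h j"
 obtains c where "(T ^^ k) ` ivl (fst s) x j = {lft (fst s) x j + c ..< lft (fst s) x j + c + x j}"
proof -
 obtain c where c: "\<forall>y\<in>ivl (fst s) x j. (T ^^ k) y = y + c"
  using st a k set_fst[OF s] unfolding stage_def by blast
 then have "(T ^^ k) ` ivl (fst s) x j = (\<lambda>y. y + c) ` ivl (fst s) x j" by (intro image_cong) auto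
 also have "\<dots> = {lft (fst s) x j + c ..< lft (fst s) x j + c + x j}"
  unfolding ivl_def by (simp add: add.commute add.left_commute)
 finally show ?thesis by (rule that)
qed

text \<open>If the numbers of iterations differed, cancelling the smaller one would make a base
  point return too early. If they agree, the base points coincide.\<close>

lemma level_disjoint:
 assumes T: "bij_betw T {0..<1} {0..<1}" and s: "valid s" and st: "stage T s x h" and len1: "len (fst s) x \<le> 1"
  and a: "j \<in> {1..d}" "k < h j" "y \<in> ivl (fst s) x j" and b: "\<beta> \<in> {1..d}" "i < h \<beta>" "z \<in> ivl (fst s) x \<beta>"
  and eq: "(T ^^ k) y = (T ^^ i) z"
 shows "j = \<beta> \<and> k = i"
proof -
 have pos: "\<forall>\<gamma>\<in>set (fst s). 0 < x \<gamma>" using stage_pos[OF s st] set_fst[OF s] by blast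
 have sub: "ivl (fst s) x \<gamma> \<subseteq> {0..<len (fst s) x}" if "\<gamma> \<in> {1..d}" for \<gamma>
  using ivl_subset[OF pos] that set_fst[OF s] by blast
 have key: "k = i" if "j \<in> {1..d}" "\<beta> \<in> {1..d}" "k < h j" "i < h \<beta>" "y \<in> ivl (fst s) x j" "z \<in> ivl (fst s) x \<beta>"
  "(T ^^ k) y = (T ^^ i) z" "k \<le> i" for j \<beta> k i y z
 proof (rule ccontr)
  assume "k \<noteq> i"
  have y1: "y \<in> {0..<1}" and z1: "z \<in> {0..<1}" using sub that len1 by fastforce+
  have "(T ^^ i) z = (T ^^ k) ((T ^^ (i - k)) z)"
   using \<open>k \<le> i\<close> funpow_add_apply[of "i - k" k T z] by simp
  then have "y = (T ^^ (i - k)) z"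
   using funpow_inj[OF T y1 funpow_in[OF T z1]] that(7) by metis
  moreover have "(T ^^ (i - k)) z \<notin> {0..<len (fst s) x}"
  proof -
   have "0 < i - k \<and> i - k < h \<beta>" using \<open>k \<noteq> i\<close> that by auto
   then show ?thesis using st that set_fst[OF s] unfolding stage_def by blast
  qed
  ultimately show False using sub that by blast
 qed
 have kj: "k = i"
  using key[OF a(1) b(1) a(2) b(2) a(3) b(3) eq] key[OF b(1) a(1) b(2) a(2) b(3) a(3) eq[symmetric]]
  by (cases "k \<le> i") auto
 have y1: "y \<in> {0..<1}" and z1: "z \<in> {0..<1}" using sub a b len1 by fastforce+
 have "y = z" using funpow_inj[OF T y1 z1] eq kj by blast
 then show ?thesis
  using ivl_unique[OF pos, of j \<beta> y] s a b kj set_fst[OF s] by (auto simp: valid_rows_def)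
qed

definition lev_meet :: "(real \<Rightarrow> real) \<Rightarrow> rows \<Rightarrow> weights \<Rightarrow> (nat \<Rightarrow> nat) \<Rightarrow> real set \<Rightarrow> nat \<Rightarrow> nat set" where
 "lev_meet T s x h J j = {k. k < h j \<and> (T ^^ k) ` ivl (fst s) x j \<inter> J \<noteq> {}}"

definition lev_in :: "(real \<Rightarrow> real) \<Rightarrow> rows \<Rightarrow> weights \<Rightarrow> (nat \<Rightarrow> nat) \<Rightarrow> real set \<Rightarrow> nat \<Rightarrow> nat set" where
 "lev_in T s x h J j = {k. k < h j \<and> (T ^^ k) ` ivl (fst s) x j \<subseteq> J}"

lemma visits_lev:
 assumes "y \<in> ivl (fst s) x j"
 shows "real (card (lev_in T s x h J j)) \<le> visits T J (h j) y"
  and "visits T J (h j) y \<le> real (card (lev_meet T s x h J j))"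
 unfolding visits_eq_card lev_in_def lev_meet_def
 by (intro of_nat_mono card_mono; use assms in auto)+

lemma x_le_len: "valid s \<Longrightarrow> stage T s x h \<Longrightarrow> j \<in> {1..d} \<Longrightarrow> x j \<le> len (fst s) x"
 using lft_bounds[of "fst s" x j] stage_pos[of s T x h] set_fst[of s] by force

lemma lev_meet_measure:
 assumes T: "bij_betw T {0..<1} {0..<1}" and s: "valid s" and st: "stage T s x h" and len1: "len (fst s) x \<le> 1"
  and uv: "u \<le> v"
 shows "(\<Sum>j\<in>{1..d}. x j * real (card (lev_meet T s x h {u..<v} j))) \<le> v - u + 2 * len (fst s) x"
proof -
 let ?l = "len (fst s) x"
 let ?L = "\<lambda>(j, k). (T ^^ k) ` ivl (fst s) x j"
 define Z where "Z = Sigma {1..d} (lev_meet T s x h {u..<v})"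
 have fin: "finite (lev_meet T s x h {u..<v} j)" for j by (simp add: lev_meet_def)
 have finZ: "finite Z" using fin by (simp add: Z_def)
 have int: "\<exists>c. ?L p = {c..<c + x (fst p)}" if pZ: "p \<in> Z" for p
 proof -
  obtain j k where p: "p = (j, k)" "j \<in> {1..d}" "k < h j" using pZ by (auto simp: Z_def lev_meet_def)
  from level_interval[OF s st p(2,3)] show ?thesis using p(1) by (metis case_prod_conv fst_conv)
 qed
 have meas: "?L p \<in> sets lborel" "emeasure lborel (?L p) = ennreal (x (fst p))" "measure lborel (?L p) = x (fst p)" if pZ: "p \<in> Z" for p
 proof -
  obtain c where c: "?L p = {c..<c + x (fst p)}" using int[OF pZ] by blast
  have "0 < x (fst p)" using pZ stage_pos[OF s st] by (auto simp: Z_def)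
  then show "?L p \<in> sets lborel" "emeasure lborel (?L p) = ennreal (x (fst p))" "measure lborel (?L p) = x (fst p)"
   unfolding c by auto
 qed
 have l0: "0 \<le> ?l" using stage_pos[OF s st] set_fst[OF s] by (intro len_nonneg) blast
 have "disjoint_family_on ?L Z"
 proof (unfold disjoint_family_on_def, intro ballI impI)
  fix p p' assume pp: "p \<in> Z" "p' \<in> Z" "p \<noteq> p'"
  show "?L p \<inter> ?L p' = {}"
   using level_disjoint[OF T s st len1] pp unfolding Z_def lev_meet_def by (fastforce simp: disjoint_iff)
 qed
 then have "measure lborel (\<Union>p\<in>Z. ?L p) = (\<Sum>p\<in>Z. measure lborel (?L p))"
  using finZ meas by (intro measure_finite_Union) auto
 also have "\<dots> = (\<Sum>p\<in>Z. x (fst p))" using meas(3) by (intro sum.cong) auto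
 also have "\<dots> = (\<Sum>j\<in>{1..d}. x j * real (card (lev_meet T s x h {u..<v} j)))"
  using sum.Sigma[of "{1..d}" "lev_meet T s x h {u..<v}" "\<lambda>j k. x j"] fin
  by (simp add: Z_def case_prod_beta' mult.commute)
 finally have eq: "measure lborel (\<Union>p\<in>Z. ?L p) = (\<Sum>j\<in>{1..d}. x j * real (card (lev_meet T s x h {u..<v} j)))" .
 have sub: "(\<Union>p\<in>Z. ?L p) \<subseteq> {u - ?l..<v + ?l}"
 proof
  fix y assume "y \<in> (\<Union>p\<in>Z. ?L p)"
  then obtain p where p: "p \<in> Z" "y \<in> ?L p" by blast
  obtain c where c: "?L p = {c..<c + x (fst p)}" using int[OF p(1)] by blast
  have "?L p \<inter> {u..<v} \<noteq> {}" using p(1) by (auto simp: Z_def lev_meet_def)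
  then obtain z where "z \<in> ?L p" "z \<in> {u..<v}" by blast
  then have z: "c \<le> z" "z < c + x (fst p)" "u \<le> z" "z < v" unfolding c by auto
  have "x (fst p) \<le> ?l" using x_le_len[OF s st] p(1) by (auto simp: Z_def)
  then show "y \<in> {u - ?l..<v + ?l}" using p(2) z unfolding c by auto
 qed
 have "(\<Union>p\<in>Z. ?L p) \<in> sets lborel" using meas finZ by (intro sets.finite_UN) auto
 then have "measure lborel (\<Union>p\<in>Z. ?L p) \<le> measure lborel {u - ?l..<v + ?l}"
  using sub uv l0 by (intro measure_mono_fmeasurable) (auto simp: fmeasurable_def)
 then show ?thesis using eq uv l0 by simp
qed

lemma lev_in_measure:
 assumes s: "valid s" and st: "stage T s x h" and uv: "0 \<le> u" "v \<le> 1"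
 shows "v - u - 2 * len (fst s) x \<le> (\<Sum>j\<in>{1..d}. x j * real (card (lev_in T s x h {u..<v} j)))"
proof -
 let ?l = "len (fst s) x"
 let ?L = "\<lambda>(j, k). (T ^^ k) ` ivl (fst s) x j"
 define Z where "Z = Sigma {1..d} (lev_in T s x h {u..<v})"
 have fin: "finite (lev_in T s x h {u..<v} j)" for j by (simp add: lev_in_def)
 have finZ: "finite Z" using fin by (simp add: Z_def)
 have meas: "?L p \<in> sets lborel" "measure lborel (?L p) = x (fst p)" "emeasure lborel (?L p) \<noteq> \<infinity>" if pZ: "p \<in> Z" for p
 proof -
  obtain j k where p: "p = (j, k)" "j \<in> {1..d}" "k < h j" using pZ by (auto simp: Z_def lev_in_def)
  obtain c where c: "?L p = {lft (fst s) x j + c ..< lft (fst s) x j + c + x j}"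
   using level_interval[OF s st p(2,3)] p(1) by auto
  have "0 < x j" using p stage_pos[OF s st] by auto
  then show "?L p \<in> sets lborel" "measure lborel (?L p) = x (fst p)" "emeasure lborel (?L p) \<noteq> \<infinity>"
   unfolding c by (auto simp: p)
 qed
 have l0: "0 \<le> ?l" using stage_pos[OF s st] set_fst[OF s] by (intro len_nonneg) blast
 have sub: "{u + ?l..<v - ?l} \<subseteq> (\<Union>p\<in>Z. ?L p)"
 proof
  fix y assume y: "y \<in> {u + ?l..<v - ?l}"
  then have "y \<in> {0..<1}" using uv l0 by auto
  then obtain j z k where a: "j \<in> {1..d}" "z \<in> ivl (fst s) x j" "k < h j" "y = (T ^^ k) z"
   using stage_fill[OF s st] by blast
  obtain c where c: "(T ^^ k) ` ivl (fst s) x j = {lft (fst s) x j + c ..< lft (fst s) x j + c + x j}"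
   using level_interval[OF s st a(1,3)] .
  have "y \<in> (T ^^ k) ` ivl (fst s) x j" using a by blast
  then have "(T ^^ k) ` ivl (fst s) x j \<subseteq> {u..<v}"
   using y x_le_len[OF s st a(1)] unfolding c by auto
  then have "(j, k) \<in> Z" using a by (auto simp: Z_def lev_in_def)
  then show "y \<in> (\<Union>p\<in>Z. ?L p)" using a by blast
 qed
 have M: "(\<Union>p\<in>Z. ?L p) \<in> fmeasurable lborel"
 proof (rule fmeasurable.finite_UN[OF finZ])
  show "?L p \<in> fmeasurable lborel" if "p \<in> Z" for p
   using meas[OF that] by (intro fmeasurableI) (simp_all add: less_top)
 qed
 have "v - u - 2 * ?l \<le> measure lborel {u + ?l..<v - ?l}" by (cases "u + ?l \<le> v - ?l") auto
 also have "\<dots> \<le> measure lborel (\<Union>p\<in>Z. ?L p)"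
  using sub M by (intro measure_mono_fmeasurable) auto
 also have "\<dots> \<le> (\<Sum>p\<in>Z. measure lborel (?L p))"
  using finZ meas by (intro measure_UNION_le) auto
 also have "\<dots> = (\<Sum>p\<in>Z. x (fst p))" using meas(2) by (intro sum.cong) auto
 also have "\<dots> = (\<Sum>j\<in>{1..d}. x j * real (card (lev_in T s x h {u..<v} j)))"
  using sum.Sigma[of "{1..d}" "lev_in T s x h {u..<v}" "\<lambda>j k. x j"] fin
  by (simp add: Z_def case_prod_beta' mult.commute)
 finally show ?thesis .
qed

text \<open>An orbit segment consists of complete towers and at most one incomplete tower at either
  end, each of height at most \<open>Q\<close>.\<close>

lemma tower_to_orbit:
 assumes S: "\<And>m n y. S (m + n) y = S m y + S n ((T ^^ m) y)" and S0: "\<And>n y. 0 \<le> (S n y :: real)"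
  and s: "valid s" and st: "stage T s x h" and Q: "\<forall>j\<in>{1..d}. real (h j) \<le> Q"
  and lo: "0 \<le> lo" and hi: "0 \<le> hi"
  and b: "\<forall>j\<in>{1..d}. \<forall>y\<in>ivl (fst s) x j. lo * real (h j) \<le> S (h j) y \<and> S (h j) y \<le> hi * real (h j)"
  and y: "y \<in> {0..<1}"
 shows "S N y \<le> hi * (real N + 2 * Q)" and "lo * (real N - Q) - hi * Q \<le> S N y"
proof -
 have posx: "\<forall>\<gamma>\<in>set (fst s). 0 < x \<gamma>" using stage_pos[OF s st] set_fst[OF s] by blast
 have dst: "distinct (fst s)" using s by (simp add: valid_rows_def)
 have mono: "S m y \<le> S n y" if "m \<le> n" for m n y
  using S[of m "n - m" y] S0[of "n - m" "(T ^^ m) y"] that by simp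
 \<comment> \<open>For a start in the base only the last tower can be incomplete; complete towers
   are stripped off one at a time.\<close>
 have base: "lo * (real N - Q) \<le> S N z \<and> S N z \<le> hi * (real N + Q)" if "z \<in> {0..<len (fst s) x}" for z N
  using that
 proof (induction N arbitrary: z rule: less_induct)
  case (less N z)
  obtain j where a: "j \<in> {1..d}" "z \<in> ivl (fst s) x j"
   using ivl_cover[OF posx, of z] less.prems dst set_fst[OF s] by auto
  have hpos: "0 < h j" using stage_pos[OF s st a(1)] by blast
  have hb: "lo * real (h j) \<le> S (h j) z" "S (h j) z \<le> hi * real (h j)" using b a by blast+
  have hQ: "real (h j) \<le> Q" using Q a by blast
  show ?case
  proof (cases "h j \<le> N")
   case True
   have e: "S N z = S (h j) z + S (N - h j) ((T ^^ h j) z)"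
    using S[of "h j" "N - h j" z] True by simp
   have "lo * (real (N - h j) - Q) \<le> S (N - h j) ((T ^^ h j) z) \<and>
     S (N - h j) ((T ^^ h j) z) \<le> hi * (real (N - h j) + Q)"
    using True hpos by (intro less.IH stage_return[OF s st a]) auto
   then show ?thesis unfolding e using hb True by (auto simp: of_nat_diff algebra_simps)
  next
   case False
   have "S N z \<le> S (h j) z" using False by (intro mono) auto
   also have "\<dots> \<le> hi * real (h j)" by (rule hb)
   also have "\<dots> \<le> hi * (real N + Q)" using hQ hi by (intro mult_left_mono) auto
   finally have up: "S N z \<le> hi * (real N + Q)" .
   have "real N \<le> Q" using False hQ by linarith
   then have "lo * (real N - Q) \<le> 0" using lo by (simp add: mult_nonneg_nonpos)
   then show ?thesis using up S0[of N z] by linarith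
  qed
 qed
 obtain j z k where a: "j \<in> {1..d}" "z \<in> ivl (fst s) x j" "k < h j" "y = (T ^^ k) z"
  using stage_fill[OF s st y] by blast
 have z: "z \<in> {0..<len (fst s) x}" using ivl_subset[OF posx, of j] a set_fst[OF s] by blast
 have kQ: "real k \<le> Q" using a Q by (meson less_imp_le of_nat_mono order_trans)
 have e: "S (k + N) z = S k z + S N y" using S[of k N z] a(4) by simp
 have "S N y \<le> S (k + N) z" using e S0[of k z] by linarith
 also have "\<dots> \<le> hi * (real (k + N) + Q)" using base[OF z] by blast
 also have "\<dots> \<le> hi * (real N + 2 * Q)" using kQ hi by (intro mult_left_mono) auto
 finally show "S N y \<le> hi * (real N + 2 * Q)" .
 have "S k z \<le> S (h j) z" using a by (intro mono) auto
 also have "\<dots> \<le> hi * real (h j)" using b a by blast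
 also have "\<dots> \<le> hi * Q" using Q a hi by (intro mult_left_mono) auto
 finally have "S k z \<le> hi * Q" .
 moreover have "lo * (real N - Q) \<le> lo * (real (k + N) - Q)" using lo by (intro mult_left_mono) auto
 moreover have "lo * (real (k + N) - Q) \<le> S (k + N) z" using base[OF z] by blast
 ultimately show "lo * (real N - Q) - hi * Q \<le> S N y" using e by linarith
qed

end

text \<open>Uniform in the starting point, and with relative error even for intervals that shrink
  almost as fast as the reciprocal of the time. Unique ergodicity alone gives no such rate, and the
  logarithmic singularities need it.\<close>

definition equidistributed :: "(real \<Rightarrow> real) \<Rightarrow> bool" where
 "equidistributed T \<longleftrightarrow> (\<forall>\<epsilon>>0. \<exists>\<delta>0>0. \<forall>\<delta> u v N y.
   0 < \<delta> \<and> \<delta> < \<delta>0 \<and> 0 \<le> u \<and> v \<le> 1 \<and> \<delta> \<le> v - u \<and> \<delta> powr (- 1 - \<epsilon>) \<le> real N \<and> y \<in> {0..<1} \<longrightarrow>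
   \<bar>visits T {u..<v} N y - real N * (v - u)\<bar> \<le> \<epsilon> * (real N * (v - u)))"

section \<open>Mixing blocks equalise visit frequencies\<close>

context rauzy
begin

lemma act_mono:
 assumes "valid s" "\<forall>j\<in>{1..d}. u j \<le> (v j :: real)" "\<beta> \<in> {1..d}"
 shows "act s w u \<beta> \<le> act s w v \<beta>"
proof -
 have "nonneg (\<lambda>j. 1 * v j + (- 1) * u j)" using assms(2) by (auto simp: nonneg_def)
 from act_nonneg[OF assms(1) this, of w] have "nonneg (\<lambda>j. 1 * act s w v j + (- 1) * act s w u j)"
  unfolding act_linear .
 then show ?thesis using assms(3) by (simp add: nonneg_def)
qed

lemma act_scale: "act s w (\<lambda>j. c * v j) = (\<lambda>j. c * (act s w v j :: real))"
 using act_linear[of s w c v 0 v] by simp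

lemma ratio_preserved:
 assumes "valid s" "\<forall>j\<in>{1..d}. lo * q j \<le> n j \<and> n j \<le> (hi * q j :: real)"
 shows "\<forall>j\<in>{1..d}. lo * act s w q j \<le> act s w n j \<and> act s w n j \<le> hi * act s w q j"
proof
 fix j assume a: "j \<in> {1..d}"
 have "act s w (\<lambda>j. lo * q j) j \<le> act s w n j" "act s w n j \<le> act s w (\<lambda>j. hi * q j) j"
  using assms a by (intro act_mono; blast)+
 then show "lo * act s w q j \<le> act s w n j \<and> act s w n j \<le> hi * act s w q j"
  unfolding act_scale by blast
qed

abbreviation gap :: "real \<Rightarrow> nat \<Rightarrow> real" where
 "gap C k \<equiv> (1 - 1 / (2 * C)) ^ k"

abbreviation ratios :: "real \<Rightarrow> real \<Rightarrow> weights \<Rightarrow> weights \<Rightarrow> bool" where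
 "ratios lo hi q n \<equiv> \<forall>j\<in>{1..d}. lo * q j \<le> n j \<and> n j \<le> hi * q j"

text \<open>The ratio at one letter, here 1, differs from \<open>lo\<close> or from
  \<open>hi\<close> by at least half the spread. The positive word passes this gain on to every
  letter, and comparability of the heights limits its dilution to the factor
  \<open>C\<close>.\<close>

lemma block_contracts:
 fixes n :: "nat \<Rightarrow> real"
 assumes s: "valid s" and C: "C \<ge> 1" and blk: "mixing_block C s (\<lambda>_. 1) u v" and lohi: "lo \<le> hi"
  and b: "ratios lo hi (cnt s u) n"
 shows "\<exists>lo' hi'. lo \<le> lo' \<and> lo' \<le> hi' \<and> hi' - lo' \<le> (1 - 1 / (2 * C)) * (hi - lo) \<and>
  (ratios lo' hi' (cnt s (u @ v)) (act (st s u) v n))"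
proof -
 let ?q = "act s u (\<lambda>_. 1 :: real)" and ?q' = "act s (u @ v) (\<lambda>_. 1 :: real)"
 have v: "valid (st s u)" by (rule valid_st[OF s])
 have q': "?q' = act (st s u) v ?q" by (simp add: act_append)
 have pw: "positive_word (st s u) v" and cmp: "\<And>j \<beta>. j \<in> {1..d} \<Longrightarrow> \<beta> \<in> {1..d} \<Longrightarrow> ?q' j \<le> C * ?q \<beta>"
  using blk unfolding mixing_block_def by blast+
 have one: "1 \<in> {1..d}" using d2 by simp
 define D where "D = (hi - lo) / 2"
 have D0: "0 \<le> D" using lohi by (simp add: D_def)
 have "D / C \<le> D / 1" using D0 C by (intro divide_left_mono) auto
 with D0 have D: "0 \<le> D" "D / C \<le> D" by auto
 have gain: "D / C * ?q' \<beta> \<le> act (st s u) v m \<beta>"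
  if m: "nonneg m" "D * ?q 1 \<le> m 1" and be: "\<beta> \<in> {1..d}" for m \<beta>
 proof -
  have "D / C * ?q' \<beta> \<le> D / C * (C * ?q 1)" using cmp[OF be one] D C by (intro mult_left_mono) auto
  also have "\<dots> = D * ?q 1" using C by simp
  also have "\<dots> \<le> m 1" by (rule m(2))
  also have "\<dots> \<le> act (st s u) v m \<beta>" using pw m(1) one be unfolding positive_word_def by blast
  finally show ?thesis .
 qed
 have pres: "lo * ?q' j \<le> act (st s u) v n j \<and> act (st s u) v n j \<le> hi * ?q' j" if "j \<in> {1..d}" for j
  using ratio_preserved[OF v b] that unfolding q' by blast
 have eq: "hi - lo = D * 2" by (simp add: D_def)
 have width: "D * 2 - D / C \<le> (1 - 1 / (2 * C)) * (hi - lo)" using C by (simp add: D_def field_simps)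
 show ?thesis
 proof (cases "n 1 \<le> (hi - D) * ?q 1")
  case True
  have "act (st s u) v n j \<le> (hi - D / C) * ?q' j" if "j \<in> {1..d}" for j
  proof -
   have "D / C * ?q' j \<le> act (st s u) v (\<lambda>j. hi * ?q j + (- 1) * n j) j"
    by (rule gain) (use b True that in \<open>auto simp: nonneg_def algebra_simps\<close>)
   then show ?thesis unfolding act_linear q'[symmetric] by (simp add: algebra_simps)
  qed
  moreover have "lo \<le> hi - D / C" "hi - D / C - lo \<le> (1 - 1 / (2 * C)) * (hi - lo)"
   using width D eq by linarith+
  ultimately show ?thesis using pres by blast
 next
  case False
  have "(lo + D / C) * ?q' j \<le> act (st s u) v n j" if "j \<in> {1..d}" for j
  proof -
   have "hi - D = lo + D" by (simp add: D_def field_simps)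
   then have "D * ?q 1 \<le> n 1 - lo * ?q 1" using False by (simp add: algebra_simps)
   then have "D / C * ?q' j \<le> act (st s u) v (\<lambda>j. 1 * n j + (- lo) * ?q j) j"
    using b that by (intro gain) (auto simp: nonneg_def algebra_simps)
   then show ?thesis unfolding act_linear q'[symmetric] by (simp add: algebra_simps)
  qed
  moreover have "lo + D / C \<le> hi" "hi - (lo + D / C) \<le> (1 - 1 / (2 * C)) * (hi - lo)" "lo \<le> lo + D / C"
   using width D eq C by (linarith | simp)+
  ultimately show ?thesis using pres by blast
 qed
qed

lemma blocks_contract:
 fixes n :: "nat \<Rightarrow> real"
 assumes s: "valid s" and C: "C \<ge> 1" and H: "0 \<le> H"
  and blk: "\<And>i. i < k \<Longrightarrow> mixing_block C s (\<lambda>_. 1) (U i) (V i)"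
  and nest: "\<And>i. i < k \<Longrightarrow> \<exists>G. U (Suc i) = U i @ V i @ G"
  and b: "\<forall>j\<in>{1..d}. 0 \<le> n j \<and> n j \<le> H * cnt s (U 0) j"
 shows "\<exists>R lo hi. U k = U 0 @ R \<and> 0 \<le> lo \<and> lo \<le> hi \<and> hi - lo \<le> gap C k * H \<and>
  (ratios lo hi (cnt s (U k)) (act (st s (U 0)) R n))"
 using blk nest
proof (induction k)
 case 0
 show ?case
  by (rule exI[of _ "[]"], rule exI[of _ 0], rule exI[of _ H]) (use b H in auto)
next
 case (Suc k)
 have "\<exists>R lo hi. U k = U 0 @ R \<and> 0 \<le> lo \<and> lo \<le> hi \<and> hi - lo \<le> gap C k * H \<and>
  (ratios lo hi (cnt s (U k)) (act (st s (U 0)) R n))"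
  by (rule Suc.IH) (use Suc.prems in auto)
 then obtain R lo hi where R: "U k = U 0 @ R" and lohi: "0 \<le> lo" "lo \<le> hi"
  and w: "hi - lo \<le> gap C k * H"
  and bd: "ratios lo hi (cnt s (U k)) (act (st s (U 0)) R n)" by blast
 from block_contracts[OF s C Suc.prems(1)[OF lessI] lohi(2) bd]
 obtain lo' hi' where lohi': "lo \<le> lo'" "lo' \<le> hi'" and w': "hi' - lo' \<le> (1 - 1 / (2 * C)) * (hi - lo)"
  and bd': "ratios lo' hi' (cnt s (U k @ V k)) (act (st s (U k)) (V k) (act (st s (U 0)) R n))" by blast
 obtain G where G: "U (Suc k) = U k @ V k @ G" using Suc.prems(2)[of k] by blast
 have "(1 - 1 / (2 * C)) * (hi - lo) \<le> (1 - 1 / (2 * C)) * (gap C k * H)"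
  using w C by (intro mult_left_mono) auto
 then have w2: "hi' - lo' \<le> gap C (Suc k) * H" using w' by (simp add: mult.assoc)
 have e: "cnt s (U (Suc k)) = act (st s (U k @ V k)) G (act s (U k @ V k) (\<lambda>_. 1 :: real))"
  unfolding G by (simp add: act_append[symmetric] del: append_assoc) (simp add: append_assoc[symmetric] del: append_assoc)
 have e2: "act (st s (U 0)) (R @ V k @ G) n = act (st s (U k @ V k)) G (act (st s (U k)) (V k) (act (st s (U 0)) R n))"
  unfolding R by (simp add: act_append st_append)
 have "ratios lo' hi' (cnt s (U (Suc k))) (act (st s (U 0)) (R @ V k @ G) n)"
  unfolding e e2 by (rule ratio_preserved[OF valid_st[OF s] bd'])
 moreover have "U (Suc k) = U 0 @ (R @ V k @ G)" using G R by simp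
 moreover have "0 \<le> lo'" using lohi lohi' by linarith
 ultimately show ?case using lohi' w2 by blast
qed

text \<open>By duality the weighted mean \<rho> is the same at all stages, so it lies between the
  extreme ratios, which are close after \<open>k\<close> blocks. The first block also yields the a
  priori bound \<open>C * \<rho>\<close> on the ratios, from which the contraction starts.\<close>

lemma ratio_near_mean:
 fixes n :: "nat \<Rightarrow> real"
 assumes s: "valid s" and C: "C \<ge> 1" and k: "0 < k"
  and blk: "\<And>i. i < k \<Longrightarrow> mixing_block C s (\<lambda>_. 1) (U i) (V i)"
  and nest: "\<And>i. i < k \<Longrightarrow> \<exists>G. U (Suc i) = U i @ V i @ G"
  and n: "nonneg n"
  and xpos: "\<And>w j. w \<in> {U 0 @ V 0, U k} \<Longrightarrow> j \<in> {1..d} \<Longrightarrow> 0 \<le> redw s w x j"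
  and x1: "(\<Sum>j\<in>{1..d}. x j) = 1"
  and \<rho>: "\<rho> = (\<Sum>j\<in>{1..d}. redw s (U 0) x j * n j)"
 shows "\<exists>R. U k = U 0 @ R \<and> (\<forall>j\<in>{1..d}.
  (\<rho> - gap C k * (C * \<rho>)) * cnt s (U k) j \<le> act (st s (U 0)) R n j \<and>
  act (st s (U 0)) R n j \<le> (\<rho> + gap C k * (C * \<rho>)) * cnt s (U k) j)"
proof -
 let ?q = "act s (U 0) (\<lambda>_. 1 :: real)" and ?q' = "act s (U 0 @ V 0) (\<lambda>_. 1 :: real)"
 let ?n' = "act (st s (U 0)) (V 0) n" and ?x' = "redw s (U 0 @ V 0) x"
 have v0: "valid (st s (U 0))" by (rule valid_st[OF s])
 have one: "(\<Sum>j\<in>{1..d}. redw s w x j * cnt s w j) = 1" for w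
  using sum_weight_invariant[OF s, of w x "\<lambda>_. 1"] x1 by simp
 have \<rho>': "(\<Sum>j\<in>{1..d}. redw s (U 0 @ R) x j * act (st s (U 0)) R n j) = \<rho>" for R
  unfolding redw_append \<rho> by (rule sum_weight_invariant[OF v0])
 have pw: "positive_word (st s (U 0)) (V 0)"
  and cmp: "\<And>j \<beta>. j \<in> {1..d} \<Longrightarrow> \<beta> \<in> {1..d} \<Longrightarrow> ?q' j \<le> C * ?q \<beta>"
  using blk[OF k] unfolding mixing_block_def by blast+
 have x'0: "0 \<le> ?x' j" if "j \<in> {1..d}" for j using xpos that by blast
 \<comment> \<open>The total length after the first block is unknown but cancels: comparability
   gives 1 as a lower bound for \<open>C * ?q j\<close> times it, and positivity gives \<rho> as an
   upper bound for \<open>n j\<close> times it.\<close>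
 have bound: "n j \<le> C * \<rho> * ?q j" if a: "j \<in> {1..d}" for j
 proof -
  have n0: "0 \<le> n j" using n a by (simp add: nonneg_def)
  have q0: "1 \<le> ?q j" using act_ge[OF s, of "\<lambda>_. 1" j "U 0"] by (simp add: nonneg_def)
  have "1 = (\<Sum>\<beta>\<in>{1..d}. ?x' \<beta> * ?q' \<beta>)" by (rule one[symmetric])
  also have "\<dots> \<le> (\<Sum>\<beta>\<in>{1..d}. ?x' \<beta> * (C * ?q j))"
   using cmp[OF _ a] x'0 by (intro sum_mono mult_left_mono) auto
  finally have 1: "1 \<le> C * ?q j * (\<Sum>\<beta>\<in>{1..d}. ?x' \<beta>)" by (simp add: sum_distrib_left mult_ac)
  have "n j * (\<Sum>\<beta>\<in>{1..d}. ?x' \<beta>) = (\<Sum>\<beta>\<in>{1..d}. ?x' \<beta> * n j)" by (simp add: sum_distrib_left mult_ac)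
  also have "\<dots> \<le> (\<Sum>\<beta>\<in>{1..d}. ?x' \<beta> * ?n' \<beta>)"
   using pw n a x'0 unfolding positive_word_def by (intro sum_mono mult_left_mono) auto
  also have "\<dots> = \<rho>" by (rule \<rho>')
  finally have 2: "n j * (\<Sum>\<beta>\<in>{1..d}. ?x' \<beta>) \<le> \<rho>" .
  have "n j \<le> n j * (C * ?q j * (\<Sum>\<beta>\<in>{1..d}. ?x' \<beta>))" using mult_left_mono[OF 1 n0] by simp
  also have "\<dots> = C * ?q j * (n j * (\<Sum>\<beta>\<in>{1..d}. ?x' \<beta>))" by (simp add: mult_ac)
  also have "\<dots> \<le> C * ?q j * \<rho>" using 2 C q0 by (intro mult_left_mono) auto
  finally show ?thesis by (simp add: mult_ac)
 qed
 have \<rho>0: "0 \<le> \<rho>"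
  unfolding \<rho>'[of "V 0", symmetric] using x'0 act_nonneg[OF v0 n, of "V 0"]
  by (intro sum_nonneg mult_nonneg_nonneg) (auto simp: nonneg_def)
 from blocks_contract[where U = U and V = V and k = k and H = "C * \<rho>" and n = n, OF s C _ blk nest]
  bound n \<rho>0 C
 obtain R lo hi where R: "U k = U 0 @ R" and lohi: "lo \<le> hi" "hi - lo \<le> gap C k * (C * \<rho>)"
  and bd: "ratios lo hi (cnt s (U k)) (act (st s (U 0)) R n)" by (auto simp: nonneg_def)
 let ?x = "redw s (U k) x" and ?Q = "act s (U k) (\<lambda>_. 1 :: real)" and ?N = "act (st s (U 0)) R n"
 have x0: "0 \<le> ?x j" if "j \<in> {1..d}" for j using xpos that by blast
 have m: "(\<Sum>j\<in>{1..d}. ?x j * ?N j) = \<rho>" using \<rho>'[of R] by (simp add: R)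
 have "lo = (\<Sum>j\<in>{1..d}. ?x j * (lo * ?Q j))" using one[of "U k"] by (simp add: sum_distrib_left[symmetric] mult.left_commute)
 also have "\<dots> \<le> (\<Sum>j\<in>{1..d}. ?x j * ?N j)" using bd x0 by (intro sum_mono mult_left_mono) auto
 finally have lo: "lo \<le> \<rho>" using m by simp
 have "(\<Sum>j\<in>{1..d}. ?x j * ?N j) \<le> (\<Sum>j\<in>{1..d}. ?x j * (hi * ?Q j))" using bd x0 by (intro sum_mono mult_left_mono) auto
 also have "\<dots> = hi" using one[of "U k"] by (simp add: sum_distrib_left[symmetric] mult.left_commute)
 finally have hi: "\<rho> \<le> hi" using m by simp
 have Q0: "0 \<le> ?Q j" if "j \<in> {1..d}" for j
  using act_nonneg[OF s, of "\<lambda>_. 1" "U k"] that by (simp add: nonneg_def)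
 let ?w = "gap C k * (C * \<rho>)"
 have "(\<rho> - ?w) * ?Q j \<le> ?N j \<and> ?N j \<le> (\<rho> + ?w) * ?Q j" if a: "j \<in> {1..d}" for j
 proof -
  have "(\<rho> - ?w) * ?Q j \<le> lo * ?Q j" "hi * ?Q j \<le> (\<rho> + ?w) * ?Q j"
   using lo hi lohi Q0[OF a] by (intro mult_right_mono; linarith)+
  then show ?thesis using bd a by (meson order_trans)
 qed
 then show ?thesis using R by blast
qed

text \<open>The scales \<open>2 ^ win e m0 i\<close> of the successive blocks.\<close>

fun win :: "nat \<Rightarrow> nat \<Rightarrow> nat \<Rightarrow> nat" where
 "win e m0 0 = m0"
| "win e m0 (Suc i) = nat \<lfloor>real (win e m0 i) * (1 + 1 / real (Suc e))\<rfloor> + 1"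

lemma win_next: "2 powr (real (win e m0 i) * (1 + 1 / real (Suc e))) < 2 ^ win e m0 (Suc i)"
proof -
 have "real (win e m0 i) * (1 + 1 / real (Suc e)) < real (win e m0 (Suc i))"
  by simp linarith
 then have "2 powr (real (win e m0 i) * (1 + 1 / real (Suc e))) < 2 powr real (win e m0 (Suc i))"
  by (intro powr_less_mono) auto
 then show ?thesis by (simp only: powr_realpow zero_less_numeral)
qed

lemma win_ge: "m0 \<le> win e m0 i"
proof (induction i)
 case (Suc i)
 have "real (win e m0 i) * 1 \<le> real (win e m0 i) * (1 + 1 / real (Suc e))" by (intro mult_left_mono) auto
 then have "win e m0 i \<le> win e m0 (Suc i)" by simp linarith
 then show ?case using Suc by linarith
qed simp

text \<open>Doubling \<open>1 / Suc e\<close> absorbs the added 1, since every scale is at least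
  \<open>Suc e\<close>.\<close>

lemma win_le: "Suc e \<le> m0 \<Longrightarrow> real (win e m0 i) \<le> real m0 * (1 + 2 / real (Suc e)) ^ i"
proof (induction i)
 case (Suc i)
 let ?m = "real (win e m0 i)"
 have m: "real (Suc e) \<le> ?m" using Suc.prems win_ge[of m0 e i] by linarith
 have "real (win e m0 (Suc i)) \<le> ?m * (1 + 1 / real (Suc e)) + 1"
 proof -
  have "0 \<le> ?m * (1 + 1 / real (Suc e))" by simp
  then have "real (nat \<lfloor>?m * (1 + 1 / real (Suc e))\<rfloor>) \<le> ?m * (1 + 1 / real (Suc e))" by linarith
  then show ?thesis by simp
 qed
 also have "?m * (1 + 1 / real (Suc e)) + 1 \<le> ?m * (1 + 2 / real (Suc e))"
 proof -
  have "1 \<le> ?m * (1 / real (Suc e))" using m by (simp add: field_simps)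
  moreover have "?m * (1 + a) + 1 \<le> ?m * (1 + 2 * a)" if "1 \<le> ?m * a" for a
   using that by (simp add: algebra_simps)
  ultimately have "?m * (1 + 1 / real (Suc e)) + 1 \<le> ?m * (1 + 2 * (1 / real (Suc e)))" by blast
  then show ?thesis by simp
 qed
 also have "\<dots> \<le> (real m0 * (1 + 2 / real (Suc e)) ^ i) * (1 + 2 / real (Suc e))"
  using Suc by (intro mult_right_mono) auto
 finally show ?case by (simp add: mult_ac)
qed simp

text \<open>Three stages of the induction are combined. At \<open>U 0\<close> the levels are shorter
  than \<eta> * \<delta>, so counting levels measures the interval. The following \<open>k\<close>
  blocks make the counts per tower proportional to the heights. At \<open>U k\<close> the towers are
  still low against \<open>N\<close>, so orbit segments of length \<open>N\<close> inherit the
  frequency.\<close>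

lemma stage_equidistributed:
 assumes T: "bij_betw T {0..<1} {0..<1}" and s: "valid s" and x1: "(\<Sum>j\<in>{1..d}. x j) = 1"
  and st: "stage T s x (\<lambda>_. 1)" and C: "C \<ge> 1" and good: "good_lengths C s x"
 shows "equidistributed T"
 unfolding equidistributed_def
proof (intro allI impI)
 fix \<epsilon>' :: real assume "0 < \<epsilon>'"
 define \<epsilon> where "\<epsilon> = min \<epsilon>' 1"
 have \<epsilon>: "0 < \<epsilon>" "\<epsilon> \<le> 1" "\<epsilon> \<le> \<epsilon>'" using \<open>0 < \<epsilon>'\<close> by (auto simp: \<epsilon>_def)
 define \<eta> where "\<eta> = \<epsilon> / 16"
 have \<eta>: "0 < \<eta>" "\<eta> \<le> 1 / 16" using \<epsilon> by (auto simp: \<eta>_def)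
 have r: "0 \<le> 1 - 1 / (2 * C)" "1 - 1 / (2 * C) < 1" using C by (auto simp: field_simps)
 \<comment> \<open>The number of blocks after which the spread, including the factor
   \<open>C\<close> of the a priori bound, has fallen to \<eta>.\<close>
 obtain k0 where k0: "gap C k0 < \<eta> / C"
  using real_arch_pow_inv[of "\<eta> / C" "1 - 1 / (2 * C)"] \<eta> C r by auto
 define k where "k = Suc k0"
 have "gap C k \<le> gap C k0" using r by (simp add: k_def mult_left_le_one_le)
 then have "gap C k < \<eta> / C" using k0 by linarith
 moreover have "t * C \<le> \<eta>" if "t < \<eta> / C" for t using that C by (simp add: field_simps)
 ultimately have k: "0 < k" "gap C k * C \<le> \<eta>" by (simp_all add: k_def)
 have "(\<lambda>e. (1 + 2 / real (Suc e)) ^ Suc k) \<longlonglongrightarrow> (1 + 0) ^ Suc k"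
  by (intro tendsto_intros LIMSEQ_Suc[OF lim_const_over_n])
 then have "eventually (\<lambda>e. (1 + 2 / real (Suc e)) ^ Suc k < 1 + \<epsilon> / 4) sequentially"
  by (rule order_tendstoD(2)) (use \<epsilon> in simp)
 \<comment> \<open>With \<open>k\<close> fixed, the windows are made so narrow that
   \<open>Suc k\<close> of them multiply the exponent of the scale by less than
   \<open>1 + \<epsilon> / 4\<close>.\<close>
 then obtain e where e: "(1 + 2 / real (Suc e)) ^ Suc k < 1 + \<epsilon> / 4"
  unfolding eventually_sequentially by blast
 obtain M where M: "\<And>m. m \<ge> M \<Longrightarrow> \<exists>w. cyl s w x \<and>
   block_between C s (2 ^ m) (2 powr (real m * (1 + 1 / real (Suc e)))) w"
  using good unfolding good_lengths_def by blast
 define M0 where "M0 = max M (Suc e)"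
 \<comment> \<open>\<open>D\<close> collects the constants in the bound for
   \<open>10 / \<epsilon> * Q\<close>. The choice of \<delta>0 makes it at most
   \<open>\<delta> powr (- (3 * \<epsilon> / 4))\<close>, the room between the exponents
   \<open>1 + \<epsilon> / 4\<close> and \<open>1 + \<epsilon>\<close>.\<close>
 define D where "D = (4 * C / \<eta>) powr (1 + \<epsilon> / 4) * 10 / \<epsilon>"
 have D: "0 < D" using C \<eta> \<epsilon> by (simp add: D_def)
 define \<delta>0 where "\<delta>0 = min (1 / 2) (min (C / (\<eta> * 2 ^ M0)) ((1 / D) powr (4 / (3 * \<epsilon>))))"
 have "0 < \<delta>0" using C \<eta> D by (simp add: \<delta>0_def)
 moreover have "\<bar>visits T {u..<v} N y - real N * (v - u)\<bar> \<le> \<epsilon>' * (real N * (v - u))"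
  if h: "0 < \<delta> \<and> \<delta> < \<delta>0 \<and> 0 \<le> u \<and> v \<le> 1 \<and> \<delta> \<le> v - u \<and> \<delta> powr (- 1 - \<epsilon>') \<le> real N \<and> y \<in> {0..<1}"
  for \<delta> u v N y
 proof -
  have \<delta>: "0 < \<delta>" "\<delta> < 1" "\<delta> < C / (\<eta> * 2 ^ M0)" "\<delta> < (1 / D) powr (4 / (3 * \<epsilon>))"
   using h by (auto simp: \<delta>0_def)
  have uv: "0 \<le> u" "v \<le> 1" "\<delta> \<le> v - u" "u \<le> v" and y: "y \<in> {0..<1}" using h by auto
  have "\<delta> powr (- 1 - \<epsilon>) \<le> \<delta> powr (- 1 - \<epsilon>')" using \<delta> \<epsilon> by (intro powr_mono') auto
  then have N: "\<delta> powr (- 1 - \<epsilon>) \<le> real N" using h by linarith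
  \<comment> \<open>As the towers have area 1, heights of at least \<open>Z / C\<close> force the
    base length down to \<open>\<eta> * \<delta> / 2\<close>.\<close>
  define Z where "Z = 2 * C / (\<eta> * \<delta>)"
  have Z: "2 ^ M0 \<le> Z / 2" using \<delta> \<eta> C by (simp add: Z_def field_simps)
  have Z1: "1 \<le> Z"
  proof -
   have "(1::real) \<le> 2 ^ M0" by simp
   then show ?thesis using Z by linarith
  qed
  define m0 where "m0 = nat \<lceil>log 2 Z\<rceil>"
  have lz: "0 \<le> log 2 Z" using Z1 by simp
  have m0: "Z \<le> 2 ^ m0" "2 ^ m0 \<le> 2 * Z"
  proof -
   have "log 2 Z \<le> real m0" unfolding m0_def using lz by linarith
   then have "2 powr log 2 Z \<le> 2 powr real m0" by (intro powr_mono) auto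
   then show "Z \<le> 2 ^ m0" using Z1 by (simp add: powr_realpow)
   have "real m0 \<le> log 2 Z + 1" unfolding m0_def using lz by linarith
   then have "2 powr real m0 \<le> 2 powr (log 2 Z + 1)" by (intro powr_mono) auto
   also have "\<dots> = 2 * Z" using Z1 by (simp add: powr_add)
   finally show "2 ^ m0 \<le> 2 * Z" by (simp add: powr_realpow)
  qed
  have "(2::real) ^ M0 \<le> 2 ^ m0" using Z m0(1) Z1 by linarith
  then have mM: "M0 \<le> m0" by simp
  define m where "m i = win e m0 i" for i
  have mge: "M \<le> m i" for i using win_ge[of m0 e i] mM by (simp add: m_def M0_def)
  obtain W where W: "\<And>i. cyl s (W i) x" "\<And>i. block_between C s (2 ^ m i) (2 powr (real (m i) * (1 + 1 / real (Suc e)))) (W i)"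
   using M[OF mge] by metis
  have "\<forall>i. \<exists>U V. W i = U @ V \<and> mixing_block C s (\<lambda>_. 1) U V \<and> (\<exists>j\<in>{1..d}. 2 ^ m i \<le> act s U (\<lambda>_. 1 :: real) j)
    \<and> (\<forall>j\<in>{1..d}. cnt s (W i) j \<le> 2 powr (real (m i) * (1 + 1 / real (Suc e))))"
   using W(2) unfolding block_between_def by blast
  then obtain U V where UV: "\<And>i. W i = U i @ V i" "\<And>i. mixing_block C s (\<lambda>_. 1) (U i) (V i)"
   "\<And>i. \<exists>j\<in>{1..d}. 2 ^ m i \<le> act s (U i) (\<lambda>_. 1 :: real) j"
   and up: "\<And>i j. j \<in> {1..d} \<Longrightarrow> cnt s (W i) j \<le> 2 powr (real (m i) * (1 + 1 / real (Suc e)))"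
   by metis
  have cU: "cyl s (U i) x" for i using W(1)[of i] unfolding UV(1) cyl_append by blast
  have lt: "cnt s (W i) j < (2 :: real) ^ m (Suc i)" if "j \<in> {1..d}" for i j
   using up[OF that, of i] win_next[of e m0 i] by (simp add: m_def del: win.simps)
  have nn1: "nonneg (\<lambda>_. 1)" by (simp add: nonneg_def)
  \<comment> \<open>At the end of \<open>W i\<close> no height has reached
    \<open>2 ^ m (Suc i)\<close>, whereas at the end of \<open>U (Suc i)\<close> one has. Both lie
    on one path, so the latter comes later.\<close>
  have nest: "\<exists>G. U (Suc i) = U i @ V i @ G" for i
  proof -
   have "length (W i) \<le> length (U (Suc i))"
   proof (rule ccontr)
    assume "\<not> ?thesis"
    then have "length (U (Suc i)) \<le> length (W i)" by simp
    then obtain R where R: "W i = U (Suc i) @ R" using cyl_prefix[OF cU W(1)] by blast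
    obtain j where a: "j \<in> {1..d}" "2 ^ m (Suc i) \<le> act s (U (Suc i)) (\<lambda>_. 1 :: real) j" using UV(3) by blast
    have "act s (U (Suc i)) (\<lambda>_. 1 :: real) j \<le> cnt s (W i) j"
     unfolding R act_append by (rule act_ge[OF valid_st[OF s] act_nonneg[OF s nn1]])
    then show False using a lt[OF a(1), of i] by linarith
   qed
   then show ?thesis using cyl_prefix[OF W(1) cU] unfolding UV(1) by fastforce
  qed
  define Q where "Q = (2::real) ^ m (Suc k)"
  have Qb: "cnt s (U k) j \<le> Q" if "j \<in> {1..d}" for j
  proof -
   have "act s (U k) (\<lambda>_. 1 :: real) j \<le> cnt s (W k) j"
    unfolding UV(1) act_append by (rule act_ge[OF valid_st[OF s] act_nonneg[OF s nn1]])
   then show ?thesis using lt[OF that, of k] by (simp add: Q_def)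
  qed
  have QN: "10 / \<epsilon> * Q \<le> real N"
  proof -
   have "real (m (Suc k)) \<le> real m0 * (1 + 2 / real (Suc e)) ^ Suc k"
    unfolding m_def by (rule win_le) (use mM in \<open>simp add: M0_def\<close>)
   also have "\<dots> \<le> real m0 * (1 + \<epsilon> / 4)" using e by (intro mult_left_mono) auto
   finally have "Q \<le> 2 powr (real m0 * (1 + \<epsilon> / 4))"
    unfolding Q_def by (subst powr_realpow[symmetric]) (auto intro: powr_mono)
   also have "\<dots> = (2 ^ m0) powr (1 + \<epsilon> / 4)" by (simp add: powr_powr[symmetric] powr_realpow)
   also have "\<dots> \<le> (2 * Z) powr (1 + \<epsilon> / 4)" using m0 \<epsilon> by (intro powr_mono2) auto
   also have "2 * Z = (4 * C / \<eta>) * (1 / \<delta>)" by (simp add: Z_def)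
   also have "((4 * C / \<eta>) * (1 / \<delta>)) powr (1 + \<epsilon> / 4) = (4 * C / \<eta>) powr (1 + \<epsilon> / 4) * \<delta> powr (- 1 - \<epsilon> / 4)"
    using C \<eta> \<delta> by (subst powr_mult) (auto simp: powr_divide powr_minus_divide[symmetric])
   finally have "10 / \<epsilon> * Q \<le> 10 / \<epsilon> * ((4 * C / \<eta>) powr (1 + \<epsilon> / 4) * \<delta> powr (- 1 - \<epsilon> / 4))"
    using \<epsilon> by (intro mult_left_mono) auto
   also have "\<dots> = D * \<delta> powr (- 1 - \<epsilon> / 4)" by (simp add: D_def)
   also have "\<dots> \<le> \<delta> powr (- (3 * \<epsilon> / 4)) * \<delta> powr (- 1 - \<epsilon> / 4)"
   proof (intro mult_right_mono)
    have "\<delta> powr (3 * \<epsilon> / 4) \<le> ((1 / D) powr (4 / (3 * \<epsilon>))) powr (3 * \<epsilon> / 4)"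
     using \<delta> \<epsilon> by (intro powr_mono2) auto
    also have "\<dots> = 1 / D" using \<epsilon> D by (simp add: powr_powr)
    finally have "D * \<delta> powr (3 * \<epsilon> / 4) \<le> 1" using D by (simp add: field_simps)
    then show "D \<le> \<delta> powr (- (3 * \<epsilon> / 4))" using \<delta> by (simp add: powr_minus field_simps)
   qed auto
   also have "\<dots> = \<delta> powr (- 1 - \<epsilon>)"
    unfolding powr_add[symmetric] by (rule arg_cong[where f = "\<lambda>t. \<delta> powr t"]) simp
   finally show ?thesis using N by linarith
  qed
  have posw: "0 < redw s w x j" if "cyl s w x" "j \<in> {1..d}" for w j
   using stage_pos[OF valid_st[OF s] stage_word[OF s st that(1)] that(2)] by blast
  have one: "(\<Sum>j\<in>{1..d}. redw s w x j * cnt s w j) = 1" for w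
   using sum_weight_invariant[OF s, of w x "\<lambda>_. 1"] x1 by simp
  let ?s0 = "st s (U 0)" and ?x0 = "redw s (U 0) x" and ?h0 = "act s (U 0) (\<lambda>_. 1 :: nat)"
  have v0: "valid ?s0" and st0: "stage T ?s0 ?x0 ?h0"
   using valid_st[OF s] stage_word[OF s st cU] by auto
  define l where "l = len (fst ?s0) ?x0"
  have l: "l = (\<Sum>j\<in>{1..d}. ?x0 j)" unfolding l_def by (rule stage_len[OF v0])
  have lsmall: "l \<le> \<eta> * \<delta> / 2"
  proof -
   obtain j where a: "j \<in> {1..d}" "2 ^ m0 \<le> act s (U 0) (\<lambda>_. 1 :: real) j" using UV(3)[of 0] by (auto simp: m_def)
   have "2 ^ m0 / C \<le> act s (U 0) (\<lambda>_. 1 :: real) \<beta>" if b: "\<beta> \<in> {1..d}" for \<beta>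
   proof -
    have "act s (U 0) (\<lambda>_. 1 :: real) j \<le> cnt s (U 0 @ V 0) j"
     unfolding act_append by (rule act_ge[OF v0 act_nonneg[OF s nn1]])
    also have "\<dots> \<le> C * cnt s (U 0) \<beta>" using UV(2)[of 0] a b unfolding mixing_block_def by blast
    finally show ?thesis using a(2) C by (simp add: field_simps)
   qed
   then have "(\<Sum>\<beta>\<in>{1..d}. ?x0 \<beta> * (2 ^ m0 / C)) \<le> (\<Sum>\<beta>\<in>{1..d}. ?x0 \<beta> * cnt s (U 0) \<beta>)"
    using posw[OF cU] by (intro sum_mono mult_left_mono) (auto intro: less_imp_le)
   then have "l * (2 ^ m0 / C) \<le> 1" unfolding one l sum_distrib_right .
   moreover have l0: "0 \<le> l" unfolding l using posw[OF cU] by (intro sum_nonneg) (auto intro: less_imp_le)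
   then have "l * (Z / C) \<le> l * (2 ^ m0 / C)" using m0 C by (intro mult_left_mono divide_right_mono) auto
   ultimately have "l * (Z / C) \<le> 1" by linarith
   moreover have "Z / C = 2 / (\<eta> * \<delta>)" using C by (simp add: Z_def)
   ultimately show ?thesis using \<eta> \<delta> by (simp add: field_simps)
  qed
  have l1: "l \<le> 1"
  proof -
   have "\<eta> * \<delta> \<le> 1 * 1" using \<eta> \<delta> by (intro mult_mono) auto
   then show ?thesis using lsmall by linarith
  qed
  define p where "p j = real (card (lev_meet T ?s0 ?x0 ?h0 {u..<v} j))" for j
  define q where "q j = real (card (lev_in T ?s0 ?x0 ?h0 {u..<v} j))" for j
  define P where "P = (\<Sum>j\<in>{1..d}. ?x0 j * p j)"
  define R where "R = (\<Sum>j\<in>{1..d}. ?x0 j * q j)"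
  let ?J = "v - u"
  have Pb: "P \<le> (1 + \<eta>) * ?J"
  proof -
   have "P \<le> ?J + 2 * l" unfolding P_def p_def l_def
    by (rule lev_meet_measure[OF T v0 st0]) (use l1 uv in \<open>auto simp: l_def\<close>)
   also have "\<dots> \<le> ?J + \<eta> * ?J" using lsmall mult_left_mono[OF uv(3) less_imp_le[OF \<eta>(1)]] by linarith
   finally show ?thesis by (simp add: algebra_simps)
  qed
  have Rb: "(1 - \<eta>) * ?J \<le> R"
  proof -
   have "?J - 2 * l \<le> R" unfolding R_def q_def l_def
    by (rule lev_in_measure[OF v0 st0]) (use uv in auto)
   moreover have "?J - \<eta> * ?J \<le> ?J - 2 * l" using lsmall mult_left_mono[OF uv(3) less_imp_le[OF \<eta>(1)]] by linarith
   ultimately show ?thesis by (simp add: algebra_simps)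
  qed
  have P0: "0 \<le> P" "0 \<le> R" unfolding P_def R_def p_def q_def
   using posw[OF cU] by (auto intro!: sum_nonneg mult_nonneg_nonneg intro: less_imp_le)
  have cW: "cyl s (U 0 @ V 0) x" using W(1)[of 0] UV(1) by simp
  have pos2: "0 \<le> redw s w x j" if "w \<in> {U 0 @ V 0, U k}" "j \<in> {1..d}" for w j
   using that posw cW cU by (auto intro: less_imp_le)
  have kk: "gap C k * (C * t) \<le> \<eta> * t" if "0 \<le> t" for t
   using mult_right_mono[OF k(2) that] by (simp add: mult.assoc)
  obtain G where G: "U k = U 0 @ G" and Gp: "\<forall>j\<in>{1..d}. act ?s0 G p j \<le> (P + gap C k * (C * P)) * cnt s (U k) j"
   using ratio_near_mean[where U = U and V = V and n = p and k = k, OF s C k(1) UV(2) nest _ pos2 x1 P_def]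
   by (auto simp: nonneg_def p_def)
  obtain G' where G': "U k = U 0 @ G'" and Gq: "\<forall>j\<in>{1..d}. (R - gap C k * (C * R)) * cnt s (U k) j \<le> act ?s0 G' q j"
   using ratio_near_mean[where U = U and V = V and n = q and k = k, OF s C k(1) UV(2) nest _ pos2 x1 R_def]
   by (auto simp: nonneg_def q_def)
  have GG: "G' = G" using G G' by simp
  have cG: "cyl ?s0 G ?x0" using cU[of k] unfolding G cyl_append by blast
  define lo where "lo = (1 - \<eta>) * ((1 - \<eta>) * ?J)"
  define hi where "hi = (1 + \<eta>) * ((1 + \<eta>) * ?J)"
  have lohi: "0 \<le> lo" "0 \<le> hi" using \<eta> uv by (auto simp: lo_def hi_def)
  let ?sk = "st s (U k)" and ?xk = "redw s (U k) x" and ?hk = "act s (U k) (\<lambda>_. 1 :: nat)"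
  have hk: "real (?hk j) = cnt s (U k) j" for j
   using act_of_nat[of s "U k" "\<lambda>_. 1"] by (simp add: fun_eq_iff)
  have ek: "?sk = st ?s0 G" "?xk = redw ?s0 G ?x0" "?hk = act ?s0 G ?h0"
   by (simp_all add: G st_append redw_append act_append)
  have ub: "\<forall>j\<in>{1..d}. \<forall>y\<in>ivl (fst ?sk) ?xk j. visits T {u..<v} (?hk j) y \<le> act ?s0 G p j"
   unfolding ek
   by (rule additive_bound[where S = "visits T {u..<v}" and T = T, OF visits_add v0 st0 cG],
     unfold p_def, intro ballI, rule visits_lev(2))
  have lb: "\<forall>j\<in>{1..d}. \<forall>y\<in>ivl (fst ?sk) ?xk j. act ?s0 G q j \<le> visits T {u..<v} (?hk j) y"
   unfolding ek
   by (rule additive_bound_below[where S = "visits T {u..<v}" and T = T, OF visits_add v0 st0 cG],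
     unfold q_def, intro ballI, rule visits_lev(1))
  have h0: "0 \<le> real (?hk j)" for j by simp
  have b: "\<forall>j\<in>{1..d}. \<forall>y\<in>ivl (fst ?sk) ?xk j. lo * real (?hk j) \<le> visits T {u..<v} (?hk j) y \<and>
    visits T {u..<v} (?hk j) y \<le> hi * real (?hk j)"
  proof (intro ballI conjI)
   fix j y assume a: "j \<in> {1..d}" and yy: "y \<in> ivl (fst ?sk) ?xk j"
   have "P + gap C k * (C * P) \<le> (1 + \<eta>) * P" using kk[OF P0(1)] by (simp add: algebra_simps)
   also have "\<dots> \<le> hi" unfolding hi_def using Pb \<eta> by (intro mult_left_mono) auto
   finally have "(P + gap C k * (C * P)) * real (?hk j) \<le> hi * real (?hk j)"
    by (intro mult_right_mono h0)
   then show "visits T {u..<v} (?hk j) y \<le> hi * real (?hk j)"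
    using ub Gp a yy unfolding hk by (meson order_trans)
   have "lo \<le> (1 - \<eta>) * R" unfolding lo_def using Rb \<eta> by (intro mult_left_mono) auto
   also have "\<dots> \<le> R - gap C k * (C * R)" using kk[OF P0(2)] by (simp add: algebra_simps)
   finally have "lo * real (?hk j) \<le> (R - gap C k * (C * R)) * real (?hk j)"
    by (intro mult_right_mono h0)
   then show "lo * real (?hk j) \<le> visits T {u..<v} (?hk j) y"
    using lb Gq a yy unfolding hk GG by (meson order_trans)
  qed
  have Qh: "\<forall>j\<in>{1..d}. real (?hk j) \<le> Q" using Qb unfolding hk by blast
  have stk: "stage T ?sk ?xk ?hk" by (rule stage_word[OF s st cU])
  note orbit = tower_to_orbit[where S = "visits T {u..<v}" and T = T, OF visits_add visits_nonneg valid_st[OF s] stk Qh lohi b y, of N]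
  have QN': "Q \<le> \<epsilon> / 10 * real N" using QN \<epsilon> by (simp add: field_simps)
  have NJ: "0 \<le> real N * ?J" using uv by simp
  have "visits T {u..<v} N y \<le> hi * (real N + 2 * Q)" by (rule orbit(1))
  also have "\<dots> \<le> hi * (real N + 2 * (\<epsilon> / 10 * real N))" using QN' lohi by (intro mult_left_mono) auto
  also have "\<dots> = (1 + \<eta>) * (1 + \<eta>) * (1 + \<epsilon> / 5) * (real N * ?J)" by (simp add: hi_def field_simps)
  also have "\<dots> \<le> (1 + \<epsilon>) * (real N * ?J)"
  proof (intro mult_right_mono NJ)
   have "(1 + \<eta>) * (1 + \<eta>) \<le> 1 + 3 * \<eta>" using \<eta> mult_left_mono[of \<eta> 1 \<eta>] by (simp add: algebra_simps)
   then have "(1 + \<eta>) * (1 + \<eta>) * (1 + \<epsilon> / 5) \<le> (1 + 3 * \<eta>) * (1 + \<epsilon> / 5)" using \<epsilon> by (intro mult_right_mono) auto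
   also have "(1 + 3 * \<eta>) * (1 + \<epsilon> / 5) = 1 + 3 * \<epsilon> / 16 + \<epsilon> / 5 + 3 * (\<epsilon> * \<epsilon>) / 80"
    by (simp add: \<eta>_def field_simps)
   also have "\<dots> \<le> 1 + \<epsilon>" using \<epsilon> mult_left_le_one_le[of \<epsilon> \<epsilon>] by linarith
   finally show "(1 + \<eta>) * (1 + \<eta>) * (1 + \<epsilon> / 5) \<le> 1 + \<epsilon>" .
  qed
  finally have 1: "visits T {u..<v} N y \<le> (1 + \<epsilon>) * (real N * ?J)" .
  have "lo * (real N - Q) - hi * Q \<le> visits T {u..<v} N y" by (rule orbit(2))
  moreover have "lo * (real N - \<epsilon> / 10 * real N) \<le> lo * (real N - Q)" using QN' lohi by (intro mult_left_mono) auto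
  moreover have "hi * Q \<le> hi * (\<epsilon> / 10 * real N)" using QN' lohi by (intro mult_left_mono) auto
  ultimately have "lo * (real N - \<epsilon> / 10 * real N) - hi * (\<epsilon> / 10 * real N) \<le> visits T {u..<v} N y" by linarith
  moreover have "lo * (real N - \<epsilon> / 10 * real N) - hi * (\<epsilon> / 10 * real N) =
    ((1 - \<eta>) * (1 - \<eta>) * (1 - \<epsilon> / 10) - (1 + \<eta>) * (1 + \<eta>) * (\<epsilon> / 10)) * (real N * ?J)"
   by (simp add: lo_def hi_def field_simps)
  moreover have "(1 - \<epsilon>) * (real N * ?J) \<le> ((1 - \<eta>) * (1 - \<eta>) * (1 - \<epsilon> / 10) - (1 + \<eta>) * (1 + \<eta>) * (\<epsilon> / 10)) * (real N * ?J)"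
  proof (intro mult_right_mono NJ)
   have "1 - 2 * \<eta> \<le> (1 - \<eta>) * (1 - \<eta>)" by (simp add: algebra_simps)
   then have "(1 - 2 * \<eta>) * (1 - \<epsilon> / 10) \<le> (1 - \<eta>) * (1 - \<eta>) * (1 - \<epsilon> / 10)" using \<epsilon> by (intro mult_right_mono) auto
   moreover have "1 - 2 * \<eta> - \<epsilon> / 10 \<le> (1 - 2 * \<eta>) * (1 - \<epsilon> / 10)" using \<eta> \<epsilon> by (simp add: algebra_simps)
   moreover have "(1 + \<eta>) * (1 + \<eta>) \<le> 1 + 3 * \<eta>" using \<eta> mult_left_mono[of \<eta> 1 \<eta>] by (simp add: algebra_simps)
   then have "(1 + \<eta>) * (1 + \<eta>) \<le> 2" using \<eta> by linarith
   then have "(1 + \<eta>) * (1 + \<eta>) * (\<epsilon> / 10) \<le> 2 * (\<epsilon> / 10)" using \<epsilon> by (intro mult_right_mono) auto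
   moreover have "1 - \<epsilon> \<le> 1 - 2 * \<eta> - \<epsilon> / 10 - 2 * (\<epsilon> / 10)" using \<epsilon> by (simp add: \<eta>_def)
   ultimately show "1 - \<epsilon> \<le> (1 - \<eta>) * (1 - \<eta>) * (1 - \<epsilon> / 10) - (1 + \<eta>) * (1 + \<eta>) * (\<epsilon> / 10)" by linarith
  qed
  ultimately have 2: "(1 - \<epsilon>) * (real N * ?J) \<le> visits T {u..<v} N y" by linarith
  have "\<bar>visits T {u..<v} N y - real N * ?J\<bar> \<le> \<epsilon> * (real N * ?J)"
   using 1 2 by (simp add: abs_le_iff algebra_simps)
  also have "\<dots> \<le> \<epsilon>' * (real N * ?J)" using \<epsilon> NJ by (intro mult_right_mono) auto
  finally show ?thesis .
 qed
 ultimately show "\<exists>\<delta>0>0. \<forall>\<delta> u v N y.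
   0 < \<delta> \<and> \<delta> < \<delta>0 \<and> 0 \<le> u \<and> v \<le> 1 \<and> \<delta> \<le> v - u \<and> \<delta> powr (- 1 - \<epsilon>') \<le> real N \<and> y \<in> {0..<1} \<longrightarrow>
   \<bar>visits T {u..<v} N y - real N * (v - u)\<bar> \<le> \<epsilon>' * (real N * (v - u))" by blast
qed

end

section \<open>Interval exchange transformations as stages\<close>

abbreviation unit_leb :: "real measure" where
 "unit_leb \<equiv> restrict_space lborel {0..<1}"

text \<open>The second row lists the letters in the order in which their images stand, whence the
  inverse.\<close>

definition iet_rows :: "nat \<Rightarrow> (nat \<Rightarrow> nat) \<Rightarrow> rows" where
 "iet_rows d \<pi> = ([1..<Suc d], map (inv \<pi>) [1..<Suc d])"

lemma lft_upt: "a \<le> j \<Longrightarrow> j < b \<Longrightarrow> lft [a..<b] x j = (\<Sum>i\<in>{a..<j}. x i)"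
proof (induction "b - a" arbitrary: a)
 case (Suc k)
 then have e: "[a..<b] = a # [Suc a..<b]" by (simp add: upt_conv_Cons)
 show ?case
 proof (cases "a = j")
  case False
  then have "lft [Suc a..<b] x j = (\<Sum>i\<in>{Suc a..<j}. x i)" using Suc by (intro Suc.hyps) auto
  then show ?thesis using False Suc.prems by (simp add: e sum.atLeast_Suc_lessThan)
 next
  case True
  then show ?thesis unfolding e by simp
 qed
qed simp

lemma lft_map: "inj_on g (insert j (set xs)) \<Longrightarrow> lft (map g xs) x (g j) = lft xs (x \<circ> g) j"
 by (induction xs) (auto simp: inj_on_def)

context rauzy
begin

lemma valid_iet_rows:
 assumes \<pi>: "\<pi> permutes {1..d}" and irr: "irreducible_perm d \<pi>"
 shows "valid (iet_rows d \<pi>)"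
proof -
 have inj: "inj (inv \<pi>)" using permutes_inj[OF permutes_inv[OF \<pi>]] .
 have im: "inv \<pi> ` {1..d} = {1..d}" using permutes_image[OF permutes_inv[OF \<pi>]] .
 have tk: "take k [1..<Suc d] = [1..<Suc k]" if "k < d" for k using that by simp
 have "set (take k [1..<Suc d]) \<noteq> set (take k (map (inv \<pi>) [1..<Suc d]))" if k: "0 < k" "k < d" for k
 proof
  assume eq: "set (take k [1..<Suc d]) = set (take k (map (inv \<pi>) [1..<Suc d]))"
  have s: "{1..<Suc k} = {1..k}" by auto
  have "{1..k} = inv \<pi> ` {1..k}" using eq unfolding take_map tk[OF k(2)] by (simp only: set_map set_upt s)
  then have "\<pi> ` {1..k} = \<pi> ` inv \<pi> ` {1..k}" by simp
  also have "\<dots> = {1..k}" using permutes_inverses(1)[OF \<pi>] by (simp add: image_image)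
  finally have "k = d" using irr k unfolding irreducible_perm_def by auto
  then show False using k by simp
 qed
 moreover have "{1..<Suc d} = {1..d}" by auto
 ultimately show ?thesis
  using im inj_on_subset[OF inj] unfolding valid_rows_def iet_rows_def
  by (simp add: distinct_map del: upt_Suc)
qed

lemma stage_iet:
 assumes \<pi>: "\<pi> permutes {1..d}" and l: "l \<in> length_simplex d"
 shows "stage (iet d l \<pi>) (iet_rows d \<pi>) l (\<lambda>_. 1)"
proof -
 have pos: "\<And>i. i \<in> {1..d} \<Longrightarrow> l i > 0" and one: "(\<Sum>i\<in>{1..d}. l i) = 1"
  using l by (auto simp: length_simplex_def)
 let ?s = "iet_rows d \<pi>"
 have set1: "set (fst ?s) = {1..d}" by (auto simp: iet_rows_def)
 have lt: "lft (fst ?s) l j = iet_left l j" if "j \<in> {1..d}" for j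
  using that lft_upt[of 1 j "Suc d" l] by (simp add: iet_rows_def iet_left_def del: upt_Suc)
 have iv: "ivl (fst ?s) l j = iet_interval l j" if "j \<in> {1..d}" for j
  using lt[OF that] by (simp add: ivl_def iet_interval_def)
 have inj: "inj (inv \<pi>)" using permutes_inj[OF permutes_inv[OF \<pi>]] .
 have lb: "lft (snd ?s) l j = iet_image_left d l \<pi> j" if a: "j \<in> {1..d}" for j
 proof -
  have p: "\<pi> j \<in> {1..d}" using permutes_in_image[OF \<pi>] a by simp
  have "lft (snd ?s) l (inv \<pi> (\<pi> j)) = lft [1..<Suc d] (l \<circ> inv \<pi>) (\<pi> j)"
   unfolding iet_rows_def snd_conv by (rule lft_map) (rule inj_on_subset[OF inj], simp)
  also have "\<dots> = iet_left (l \<circ> inv \<pi>) (\<pi> j)"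
   using p lft_upt[of 1 "\<pi> j" "Suc d" "l \<circ> inv \<pi>"] by (simp add: iet_left_def del: upt_Suc)
  finally show ?thesis using iet_image_left_eq[OF \<pi> a] permutes_inverses(2)[OF \<pi>] by simp
 qed
 show ?thesis
  unfolding stage_def set1
 proof (intro conjI ballI allI impI)
  fix j y assume a: "j \<in> {1..d}" and y: "y \<in> ivl (fst ?s) l j"
  show "(iet d l \<pi> ^^ 1) y = y - lft (fst ?s) l j + lft (snd ?s) l j"
   using iet_apply[OF l a, of y] y iv[OF a] lt[OF a] lb[OF a] by simp
 next
  fix j k assume "k < (1::nat)"
  then show "\<exists>c. \<forall>y\<in>ivl (fst ?s) l j. (iet d l \<pi> ^^ k) y = y + c" by (intro exI[of _ 0]) simp
 next
  fix y :: real assume "y \<in> {0..<1}"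
  then obtain j where "j \<in> {1..d}" "y \<in> iet_interval l j"
   using iet_partition[of d l y] pos one by auto
  then show "\<exists>j\<in>{1..d}. \<exists>z\<in>ivl (fst ?s) l j. \<exists>k<1. y = (iet d l \<pi> ^^ k) z" using iv by auto
 qed (use pos in auto)
qed

lemma unit_stage_apply:
 assumes s: "valid s" and st: "stage T s x (\<lambda>_. 1)" and a: "j \<in> {1..d}" and y: "y \<in> ivl (fst s) x j"
 shows "T y = y - lft (fst s) x j + lft (snd s) x j" "T y \<in> ivl (snd s) x j"
proof -
 have "(T ^^ 1) y = y - lft (fst s) x j + lft (snd s) x j"
  using st a y set_fst[OF s] unfolding stage_def by simp
 then show "T y = y - lft (fst s) x j + lft (snd s) x j" by simp
 then show "T y \<in> ivl (snd s) x j" using y by (simp add: ivl_def)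
qed

lemma row_partition:
 assumes "distinct t" "set t = {1..d}" "\<forall>j\<in>{1..d}. 0 < x j" "(\<Sum>j\<in>{1..d}. x j) = 1" "y \<in> {0..<1::real}"
 shows "\<exists>!j. j \<in> {1..d} \<and> y \<in> ivl t x j"
proof -
 have "len t x = 1" using len_eq_sum[OF assms(1), of x] assms by simp
 then obtain j where "j \<in> {1..d}" "y \<in> ivl t x j" using ivl_cover[of t x y] assms by auto
 then show ?thesis using ivl_unique[of t x] assms by (metis (no_types, lifting))
qed

lemma row_subset:
 assumes "distinct t" "set t = {1..d}" "\<forall>j\<in>{1..d}. 0 < x j" "(\<Sum>j\<in>{1..d}. x j) = 1" "j \<in> {1..d}"
 shows "ivl t x j \<subseteq> {0..<1}"
 using ivl_subset[of t x j] len_eq_sum[OF assms(1), of x] assms by simp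

lemma sum_indicator_partition:
 assumes "\<exists>!j. j \<in> {1..d} \<and> y \<in> A j" "\<beta> \<in> {1..d}" "y \<in> A \<beta>"
 shows "(\<Sum>j\<in>{1..d}. indicator (A j) y * (f j :: 'b::semiring_1)) = f \<beta>"
proof -
 have "(\<Sum>j\<in>{1..d}. indicator (A j) y * f j) = (\<Sum>j\<in>{1..d}. if j = \<beta> then f \<beta> else 0)"
  using assms by (intro sum.cong) (auto simp: indicator_def)
 then show ?thesis using assms(2) by simp
qed

text \<open>\<open>T\<close> translates the pieces of the first row onto those of the second, so
  \<open>T\<close> and its inverse are finite sums of translated pieces, and measure is compared
  piece by piece.\<close>

lemma unit_stage_measure:
 assumes s: "valid s" and st: "stage T s x (\<lambda>_. 1)" and x1: "(\<Sum>j\<in>{1..d}. x j) = 1"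
  and bij: "bij_betw T {0..<1} {0..<1}"
 shows "T \<in> unit_leb \<rightarrow>\<^sub>M unit_leb" "inv_into {0..<1} T \<in> unit_leb \<rightarrow>\<^sub>M unit_leb" "distr unit_leb unit_leb T = unit_leb"
proof -
 have pos: "\<forall>j\<in>{1..d}. 0 < x j" using stage_pos[OF s st] by blast
 have t: "distinct (fst s)" "set (fst s) = {1..d}" and b: "distinct (snd s)" "set (snd s) = {1..d}"
  using s by (auto simp: valid_rows_def)
 note pt = row_partition[OF t pos x1] and pb = row_partition[OF b pos x1]
 define c where "c j = lft (snd s) x j - lft (fst s) x j" for j
 have Tc: "T y = y + c j" if "j \<in> {1..d}" "y \<in> ivl (fst s) x j" for j y
  using unit_stage_apply(1)[OF s st that] by (simp add: c_def)
 have shift: "y \<in> ivl (fst s) x j \<longleftrightarrow> y + c j \<in> ivl (snd s) x j" for y j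
  by (auto simp: ivl_def c_def)
 have ivm: "ivl r x j \<in> sets borel" for r j by (simp add: ivl_def)
 have Tsum: "T y = (\<Sum>j\<in>{1..d}. indicator (ivl (fst s) x j) y * (y + c j))" if y: "y \<in> {0..<1}" for y
 proof -
  obtain j where a: "j \<in> {1..d}" "y \<in> ivl (fst s) x j" using pt[OF y] by blast
  show ?thesis using sum_indicator_partition[OF pt[OF y] a, of "\<lambda>j. y + c j"] Tc[OF a] by simp
 qed
 have Tin: "T y \<in> {0..<1}" if "y \<in> {0..<1}" for y using bij that by (auto dest: bij_betwE)
 have Iin: "inv_into {0..<1} T y \<in> {0..<1}" if "y \<in> {0..<1}" for y
  using bij that by (metis bij_betw_imp_surj_on inv_into_into)
 have Isum: "inv_into {0..<1} T y = (\<Sum>j\<in>{1..d}. indicator (ivl (snd s) x j) y * (y - c j))" if y: "y \<in> {0..<1}" for y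
 proof -
  obtain j where a: "j \<in> {1..d}" "y \<in> ivl (snd s) x j" using pb[OF y] by blast
  have z: "y - c j \<in> ivl (fst s) x j" using shift[of "y - c j" j] a by simp
  then have "y - c j \<in> {0..<1}" using row_subset[OF t pos x1 a(1)] by blast
  moreover have "T (y - c j) = y" using Tc[OF a(1) z] by simp
  ultimately have "inv_into {0..<1} T y = y - c j" using bij by (metis bij_betw_def inv_into_f_f)
  then show ?thesis using sum_indicator_partition[OF pb[OF y] a, of "\<lambda>j. y - c j"] by simp
 qed
 have sp: "space unit_leb = {0..<1}" by (simp add: space_restrict_space)
 have "(\<lambda>y. \<Sum>j\<in>{1..d}. indicator (ivl (fst s) x j) y * (y + c j)) \<in> borel_measurable borel"
  using ivm by (intro borel_measurable_sum borel_measurable_times borel_measurable_indicator) auto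
 then have "(\<lambda>y. \<Sum>j\<in>{1..d}. indicator (ivl (fst s) x j) y * (y + c j)) \<in> borel_measurable unit_leb"
  by (intro measurable_restrict_space1) simp
 then have "T \<in> borel_measurable unit_leb" by (rule measurable_cong[THEN iffD2, rotated]) (use Tsum sp in auto)
 then show T: "T \<in> unit_leb \<rightarrow>\<^sub>M unit_leb"
  by (intro measurable_restrict_space2) (use Tin sp in auto)
 have "(\<lambda>y. \<Sum>j\<in>{1..d}. indicator (ivl (snd s) x j) y * (y - c j)) \<in> borel_measurable borel"
  using ivm by (intro borel_measurable_sum borel_measurable_times borel_measurable_indicator) auto
 then have "(\<lambda>y. \<Sum>j\<in>{1..d}. indicator (ivl (snd s) x j) y * (y - c j)) \<in> borel_measurable unit_leb"
  by (intro measurable_restrict_space1) simp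
 then have "inv_into {0..<1} T \<in> borel_measurable unit_leb" by (rule measurable_cong[THEN iffD2, rotated]) (use Isum sp in auto)
 then show "inv_into {0..<1} T \<in> unit_leb \<rightarrow>\<^sub>M unit_leb"
  by (intro measurable_restrict_space2) (use Iin sp in auto)
 show "distr unit_leb unit_leb T = unit_leb"
 proof (rule measure_eqI)
  fix E assume "E \<in> sets (distr unit_leb unit_leb T)"
  then have E: "E \<in> sets unit_leb" by simp
  then have Eb: "E \<in> sets borel" "E \<subseteq> {0..<1}" by (auto simp: sets_restrict_space_iff)
  have "emeasure (distr unit_leb unit_leb T) E = (\<integral>\<^sup>+y. indicator E (T y) \<partial>unit_leb)"
   using T E by (simp add: emeasure_distr nn_integral_distr[symmetric, of T unit_leb unit_leb "indicator E"]
     flip: nn_integral_indicator[of E "distr unit_leb unit_leb T"])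
  also have "\<dots> = (\<integral>\<^sup>+y. indicator E (T y) * indicator {0..<1} y \<partial>lborel)"
   by (subst nn_integral_restrict_space) auto
  also have "\<dots> = (\<integral>\<^sup>+y. (\<Sum>j\<in>{1..d}. indicator (ivl (fst s) x j) y * indicator E (y + c j)) \<partial>lborel)"
  proof (rule nn_integral_cong)
   fix y :: real
   show "indicator E (T y) * indicator {0..<1} y =
     (\<Sum>j\<in>{1..d}. indicator (ivl (fst s) x j) y * (indicator E (y + c j) :: ennreal))"
   proof (cases "y \<in> {0..<1}")
    case True
    then obtain j where a: "j \<in> {1..d}" "y \<in> ivl (fst s) x j" using pt by blast
    show ?thesis using sum_indicator_partition[OF pt[OF True] a, of "\<lambda>j. indicator E (y + c j) :: ennreal"] Tc[OF a] True by simp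
   next
    case False
    then have "y \<notin> ivl (fst s) x j" if "j \<in> {1..d}" for j using row_subset[OF t pos x1 that] by blast
    then have "(\<Sum>j\<in>{1..d}. indicator (ivl (fst s) x j) y * (indicator E (y + c j) :: ennreal)) = 0"
     by (intro sum.neutral) auto
    then show ?thesis using False by simp
   qed
  qed
  also have "\<dots> = (\<Sum>j\<in>{1..d}. \<integral>\<^sup>+y. indicator (ivl (fst s) x j) y * indicator E (y + c j) \<partial>lborel)"
  proof (rule nn_integral_sum)
   fix j
   have "(\<lambda>y. indicator E (y + c j) :: ennreal) \<in> borel_measurable borel"
    using measurable_compose[of "\<lambda>y. y + c j" borel borel "indicator E :: real \<Rightarrow> ennreal"] Eb by simp
   then show "(\<lambda>y. indicator (ivl (fst s) x j) y * indicator E (y + c j) :: ennreal) \<in> borel_measurable lborel"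
    using ivm by simp
  qed
  also have "\<dots> = (\<Sum>j\<in>{1..d}. \<integral>\<^sup>+y. indicator (ivl (snd s) x j) y * indicator E y \<partial>lborel)"
  proof (rule sum.cong[OF refl])
   fix j
   have "(\<lambda>y. indicator (ivl (snd s) x j) y * indicator E y :: ennreal) \<in> borel_measurable borel"
    using ivm Eb by simp
   from nn_integral_real_affine[OF this, of 1 "c j"]
   show "(\<integral>\<^sup>+y. indicator (ivl (fst s) x j) y * indicator E (y + c j) \<partial>lborel) =
     (\<integral>\<^sup>+y. indicator (ivl (snd s) x j) y * indicator E y \<partial>lborel)"
    using shift by (simp add: add.commute indicator_def cong: if_cong)
  qed
  also have "\<dots> = (\<integral>\<^sup>+y. (\<Sum>j\<in>{1..d}. indicator (ivl (snd s) x j) y * indicator E y) \<partial>lborel)"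
   using ivm Eb by (intro nn_integral_sum[symmetric]) simp
  also have "\<dots> = (\<integral>\<^sup>+y. indicator E y \<partial>lborel)"
  proof (rule nn_integral_cong)
   fix y :: real
   show "(\<Sum>j\<in>{1..d}. indicator (ivl (snd s) x j) y * (indicator E y :: ennreal)) = indicator E y"
   proof (cases "y \<in> E")
    case True
    then have y: "y \<in> {0..<1}" using Eb by blast
    then obtain j where a: "j \<in> {1..d}" "y \<in> ivl (snd s) x j" using pb by blast
    show ?thesis by (rule sum_indicator_partition[OF pb[OF y] a])
   qed simp
  qed
  also have "\<dots> = emeasure unit_leb E"
   using Eb by (simp add: emeasure_restrict_space)
  finally show "emeasure (distr unit_leb unit_leb T) E = emeasure unit_leb E" .
 qed simp
qed

lemma unit_stage_translation:
 assumes s: "valid s" and st: "stage T s x (\<lambda>_. 1)" and x1: "(\<Sum>j\<in>{1..d}. x j) = 1"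
  and yz: "0 \<le> y" "y \<le> z" "z < 1" and D: "{y<..z} \<inter> lft (fst s) x ` {1..d} = {}"
 shows "T z - T y = z - y"
proof -
 have pos: "\<forall>j\<in>{1..d}. 0 < x j" using stage_pos[OF s st] by blast
 have t: "distinct (fst s)" "set (fst s) = {1..d}" using s by (auto simp: valid_rows_def)
 note pt = row_partition[OF t pos x1]
 obtain j where a: "j \<in> {1..d}" "y \<in> ivl (fst s) x j" using pt[of y] yz by auto
 obtain \<beta> where b: "\<beta> \<in> {1..d}" "z \<in> ivl (fst s) x \<beta>" using pt[of z] yz by auto
 have "lft (fst s) x \<beta> \<le> z" using b by (simp add: ivl_def)
 moreover have "lft (fst s) x \<beta> \<notin> {y<..z}" using D b(1) by blast
 ultimately have "y \<in> ivl (fst s) x \<beta>" using b yz by (auto simp: ivl_def)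
 then have "j = \<beta>" using pt[of y] a b yz by auto
 then show ?thesis using unit_stage_apply(1)[OF s st a] unit_stage_apply(1)[OF s st b] by simp
qed

end

text \<open>All that the mixing argument needs to know about the interval exchange.\<close>

definition admissible :: "(real \<Rightarrow> real) \<Rightarrow> real set \<Rightarrow> bool" where
 "admissible T D \<longleftrightarrow> bij_betw T {0..<1} {0..<1} \<and> finite D \<and>
   (\<forall>y z. 0 \<le> y \<and> y \<le> z \<and> z < 1 \<and> {y<..z} \<inter> D = {} \<longrightarrow> T z - T y = z - y) \<and>
   T \<in> unit_leb \<rightarrow>\<^sub>M unit_leb \<and> inv_into {0..<1} T \<in> unit_leb \<rightarrow>\<^sub>M unit_leb \<and>
   distr unit_leb unit_leb T = unit_leb \<and> equidistributed T"

lemma AE_admissible: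
 assumes "d \<ge> 2" "\<pi> permutes {1..d}" "irreducible_perm d \<pi>"
 shows "AE l in simplex_lebesgue d. \<exists>D. admissible (iet d l \<pi>) D"
proof -
 interpret rauzy d by standard (rule assms(1))
 let ?s = "iet_rows d \<pi>"
 have s: "valid ?s" by (rule valid_iet_rows[OF assms(2,3)])
 obtain C where C: "C \<ge> 1" and ae: "AE l in simplex_lebesgue d. good_lengths C ?s l"
  using AE_good_lengths_simplex s by blast
 have "AE l in simplex_lebesgue d. l \<in> length_simplex d"
 proof (rule AE_I2)
  fix l assume "l \<in> space (simplex_lebesgue d)"
  then show "l \<in> length_simplex d" by (simp add: simplex_lebesgue_def space_restrict_space)
 qed
 with ae show ?thesis
 proof eventually_elim
  case (elim l)
  have x1: "(\<Sum>i\<in>{1..d}. l i) = 1" using elim(2) by (simp add: length_simplex_def)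
  have st: "stage (iet d l \<pi>) ?s l (\<lambda>_. 1)" by (rule stage_iet[OF assms(2) elim(2)])
  have bij: "bij_betw (iet d l \<pi>) {0..<1} {0..<1}" by (rule bij_betw_iet[OF assms(2) elim(2)])
  have "admissible (iet d l \<pi>) (lft (fst ?s) l ` {1..d})"
   unfolding admissible_def
   using bij unit_stage_translation[OF s st x1] unit_stage_measure[OF s st x1 bij]
    stage_equidistributed[OF bij s x1 st C elim(1)] by blast
  then show ?case by blast
 qed
qed

section \<open>Reciprocals along orbits\<close>

text \<open>The predicate \<open>q\<close> is left free at \<open>p\<close> itself, so that
  half-open intervals at either end of the unit interval are both covered.\<close>

lemma recip_integral:
 assumes a: "0 < a" "a \<le> 1" and p: "0 \<le> p" "p \<le> 1" and q: "\<And>\<delta>. \<delta> \<noteq> p \<Longrightarrow> q \<delta> \<longleftrightarrow> p < \<delta>"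
 shows "((\<lambda>\<delta>. of_bool (q \<delta>) / \<delta>\<^sup>2) has_integral (1 / max p a - 1)) {a..1::real}"
proof -
 define b where "b = max p a"
 have b: "a \<le> b" "b \<le> 1" "0 < b" using a p by (auto simp: b_def)
 have "((\<lambda>\<delta>. 1 / \<delta>\<^sup>2) has_integral (- (1 / 1) - (- (1 / b)))) {b..1}"
 proof (rule fundamental_theorem_of_calculus[OF b(2)])
  fix x assume x: "x \<in> {b..1}"
  then have "x \<noteq> 0" using b by auto
  then have "((\<lambda>x. - (1 / x)) has_field_derivative (1 / x\<^sup>2)) (at x within {b..1})"
   by (auto intro!: derivative_eq_intros simp: power2_eq_square)
  then show "((\<lambda>x. - (1 / x)) has_vector_derivative (1 / x\<^sup>2)) (at x within {b..1})"
   by (simp add: has_real_derivative_iff_has_vector_derivative)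
 qed
 then have "((\<lambda>\<delta>. if \<delta> \<in> {b..1} then 1 / \<delta>\<^sup>2 else 0) has_integral (1 / b - 1)) {a..1}"
  using b by (subst has_integral_restrict) auto
 then have "((\<lambda>\<delta>. of_bool (q \<delta>) / \<delta>\<^sup>2) has_integral (1 / b - 1)) {a..1}"
 proof (rule has_integral_spike_finite[where S = "{p}", rotated 2])
  fix \<delta> assume "\<delta> \<in> {a..1} - {p}"
  then show "of_bool (q \<delta>) / \<delta>\<^sup>2 = (if \<delta> \<in> {b..1} then 1 / \<delta>\<^sup>2 else 0)"
   using q[of \<delta>] by (auto simp: b_def)
 qed simp
 then show ?thesis by (simp add: b_def)
qed

text \<open>Layer cake: \<open>1 / max p a - 1\<close> is the integral of \<open>1 / \<delta>\<^sup>2\<close> over the \<open>\<delta>\<close> in \<open>{a..1}\<close> above \<open>p\<close>.\<close>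

lemma recip_sum:
 assumes a: "0 < a" "a \<le> 1" and p: "\<And>k. k < N \<Longrightarrow> 0 \<le> p k \<and> p k \<le> 1"
  and q: "\<And>k \<delta>. k < N \<Longrightarrow> \<delta> \<noteq> p k \<Longrightarrow> q k \<delta> \<longleftrightarrow> p k < \<delta>"
  and count: "\<And>\<delta>. a \<le> \<delta> \<Longrightarrow> \<delta> \<le> 1 \<Longrightarrow> \<bar>(\<Sum>k<N. of_bool (q k \<delta>)) - real N * \<delta>\<bar> \<le> \<epsilon> * (real N * \<delta>)"
 shows "\<bar>(\<Sum>k<N. 1 / max (p k) a - 1) - real N * ln (1 / a)\<bar> \<le> \<epsilon> * (real N * ln (1 / a))"
proof -
 have 1: "((\<lambda>\<delta>. \<Sum>k<N. of_bool (q k \<delta>) / \<delta>\<^sup>2) has_integral (\<Sum>k<N. 1 / max (p k) a - 1)) {a..1}"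
  using p q a by (intro has_integral_sum recip_integral) auto
 have 2: "((\<lambda>\<delta>. c * (1 / \<delta>)) has_integral (c * ln (1 / a))) {a..1}" for c
 proof -
  have "((\<lambda>\<delta>. 1 / \<delta>) has_integral (ln 1 - ln a)) {a..1}"
  proof (rule fundamental_theorem_of_calculus[OF a(2)])
   fix x assume x: "x \<in> {a..1}"
   then have "(ln has_field_derivative (1 / x)) (at x within {a..1})"
    using a by (auto intro!: derivative_eq_intros)
   then show "(ln has_vector_derivative (1 / x)) (at x within {a..1})"
    by (simp add: has_real_derivative_iff_has_vector_derivative)
  qed
  from has_integral_mult_right[OF this, of c] show ?thesis using a by (simp add: ln_div)
 qed
 have b: "(1 - \<epsilon>) * real N * (1 / \<delta>) \<le> (\<Sum>k<N. of_bool (q k \<delta>) / \<delta>\<^sup>2) \<and>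
   (\<Sum>k<N. of_bool (q k \<delta>) / \<delta>\<^sup>2) \<le> (1 + \<epsilon>) * real N * (1 / \<delta>)" if "\<delta> \<in> {a..1}" for \<delta>
 proof -
  have d: "0 < \<delta>" using that a by auto
  have "\<bar>(\<Sum>k<N. of_bool (q k \<delta>)) - real N * \<delta>\<bar> \<le> \<epsilon> * (real N * \<delta>)" using count that by auto
  then have "(1 - \<epsilon>) * real N * \<delta> \<le> (\<Sum>k<N. of_bool (q k \<delta>))" "(\<Sum>k<N. of_bool (q k \<delta>)) \<le> (1 + \<epsilon>) * real N * \<delta>"
   by (simp_all add: abs_le_iff algebra_simps)
  then have "(1 - \<epsilon>) * real N * \<delta> / \<delta>\<^sup>2 \<le> (\<Sum>k<N. of_bool (q k \<delta>)) / \<delta>\<^sup>2"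
   "(\<Sum>k<N. of_bool (q k \<delta>)) / \<delta>\<^sup>2 \<le> (1 + \<epsilon>) * real N * \<delta> / \<delta>\<^sup>2"
   by (intro divide_right_mono; simp)+
  moreover have "c * \<delta> / \<delta>\<^sup>2 = c * (1 / \<delta>)" for c using d by (simp add: power2_eq_square)
  ultimately show ?thesis unfolding sum_divide_distrib by simp
 qed
 have "(1 - \<epsilon>) * real N * ln (1 / a) \<le> (\<Sum>k<N. 1 / max (p k) a - 1)"
  by (rule has_integral_le[OF 2 1]) (use b in blast)
 moreover have "(\<Sum>k<N. 1 / max (p k) a - 1) \<le> (1 + \<epsilon>) * real N * ln (1 / a)"
  by (rule has_integral_le[OF 1 2]) (use b in blast)
 ultimately show ?thesis by (simp add: abs_le_iff algebra_simps)
qed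

section \<open>The derivative of the roof function\<close>

lemma C2_derivs:
 assumes "C2_on f {0<..<1}" "x \<in> {0<..<1}"
 shows "(f has_real_derivative deriv f x) (at x)" "(deriv f has_real_derivative deriv (deriv f) x) (at x)"
 using assms unfolding C2_on_def by (auto intro: DERIV_deriv_iff_real_differentiable[THEN iffD2])

text \<open>l'Hopital's rule against \<open>1 / x\<close>, whose derivative has the order prescribed
  for the second derivative of \<open>f\<close>.\<close>

lemma deriv_asymp_right:
 assumes f: "C2_on f {0<..<1}" and lim: "((\<lambda>x. x\<^sup>2 * deriv (deriv f) x) \<longlongrightarrow> Cp) (at_right 0)"
 shows "((\<lambda>x. x * deriv f x) \<longlongrightarrow> - Cp) (at_right 0)"
proof -
 have ev: "eventually (\<lambda>x::real. x \<in> {0<..<1}) (at_right 0)"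
  by (rule eventually_at_right_real) simp
 have "((\<lambda>x. deriv f x / (1 / x)) \<longlongrightarrow> - Cp) (at_right 0)"
 proof (rule lhopital_right_0_at_top[where f' = "deriv (deriv f)" and g' = "\<lambda>x. - 1 / x\<^sup>2"])
  show "LIM x at_right 0. 1 / x :> (at_top :: real filter)" by real_asymp
  show "eventually (\<lambda>x::real. - 1 / x\<^sup>2 \<noteq> 0) (at_right 0)" using ev by eventually_elim auto
  show "eventually (\<lambda>x. DERIV (deriv f) x :> deriv (deriv f) x) (at_right 0)"
   using ev by eventually_elim (rule C2_derivs[OF f])
  show "eventually (\<lambda>x::real. DERIV (\<lambda>x. 1 / x) x :> - 1 / x\<^sup>2) (at_right 0)"
   using ev by eventually_elim (auto intro!: derivative_eq_intros simp: power2_eq_square)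
  show "((\<lambda>x. deriv (deriv f) x / (- 1 / x\<^sup>2)) \<longlongrightarrow> - Cp) (at_right 0)"
   using tendsto_minus[OF lim] by (simp add: mult.commute)
 qed
 then show ?thesis by (simp add: mult.commute)
qed

lemma deriv_asymp_left:
 assumes f: "C2_on f {0<..<1}" and lim: "((\<lambda>x. (1 - x)\<^sup>2 * deriv (deriv f) x) \<longlongrightarrow> Cm) (at_left 1)"
 shows "((\<lambda>x. (1 - x) * deriv f x) \<longlongrightarrow> Cm) (at_left 1)"
proof -
 have ev: "eventually (\<lambda>x::real. x \<in> {0<..<1}) (at_left 1)"
  by (rule eventually_at_left_real) simp
 have "((\<lambda>x. deriv f x / (1 / (1 - x))) \<longlongrightarrow> Cm) (at_left 1)"
 proof (rule lhopital_left_at_top[where f' = "deriv (deriv f)" and g' = "\<lambda>x. 1 / (1 - x)\<^sup>2"])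
  show "LIM x at_left 1. 1 / (1 - x) :> (at_top :: real filter)" by real_asymp
  show "eventually (\<lambda>x::real. 1 / (1 - x)\<^sup>2 \<noteq> 0) (at_left 1)" using ev by eventually_elim auto
  show "eventually (\<lambda>x. DERIV (deriv f) x :> deriv (deriv f) x) (at_left 1)"
   using ev by eventually_elim (rule C2_derivs[OF f])
  show "eventually (\<lambda>x::real. DERIV (\<lambda>x. 1 / (1 - x)) x :> 1 / (1 - x)\<^sup>2) (at_left 1)"
   using ev by eventually_elim (auto intro!: derivative_eq_intros simp: power2_eq_square)
  show "((\<lambda>x. deriv (deriv f) x / (1 / (1 - x)\<^sup>2)) \<longlongrightarrow> Cm) (at_left 1)"
   using lim by (simp add: mult.commute)
 qed
 then show ?thesis by (simp add: mult.commute)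
qed

lemma abs_bound_rearrange:
 fixes a z :: real
 assumes "0 \<le> z" "z \<le> K"
 shows "\<bar>a\<bar> \<le> p \<Longrightarrow> 0 \<le> r \<Longrightarrow> \<bar>a - z\<bar> \<le> p + r + K"
  and "\<bar>a\<bar> \<le> p \<Longrightarrow> 0 \<le> r \<Longrightarrow> \<bar>a + z\<bar> \<le> r + p + K"
 using assms by linarith+

text \<open>The limits determine the singular part of f' only up to a small multiple of its size,
  not up to a bounded function; hence an error in \<eta>, with \<open>K\<close> depending on
  it.\<close>

lemma deriv_expansion:
 assumes f: "C2_on f {0<..<1}" and C: "0 < Cp" "0 < Cm"
  and lim0: "((\<lambda>x. x\<^sup>2 * deriv (deriv f) x) \<longlongrightarrow> Cp) (at_right 0)"
  and lim1: "((\<lambda>x. (1 - x)\<^sup>2 * deriv (deriv f) x) \<longlongrightarrow> Cm) (at_left 1)" and \<eta>: "0 < \<eta>"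
 shows "\<exists>K\<ge>0. \<forall>x\<in>{0<..<1}. \<bar>deriv f x + Cp / x - Cm / (1 - x)\<bar> \<le> \<eta> * (1 / x + 1 / (1 - x)) + K"
proof -
 have "eventually (\<lambda>x. dist (x * deriv f x) (- Cp) < \<eta>) (at_right 0)"
  using deriv_asymp_right[OF f lim0] \<eta> by (rule tendstoD)
 then obtain a where a: "0 < a" "\<And>x. 0 < x \<Longrightarrow> x < a \<Longrightarrow> dist (x * deriv f x) (- Cp) < \<eta>"
  unfolding eventually_at_right_field by blast
 have "eventually (\<lambda>x. dist ((1 - x) * deriv f x) Cm < \<eta>) (at_left 1)"
  using deriv_asymp_left[OF f lim1] \<eta> by (rule tendstoD)
 then obtain b where b: "b < 1" "\<And>x. b < x \<Longrightarrow> x < 1 \<Longrightarrow> dist ((1 - x) * deriv f x) Cm < \<eta>"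
  unfolding eventually_at_left_field by blast
 define a' where "a' = min a (1 / 2)"
 define b' where "b' = max b (1 / 2)"
 have a': "0 < a'" "a' \<le> 1 / 2" "a' \<le> a" and b': "b' < 1" "1 / 2 \<le> b'" "b \<le> b'" using a b by (auto simp: a'_def b'_def)
 have "continuous_on {a'..b'} (deriv f)"
 proof (rule DERIV_continuous_on)
  fix x assume "x \<in> {a'..b'}"
  then have "x \<in> {0<..<1}" using a' b' by auto
  from C2_derivs(2)[OF f this] show "(deriv f has_real_derivative deriv (deriv f) x) (at x within {a'..b'})"
   by (rule has_field_derivative_at_within)
 qed
 then have "bounded (deriv f ` {a'..b'})" by (intro compact_imp_bounded compact_continuous_image) auto
 then obtain M where M: "\<And>x. x \<in> {a'..b'} \<Longrightarrow> \<bar>deriv f x\<bar> \<le> M"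
  unfolding bounded_iff by (metis image_eqI real_norm_def)
 define K where "K = \<bar>M\<bar> + Cp / a' + Cm / (1 - b') + 2 * Cp + 2 * Cm"
 have K: "0 \<le> K" "2 * Cm \<le> K" "2 * Cp \<le> K" using C a' b' by (auto simp: K_def)
 have "\<bar>deriv f x + Cp / x - Cm / (1 - x)\<bar> \<le> \<eta> * (1 / x + 1 / (1 - x)) + K" if x: "x \<in> {0<..<1}" for x
 proof -
  have x0: "0 < x" "0 < 1 - x" using x by auto
  have np: "0 \<le> \<eta> * (1 / x)" "0 \<le> \<eta> * (1 / (1 - x))" using \<eta> x0 by auto
  consider "x < a'" | "b' < x" | "a' \<le> x" "x \<le> b'" by linarith
  then show ?thesis
  proof cases
   case 1
   have "\<bar>x * deriv f x + Cp\<bar> \<le> \<eta>" using a(2)[of x] 1 a' x0 by (simp add: dist_real_def)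
   then have "\<bar>x * deriv f x + Cp\<bar> / x \<le> \<eta> / x" using x0 by (intro divide_right_mono) auto
   moreover have "\<bar>x * deriv f x + Cp\<bar> / x = \<bar>deriv f x + Cp / x\<bar>"
   proof -
    have "(x * deriv f x + Cp) / x = deriv f x + Cp / x" using x0 by (simp add: add_divide_distrib)
    then show ?thesis using x0 by (metis abs_divide abs_of_pos)
   qed
   ultimately have "\<bar>deriv f x + Cp / x\<bar> \<le> \<eta> * (1 / x)" by simp
   moreover have "Cm / (1 - x) \<le> Cm / (1 / 2)" using 1 a' C by (intro divide_left_mono) auto
   then have "Cm / (1 - x) \<le> K" using K by simp
   moreover have "0 \<le> Cm / (1 - x)" using C x0 by simp
   ultimately show ?thesis using np unfolding distrib_left by (intro abs_bound_rearrange(1))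
  next
   case 2
   have "\<bar>(1 - x) * deriv f x - Cm\<bar> \<le> \<eta>" using b(2)[of x] 2 b' x0 by (simp add: dist_real_def)
   then have "\<bar>(1 - x) * deriv f x - Cm\<bar> / (1 - x) \<le> \<eta> / (1 - x)" using x0 by (intro divide_right_mono) auto
   moreover have "\<bar>(1 - x) * deriv f x - Cm\<bar> / (1 - x) = \<bar>deriv f x - Cm / (1 - x)\<bar>"
   proof -
    have "((1 - x) * deriv f x - Cm) / (1 - x) = deriv f x - Cm / (1 - x)" using x0 by (simp add: diff_divide_distrib)
    then show ?thesis using x0 by (metis abs_divide abs_of_pos)
   qed
   ultimately have "\<bar>deriv f x - Cm / (1 - x)\<bar> \<le> \<eta> * (1 / (1 - x))" by simp
   moreover have "Cp / x \<le> Cp / (1 / 2)" using 2 b' C by (intro divide_left_mono) auto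
   then have "Cp / x \<le> K" using K by simp
   moreover have "0 \<le> Cp / x" using C x0 by simp
   moreover have "deriv f x + Cp / x - Cm / (1 - x) = deriv f x - Cm / (1 - x) + Cp / x" by simp
   ultimately show ?thesis using np unfolding distrib_left by (simp only: abs_bound_rearrange(2))
  next
   case 3
   have "\<bar>deriv f x\<bar> \<le> \<bar>M\<bar>" using M[of x] 3 by auto
   moreover have "Cp / x \<le> Cp / a'" using 3 a' C x0 by (intro divide_left_mono) auto
   moreover have "Cm / (1 - x) \<le> Cm / (1 - b')" using 3 b' C x0 by (intro divide_left_mono) auto
   moreover have "0 \<le> Cp / x" "0 \<le> Cm / (1 - x)" using C x0 by auto
   ultimately show ?thesis using np C unfolding K_def distrib_left by linarith
  qed
 qed
 then show ?thesis using K by blast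
qed

section \<open>Birkhoff sums from below\<close>

text \<open>For a fixed interval the times too short for equidistribution are absorbed by the
  additive constant.\<close>

lemma visits_affine_bounds:
 assumes E: "equidistributed T" and \<epsilon>: "0 < \<epsilon>" "\<epsilon> < 1" and uv: "0 \<le> u" "u < v" "v \<le> 1"
 shows "\<exists>K\<ge>0. \<forall>N. \<forall>y\<in>{0..<1}. (1 - \<epsilon>) * real N * (v - u) - K \<le> visits T {u..<v} N y \<and>
   visits T {u..<v} N y \<le> (1 + \<epsilon>) * real N * (v - u) + K"
proof -
 obtain \<delta>0 where \<delta>0: "0 < \<delta>0" and E': "\<forall>\<delta> u v N y.
   0 < \<delta> \<and> \<delta> < \<delta>0 \<and> 0 \<le> u \<and> v \<le> 1 \<and> \<delta> \<le> v - u \<and> \<delta> powr (- 1 - \<epsilon>) \<le> real N \<and> y \<in> {0..<1} \<longrightarrow>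
   \<bar>visits T {u..<v} N y - real N * (v - u)\<bar> \<le> \<epsilon> * (real N * (v - u))"
  using E \<epsilon> unfolding equidistributed_def by blast
 define \<delta> where "\<delta> = min (\<delta>0 / 2) (v - u)"
 have \<delta>: "0 < \<delta>" "\<delta> < \<delta>0" "\<delta> \<le> v - u" using \<delta>0 uv by (auto simp: \<delta>_def)
 define K where "K = \<delta> powr (- 1 - \<epsilon>)"
 have "(1 - \<epsilon>) * real N * (v - u) - K \<le> visits T {u..<v} N y \<and>
   visits T {u..<v} N y \<le> (1 + \<epsilon>) * real N * (v - u) + K" if y: "y \<in> {0..<1}" for N y
 proof (cases "K \<le> real N")
  case True
  define X where "X = real N * (v - u)"
  have "\<bar>visits T {u..<v} N y - X\<bar> \<le> \<epsilon> * X"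
   using E' \<delta> uv y True unfolding K_def X_def by blast
  moreover have "0 \<le> K" by (simp add: K_def)
  moreover have "(1 - \<epsilon>) * real N * (v - u) = X - \<epsilon> * X" "(1 + \<epsilon>) * real N * (v - u) = X + \<epsilon> * X"
   by (simp_all add: X_def algebra_simps)
  ultimately show ?thesis by linarith
 next
  case False
  have "visits T {u..<v} N y \<le> (\<Sum>k<N. 1)" unfolding visits_def by (intro sum_mono) auto
  then have up: "visits T {u..<v} N y \<le> real N" by simp
  have "(1 - \<epsilon>) * real N * (v - u) \<le> 1 * real N * 1" using \<epsilon> uv by (intro mult_mono) auto
  moreover have "0 \<le> (1 + \<epsilon>) * real N * (v - u)" using \<epsilon> uv by simp
  ultimately show ?thesis using False up visits_nonneg[of T "{u..<v}" N y] by linarith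
 qed
 moreover have "0 \<le> K" by (simp add: K_def)
 ultimately show ?thesis by blast
qed

abbreviation grid :: "nat \<Rightarrow> nat \<Rightarrow> real set" where
 "grid n i \<equiv> {real i / real n ..< real (Suc i) / real n}"

lemma grid_unique:
 assumes n: "0 < n" and x: "x \<in> {0..<1::real}"
 shows "\<exists>i<n. x \<in> grid n i \<and> (\<forall>j. x \<in> grid n j \<longrightarrow> j = i)"
proof -
 define i where "i = nat \<lfloor>x * real n\<rfloor>"
 have iff: "x \<in> grid n j \<longleftrightarrow> j = i" for j
 proof -
  have "x \<in> grid n j \<longleftrightarrow> real j \<le> x * real n \<and> x * real n < real j + 1"
   using n by (auto simp: field_simps)
  also have "\<dots> \<longleftrightarrow> \<lfloor>x * real n\<rfloor> = int j" by (auto simp: floor_eq_iff)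
  also have "\<dots> \<longleftrightarrow> j = i" unfolding i_def using x n by auto
  finally show ?thesis .
 qed
 have "x * real n < 1 * real n" using x n by (intro mult_strict_right_mono) auto
 then have "i < n" unfolding i_def using x by (simp add: nat_less_iff floor_less_iff)
 then show ?thesis using iff by blast
qed

text \<open>The infima over the cells of finer and finer grids converge to \<open>f\<close> at
  points of continuity, and \<open>f\<close> itself dominates them.\<close>

lemma lower_step_function:
 fixes f :: "real \<Rightarrow> real"
 assumes int: "set_integrable lebesgue {0..<1} f" and nn: "\<And>x. x \<in> {0..<1} \<Longrightarrow> 0 \<le> f x"
  and cont: "continuous_on {0<..<1} f" and \<kappa>: "0 < \<kappa>"
 shows "\<exists>n>0. \<exists>c. (\<forall>i<n. 0 \<le> c i) \<and> (\<forall>i<n. \<forall>x\<in>grid n i. c i \<le> f x) \<and>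
  (LINT x:{0..<1}|lebesgue. f x) - \<kappa> \<le> (\<Sum>i<n. c i / real n)"
proof -
 define c where "c j i = (INF x\<in>grid (Suc j) i. f x)" for j i
 define g where "g j x = (\<Sum>i<Suc j. c j i * indicator (grid (Suc j) i) x)" for j and x :: real
 have gridsub: "grid (Suc j) i \<subseteq> {0..<1}" if "i < Suc j" for i j
 proof
  fix x assume x: "x \<in> grid (Suc j) i"
  have "real (Suc i) / real (Suc j) \<le> 1" using that by (simp add: field_simps)
  moreover have "0 \<le> real i / real (Suc j)" by simp
  ultimately show "x \<in> {0..<1}" using x unfolding atLeastLessThan_iff by linarith
 qed
 have ne: "grid (Suc j) i \<noteq> {}" for i j by (simp add: divide_strict_right_mono)
 have bdd: "bdd_below (f ` grid (Suc j) i)" if "i < Suc j" for i j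
  using nn gridsub[OF that] by (intro bdd_belowI2[of _ 0]) blast
 have c0: "0 \<le> c j i" if "i < Suc j" for i j
  unfolding c_def using nn gridsub[OF that] ne by (intro cINF_greatest) blast+
 have cle: "c j i \<le> f x" if "i < Suc j" "x \<in> grid (Suc j) i" for i j x
  unfolding c_def by (rule cINF_lower[OF bdd[OF that(1)] that(2)])
 have geq: "g j x = c j i" if "i < Suc j" "x \<in> grid (Suc j) i" for i j x
 proof -
  have "x \<in> {0..<1}" using gridsub that by blast
  from grid_unique[OF _ this, of "Suc j"] have u: "x \<in> grid (Suc j) k \<longleftrightarrow> k = i" for k using that by blast
  have "g j x = (\<Sum>k<Suc j. if k = i then c j i else 0)"
   unfolding g_def by (intro sum.cong) (auto simp: u indicator_def simp del: atLeastLessThan_iff of_nat_Suc)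
  then show ?thesis using that(1) by simp
 qed
 have g0: "g j x = 0" if "x \<notin> {0..<1}" for j x
  unfolding g_def
 proof (intro sum.neutral ballI)
  fix i assume "i \<in> {..<Suc j}"
  then have "x \<notin> grid (Suc j) i" using gridsub that by blast
  then have "indicator (grid (Suc j) i) x = (0 :: real)" by (rule indicator_simps(2))
  then show "c j i * indicator (grid (Suc j) i) x = 0" by (simp only: mult_zero_right)
 qed
 have gbound: "0 \<le> g j x \<and> g j x \<le> indicator {0..<1} x * f x" for j x
 proof (cases "x \<in> {0..<1}")
  case True
  then obtain i where "i < Suc j" "x \<in> grid (Suc j) i" using grid_unique[of "Suc j" x] by blast
  then show ?thesis using geq c0 cle True by simp
 qed (use g0 in simp)
 \<comment> \<open>Continuity is known only in the open interval; the single point 0 is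
   negligible.\<close>
 have conv: "(\<lambda>j. g j x) \<longlonglongrightarrow> indicator {0..<1} x * f x" if x0: "x \<noteq> 0" for x
 proof (cases "x \<in> {0..<1}")
  case True
  then have x: "x \<in> {0<..<1}" using x0 by auto
  then have "isCont f x" using cont by (simp add: continuous_on_eq_continuous_at)
  show ?thesis
  proof (rule LIMSEQ_I)
   fix e :: real assume e: "0 < e"
   then obtain s where s: "0 < s" "\<And>y. dist y x < s \<Longrightarrow> dist (f y) (f x) < e / 2"
    using \<open>isCont f x\<close> unfolding continuous_at_eps_delta by (metis half_gt_zero)
   obtain j0 where j0: "1 / s < real j0" using reals_Archimedean2 by blast
   have "norm (g j x - indicator {0..<1} x * f x) < e" if "j \<ge> j0" for j
   proof -
    obtain i where i: "i < Suc j" "x \<in> grid (Suc j) i" using grid_unique[of "Suc j" x] True by blast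
    have js: "1 / real (Suc j) < s"
    proof -
     have "1 / s < real (Suc j)" using j0 that by linarith
     then show ?thesis using s by (simp add: field_simps)
    qed
    have "f x - e / 2 \<le> c j i" unfolding c_def
    proof (rule cINF_greatest[OF ne])
     fix y assume y: "y \<in> grid (Suc j) i"
     have "real (Suc i) / real (Suc j) = real i / real (Suc j) + 1 / real (Suc j)" by (simp add: add_divide_distrib)
     then have "y - x < s" "x - y < s" using y i(2) js unfolding atLeastLessThan_iff by linarith+
     then have "dist y x < s" by (simp add: dist_real_def abs_less_iff)
     then have "\<bar>f y - f x\<bar> < e / 2" using s(2)[of y] by (simp only: dist_real_def)
     then show "f x - e / 2 \<le> f y" using abs_ge_minus_self[of "f y - f x"] by linarith
    qed
    then show ?thesis using cle[OF i] geq[OF i] True e by (simp add: abs_less_iff)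
   qed
   then show "\<exists>no. \<forall>n\<ge>no. norm (g n x - indicator {0..<1} x * f x) < e" by blast
  qed
 qed (use g0 in simp)
 have fint: "integrable lebesgue (\<lambda>x. indicator {0..<1} x * f x)"
  using int unfolding set_integrable_def by simp
 have "(\<lambda>j. \<integral>x. g j x \<partial>lebesgue) \<longlonglongrightarrow> (\<integral>x. indicator {0..<1} x * f x \<partial>lebesgue)"
 proof (rule integral_dominated_convergence[where w = "\<lambda>x. indicator {0..<1} x * f x"])
  show "AE x in lebesgue. (\<lambda>j. g j x) \<longlonglongrightarrow> indicator {0..<1} x * f x"
  proof (rule AE_I')
   show "{0::real} \<in> null_sets lebesgue" by simp
  qed (use conv in auto)
  show "AE x in lebesgue. norm (g j x) \<le> indicator {0..<1} x * f x" for j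
   using gbound[of j] by (intro AE_I2) simp
  show "(\<lambda>x. g j x) \<in> borel_measurable lebesgue" for j
   unfolding g_def by (intro borel_measurable_sum borel_measurable_times borel_measurable_indicator) auto
 qed (use fint in auto)
 then have "eventually (\<lambda>j. (LINT x:{0..<1}|lebesgue. f x) - \<kappa> < (\<integral>x. g j x \<partial>lebesgue)) sequentially"
  using \<kappa> by (intro order_tendstoD(1)) (auto simp: set_lebesgue_integral_def)
 then obtain j where j: "(LINT x:{0..<1}|lebesgue. f x) - \<kappa> < (\<integral>x. g j x \<partial>lebesgue)"
  unfolding eventually_sequentially by blast
 have fin: "emeasure lebesgue (grid (Suc j) i) < \<infinity>" for i
 proof -
  have "real i / real (Suc j) \<le> real (Suc i) / real (Suc j)" by (simp add: divide_right_mono)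
  then show ?thesis by (simp del: of_nat_Suc)
 qed
 have "(\<integral>x. g j x \<partial>lebesgue) = (\<Sum>i<Suc j. \<integral>x. c j i * indicator (grid (Suc j) i) x \<partial>lebesgue)"
  unfolding g_def using fin
  by (intro Bochner_Integration.integral_sum integrable_mult_right integrable_real_indicator) (auto simp del: of_nat_Suc)
 also have "\<dots> = (\<Sum>i<Suc j. c j i / real (Suc j))"
 proof (rule sum.cong[OF refl])
  fix i
  have "real i / real (Suc j) \<le> real (Suc i) / real (Suc j)" by (simp add: divide_right_mono)
  then have "measure lebesgue (grid (Suc j) i) = real (Suc i) / real (Suc j) - real i / real (Suc j)"
   by (simp del: of_nat_Suc)
  also have "\<dots> = 1 / real (Suc j)" by (simp add: diff_divide_distrib[symmetric])
  finally show "(\<integral>x. c j i * indicator (grid (Suc j) i) x \<partial>lebesgue) = c j i / real (Suc j)" by simp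
 qed
 finally show ?thesis using j c0 cle
  by (intro exI[of _ "Suc j"] conjI exI[of _ "c j"]) (auto simp del: atLeastLessThan_iff of_nat_Suc)
qed

section \<open>Special flows with one asymmetric logarithmic singularity\<close>

locale asym_flow = suspension_data T f m for T f :: "real \<Rightarrow> real" and m :: real +
 fixes D :: "real set" and Cp Cm :: real
 assumes adm: "admissible T D"
  and f_int: "set_integrable lebesgue {0..<1} f"
  and f_one: "(LINT x:{0..<1}|lebesgue. f x) = 1"
  and C2: "C2_on f {0<..<1}"
  and Cpm: "0 < Cp" "0 < Cm" "Cp \<noteq> Cm"
  and lim0: "((\<lambda>x. x\<^sup>2 * deriv (deriv f) x) \<longlongrightarrow> Cp) (at_right 0)"
  and lim1: "((\<lambda>x. (1 - x)\<^sup>2 * deriv (deriv f) x) \<longlongrightarrow> Cm) (at_left 1)"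
begin

definition Sn :: "nat \<Rightarrow> real \<Rightarrow> real" where
 "Sn n x = (\<Sum>k<n. f ((T ^^ k) x))"

lemma equi: "equidistributed T" and finD: "finite D"
 and T_meas: "T \<in> unit_leb \<rightarrow>\<^sub>M unit_leb" and Ti_meas: "Ti \<in> unit_leb \<rightarrow>\<^sub>M unit_leb"
 and T_distr: "distr unit_leb unit_leb T = unit_leb"
 using adm unfolding admissible_def by simp_all

lemma T_trans: "0 \<le> y \<Longrightarrow> y \<le> z \<Longrightarrow> z < 1 \<Longrightarrow> {y<..z} \<inter> D = {} \<Longrightarrow> T z - T y = z - y"
 using adm unfolding admissible_def by blast

lemma space_unit: "space unit_leb = {0..<1}"
 by (simp add: space_restrict_space)

lemma pow_in: "x \<in> {0..<1} \<Longrightarrow> (T ^^ k) x \<in> {0..<1}"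
 by (rule funpow_in[OF bij])

lemma pow_meas: "(T ^^ k) \<in> unit_leb \<rightarrow>\<^sub>M unit_leb"
proof (induction k)
 case 0
 then show ?case by (simp add: id_def)
next
 case (Suc k)
 then show ?case using T_meas by (simp add: measurable_comp)
qed

lemma nn_integral_pow:
 assumes "g \<in> borel_measurable unit_leb"
 shows "(\<integral>\<^sup>+x. g ((T ^^ k) x) \<partial>unit_leb) = (\<integral>\<^sup>+x. g x \<partial>unit_leb)"
proof (induction k)
 case (Suc k)
 have g: "(\<lambda>x. g ((T ^^ k) x)) \<in> borel_measurable unit_leb"
  by (rule measurable_compose[OF pow_meas assms])
 have "(\<integral>\<^sup>+x. g ((T ^^ Suc k) x) \<partial>unit_leb) = (\<integral>\<^sup>+x. g ((T ^^ k) (T x)) \<partial>unit_leb)"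
  by (simp add: funpow_swap1)
 also have "\<dots> = (\<integral>\<^sup>+x. g ((T ^^ k) x) \<partial>distr unit_leb unit_leb T)"
  using g by (subst nn_integral_distr[OF T_meas]) auto
 also have "\<dots> = (\<integral>\<^sup>+x. g x \<partial>unit_leb)" using Suc by (simp add: T_distr)
 finally show ?case .
qed simp

lemma f_pos: "x \<in> {0..<1} \<Longrightarrow> 0 < f x"
 using f_ge m_pos by (meson less_le_trans)

lemma f_deriv: "x \<in> {0<..<1} \<Longrightarrow> (f has_real_derivative deriv f x) (at x)"
 by (rule C2_derivs(1)[OF C2])

lemma f_cont: "continuous_on {0<..<1} f"
 by (rule DERIV_continuous_on[where D = "deriv f"]) (use f_deriv has_field_derivative_at_within in blast)

lemma f_ind_borel: "(\<lambda>x. indicator {0..<1} x * f x) \<in> borel_measurable borel"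
proof -
 have "(\<lambda>x. indicator {0<..<1} x *\<^sub>R f x + indicator {0} x * f 0) \<in> borel_measurable borel"
  by (intro borel_measurable_add borel_measurable_times borel_measurable_continuous_on_indicator f_cont) auto
 moreover have "indicator {0<..<1} x *\<^sub>R f x + indicator {0} x * f 0 = indicator {0..<1} x * f x" for x
  by (auto simp: indicator_def)
 ultimately show ?thesis by simp
qed

lemma f_meas: "f \<in> borel_measurable unit_leb"
proof -
 have "(\<lambda>x. indicator {0..<1} x * f x) \<in> borel_measurable unit_leb"
  by (intro measurable_restrict_space1) (use f_ind_borel in simp)
 then show ?thesis by (rule measurable_cong[THEN iffD1, rotated]) (simp add: space_unit)
qed

lemma Sn_meas: "Sn n \<in> borel_measurable unit_leb"
 unfolding Sn_def by (intro borel_measurable_sum measurable_compose[OF pow_meas f_meas])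

lemma nn_integral_f: "(\<integral>\<^sup>+x. ennreal (f x) \<partial>unit_leb) = 1"
proof -
 have i: "integrable lebesgue (\<lambda>x. indicator {0..<1} x * f x)"
  using f_int unfolding set_integrable_def by simp
 have "(\<integral>\<^sup>+x. ennreal (f x) \<partial>unit_leb) = (\<integral>\<^sup>+x. ennreal (indicator {0..<1} x * f x) \<partial>lborel)"
  by (subst nn_integral_restrict_space) (auto intro!: nn_integral_cong simp: indicator_def)
 also have "\<dots> = (\<integral>\<^sup>+x. ennreal (indicator {0..<1} x * f x) \<partial>lebesgue)"
  using f_ind_borel by (subst nn_integral_completion) auto
 also have "\<dots> = ennreal (\<integral>x. indicator {0..<1} x * f x \<partial>lebesgue)"
  using i f_pos by (intro nn_integral_eq_integral AE_I2) (auto simp: indicator_def less_imp_le)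
 also have "(\<integral>x. indicator {0..<1} x * f x \<partial>lebesgue) = 1"
  using f_one by (simp add: set_lebesgue_integral_def)
 finally show ?thesis by simp
qed

lemma Sn_add: "Sn (a + b) x = Sn a x + Sn b ((T ^^ a) x)"
 by (induction b) (simp_all add: Sn_def funpow_add_apply)

lemma Sn_ge: "x \<in> {0..<1} \<Longrightarrow> real n * m \<le> Sn n x"
proof -
 assume x: "x \<in> {0..<1}"
 have "(\<Sum>k<n. m) \<le> Sn n x" unfolding Sn_def using f_ge pow_in[OF x] by (intro sum_mono) blast
 then show ?thesis by simp
qed

lemma Sn_nonneg: "x \<in> {0..<1} \<Longrightarrow> 0 \<le> Sn n x"
 using Sn_ge[of x n] m_pos by (meson mult_nonneg_nonneg of_nat_0_le_iff less_imp_le order_trans)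

lemma Sn_mono: "x \<in> {0..<1} \<Longrightarrow> a \<le> b \<Longrightarrow> Sn a x \<le> Sn b x"
 using Sn_add[of a "b - a" x] Sn_nonneg[OF pow_in, of x "b - a" a] by simp

text \<open>Equidistribution is applied to every cell of a step function below \<open>f\<close>. A
  matching uniform upper bound is out of reach, as \<open>f\<close> is unbounded near the
  ends.\<close>

lemma Sn_lower:
 assumes \<kappa>: "0 < \<kappa>" "\<kappa> < 1"
 shows "\<exists>K\<ge>0. \<forall>N. \<forall>y\<in>{0..<1}. (1 - \<kappa>) * real N - K \<le> Sn N y"
proof -
 have "0 < \<kappa> / 2" using \<kappa> by simp
 from lower_step_function[OF f_int _ f_cont this] f_pos obtain n c where n: "0 < n"
  and c: "\<And>i. i < n \<Longrightarrow> 0 \<le> c i" "\<And>i x. i < n \<Longrightarrow> x \<in> grid n i \<Longrightarrow> c i \<le> f x"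
  and sum: "1 - \<kappa> / 2 \<le> (\<Sum>i<n. c i / real n)" unfolding f_one by (meson less_imp_le)
 have "\<exists>K\<ge>0. \<forall>N. \<forall>y\<in>{0..<1}. (1 - \<kappa> / 2) * real N * (1 / real n) - K \<le> visits T (grid n i) N y" if i: "i < n" for i
 proof -
  have w: "real (Suc i) / real n - real i / real n = 1 / real n"
   by (simp add: diff_divide_distrib[symmetric])
  have "0 \<le> real i / real n" "real (Suc i) / real n \<le> 1" using i by (simp_all add: field_simps)
  moreover have "real i / real n < real (Suc i) / real n" using n by (simp add: divide_strict_right_mono)
  ultimately show ?thesis
   using visits_affine_bounds[OF equi, of "\<kappa> / 2" "real i / real n" "real (Suc i) / real n"] \<kappa>
   unfolding w by auto
 qed
 then obtain K where K: "\<And>i. i < n \<Longrightarrow> 0 \<le> K i"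
  and Kb: "\<And>i N y. i < n \<Longrightarrow> y \<in> {0..<1} \<Longrightarrow> (1 - \<kappa> / 2) * real N * (1 / real n) - K i \<le> visits T (grid n i) N y"
  by metis
 define K' where "K' = (\<Sum>i<n. c i * K i)"
 have K': "0 \<le> K'" unfolding K'_def using K c by (intro sum_nonneg mult_nonneg_nonneg) auto
 have "(1 - \<kappa>) * real N - K' \<le> Sn N y" if y: "y \<in> {0..<1}" for N y
 proof -
  have "(1 - \<kappa>) * real N \<le> (1 - \<kappa> / 2) * real N * (1 - \<kappa> / 2)"
  proof -
   have "1 - \<kappa> \<le> (1 - \<kappa> / 2) * (1 - \<kappa> / 2)" by (simp add: algebra_simps)
   from mult_right_mono[OF this, of "real N"] show ?thesis by (simp add: mult_ac)
  qed
  also have "\<dots> \<le> (1 - \<kappa> / 2) * real N * (\<Sum>i<n. c i / real n)" using sum \<kappa> by (intro mult_left_mono) auto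
  also have "\<dots> = (\<Sum>i<n. c i * ((1 - \<kappa> / 2) * real N * (1 / real n)))" by (simp add: sum_distrib_left mult_ac)
  finally have "(1 - \<kappa>) * real N - K' \<le> (\<Sum>i<n. c i * ((1 - \<kappa> / 2) * real N * (1 / real n) - K i))"
   by (simp add: K'_def right_diff_distrib sum_subtractf)
  also have "\<dots> \<le> (\<Sum>i<n. c i * visits T (grid n i) N y)"
   using Kb y c by (intro sum_mono mult_left_mono) auto
  also have "\<dots> = (\<Sum>k<N. \<Sum>i<n. c i * of_bool ((T ^^ k) y \<in> grid n i))"
   unfolding visits_def sum_distrib_left by (rule sum.swap)
  also have "\<dots> \<le> (\<Sum>k<N. f ((T ^^ k) y))"
  proof (rule sum_mono)
   fix k
   have x: "(T ^^ k) y \<in> {0..<1}" by (rule pow_in[OF y])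
   from grid_unique[OF n x] obtain i where i: "i < n" "(T ^^ k) y \<in> grid n i" and
    i3: "\<forall>j. (T ^^ k) y \<in> grid n j \<longrightarrow> j = i" by (elim exE conjE) (rule that; assumption)
   have "(\<Sum>j<n. c j * of_bool ((T ^^ k) y \<in> grid n j)) = (\<Sum>j<n. if j = i then c i else 0)"
   proof (rule sum.cong)
    fix j
    show "c j * of_bool ((T ^^ k) y \<in> grid n j) = (if j = i then c i else 0)"
    proof (cases "j = i")
     case True
     have "(of_bool ((T ^^ k) y \<in> grid n i) :: real) = 1" using i(2) by (simp only: of_bool_def if_True)
     then show ?thesis unfolding True by (simp only: if_True mult_1_right refl)
    next
     case False
     then have "(T ^^ k) y \<notin> grid n j" using i3 by metis
     then have "(of_bool ((T ^^ k) y \<in> grid n j) :: real) = 0" by (simp only: of_bool_def if_False)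
     then show ?thesis using False by (simp only: if_False mult_zero_right)
    qed
   qed simp
   also have "\<dots> = c i" using i(1) by simp
   also have "\<dots> \<le> f ((T ^^ k) y)" using c(2) i by blast
   finally show "(\<Sum>j<n. c j * of_bool ((T ^^ k) y \<in> grid n j)) \<le> f ((T ^^ k) y)" .
  qed
  finally show ?thesis by (simp add: Sn_def)
 qed
 then show ?thesis using K' by blast
qed

abbreviation recips_near :: "(nat \<Rightarrow> real) \<Rightarrow> real \<Rightarrow> nat \<Rightarrow> real \<Rightarrow> real \<Rightarrow> bool" where
 "recips_near p a N M \<epsilon> \<equiv> \<bar>(\<Sum>k<N. 1 / max (p k) a - 1) - real N * M\<bar> \<le> \<epsilon> * (real N * M)"

text \<open>For distances down to \<open>t powr (\<epsilon> - 1)\<close> equidistribution asks for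
  \<open>t powr (1 - \<epsilon>\<^sup>2)\<close> steps, which is less than
  \<open>\<kappa> * t\<close> for large \<open>t\<close>. The layer cake formula then turns the
  counts into a logarithm.\<close>

lemma recip_uniform:
 assumes \<epsilon>: "0 < \<epsilon>" "\<epsilon> < 1" and \<kappa>: "0 < \<kappa>"
 shows "eventually (\<lambda>t. \<forall>N y. \<kappa> * t \<le> real N \<and> y \<in> {0..<1} \<longrightarrow>
  recips_near (\<lambda>k. (T ^^ k) y) (t powr (\<epsilon> - 1)) N ((1 - \<epsilon>) * ln t) \<epsilon> \<and>
  recips_near (\<lambda>k. 1 - (T ^^ k) y) (t powr (\<epsilon> - 1)) N ((1 - \<epsilon>) * ln t) \<epsilon>) at_top"
proof -
 obtain \<delta>0 where \<delta>0: "0 < \<delta>0" and E0: "\<forall>\<delta> u v N y.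
   0 < \<delta> \<and> \<delta> < \<delta>0 \<and> 0 \<le> u \<and> v \<le> 1 \<and> \<delta> \<le> v - u \<and> \<delta> powr (- 1 - \<epsilon>) \<le> real N \<and> y \<in> {0..<1} \<longrightarrow>
   \<bar>visits T {u..<v} N y - real N * (v - u)\<bar> \<le> \<epsilon> * (real N * (v - u))"
  using equi[unfolded equidistributed_def, rule_format, OF \<epsilon>(1)] by (elim exE conjE) (rule that; assumption)
 have E: "\<bar>visits T {u..<v} N y - real N * (v - u)\<bar> \<le> \<epsilon> * (real N * (v - u))"
  if "0 < \<delta>" "\<delta> < \<delta>0" "0 \<le> u" "v \<le> 1" "\<delta> \<le> v - u" "\<delta> powr (- 1 - \<epsilon>) \<le> real N" "y \<in> {0..<1}" for \<delta> u v N y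
  using E0[rule_format, OF conjI[OF that(1) conjI[OF that(2) conjI[OF that(3) conjI[OF that(4) conjI[OF that(5) conjI[OF that(6) that(7)]]]]]]] .
 have "((\<lambda>t. t powr (\<epsilon> - 1)) \<longlongrightarrow> 0) at_top" using \<epsilon> by real_asymp
 then have e1: "eventually (\<lambda>t. t powr (\<epsilon> - 1) < \<delta>0) at_top" using \<delta>0 by (rule order_tendstoD(2))
 have "((\<lambda>t. t powr (1 - \<epsilon>\<^sup>2) / t) \<longlongrightarrow> 0) at_top" using \<epsilon> by real_asymp
 then have e2: "eventually (\<lambda>t. t powr (1 - \<epsilon>\<^sup>2) / t < \<kappa>) at_top" using \<kappa> by (rule order_tendstoD(2))
 show ?thesis
  using e1 e2 eventually_gt_at_top[of 1]
 proof eventually_elim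
  case (elim t)
  define a where "a = t powr (\<epsilon> - 1)"
  have t: "1 < t" using elim by simp
  have a: "0 < a" "a \<le> 1" using t \<epsilon> by (auto simp: a_def intro!: less_imp_le[OF powr_less_one])
  have la: "ln (1 / a) = (1 - \<epsilon>) * ln t" using t by (simp add: a_def ln_div ln_powr algebra_simps)
  have pw: "a powr (- 1 - \<epsilon>) = t powr (1 - \<epsilon>\<^sup>2)"
   unfolding a_def powr_powr by (simp add: algebra_simps power2_eq_square)
  have main: "recips_near (\<lambda>k. (T ^^ k) y) a N (ln (1 / a)) \<epsilon> \<and>
    recips_near (\<lambda>k. 1 - (T ^^ k) y) a N (ln (1 / a)) \<epsilon>"
   if N: "\<kappa> * t \<le> real N" and y: "y \<in> {0..<1}" for N y
  proof
   have "t powr (1 - \<epsilon>\<^sup>2) \<le> \<kappa> * t" using elim t by (simp add: field_simps)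
   then have aN: "a powr (- 1 - \<epsilon>) \<le> real N" using N unfolding pw by linarith
   have yk: "(T ^^ k) y \<in> {0..<1}" for k by (rule pow_in[OF y])
   have v: "\<bar>visits T {u..<v} N y - real N * (v - u)\<bar> \<le> \<epsilon> * (real N * (v - u))"
    if "0 \<le> u" "v \<le> 1" "a \<le> v - u" for u v
    using E[OF a(1) _ that aN y] elim by (simp add: a_def)
   show "recips_near (\<lambda>k. (T ^^ k) y) a N (ln (1 / a)) \<epsilon>"
   proof (rule recip_sum[OF a, where q = "\<lambda>k \<delta>. (T ^^ k) y \<in> {0..<\<delta>}"])
    show "\<bar>(\<Sum>k<N. of_bool ((T ^^ k) y \<in> {0..<\<delta>})) - real N * \<delta>\<bar> \<le> \<epsilon> * (real N * \<delta>)"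
     if "a \<le> \<delta>" "\<delta> \<le> 1" for \<delta>
     using v[of 0 \<delta>] that unfolding visits_def by (simp only: diff_zero order_refl)
   qed (use yk in \<open>auto intro: less_imp_le\<close>)
   show "recips_near (\<lambda>k. 1 - (T ^^ k) y) a N (ln (1 / a)) \<epsilon>"
   proof (rule recip_sum[OF a, where q = "\<lambda>k \<delta>. (T ^^ k) y \<in> {1 - \<delta>..<1}"])
    show "\<bar>(\<Sum>k<N. of_bool ((T ^^ k) y \<in> {1 - \<delta>..<1})) - real N * \<delta>\<bar> \<le> \<epsilon> * (real N * \<delta>)"
     if "a \<le> \<delta>" "\<delta> \<le> 1" for \<delta>
    proof -
     have "1 - (1 - \<delta>) = \<delta>" by simp
     then show ?thesis using v[of "1 - \<delta>" 1] that unfolding visits_def by (simp only: diff_ge_0_iff_ge order_refl)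
    qed
    show "((T ^^ k) y \<in> {1 - \<delta>..<1}) = (1 - (T ^^ k) y < \<delta>)" if "\<delta> \<noteq> 1 - (T ^^ k) y" for k \<delta>
     using yk[of k] that by auto
    show "0 \<le> 1 - (T ^^ k) y \<and> 1 - (T ^^ k) y \<le> 1" for k using yk[of k] by auto
   qed
  qed
  show ?case by (intro allI impI, elim conjE, rule main[unfolded la, unfolded a_def]; assumption)
 qed
qed

lemma markov_sum:
 assumes g: "g \<in> borel_measurable unit_leb" and int: "(\<integral>\<^sup>+x. g x \<partial>unit_leb) \<le> ennreal I" and I: "0 \<le> I" and c: "0 < c"
  and A: "A \<in> sets unit_leb" "\<And>x. x \<in> A \<Longrightarrow> ennreal c \<le> (\<Sum>k<n. g ((T ^^ k) x))"
 shows "measure lborel A \<le> real n * I / c"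
proof -
 have "ennreal c * emeasure unit_leb A = (\<integral>\<^sup>+x. ennreal c * indicator A x \<partial>unit_leb)"
  using A(1) by (simp add: nn_integral_cmult_indicator)
 also have "\<dots> \<le> (\<integral>\<^sup>+x. (\<Sum>k<n. g ((T ^^ k) x)) \<partial>unit_leb)"
  using A(2) by (intro nn_integral_mono) (auto simp: indicator_def)
 also have "\<dots> = (\<Sum>k<n. \<integral>\<^sup>+x. g ((T ^^ k) x) \<partial>unit_leb)"
  by (intro nn_integral_sum measurable_compose[OF pow_meas g])
 also have "\<dots> = of_nat n * (\<integral>\<^sup>+x. g x \<partial>unit_leb)" by (simp add: nn_integral_pow[OF g])
 also have "\<dots> \<le> of_nat n * ennreal I" using int by (intro mult_left_mono) auto
 also have "\<dots> = ennreal (real n * I)" by (simp add: ennreal_mult ennreal_of_nat_eq_real_of_nat I)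
 finally have *: "ennreal c * emeasure unit_leb A \<le> ennreal (real n * I)" .
 have Ab: "A \<in> sets borel" "A \<subseteq> {0..<1}" using A(1) by (auto simp: sets_restrict_space_iff)
 have e: "emeasure unit_leb A = emeasure lborel A" using Ab by (intro emeasure_restrict_space) auto
 have "emeasure lborel A \<le> emeasure lborel {0..<1::real}" using Ab by (intro emeasure_mono) auto
 then have "emeasure lborel A = ennreal (measure lborel A)"
  by (intro emeasure_eq_ennreal_measure) (auto simp: top_unique)
 then have "ennreal (c * measure lborel A) \<le> ennreal (real n * I)"
  using * c by (simp add: e ennreal_mult)
 then have "c * measure lborel A \<le> real n * I" using I by (simp add: ennreal_le_iff)
 then show ?thesis using c by (simp add: field_simps)
qed

end

abbreviation cut :: "real \<Rightarrow> real \<Rightarrow> real" where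
 "cut a x \<equiv> if x < 2 * a then 1 / x else 0"

text \<open>The cap at \<open>a\<close> matters only when \<open>p k < a\<close>. Then
  \<open>q k < 2 * a\<close>, and the nearby point pays for the term, as \<open>1 / p k\<close> is
  at most twice \<open>1 / q k\<close>.\<close>

lemma recip_excess:
 fixes p q :: "nat \<Rightarrow> real"
 assumes a: "0 < a" and pq: "\<And>k. k < N \<Longrightarrow> 0 < p k \<and> 0 < q k \<and> q k \<le> 2 * p k \<and> \<bar>p k - q k\<bar> \<le> a"
  and X: "(\<Sum>k<N. cut a (q k)) \<le> X"
 shows "\<bar>(\<Sum>k<N. 1 / p k) - real N - (\<Sum>k<N. 1 / max (p k) a - 1)\<bar> \<le> 2 * X"
proof -
 have e: "(\<Sum>k<N. 1 / p k) - real N - (\<Sum>k<N. 1 / max (p k) a - 1) = (\<Sum>k<N. 1 / p k - 1 / max (p k) a)"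
  by (simp add: sum_subtractf)
 have b: "0 \<le> 1 / p k - 1 / max (p k) a \<and> 1 / p k - 1 / max (p k) a \<le> 2 * (cut a (q k))"
  if k: "k < N" for k
 proof (cases "p k < a")
  case True
  then have "q k < 2 * a" using pq[OF k] by linarith
  moreover have "1 / a \<le> 1 / p k" using True pq[OF k] by (simp add: frac_le)
  moreover have "1 / p k \<le> 2 * (1 / q k)" using pq[OF k] by (simp add: field_simps)
  moreover have "0 \<le> 1 / p k" "0 < 1 / a" using a pq[OF k] by simp_all
  moreover have "max (p k) a = a" using True by simp
  ultimately show ?thesis by (simp only: if_True) linarith
 next
  case False
  then show ?thesis using pq[OF k] by (simp add: max_def)
 qed
 have "0 \<le> (\<Sum>k<N. 1 / p k - 1 / max (p k) a)" using b by (intro sum_nonneg) auto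
 moreover have "(\<Sum>k<N. 1 / p k - 1 / max (p k) a) \<le> (\<Sum>k<N. 2 * (cut a (q k)))"
  using b by (intro sum_mono) auto
 moreover have "\<dots> \<le> 2 * X" using X by (simp only: sum_distrib_left[symmetric])
 ultimately show ?thesis unfolding e by linarith
qed

lemma recip_sum_estimate:
 fixes P R N L \<epsilon> \<sigma> X :: real
 assumes "\<bar>P - N - R\<bar> \<le> 2 * X" "\<bar>R - N * ((1 - \<epsilon>) * L)\<bar> \<le> \<epsilon> * (N * ((1 - \<epsilon>) * L))"
  and "0 \<le> N" "0 < L" "0 \<le> \<epsilon>" "1 \<le> \<sigma> / 4 * L" "\<epsilon> \<le> \<sigma> / 4" "X \<le> \<sigma> / 8 * (N * L)"
 shows "\<bar>P - N * L\<bar> \<le> \<sigma> * (N * L)"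
proof -
 have NL: "0 \<le> N * L" using assms by simp
 have 1: "N \<le> \<sigma> / 4 * (N * L)" using mult_left_mono[OF assms(6) assms(3)] by (simp add: mult_ac)
 have 2: "\<epsilon> * (N * L) \<le> \<sigma> / 4 * (N * L)" using assms(7) NL by (rule mult_right_mono)
 have 3: "N * ((1 - \<epsilon>) * L) = N * L - \<epsilon> * (N * L)" by (simp add: algebra_simps)
 have "\<epsilon> * (N * ((1 - \<epsilon>) * L)) \<le> \<epsilon> * (N * L)" unfolding 3 using NL assms(5) by (intro mult_left_mono) auto
 with assms(1,2,8) 1 2 show ?thesis unfolding 3 using assms(3) by linarith
qed

section \<open>Birkhoff sums of the derivative\<close>

context asym_flow
begin

abbreviation "\<Delta> \<equiv> Cm - Cp"

text \<open>The points \<open>q k\<close> stand for the orbit of a nearby point that does not come too close to the ends.\<close>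

definition deriv_control :: "real \<Rightarrow> real \<Rightarrow> real \<Rightarrow> real \<Rightarrow> real \<Rightarrow> bool" where
 "deriv_control \<kappa> \<eta> \<epsilon> \<theta> t \<longleftrightarrow> (\<forall>N x q.
  \<kappa> * t \<le> real N \<and> x \<in> {0..<1} \<and>
  (\<forall>k<N. 0 < (T ^^ k) x \<and> 0 < q k \<and> q k < 1 \<and> q k \<le> 2 * (T ^^ k) x \<and> 1 - q k \<le> 2 * (1 - (T ^^ k) x) \<and>
    \<bar>(T ^^ k) x - q k\<bar> \<le> t powr (\<epsilon> - 1)) \<and>
  (\<Sum>k<N. cut (t powr (\<epsilon> - 1)) (q k)) \<le> \<theta> * (t * ln t) \<and>
  (\<Sum>k<N. cut (t powr (\<epsilon> - 1)) (1 - q k)) \<le> \<theta> * (t * ln t) \<longrightarrow>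
  \<bar>(\<Sum>k<N. deriv f ((T ^^ k) x)) - \<Delta> * (real N * ln t)\<bar> \<le> \<eta> * (real N * ln t))"

text \<open>Both reciprocal sums are close to \<open>N * ln t\<close>, and
  \<open>deriv_expansion\<close> combines them with the coefficients \<open>- Cp\<close> and
  \<open>Cm\<close>. This is the place where equal constants would cancel the main term.\<close>

lemma deriv_sum:
 assumes \<eta>: "0 < \<eta>" and \<kappa>: "0 < \<kappa>"
 shows "\<exists>\<sigma>>0. \<forall>\<epsilon> \<theta>. 0 < \<epsilon> \<and> \<epsilon> < 1 \<and> \<epsilon> \<le> \<sigma> \<and> 0 < \<theta> \<and> \<theta> \<le> \<sigma> \<longrightarrow> eventually (deriv_control \<kappa> \<eta> \<epsilon> \<theta>) at_top"
proof -
 have "0 < \<eta> / 16" using \<eta> by simp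
 from deriv_expansion[OF C2 Cpm(1,2) lim0 lim1 this] obtain K where K: "0 \<le> K"
  and exp: "\<And>x. x \<in> {0<..<1} \<Longrightarrow> \<bar>deriv f x + Cp / x - Cm / (1 - x)\<bar> \<le> \<eta> / 16 * (1 / x + 1 / (1 - x)) + K"
  by blast
 define \<sigma>1 where "\<sigma>1 = min 1 (\<eta> / (4 * (Cp + Cm)))"
 have \<sigma>1: "0 < \<sigma>1" "\<sigma>1 \<le> 1" using \<eta> Cpm by (auto simp: \<sigma>1_def)
 have "\<sigma>1 \<le> \<eta> / (4 * (Cp + Cm))" by (simp add: \<sigma>1_def)
 then have \<sigma>1C: "(Cp + Cm) * \<sigma>1 \<le> \<eta> / 4" using Cpm by (simp add: field_simps)
 \<comment> \<open>Since \<open>\<kappa> * t \<le> N\<close>, the second bound turns the allowance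
   \<open>\<theta> * (t * ln t)\<close> for close visits into a small share of
   \<open>N * ln t\<close>.\<close>
 define \<sigma> where "\<sigma> = min (\<sigma>1 / 4) (\<sigma>1 * \<kappa> / 8)"
 have \<sigma>: "0 < \<sigma>" "\<sigma> \<le> \<sigma>1 / 4" "\<sigma> \<le> \<sigma>1 * \<kappa> / 8" using \<sigma>1 \<kappa> by (auto simp: \<sigma>_def)
 show ?thesis
 proof (intro exI[of _ \<sigma>] conjI \<sigma>(1) allI impI)
  fix \<epsilon> \<theta> :: real assume h: "0 < \<epsilon> \<and> \<epsilon> < 1 \<and> \<epsilon> \<le> \<sigma> \<and> 0 < \<theta> \<and> \<theta> \<le> \<sigma>"
  have e1: "eventually (\<lambda>t. 4 / \<sigma>1 < ln t) at_top" by real_asymp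
  have e2: "eventually (\<lambda>t. 4 * K / \<eta> < ln t) at_top" by real_asymp
  have e3: "eventually (\<lambda>t::real. 1 < t) at_top" by (rule eventually_gt_at_top)
  have h': "0 < \<epsilon>" "\<epsilon> < 1" using h by auto
  show "eventually (deriv_control \<kappa> \<eta> \<epsilon> \<theta>) at_top"
   unfolding deriv_control_def[abs_def] using e1 e2 e3 recip_uniform[OF h' \<kappa>]
  proof eventually_elim
   case (elim t)
   note L4 = elim(1) and LK = elim(2) and t = elim(3) and R = elim(4)
   show ?case
   proof (intro allI impI, elim conjE)
   fix N :: nat and x :: real and q :: "nat \<Rightarrow> real"
   assume N: "\<kappa> * t \<le> real N" and x: "x \<in> {0..<1}"
    and q: "\<forall>k<N. 0 < (T ^^ k) x \<and> 0 < q k \<and> q k < 1 \<and> q k \<le> 2 * (T ^^ k) x \<and> 1 - q k \<le> 2 * (1 - (T ^^ k) x) \<and>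
     \<bar>(T ^^ k) x - q k\<bar> \<le> t powr (\<epsilon> - 1)"
    and X0: "(\<Sum>k<N. cut (t powr (\<epsilon> - 1)) (q k)) \<le> \<theta> * (t * ln t)"
    and X1: "(\<Sum>k<N. cut (t powr (\<epsilon> - 1)) (1 - q k)) \<le> \<theta> * (t * ln t)"
   define L where "L = ln t"
   define a where "a = t powr (\<epsilon> - 1)"
   have L: "0 < L" using t by (simp add: L_def)
   have a: "0 < a" using t by (simp add: a_def)
   have x1: "(T ^^ k) x < 1" for k using pow_in[OF x, of k] by simp
   define P Q where "P = (\<Sum>k<N. 1 / (T ^^ k) x)" and "Q = (\<Sum>k<N. 1 / (1 - (T ^^ k) x))"
   have Xb: "\<theta> * (t * L) \<le> \<sigma>1 / 8 * (real N * L)"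
   proof -
    have "\<theta> * (t * L) \<le> \<sigma>1 * \<kappa> / 8 * (t * L)" using h \<sigma>(3) t L by (intro mult_right_mono) auto
    also have "\<dots> = \<sigma>1 / 8 * ((\<kappa> * t) * L)" by simp
    also have "\<dots> \<le> \<sigma>1 / 8 * (real N * L)" using N \<sigma>1 L by (intro mult_left_mono mult_right_mono) auto
    finally show ?thesis .
   qed
   have L4': "1 \<le> \<sigma>1 / 4 * L" using L4 \<sigma>1 by (simp add: L_def field_simps)
   have \<epsilon>\<sigma>: "\<epsilon> \<le> \<sigma>1 / 4" "0 \<le> \<epsilon>" using h \<sigma> by auto
   note RN = conjunct1[OF R[rule_format, OF conjI[OF N x], folded L_def a_def]]
    conjunct2[OF R[rule_format, OF conjI[OF N x], folded L_def a_def]]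
   have Pe: "\<bar>P - real N - (\<Sum>k<N. 1 / max ((T ^^ k) x) a - 1)\<bar> \<le> 2 * (\<theta> * (t * L))"
    unfolding P_def
    by (rule recip_excess[OF a, where q = q]) (use q X0 in \<open>auto simp: a_def L_def\<close>)
   have "1 - (T ^^ k) x - (1 - q k) = - ((T ^^ k) x - q k)" for k by simp
   then have c: "\<bar>1 - (T ^^ k) x - (1 - q k)\<bar> = \<bar>(T ^^ k) x - q k\<bar>" for k by (simp only: abs_minus_cancel)
   have Qe: "\<bar>Q - real N - (\<Sum>k<N. 1 / max (1 - (T ^^ k) x) a - 1)\<bar> \<le> 2 * (\<theta> * (t * L))"
    unfolding Q_def
   proof (rule recip_excess[OF a, where q = "\<lambda>k. 1 - q k"])
    show "0 < 1 - (T ^^ k) x \<and> 0 < 1 - q k \<and> 1 - q k \<le> 2 * (1 - (T ^^ k) x) \<and> \<bar>1 - (T ^^ k) x - (1 - q k)\<bar> \<le> a" if "k < N" for k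
     using q that x1[of k] unfolding c a_def by auto
   qed (use X1 in \<open>simp add: a_def L_def\<close>)
   have PN: "\<bar>P - real N * L\<bar> \<le> \<sigma>1 * (real N * L)"
    by (rule recip_sum_estimate[OF Pe RN(1) _ L \<epsilon>\<sigma>(2) L4' \<epsilon>\<sigma>(1) Xb]) simp
   have QN: "\<bar>Q - real N * L\<bar> \<le> \<sigma>1 * (real N * L)"
    by (rule recip_sum_estimate[OF Qe RN(2) _ L \<epsilon>\<sigma>(2) L4' \<epsilon>\<sigma>(1) Xb]) simp
   define DS where "DS = (\<Sum>k<N. deriv f ((T ^^ k) x))"
   have x01: "(T ^^ k) x \<in> {0<..<1}" if "k < N" for k
    using conjunct1[OF q[rule_format, OF that]] x1[of k] by simp
   have D0: "DS + Cp * P - Cm * Q = (\<Sum>k<N. deriv f ((T ^^ k) x) + Cp / (T ^^ k) x - Cm / (1 - (T ^^ k) x))"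
    by (simp add: DS_def P_def Q_def sum.distrib sum_subtractf sum_distrib_left)
   have "\<bar>DS + Cp * P - Cm * Q\<bar> \<le> (\<Sum>k<N. \<bar>deriv f ((T ^^ k) x) + Cp / (T ^^ k) x - Cm / (1 - (T ^^ k) x)\<bar>)"
    unfolding D0 by (rule sum_abs)
   also have "\<dots> \<le> (\<Sum>k<N. \<eta> / 16 * (1 / (T ^^ k) x + 1 / (1 - (T ^^ k) x)) + K)"
    by (rule sum_mono, rule exp, rule x01) simp
   also have "\<dots> = \<eta> / 16 * (P + Q) + K * real N"
    by (simp add: P_def Q_def sum.distrib sum_distrib_left distrib_left)
   finally have D1: "\<bar>DS + Cp * P - Cm * Q\<bar> \<le> \<eta> / 16 * (P + Q) + K * real N" .
   have NL: "0 \<le> real N * L" using L by simp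
   have "\<sigma>1 * (real N * L) \<le> 1 * (real N * L)" using \<sigma>1 NL by (intro mult_right_mono) auto
   then have "P + Q \<le> 4 * (real N * L)" using PN QN by linarith
   then have D2: "\<eta> / 16 * (P + Q) \<le> \<eta> / 16 * (4 * (real N * L))" using \<eta> by (intro mult_left_mono) auto
   have "K \<le> \<eta> / 4 * L" using LK \<eta> by (simp add: L_def field_simps)
   then have D3: "K * real N \<le> \<eta> / 4 * L * real N" by (intro mult_right_mono) auto
   have D4: "\<bar>Cp * (P - real N * L)\<bar> \<le> Cp * (\<sigma>1 * (real N * L))" "\<bar>Cm * (Q - real N * L)\<bar> \<le> Cm * (\<sigma>1 * (real N * L))"
    using PN QN Cpm by (simp_all add: abs_mult)
   have D5: "(Cp + Cm) * \<sigma>1 * (real N * L) \<le> \<eta> / 4 * (real N * L)" using \<sigma>1C NL by (rule mult_right_mono)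
   have "DS - \<Delta> * (real N * L) = (DS + Cp * P - Cm * Q) - Cp * (P - real N * L) + Cm * (Q - real N * L)"
    by (simp add: algebra_simps)
   then have "\<bar>DS - \<Delta> * (real N * L)\<bar>
     \<le> \<bar>DS + Cp * P - Cm * Q\<bar> + \<bar>Cp * (P - real N * L)\<bar> + \<bar>Cm * (Q - real N * L)\<bar>" by linarith
   also have "\<dots> \<le> \<eta> / 4 * (real N * L) + \<eta> / 4 * (real N * L) + (Cp + Cm) * \<sigma>1 * (real N * L)"
   proof -
    have "Cp * (\<sigma>1 * (real N * L)) + Cm * (\<sigma>1 * (real N * L)) = (Cp + Cm) * \<sigma>1 * (real N * L)"
     "\<eta> / 16 * (4 * (real N * L)) = \<eta> / 4 * (real N * L)" "\<eta> / 4 * L * real N = \<eta> / 4 * (real N * L)"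
     by (simp_all add: algebra_simps)
    then show ?thesis using D1 D2 D3 D4 by linarith
   qed
   also have "\<dots> \<le> \<eta> * (real N * L)" using D5 NL \<eta> mult_nonneg_nonneg[of "\<eta>/4" "real N * L"] by linarith
   finally show "\<bar>(\<Sum>k<N. deriv f ((T ^^ k) x)) - \<Delta> * (real N * ln t)\<bar> \<le> \<eta> * (real N * ln t)"
    unfolding DS_def L_def .
   qed
  qed
 qed
qed

lemma orbit_translate:
 assumes y: "y \<in> {0..<1}" and far: "\<And>k p. k < n \<Longrightarrow> p \<in> D \<Longrightarrow> \<tau> \<le> \<bar>(T ^^ k) y - p\<bar>"
  and x: "x \<in> {0..<1}" "\<bar>x - y\<bar> < \<tau>" and "k \<le> n"
 shows "(T ^^ k) x = (T ^^ k) y + (x - y)"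
 using \<open>k \<le> n\<close>
proof (induction k)
 case (Suc k)
 then have IH: "(T ^^ k) x = (T ^^ k) y + (x - y)" and k: "k < n" by simp_all
 have xk: "(T ^^ k) x \<in> {0..<1}" and yk: "(T ^^ k) y \<in> {0..<1}" using pow_in x y by blast+
 have "T ((T ^^ k) x) - T ((T ^^ k) y) = (T ^^ k) x - (T ^^ k) y"
 proof (cases "(T ^^ k) y \<le> (T ^^ k) x")
  case True
  have "p \<notin> {(T ^^ k) y<..(T ^^ k) x}" if "p \<in> D" for p
   using far[OF k that] x(2) IH by (simp add: abs_le_iff abs_if split: if_splits)
  then have "{(T ^^ k) y<..(T ^^ k) x} \<inter> D = {}" by blast
  then show ?thesis using T_trans[of "(T ^^ k) y" "(T ^^ k) x"] True xk yk by auto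
 next
  case False
  have "p \<notin> {(T ^^ k) x<..(T ^^ k) y}" if "p \<in> D" for p
   using far[OF k that] x(2) IH by (simp add: abs_le_iff abs_if split: if_splits)
  then have "{(T ^^ k) x<..(T ^^ k) y} \<inter> D = {}" by blast
  then have "T ((T ^^ k) y) - T ((T ^^ k) x) = (T ^^ k) y - (T ^^ k) x"
   using T_trans[of "(T ^^ k) x" "(T ^^ k) y"] False xk yk by auto
  then show ?thesis by simp
 qed
 then show ?case using IH by simp
qed simp

text \<open>Orbits starting near \<open>y\<close> run parallel to that of \<open>y\<close> and meet
  neither a discontinuity nor an end. So the Birkhoff sum is differentiable there, and the mean
  value theorem applies.\<close>

lemma Sn_variation:
 assumes y: "y \<in> {0..<1}" and far: "\<And>k p. k < n \<Longrightarrow> p \<in> D \<union> {0, 1} \<Longrightarrow> \<tau> \<le> \<bar>(T ^^ k) y - p\<bar>"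
  and r: "0 < r" "r \<le> n" and w: "w < \<tau>" and xx: "x < x'" "\<bar>x - y\<bar> \<le> w" "\<bar>x' - y\<bar> \<le> w"
 shows "\<exists>z. \<bar>z - y\<bar> \<le> w \<and> z \<in> {0..<1} \<and> Sn r x' - Sn r x = (x' - x) * (\<Sum>k<r. deriv f ((T ^^ k) z))"
proof -
 have yk: "(T ^^ k) y \<in> {0..<1}" for k using pow_in y by blast
 have far': "\<tau> \<le> (T ^^ k) y" "\<tau> \<le> 1 - (T ^^ k) y" if "k < n" for k
  using far[OF that, of 0] far[OF that, of 1] yk[of k] by auto
 have "0 < n" using r by simp
 from far'[OF this] have y0: "\<tau> \<le> y" "\<tau> \<le> 1 - y" by simp_all
 have in01: "z \<in> {0..<1}" if "\<bar>z - y\<bar> \<le> w" for z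
  using that y0 w by (auto simp: abs_le_iff)
 have tr: "(T ^^ k) z = (T ^^ k) y + (z - y)" if "\<bar>z - y\<bar> \<le> w" "k \<le> n" for z k
  by (rule orbit_translate[OF y _ in01[OF that(1)] _ that(2), of \<tau>]) (use far that w in auto)
 define G where "G z = (\<Sum>k<r. f ((T ^^ k) y + (z - y)))" for z
 have Geq: "Sn r z = G z" if "\<bar>z - y\<bar> \<le> w" for z
  unfolding Sn_def G_def using tr[OF that] r by (intro sum.cong) auto
 have bet: "\<bar>z - y\<bar> \<le> w" if "x \<le> z" "z \<le> x'" for z using that xx by (auto simp: abs_le_iff)
 have Gd: "(G has_real_derivative (\<Sum>k<r. deriv f ((T ^^ k) z))) (at z)" if z: "x \<le> z" "z \<le> x'" for z
 proof -
  have "((\<lambda>z. f ((T ^^ k) y + (z - y))) has_real_derivative deriv f ((T ^^ k) z)) (at z)" if "k < r" for k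
  proof -
   have k: "k \<le> n" "k < n" using that r by auto
   have e: "(T ^^ k) z = (T ^^ k) y + (z - y)" using tr[OF bet[OF z] k(1)] .
   have "(T ^^ k) z \<in> {0<..<1}" unfolding e using far'[OF k(2)] bet[OF z] w by (auto simp: abs_le_iff)
   then have "(f has_real_derivative deriv f ((T ^^ k) z)) (at ((T ^^ k) y + (z - y)))"
    using f_deriv unfolding e by blast
   moreover have "((\<lambda>z. (T ^^ k) y + (z - y)) has_real_derivative 1) (at z)"
    by (auto intro!: derivative_eq_intros)
   ultimately show ?thesis using DERIV_chain2[of f "deriv f ((T ^^ k) z)" "\<lambda>z. (T ^^ k) y + (z - y)" z 1 UNIV] by simp
  qed
  then show ?thesis unfolding G_def by (intro DERIV_sum) auto
 qed
 obtain z where z: "x < z" "z < x'" "G x' - G x = (x' - x) * (\<Sum>k<r. deriv f ((T ^^ k) z))"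
  using MVT2[OF xx(1), of G "\<lambda>z. \<Sum>k<r. deriv f ((T ^^ k) z)"] Gd by blast
 show ?thesis
  using z bet[of z] in01[of z] Geq[OF xx(2)] Geq[OF xx(3)] by (intro exI[of _ z]) auto
qed

end

section \<open>Most points are good\<close>

context asym_flow
begin

lemma markov_real:
 assumes h: "h \<in> borel_measurable unit_leb" "\<And>x. 0 \<le> h x"
  and int: "(\<integral>\<^sup>+x. ennreal (h x) \<partial>unit_leb) \<le> ennreal I" and I: "0 \<le> I" and c: "0 < c"
 shows "{x \<in> {0..<1}. c \<le> (\<Sum>k<n. h ((T ^^ k) x))} \<in> sets unit_leb"
  and "measure lborel {x \<in> {0..<1}. c \<le> (\<Sum>k<n. h ((T ^^ k) x))} \<le> real n * I / c"
proof -
 have s: "(\<lambda>x. \<Sum>k<n. h ((T ^^ k) x)) \<in> borel_measurable unit_leb"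
  by (intro borel_measurable_sum measurable_compose[OF pow_meas h(1)])
 have "{x \<in> space unit_leb. c \<le> (\<Sum>k<n. h ((T ^^ k) x))} \<in> sets unit_leb"
  using s by measurable
 then show A: "{x \<in> {0..<1}. c \<le> (\<Sum>k<n. h ((T ^^ k) x))} \<in> sets unit_leb" by (simp only: space_unit)
 show "measure lborel {x \<in> {0..<1}. c \<le> (\<Sum>k<n. h ((T ^^ k) x))} \<le> real n * I / c"
 proof (rule markov_sum[where g = "\<lambda>x. ennreal (h x)", OF _ int I c A])
  show "(\<lambda>x. ennreal (h x)) \<in> borel_measurable unit_leb" using h(1) by measurable
  show "ennreal c \<le> (\<Sum>k<n. ennreal (h ((T ^^ k) x)))" if "x \<in> {x \<in> {0..<1}. c \<le> (\<Sum>k<n. h ((T ^^ k) x))}" for x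
  proof -
   have "c \<le> (\<Sum>k<n. h ((T ^^ k) x))" using that by simp
   then have "ennreal c \<le> ennreal (\<Sum>k<n. h ((T ^^ k) x))" by (rule ennreal_leI)
   then show ?thesis using h(2) by (simp add: sum_ennreal)
  qed
 qed
qed

lemma nn_integral_unit_le:
 assumes "g \<in> borel_measurable borel" "\<And>x. 0 \<le> g x" "u \<le> v" "\<And>x. x \<in> {u..v} \<Longrightarrow> (G has_real_derivative g' x) (at x)"
  "\<And>x. x \<in> {u..v} \<Longrightarrow> g x \<le> g' x" "\<And>x. x \<notin> {u..v} \<Longrightarrow> g x = 0" "g' \<in> borel_measurable borel"
 shows "(\<integral>\<^sup>+x. ennreal (g x) \<partial>unit_leb) \<le> ennreal (G v - G u)"
proof -
 have "(\<integral>\<^sup>+x. ennreal (g x) \<partial>unit_leb) = (\<integral>\<^sup>+x. ennreal (g x) * indicator {0..<1} x \<partial>lborel)"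
  by (subst nn_integral_restrict_space) auto
 also have "\<dots> \<le> (\<integral>\<^sup>+x. ennreal (g' x) * indicator {u..v} x \<partial>lborel)"
  using assms(5,6) by (intro nn_integral_mono) (auto simp: indicator_def intro!: ennreal_leI)
 also have "\<dots> = ennreal (G v - G u)"
 proof (rule nn_integral_FTC_Icc)
  show "0 \<le> g' x" if "x \<in> {u..v}" for x using assms(2)[of x] assms(5)[OF that] by auto
 qed (use assms in auto)
 finally show ?thesis .
qed

text \<open>\<open>ww t\<close> is the length of the intervals that get stretched,
  \<open>tt t\<close> the distance kept from discontinuities and ends, and \<open>nn t\<close>
  exceeds the number of passages up to time \<open>t\<close>. As \<open>t * tt t\<close> tends to 0,
  most orbit segments of length \<open>nn t\<close> keep this distance; as
  \<open>ww t * (t * ln t)\<close> is \<open>sqrt (ln t)\<close>, the stretch is unbounded; and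
  \<open>ww t\<close> is small against \<open>tt t\<close>.\<close>

abbreviation "ww t \<equiv> 1 / (t * sqrt (ln t))"
abbreviation "tt t \<equiv> 1 / (t * ln t powr (1 / 4))"
abbreviation "nn t \<equiv> nat \<lfloor>t / m\<rfloor> + 1"

abbreviation clip :: "real \<Rightarrow> real \<Rightarrow> real \<Rightarrow> real" where
 "clip \<tau> a x \<equiv> if \<tau> \<le> x \<and> x < 2 * a then 1 / x else 0"

definition nearsum :: "real \<Rightarrow> real \<Rightarrow> real" where
 "nearsum \<tau> x = (\<Sum>p\<in>D \<union> {0, 1}. of_bool (\<bar>x - p\<bar> < \<tau>))"

text \<open>
 The orbit up to time \<open>nn t\<close> avoids the discontinuities and the ends by \<open>tt t\<close>, its visits very close
 to an end contribute little to the derivatives, and time \<open>t\<close> is not reached in few steps.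
\<close>

definition good :: "real \<Rightarrow> real \<Rightarrow> real \<Rightarrow> real \<Rightarrow> real set" where
 "good \<kappa> \<epsilon> \<theta> t = {0..<1} -
  ({y \<in> {0..<1}. 1 \<le> (\<Sum>k<nn t. nearsum (tt t) ((T ^^ k) y))} \<union>
   {y \<in> {0..<1}. \<theta> * (t * ln t) \<le> (\<Sum>k<nn t. clip (tt t) (t powr (\<epsilon> - 1)) ((T ^^ k) y))} \<union>
   {y \<in> {0..<1}. \<theta> * (t * ln t) \<le> (\<Sum>k<nn t. clip (tt t) (t powr (\<epsilon> - 1)) (1 - (T ^^ k) y))} \<union>
   {y \<in> {0..<1}. t / 2 \<le> (\<Sum>k<nat \<lceil>\<kappa> * t\<rceil>. max 0 (f ((T ^^ k) y)))})"

text \<open>Markov's inequality and the invariance of length bound each of the four exceptional sets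
  by \<open>e / 4\<close>. For close visits the mean of one term is an integral of
  \<open>1 / x\<close> from \<open>tt t\<close> to \<open>2 * t powr (\<epsilon> - 1)\<close>, hence
  of order \<epsilon> * ln t.\<close>

lemma good_measure:
 assumes \<kappa>: "0 < \<kappa>" "\<kappa> \<le> e / 16" and \<epsilon>: "0 < \<epsilon>" "\<epsilon> \<le> e * m * \<theta> / 16" and \<theta>: "0 < \<theta>" and e: "0 < e"
 shows "eventually (\<lambda>t. good \<kappa> \<epsilon> \<theta> t \<in> sets unit_leb \<and> measure lborel ({0..<1} - good \<kappa> \<epsilon> \<theta> t) \<le> e) at_top"
proof -
 define d where "d = real (card (D \<union> {0, 1}))"
 have "((\<lambda>t. (t / m + 1) * (d * (2 * tt t))) \<longlongrightarrow> 0) at_top" using m_pos by real_asymp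
 then have e1: "eventually (\<lambda>t. (t / m + 1) * (d * (2 * tt t)) < e / 4) at_top" using e by (intro order_tendstoD(2)) auto
 have "((\<lambda>t::real. (ln 2 + ln (ln t) / 4) / ln t) \<longlongrightarrow> 0) at_top" by real_asymp
 then have e2: "eventually (\<lambda>t. (ln 2 + ln (ln t) / 4) / ln t < \<epsilon>) at_top" using \<epsilon> by (intro order_tendstoD(2)) auto
 have e3: "eventually (\<lambda>t. m < t) at_top" "eventually (\<lambda>t. 16 / e < t) at_top" by (rule eventually_gt_at_top)+
 have e4: "eventually (\<lambda>t::real. 1 < ln t) at_top" by real_asymp
 show ?thesis
  using e1 e2 e3 e4 eventually_gt_at_top[of 1]
 proof eventually_elim
  case (elim t)
  have t: "1 < t" "1 < ln t" using elim by auto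
  define \<tau> a L where "\<tau> = tt t" and "a = t powr (\<epsilon> - 1)" and "L = ln t"
  have \<tau>: "0 < \<tau>" using t by (simp add: \<tau>_def)
  have L: "1 < L" using t by (simp add: L_def)
  have a: "0 < a" using t by (simp add: a_def)
  have ta: "\<tau> \<le> 2 * a"
  proof -
   have "1 \<le> L powr (1 / 4)" using L by (simp add: ge_one_powr_ge_zero)
   then have "t * 1 \<le> t * L powr (1 / 4)" using t by (intro mult_left_mono) auto
   then have "\<tau> \<le> 1 / t" using t unfolding \<tau>_def L_def by (intro divide_left_mono) auto
   also have "1 / t = t powr (- 1)" using t by (simp add: powr_minus divide_inverse)
   also have "\<dots> \<le> a" unfolding a_def using t \<epsilon> by (intro powr_mono) auto
   finally show ?thesis using a by linarith
  qed
  have lnb: "ln (2 * a) - ln \<tau> \<le> 2 * \<epsilon> * L"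
  proof -
   have "ln \<tau> = - (L + ln L / 4)" unfolding \<tau>_def L_def using t by (simp add: ln_div ln_mult ln_powr)
   moreover have "ln (2 * a) = ln 2 + (\<epsilon> - 1) * L" unfolding a_def L_def using t by (simp add: ln_mult ln_powr)
   moreover have "ln 2 + ln L / 4 \<le> \<epsilon> * L" using elim L by (simp add: L_def field_simps)
   ultimately show ?thesis by (simp add: algebra_simps)
  qed
  have nn1: "real (nn t) \<le> t / m + 1"
   using t m_pos by (simp add: of_nat_nat)
  have nnt: "real (nn t) \<le> 2 * (t / m)" using nn1 elim(3) m_pos by (simp add: field_simps)
  let ?B1 = "{y \<in> {0..<1}. 1 \<le> (\<Sum>k<nn t. nearsum \<tau> ((T ^^ k) y))}"
  let ?B2 = "{y \<in> {0..<1}. \<theta> * (t * L) \<le> (\<Sum>k<nn t. clip \<tau> a ((T ^^ k) y))}"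
  let ?B3 = "{y \<in> {0..<1}. \<theta> * (t * L) \<le> (\<Sum>k<nn t. clip \<tau> a (1 - (T ^^ k) y))}"
  let ?B4 = "{y \<in> {0..<1}. t / 2 \<le> (\<Sum>k<nat \<lceil>\<kappa> * t\<rceil>. max 0 (f ((T ^^ k) y)))}"
  have g: "good \<kappa> \<epsilon> \<theta> t = {0..<1} - (?B1 \<union> ?B2 \<union> ?B3 \<union> ?B4)"
   unfolding good_def \<tau>_def a_def L_def ..
  have tL: "0 < \<theta> * (t * L)" using \<theta> t L by simp
  have m1: "nearsum \<tau> \<in> borel_measurable borel" unfolding nearsum_def by measurable
  have m1': "nearsum \<tau> \<in> borel_measurable unit_leb" using m1 by (simp add: measurable_restrict_space1)
  have i1: "(\<integral>\<^sup>+x. ennreal (nearsum \<tau> x) \<partial>unit_leb) \<le> ennreal (d * (2 * \<tau>))"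
  proof -
   have "(\<integral>\<^sup>+x. ennreal (nearsum \<tau> x) \<partial>unit_leb) = (\<integral>\<^sup>+x. ennreal (nearsum \<tau> x) * indicator {0..<1} x \<partial>lborel)"
    by (subst nn_integral_restrict_space) auto
   also have "\<dots> \<le> (\<integral>\<^sup>+x. (\<Sum>p\<in>D \<union> {0, 1}. indicator {p - \<tau>..p + \<tau>} x) \<partial>lborel)"
   proof (rule nn_integral_mono)
    fix x :: real
    have "ennreal (nearsum \<tau> x) * indicator {0..<1} x \<le> ennreal (nearsum \<tau> x)" by (simp add: indicator_def)
    also have "\<dots> = (\<Sum>p\<in>D \<union> {0, 1}. ennreal (of_bool (\<bar>x - p\<bar> < \<tau>)))" unfolding nearsum_def by (simp add: sum_ennreal)
    also have "\<dots> \<le> (\<Sum>p\<in>D \<union> {0, 1}. indicator {p - \<tau>..p + \<tau>} x)"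
    proof (rule sum_mono)
     fix p show "ennreal (of_bool (\<bar>x - p\<bar> < \<tau>)) \<le> indicator {p - \<tau>..p + \<tau>} x"
      by (cases "\<bar>x - p\<bar> < \<tau>") (auto simp: indicator_def abs_less_iff)
    qed
    finally show "ennreal (nearsum \<tau> x) * indicator {0..<1} x \<le> (\<Sum>p\<in>D \<union> {0, 1}. indicator {p - \<tau>..p + \<tau>} x)" .
   qed
   also have "\<dots> = (\<Sum>p\<in>D \<union> {0, 1}. (\<integral>\<^sup>+x. indicator {p - \<tau>..p + \<tau>} x \<partial>lborel))"
    by (rule nn_integral_sum) simp
   also have "\<dots> = (\<Sum>p\<in>D \<union> {0, 1}. ennreal (2 * \<tau>))" using \<tau> by simp
   also have "\<dots> = ennreal (d * (2 * \<tau>))"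
    using \<tau> by (simp add: d_def ennreal_mult ennreal_of_nat_eq_real_of_nat del: Un_insert_right)
   finally show ?thesis .
  qed
  have d0: "0 \<le> d * (2 * \<tau>)" using \<tau> by (simp add: d_def)
  have B1: "?B1 \<in> sets unit_leb" "measure lborel ?B1 \<le> e / 4"
  proof -
   show "?B1 \<in> sets unit_leb"
    by (rule markov_real(1)[OF m1' _ i1 d0]) (auto simp: nearsum_def sum_nonneg)
   have "measure lborel ?B1 \<le> real (nn t) * (d * (2 * \<tau>)) / 1"
    by (rule markov_real(2)[OF m1' _ i1 d0]) (auto simp: nearsum_def sum_nonneg)
   also have "\<dots> \<le> (t / m + 1) * (d * (2 * \<tau>))" unfolding div_by_1 using nn1 d0 by (rule mult_right_mono)
   also have "\<dots> \<le> e / 4" using elim(1) unfolding \<tau>_def by linarith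
   finally show "measure lborel ?B1 \<le> e / 4" .
  qed
  have I: "0 \<le> 2 * \<epsilon> * L" using \<epsilon> L by simp
  \<comment> \<open>The factors \<open>t * ln t\<close> cancel; this is why \<epsilon> has to be
    small against \<open>e * m * \<theta>\<close>.\<close>
  have B23: "real (nn t) * (2 * \<epsilon> * L) / (\<theta> * (t * L)) \<le> e / 4"
  proof -
   have "real (nn t) * (2 * \<epsilon> * L) / (\<theta> * (t * L)) \<le> 2 * (t / m) * (2 * \<epsilon> * L) / (\<theta> * (t * L))"
    using nnt I tL by (intro divide_right_mono mult_right_mono) auto
   also have "\<dots> = 4 * \<epsilon> / (m * \<theta>)" using t L by (simp add: field_simps)
   also have "\<dots> \<le> e / 4" using \<epsilon>(2) \<theta> m_pos by (simp add: field_simps)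
   finally show ?thesis .
  qed
  have B2: "?B2 \<in> sets unit_leb" "measure lborel ?B2 \<le> e / 4"
  proof -
   let ?h = "\<lambda>x. clip \<tau> a x"
   have hm: "?h \<in> borel_measurable borel" by measurable
   have hm': "?h \<in> borel_measurable unit_leb" using hm by (simp add: measurable_restrict_space1)
   have "(\<integral>\<^sup>+x. ennreal (?h x) \<partial>unit_leb) \<le> ennreal (ln (2 * a) - ln \<tau>)"
    by (rule nn_integral_unit_le[where g' = "\<lambda>x. 1 / x", OF hm _ ta])
     (use \<tau> in \<open>auto intro!: derivative_eq_intros simp: divide_inverse\<close>)
   also have "\<dots> \<le> ennreal (2 * \<epsilon> * L)" using lnb by (rule ennreal_leI)
   finally have hi: "(\<integral>\<^sup>+x. ennreal (?h x) \<partial>unit_leb) \<le> ennreal (2 * \<epsilon> * L)" .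
   have h0: "0 \<le> ?h x" for x using \<tau> by auto
   show "?B2 \<in> sets unit_leb" by (rule markov_real(1)[OF hm' h0 hi I tL])
   show "measure lborel ?B2 \<le> e / 4" by (rule order_trans[OF markov_real(2)[OF hm' h0 hi I tL] B23])
  qed
  have B3: "?B3 \<in> sets unit_leb" "measure lborel ?B3 \<le> e / 4"
  proof -
   let ?h = "\<lambda>x. clip \<tau> a (1 - x)"
   have hm: "?h \<in> borel_measurable borel" by measurable
   have hm': "?h \<in> borel_measurable unit_leb" using hm by (simp add: measurable_restrict_space1)
   have "(\<integral>\<^sup>+x. ennreal (?h x) \<partial>unit_leb) \<le> ennreal (- ln (1 - (1 - \<tau>)) - - ln (1 - (1 - 2 * a)))"
    by (rule nn_integral_unit_le[where g' = "\<lambda>x. 1 / (1 - x)" and u = "1 - 2 * a" and v = "1 - \<tau>" and G = "\<lambda>x. - ln (1 - x)", OF hm])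
     (use \<tau> ta in \<open>auto intro!: derivative_eq_intros simp: divide_inverse\<close>)
   also have "\<dots> \<le> ennreal (2 * \<epsilon> * L)" using lnb by (intro ennreal_leI) simp
   finally have hi: "(\<integral>\<^sup>+x. ennreal (?h x) \<partial>unit_leb) \<le> ennreal (2 * \<epsilon> * L)" .
   have h0: "0 \<le> ?h x" for x using \<tau> by auto
   show "?B3 \<in> sets unit_leb" by (rule markov_real(1)[OF hm' h0 hi I tL])
   show "measure lborel ?B3 \<le> e / 4" by (rule order_trans[OF markov_real(2)[OF hm' h0 hi I tL] B23])
  qed
  have B4: "?B4 \<in> sets unit_leb" "measure lborel ?B4 \<le> e / 4"
  proof -
   have fm: "(\<lambda>x. max 0 (f x)) \<in> borel_measurable unit_leb" using f_meas by measurable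
   have "(\<integral>\<^sup>+x. ennreal (max 0 (f x)) \<partial>unit_leb) = (\<integral>\<^sup>+x. ennreal (f x) \<partial>unit_leb)"
    by (rule nn_integral_cong) (use f_pos in \<open>auto simp: space_unit less_imp_le max_def\<close>)
   then have fi: "(\<integral>\<^sup>+x. ennreal (max 0 (f x)) \<partial>unit_leb) \<le> ennreal 1" using nn_integral_f by simp
   have t2: "0 < t / 2" using t by simp
   show "?B4 \<in> sets unit_leb" by (rule markov_real(1)[OF fm _ fi _ t2]) simp_all
   have "measure lborel ?B4 \<le> real (nat \<lceil>\<kappa> * t\<rceil>) * 1 / (t / 2)"
    by (rule markov_real(2)[OF fm _ fi _ t2]) simp_all
   also have "\<dots> \<le> (\<kappa> * t + 1) * 1 / (t / 2)"
    using t \<kappa> by (intro divide_right_mono mult_right_mono) (auto simp: of_nat_nat)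
   also have "\<dots> = 2 * \<kappa> + 2 / t" using t by (simp add: field_simps)
   also have "\<dots> \<le> e / 4"
   proof -
    have "2 / t \<le> e / 8" using elim(4) t e by (simp add: field_simps)
    then show ?thesis using \<kappa> by linarith
   qed
   finally show "measure lborel ?B4 \<le> e / 4" .
  qed
  have sb: "A \<in> sets borel \<and> A \<subseteq> {0..<1} \<and> A \<in> fmeasurable lborel" if "A \<in> sets unit_leb" for A :: "real set"
  proof -
   have "A \<in> sets borel" "A \<subseteq> {0..<1}" using that by (auto simp: sets_restrict_space_iff)
   moreover have "emeasure lborel A \<le> emeasure lborel {0..<1::real}" using calculation by (intro emeasure_mono) auto
   ultimately show ?thesis by (auto simp: fmeasurable_def intro: le_less_trans)
  qed
  have "{0..<1} - good \<kappa> \<epsilon> \<theta> t = ?B1 \<union> ?B2 \<union> ?B3 \<union> ?B4" unfolding g by blast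
  moreover have "measure lborel (?B1 \<union> ?B2 \<union> ?B3 \<union> ?B4) \<le> e / 4 + e / 4 + e / 4 + e / 4"
   using B1 B2 B3 B4 sb
   by (intro order_trans[OF measure_Un_le] add_mono) (auto intro: sets.Un)
  moreover have "{0..<1} \<in> sets unit_leb" using sets.top[of unit_leb] by (simp only: space_unit)
  ultimately have "measure lborel ({0..<1} - good \<kappa> \<epsilon> \<theta> t) \<le> e" and top: "{0..<1} \<in> sets unit_leb" by simp_all
  moreover have "good \<kappa> \<epsilon> \<theta> t \<in> sets unit_leb" unfolding g
   by (intro sets.Diff sets.Un top B1(1) B2(1) B3(1) B4(1))
  ultimately show ?case by blast
 qed
qed

end

section \<open>Nearly affine Birkhoff sums around good points\<close>

context asym_flow
begin

text \<open>Near such a point the Birkhoff sums have slopes close to \<open>\<plusminus> \<Delta> * r * ln t\<close>.\<close>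

definition flat :: "real \<Rightarrow> real \<Rightarrow> real \<Rightarrow> real \<Rightarrow> bool" where
 "flat \<kappa> \<eta> t y \<longleftrightarrow>
  (\<forall>x. \<bar>x - y\<bar> \<le> ww t \<longrightarrow> x \<in> {0..<1} \<and> (\<forall>k\<le>nn t. (T ^^ k) x = (T ^^ k) y + (x - y)) \<and> Sn (nat \<lceil>\<kappa> * t\<rceil>) x \<le> t) \<and>
  (\<forall>x x' r. \<bar>x - y\<bar> \<le> ww t \<and> \<bar>x' - y\<bar> \<le> ww t \<and> \<kappa> * t \<le> real r \<and> r \<le> nn t \<longrightarrow>
    (\<bar>\<Delta>\<bar> - \<eta>) * (real r * ln t) * \<bar>x' - x\<bar> \<le> \<bar>Sn r x' - Sn r x\<bar> \<and>
    \<bar>Sn r x' - Sn r x\<bar> \<le> (\<bar>\<Delta>\<bar> + \<eta>) * (real r * ln t) * \<bar>x' - x\<bar>)"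

lemma nn_gt: "t / m < real (nn t)"
proof -
 have "t / m < of_int \<lfloor>t / m\<rfloor> + 1" by linarith
 also have "of_int \<lfloor>t / m\<rfloor> \<le> real (nat \<lfloor>t / m\<rfloor>)" by (cases "0 \<le> \<lfloor>t / m\<rfloor>") auto
 finally show ?thesis by simp
qed

lemma good_far:
 assumes y: "y \<in> {0..<1}" and near: "(\<Sum>k<n. nearsum \<tau> ((T ^^ k) y)) < 1"
  and k: "k < n" and p: "p \<in> D \<union> {0, 1}"
 shows "\<tau> \<le> \<bar>(T ^^ k) y - p\<bar>"
proof (rule ccontr)
 assume "\<not> \<tau> \<le> \<bar>(T ^^ k) y - p\<bar>"
 then have "(1::real) = of_bool (\<bar>(T ^^ k) y - p\<bar> < \<tau>)" by simp
 also have "\<dots> \<le> nearsum \<tau> ((T ^^ k) y)" unfolding nearsum_def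
  using finD p by (intro member_le_sum[where f = "\<lambda>p. of_bool (\<bar>(T ^^ k) y - p\<bar> < \<tau>) :: real"]) auto
 also have "\<dots> \<le> (\<Sum>k<n. nearsum \<tau> ((T ^^ k) y))"
  using k by (intro member_le_sum[where f = "\<lambda>k. nearsum \<tau> ((T ^^ k) y)"]) (auto simp: nearsum_def sum_nonneg)
 finally show False using near by simp
qed

text \<open>The orbit of the good point \<open>y\<close> serves as the comparison orbit in
  \<open>deriv_control\<close> for every starting point of the window around
  \<open>y\<close>.\<close>

lemma good_flat:
 assumes \<eta>: "0 < \<eta>" and \<kappa>: "0 < \<kappa>" "\<kappa> * m \<le> 1 / 2"
 shows "\<exists>\<sigma>>0. \<forall>\<epsilon> \<theta>. 0 < \<epsilon> \<and> \<epsilon> < 1 \<and> \<epsilon> \<le> \<sigma> \<and> 0 < \<theta> \<and> \<theta> \<le> \<sigma> \<longrightarrow>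
  eventually (\<lambda>t. \<forall>y\<in>good \<kappa> \<epsilon> \<theta> t. flat \<kappa> \<eta> t y) at_top"
proof -
 obtain \<sigma> where \<sigma>: "0 < \<sigma>" and DS: "\<forall>\<epsilon> \<theta>. 0 < \<epsilon> \<and> \<epsilon> < 1 \<and> \<epsilon> \<le> \<sigma> \<and> 0 < \<theta> \<and> \<theta> \<le> \<sigma> \<longrightarrow> eventually (deriv_control \<kappa> \<eta> \<epsilon> \<theta>) at_top"
  using deriv_sum[OF \<eta> \<kappa>(1)] by (elim exE conjE) (rule that; assumption)
 show ?thesis
 proof (intro exI[of _ \<sigma>] conjI \<sigma> allI impI)
  fix \<epsilon> \<theta> :: real assume h: "0 < \<epsilon> \<and> \<epsilon> < 1 \<and> \<epsilon> \<le> \<sigma> \<and> 0 < \<theta> \<and> \<theta> \<le> \<sigma>"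
  have e1: "eventually (\<lambda>t::real. 2 < sqrt (ln t) / ln t powr (1 / 4)) at_top" by real_asymp
  have "((\<lambda>t. (\<bar>\<Delta>\<bar> + \<eta>) * (\<kappa> + 1) * (sqrt (ln t) / t)) \<longlongrightarrow> (\<bar>\<Delta>\<bar> + \<eta>) * (\<kappa> + 1) * 0) at_top"
   by (intro tendsto_mult tendsto_const) real_asymp
  then have e2: "eventually (\<lambda>t. (\<bar>\<Delta>\<bar> + \<eta>) * (\<kappa> + 1) * (sqrt (ln t) / t) < 1 / 2) at_top"
   by (intro order_tendstoD(2)) auto
  have e3: "eventually (\<lambda>t::real. 1 < ln t) at_top" by real_asymp
  show "eventually (\<lambda>t. \<forall>y\<in>good \<kappa> \<epsilon> \<theta> t. flat \<kappa> \<eta> t y) at_top"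
   using DS[rule_format, OF h] e1 e2 e3 eventually_gt_at_top[of 1] eventually_gt_at_top[of "2 * m"]
  proof (eventually_elim, intro ballI)
   fix t y :: real
   assume ds: "deriv_control \<kappa> \<eta> \<epsilon> \<theta> t"
    and wt0: "2 < sqrt (ln t) / ln t powr (1 / 4)"
    and sm: "(\<bar>\<Delta>\<bar> + \<eta>) * (\<kappa> + 1) * (sqrt (ln t) / t) < 1 / 2"
    and l1: "1 < ln t" and t: "1 < t" and tm: "2 * m < t" and yg: "y \<in> good \<kappa> \<epsilon> \<theta> t"
   define w \<tau> a L n where "w = ww t" and "\<tau> = tt t" and "a = t powr (\<epsilon> - 1)" and "L = ln t" and "n = nn t"
   have L: "1 < L" using l1 by (simp add: L_def)
   have w0: "0 < w" using t L by (simp add: w_def L_def)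
   have \<tau>0: "0 < \<tau>" using t L by (simp add: \<tau>_def L_def)
   \<comment> \<open>The factor 2 makes the distances of the two orbits to an end comparable up to
     2.\<close>
   have w\<tau>: "2 * w < \<tau>"
   proof -
    have "2 * L powr (1 / 4) < sqrt L" using wt0 L by (simp add: L_def field_simps)
    then have "2 * (1 / (t * sqrt L)) < 1 / (t * L powr (1 / 4))"
     using t L by (simp add: field_simps)
    then show ?thesis by (simp add: w_def \<tau>_def L_def)
   qed
   have wa: "w \<le> a"
   proof -
    have "t * 1 \<le> t * sqrt L" using t L by (intro mult_left_mono) auto
    then have "w \<le> 1 / t" using t unfolding w_def L_def by (intro divide_left_mono) auto
    also have "1 / t = t powr (- 1)" using t by (simp add: powr_minus divide_inverse)
    also have "\<dots> \<le> a" unfolding a_def using t h by (intro powr_mono) auto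
    finally show ?thesis .
   qed
   have y: "y \<in> {0..<1}" using yg unfolding good_def by blast
   have B1: "(\<Sum>k<n. nearsum \<tau> ((T ^^ k) y)) < 1"
    using yg y unfolding good_def n_def \<tau>_def by (simp only: Diff_iff Un_iff mem_Collect_eq not_le de_Morgan_disj simp_thms)
   have B2: "(\<Sum>k<n. clip \<tau> a ((T ^^ k) y)) < \<theta> * (t * L)"
    using yg y unfolding good_def n_def \<tau>_def a_def L_def by (simp only: Diff_iff Un_iff mem_Collect_eq not_le de_Morgan_disj simp_thms)
   have B3: "(\<Sum>k<n. clip \<tau> a (1 - (T ^^ k) y)) < \<theta> * (t * L)"
    using yg y unfolding good_def n_def \<tau>_def a_def L_def by (simp only: Diff_iff Un_iff mem_Collect_eq not_le de_Morgan_disj simp_thms)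
   have B4: "(\<Sum>k<nat \<lceil>\<kappa> * t\<rceil>. max 0 (f ((T ^^ k) y))) < t / 2"
    using yg y unfolding good_def by (simp only: Diff_iff Un_iff mem_Collect_eq not_le de_Morgan_disj simp_thms)
   note far = good_far[OF y B1]
   have yk: "(T ^^ k) y \<in> {0..<1}" for k using pow_in[OF y] .
   have far': "\<tau> \<le> (T ^^ k) y" "\<tau> \<le> 1 - (T ^^ k) y" if "k < n" for k
    using far[OF that, of 0] far[OF that, of 1] yk[of k] by auto
   have n0: "0 < n" by (simp add: n_def)
   have in01: "x \<in> {0..<1}" if "\<bar>x - y\<bar> \<le> w" for x
    using that far'[OF n0] w\<tau> w0 by (auto simp: abs_le_iff)
   have tr: "(T ^^ k) x = (T ^^ k) y + (x - y)" if "\<bar>x - y\<bar> \<le> w" "k \<le> n" for x k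
    by (rule orbit_translate[OF y _ in01[OF that(1)] _ that(2), of \<tau>]) (use far that w\<tau> w0 in auto)
   have dsum: "\<bar>(\<Sum>k<r. deriv f ((T ^^ k) x)) - \<Delta> * (real r * L)\<bar> \<le> \<eta> * (real r * L)"
    if x: "\<bar>x - y\<bar> \<le> w" and r: "\<kappa> * t \<le> real r" "r \<le> n" for x r
    unfolding L_def
   proof (rule ds[unfolded deriv_control_def, rule_format, where q = "\<lambda>k. (T ^^ k) y"], intro conjI allI impI)
    fix k assume "k < r"
    then have kn: "k < n" "k \<le> n" using r by auto
    note fk = far'[OF kn(1)]
    have e: "(T ^^ k) x = (T ^^ k) y + (x - y)" by (rule tr[OF x kn(2)])
    have xl: "x - y \<le> w" "- w \<le> x - y" using x by (auto simp: abs_le_iff)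
    show "0 < (T ^^ k) x" unfolding e using fk xl w\<tau> w0 by linarith
    show "0 < (T ^^ k) y" using fk \<tau>0 by linarith
    show "(T ^^ k) y < 1" using fk \<tau>0 by linarith
    have "0 \<le> (T ^^ k) y + 2 * (x - y)" using fk xl w\<tau> w0 by argo
    then show "(T ^^ k) y \<le> 2 * (T ^^ k) x" unfolding e by (simp add: algebra_simps)
    have "0 \<le> (1 - (T ^^ k) y) - 2 * (x - y)" using fk xl w\<tau> w0 by argo
    then show "1 - (T ^^ k) y \<le> 2 * (1 - (T ^^ k) x)" unfolding e by (simp add: algebra_simps)
    show "\<bar>(T ^^ k) x - (T ^^ k) y\<bar> \<le> t powr (\<epsilon> - 1)" unfolding e using x wa by (simp add: a_def)
   next
    have "(\<Sum>k<r. cut a ((T ^^ k) y))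
      \<le> (\<Sum>k<n. clip \<tau> a ((T ^^ k) y))"
    proof -
     have "(\<Sum>k<r. cut a ((T ^^ k) y)) = (\<Sum>k<r. clip \<tau> a ((T ^^ k) y))"
      using far' r by (intro sum.cong refl) (meson lessThan_iff order_less_le_trans)
     also have "\<dots> \<le> (\<Sum>k<n. clip \<tau> a ((T ^^ k) y))"
      using r yk by (intro sum_mono2) auto
     finally show ?thesis .
    qed
    then show "(\<Sum>k<r. cut (t powr (\<epsilon> - 1)) ((T ^^ k) y)) \<le> \<theta> * (t * ln t)"
     using B2 unfolding a_def L_def by linarith
    have "(\<Sum>k<r. cut a (1 - (T ^^ k) y))
      \<le> (\<Sum>k<n. clip \<tau> a (1 - (T ^^ k) y))"
    proof -
     have "(\<Sum>k<r. cut a (1 - (T ^^ k) y)) = (\<Sum>k<r. clip \<tau> a (1 - (T ^^ k) y))"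
      using far' r by (intro sum.cong refl) (meson lessThan_iff order_less_le_trans)
     also have "\<dots> \<le> (\<Sum>k<n. clip \<tau> a (1 - (T ^^ k) y))"
      using r yk by (intro sum_mono2) (auto simp: less_imp_le)
     finally show ?thesis .
    qed
    then show "(\<Sum>k<r. cut (t powr (\<epsilon> - 1)) (1 - (T ^^ k) y)) \<le> \<theta> * (t * ln t)"
     using B3 unfolding a_def L_def by linarith
   qed (use r in01[OF x] in auto)
   have var1: "(\<bar>\<Delta>\<bar> - \<eta>) * (real r * L) * \<bar>x' - x\<bar> \<le> \<bar>Sn r x' - Sn r x\<bar> \<and>
     \<bar>Sn r x' - Sn r x\<bar> \<le> (\<bar>\<Delta>\<bar> + \<eta>) * (real r * L) * \<bar>x' - x\<bar>"
    if xx: "x < x'" "\<bar>x - y\<bar> \<le> w" "\<bar>x' - y\<bar> \<le> w" and r: "\<kappa> * t \<le> real r" "r \<le> n" for x x' r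
   proof -
    have r0: "0 < r" using r(1) \<kappa> t by (metis gr0I mult_pos_pos not_le of_nat_0 order.strict_trans zero_less_one)
    have "w < \<tau>" using w\<tau> w0 by linarith
    from Sn_variation[OF y far r0 r(2) this xx] obtain z where z: "\<bar>z - y\<bar> \<le> w"
     "Sn r x' - Sn r x = (x' - x) * (\<Sum>k<r. deriv f ((T ^^ k) z))" by blast
    define Z where "Z = (\<Sum>k<r. deriv f ((T ^^ k) z))"
    have "\<bar>Z - \<Delta> * (real r * L)\<bar> \<le> \<eta> * (real r * L)" unfolding Z_def by (rule dsum[OF z(1) r])
    moreover have "\<bar>\<Delta> * (real r * L)\<bar> = \<bar>\<Delta>\<bar> * (real r * L)" using L by (simp add: abs_mult)
    ultimately have Z: "(\<bar>\<Delta>\<bar> - \<eta>) * (real r * L) \<le> \<bar>Z\<bar>" "\<bar>Z\<bar> \<le> (\<bar>\<Delta>\<bar> + \<eta>) * (real r * L)"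
     by (simp_all add: left_diff_distrib distrib_right)
    have "\<bar>Sn r x' - Sn r x\<bar> = \<bar>Z\<bar> * \<bar>x' - x\<bar>" unfolding z(2) Z_def by (simp add: abs_mult)
    then show ?thesis using Z by (simp add: mult_right_mono)
   qed
   have var: "(\<bar>\<Delta>\<bar> - \<eta>) * (real r * L) * \<bar>x' - x\<bar> \<le> \<bar>Sn r x' - Sn r x\<bar> \<and>
     \<bar>Sn r x' - Sn r x\<bar> \<le> (\<bar>\<Delta>\<bar> + \<eta>) * (real r * L) * \<bar>x' - x\<bar>"
    if xx: "\<bar>x - y\<bar> \<le> w" "\<bar>x' - y\<bar> \<le> w" and r: "\<kappa> * t \<le> real r" "r \<le> n" for x x' r
   proof (cases x x' rule: linorder_cases)
    case less then show ?thesis using var1 xx r by blast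
   next
    case greater then show ?thesis using var1[OF greater xx(2,1) r] by (simp only: abs_minus_commute)
   qed simp
   define r0 where "r0 = nat \<lceil>\<kappa> * t\<rceil>"
   have \<kappa>t: "0 < \<kappa> * t" using \<kappa> t by simp
   have r0: "\<kappa> * t \<le> real r0" "real r0 \<le> \<kappa> * t + 1" using \<kappa>t unfolding r0_def by linarith+
   have r0n: "r0 \<le> n"
   proof -
    have "t / m < real n" unfolding n_def by (rule nn_gt)
    moreover have "\<kappa> * t + 1 \<le> t / m"
    proof -
     have "\<kappa> * m * t \<le> 1 / 2 * t" using \<kappa>(2) t by (intro mult_right_mono) auto
     then have "(\<kappa> * t + 1) * m \<le> t" using tm by (simp add: algebra_simps)
     then show ?thesis using m_pos by (simp add: field_simps)
    qed
    ultimately have "real r0 < real n" using r0 by linarith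
    then show ?thesis by simp
   qed
   \<comment> \<open>At \<open>y\<close> the sum is below \<open>t / 2\<close>, and over the window
     it varies by an amount negligible against \<open>t\<close>. Thus at time \<open>t\<close> at
     least \<open>\<kappa> * t\<close> passages have occurred, as the slope estimate
     requires.\<close>
   have low: "Sn r0 x \<le> t" if x: "\<bar>x - y\<bar> \<le> w" for x
   proof -
    have "Sn r0 y = (\<Sum>k<r0. max 0 (f ((T ^^ k) y)))"
     unfolding Sn_def using f_pos[OF yk] by (intro sum.cong) (auto simp: max_def less_imp_le)
    then have 1: "Sn r0 y < t / 2" using B4 unfolding r0_def by simp
    have "\<bar>Sn r0 x - Sn r0 y\<bar> \<le> (\<bar>\<Delta>\<bar> + \<eta>) * (real r0 * L) * \<bar>x - y\<bar>"
     using var[of y x r0] x r0 r0n w0 by simp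
    also have "\<dots> \<le> (\<bar>\<Delta>\<bar> + \<eta>) * (((\<kappa> + 1) * t) * L) * w"
    proof -
     have "real r0 \<le> (\<kappa> + 1) * t" using r0 t by (simp add: algebra_simps)
     then show ?thesis using x \<eta> L w0 \<kappa> t by (intro mult_mono mult_left_mono mult_right_mono) auto
    qed
    also have "\<dots> = t * ((\<bar>\<Delta>\<bar> + \<eta>) * (\<kappa> + 1) * (sqrt L / t))"
    proof -
     have "L * w = sqrt L / t" using t L unfolding w_def L_def by (simp add: field_simps real_sqrt_mult_self)
     then have "t * (L * w) = t * (sqrt L / t)" by simp
     moreover have "(\<bar>\<Delta>\<bar> + \<eta>) * (((\<kappa> + 1) * t) * L) * w = (\<bar>\<Delta>\<bar> + \<eta>) * (\<kappa> + 1) * (t * (L * w))" by (simp only: mult_ac)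
     ultimately show ?thesis by (simp only: mult_ac)
    qed
    also have "\<dots> \<le> t * (1 / 2)" using sm t unfolding L_def by (intro mult_left_mono) auto
    finally show ?thesis using 1 by linarith
   qed
   show "flat \<kappa> \<eta> t y"
    unfolding flat_def w_def[symmetric] n_def[symmetric] r0_def[symmetric]
    using in01 tr low var unfolding L_def by blast
  qed
 qed
qed

end

section \<open>The flow on short intervals\<close>

text \<open>Replacing the set by an interval makes its shape and its measurability
  irrelevant.\<close>

lemma diameter_cover:
 fixes S :: "real set"
 assumes "\<And>x x'. x \<in> S \<Longrightarrow> x' \<in> S \<Longrightarrow> \<bar>x' - x\<bar> \<le> \<delta>"
 shows "\<exists>a. S \<subseteq> {a..a + \<delta>}"
proof (cases "S = {}")
 case False
 then obtain x0 where x0: "x0 \<in> S" by blast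
 have bdd: "bdd_below S" 
 proof (rule bdd_belowI)
  show "x0 - \<delta> \<le> x" if "x \<in> S" for x using assms[OF x0 that] by (simp add: abs_le_iff)
 qed
 have "x \<le> Inf S + \<delta>" if x: "x \<in> S" for x
 proof -
  have "x - \<delta> \<le> Inf S" 
  proof (rule cInf_greatest[OF False])
   show "x - \<delta> \<le> x'" if "x' \<in> S" for x' using assms[OF x that] by (simp add: abs_le_iff)
  qed
  then show ?thesis by simp
 qed
 then have "S \<subseteq> {Inf S..Inf S + \<delta>}" using cInf_lower[OF _ bdd] by auto
 then show ?thesis by blast
qed simp

context asym_flow
begin

text \<open>The base points that at time \<open>t\<close> are in the rectangle with sides from
  \<open>j1\<close> to \<open>j2\<close> and from \<open>h1\<close> to \<open>h2\<close>;
  \<open>r\<close> is the number of passages.\<close>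

definition hits :: "real \<Rightarrow> real \<Rightarrow> real \<Rightarrow> real \<Rightarrow> real \<Rightarrow> real set" where
 "hits j1 j2 h1 h2 t = {x \<in> {0..<1}. \<exists>r. Sn r x \<le> t \<and> t < Sn (r + 1) x \<and>
   j1 \<le> (T ^^ r) x \<and> (T ^^ r) x \<le> j2 \<and> h1 \<le> t - Sn r x \<and> t - Sn r x \<le> h2}"

lemma pow_borel: "(\<lambda>x. (T ^^ r) x) \<in> borel_measurable unit_leb"
 by (rule measurable_compose[OF pow_meas]) (simp add: measurable_restrict_space1)

lemma hits_meas: "hits j1 j2 h1 h2 t \<in> sets unit_leb"
proof -
 have "{x \<in> space unit_leb. \<exists>r. Sn r x \<le> t \<and> t < Sn (r + 1) x \<and>
   j1 \<le> (T ^^ r) x \<and> (T ^^ r) x \<le> j2 \<and> h1 \<le> t - Sn r x \<and> t - Sn r x \<le> h2} \<in> sets unit_leb"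
  using Sn_meas pow_borel by measurable
 then show ?thesis unfolding hits_def space_unit .
qed

lemma level_ex:
 assumes x: "x \<in> {0..<1}" and t: "0 \<le> t"
 shows "\<exists>r. Sn r x \<le> t \<and> t < Sn (r + 1) x"
proof -
 have bd: "r \<le> nn t" if "Sn r x \<le> t" for r
 proof (rule ccontr)
  assume "\<not> r \<le> nn t"
  then have "real (nn t) * m \<le> real r * m" using m_pos by (intro mult_right_mono) auto
  moreover have "t < real (nn t) * m" using nn_gt[of t] m_pos by (simp add: pos_divide_less_eq)
  ultimately show False using Sn_ge[OF x, of r] that by linarith
 qed
 have fin: "finite {r. Sn r x \<le> t}" by (rule finite_subset[of _ "{..nn t}"]) (use bd in auto)
 have "0 \<in> {r. Sn r x \<le> t}" using t by (simp add: Sn_def)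
 then have M: "Max {r. Sn r x \<le> t} \<in> {r. Sn r x \<le> t}" using fin by (intro Max_in) auto
 have "Max {r. Sn r x \<le> t} + 1 \<notin> {r. Sn r x \<le> t}" using Max_ge[OF fin] by fastforce
 then show ?thesis using M by (intro exI[of _ "Max {r. Sn r x \<le> t}"]) auto
qed

lemma level_bounds:
 assumes x: "x \<in> {0..<1}" and r: "Sn r x \<le> t" "t < Sn (r + 1) x"
 shows "r < nn t" and "Sn k x \<le> t \<Longrightarrow> k \<le> r"
proof -
 show "k \<le> r" if "Sn k x \<le> t"
  using Sn_mono[OF x, of "r + 1" k] that r by (cases "k \<le> r") auto
 have "t < real (nn t) * m" using nn_gt[of t] m_pos by (simp add: pos_divide_less_eq)
 then have "t < Sn (nn t) x" using Sn_ge[OF x, of "nn t"] by linarith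
 then show "r < nn t" using Sn_mono[OF x, of "nn t" r] r by (cases "r < nn t") auto
qed

text \<open>In the application \<open>N\<close> levels are crossed, \<open>X\<close> is the least
  number of passages, and each level takes up at most \<open>H / (dm * (X * L))\<close> of the
  window. The number of levels is governed by the stretch \<open>dp * (X * L) * w\<close>, so
  \<open>X\<close> and \<open>L\<close> cancel in the main term.\<close>

lemma level_count_arith:
 fixes N X L w t s b H dp dm K2 K3 \<kappa> :: real
 assumes N: "(1 - s) * (N - 2) - K3 \<le> dp * ((X + 1) * L) * w"
  and pos: "0 < s" "s < 1" "0 \<le> b" "0 \<le> H" "0 < dm" "0 < dp" "0 \<le> K2" "0 \<le> K3" "0 < \<kappa>" "1 < t" "0 < L"
  and w: "w = 1 / (t * sqrt L)" and X: "\<kappa> * t \<le> X"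
  and small: "((1 + s) * b * (2 + K3 / (1 - s)) + K2) * H / dm / (\<kappa> * sqrt L) + (1 + s) * b * H * dp / ((1 - s) * dm) / (\<kappa> * t) \<le> s"
 shows "((1 + s) * N * b + K2) * (H / (dm * (X * L))) \<le> w * ((1 + s) * b * H * dp / ((1 - s) * dm) + s)"
proof -
 define C1 where "C1 = ((1 + s) * b * (2 + K3 / (1 - s)) + K2) * H / dm"
 define c1 where "c1 = (1 + s) * b * H * dp / ((1 - s) * dm)"
 have C1: "0 \<le> C1" and c1: "0 \<le> c1" using pos by (simp_all add: C1_def c1_def)
 have \<kappa>t: "0 < \<kappa> * t" using pos by simp
 then have X0: "0 < X" using X by linarith
 have w0: "0 < w" using pos w by simp
 have "N \<le> 2 + K3 / (1 - s) + dp * ((X + 1) * L) * w / (1 - s)"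
 proof -
  have "(1 - s) * N \<le> (1 - s) * (2 + K3 / (1 - s) + dp * ((X + 1) * L) * w / (1 - s))"
  proof -
   have "(1 - s) * (2 + K3 / (1 - s) + dp * ((X + 1) * L) * w / (1 - s)) = (1 - s) * 2 + K3 + dp * ((X + 1) * L) * w"
    using pos by (simp add: distrib_left)
   then show ?thesis using N by (simp add: right_diff_distrib)
  qed
  then show ?thesis using pos by (simp add: mult_le_cancel_left_pos)
 qed
 then have "(1 + s) * b * N \<le> (1 + s) * b * (2 + K3 / (1 - s) + dp * ((X + 1) * L) * w / (1 - s))"
  using pos by (intro mult_left_mono) auto
 then have "((1 + s) * N * b + K2) \<le> ((1 + s) * b * (2 + K3 / (1 - s)) + K2) + (1 + s) * b * (dp * ((X + 1) * L) * w / (1 - s))"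
  by (simp add: algebra_simps)
 then have "((1 + s) * N * b + K2) * (H / (dm * (X * L))) \<le>
   (((1 + s) * b * (2 + K3 / (1 - s)) + K2) + (1 + s) * b * (dp * ((X + 1) * L) * w / (1 - s))) * (H / (dm * (X * L)))"
  using pos X0 by (intro mult_right_mono) auto
 also have "\<dots> = C1 / (X * L) + c1 * w * ((X + 1) / X)"
 proof -
  have ne: "dm \<noteq> 0" "X \<noteq> 0" "L \<noteq> 0" "1 - s \<noteq> 0" using pos X0 by auto
  have 1: "((1 + s) * b * (2 + K3 / (1 - s)) + K2) * (H / (dm * (X * L))) = C1 / (X * L)"
   by (simp add: C1_def)
  have 2: "(1 + s) * b * (dp * ((X + 1) * L) * w / (1 - s)) * (H / (dm * (X * L))) = c1 * w * ((X + 1) / X)"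
   using ne by (simp add: c1_def mult_ac)
  show ?thesis unfolding 1[symmetric] 2[symmetric] by (rule distrib_right)
 qed
 also have "\<dots> \<le> w * (C1 / (\<kappa> * sqrt L)) + w * (c1 + c1 / (\<kappa> * t))"
 proof (rule add_mono)
  have "C1 / (X * L) \<le> C1 / (\<kappa> * t * L)" using C1 X \<kappa>t pos by (intro divide_left_mono mult_right_mono mult_pos_pos) (auto simp: X0)
  also have "\<dots> = w * (C1 / (\<kappa> * sqrt L))"
  proof -
   have "L = sqrt L * sqrt L" using pos by simp
   then have "\<kappa> * t * L = (t * sqrt L) * (\<kappa> * sqrt L)" by (simp only: mult_ac)
   then show ?thesis unfolding w by simp
  qed
  finally show "C1 / (X * L) \<le> w * (C1 / (\<kappa> * sqrt L))" .
  have "(X + 1) / X = 1 + 1 / X" using X0 by (simp add: field_simps)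
  also have "\<dots> \<le> 1 + 1 / (\<kappa> * t)" using X \<kappa>t by (simp add: frac_le)
  finally have "c1 * w * ((X + 1) / X) \<le> c1 * w * (1 + 1 / (\<kappa> * t))" using c1 w0 by (intro mult_left_mono) auto
  also have "\<dots> = w * (c1 + c1 / (\<kappa> * t))" by (simp add: algebra_simps)
  finally show "c1 * w * ((X + 1) / X) \<le> w * (c1 + c1 / (\<kappa> * t))" .
 qed
 also have "\<dots> = w * (c1 + (C1 / (\<kappa> * sqrt L) + c1 / (\<kappa> * t)))" by (simp add: algebra_simps)
 also have "\<dots> \<le> w * (c1 + s)" using small w0 unfolding C1_def c1_def by (intro mult_left_mono add_left_mono) auto
 finally show ?thesis unfolding c1_def .
qed

text \<open>
 The flow stretches a short interval over many levels of the tower, each of which it crosses at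
 the same speed; the bases of these levels form an orbit segment, which is equidistributed.
\<close>

lemma interval_estimate:
 assumes J: "s \<le> j1" "j1 \<le> j2" "j2 + s \<le> 1" and H: "h1 \<le> h2"
  and s: "0 < s" "s < 1" and \<eta>: "0 < \<eta>" "\<eta> < \<bar>\<Delta>\<bar>" and \<kappa>: "0 < \<kappa>"
 shows "eventually (\<lambda>t. \<forall>y lo. flat \<kappa> \<eta> t y \<and> lo \<le> y \<and> y < lo + ww t \<longrightarrow>
  measure lborel (hits j1 j2 h1 h2 t \<inter> {lo..<lo + ww t}) \<le>
   ww t * ((1 + s) * (j2 - j1 + 2 * s) * (h2 - h1) * (\<bar>\<Delta>\<bar> + \<eta>) / ((1 - s) * (\<bar>\<Delta>\<bar> - \<eta>)) + s)) at_top"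
proof -
 define b Hh dp dm where "b = j2 - j1 + 2 * s" and "Hh = h2 - h1" and "dp = \<bar>\<Delta>\<bar> + \<eta>" and "dm = \<bar>\<Delta>\<bar> - \<eta>"
 have pos: "0 \<le> b" "0 \<le> Hh" "0 < dm" "0 < dp" using J H s \<eta> by (simp_all add: b_def Hh_def dp_def dm_def)
 have "0 \<le> j1 - s" "j1 - s < j2 + s" "j2 + s \<le> 1" using J s by auto
 from visits_affine_bounds[OF equi s this] obtain K2 where K2: "0 \<le> K2"
  and vb: "\<And>N y. y \<in> {0..<1} \<Longrightarrow> visits T {j1 - s..<j2 + s} N y \<le> (1 + s) * real N * (j2 + s - (j1 - s)) + K2"
  by blast
 from Sn_lower[OF s] obtain K3 where K3: "0 \<le> K3" and lb: "\<And>N y. y \<in> {0..<1} \<Longrightarrow> (1 - s) * real N - K3 \<le> Sn N y"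
  by blast
 have "((\<lambda>t. ((1 + s) * b * (2 + K3 / (1 - s)) + K2) * Hh / dm / (\<kappa> * sqrt (ln t)) + (1 + s) * b * Hh * dp / ((1 - s) * dm) / (\<kappa> * t)) \<longlongrightarrow> 0) at_top"
  using \<kappa> by real_asymp
 then have e1: "eventually (\<lambda>t. ((1 + s) * b * (2 + K3 / (1 - s)) + K2) * Hh / dm / (\<kappa> * sqrt (ln t)) + (1 + s) * b * Hh * dp / ((1 - s) * dm) / (\<kappa> * t) < s) at_top"
  using s(1) by (rule order_tendstoD(2))
 have "((\<lambda>t. ww t) \<longlongrightarrow> 0) at_top" by real_asymp
 then have e2: "eventually (\<lambda>t. ww t < s) at_top" using s(1) by (rule order_tendstoD(2))
 show ?thesis
  using e1 e2 eventually_gt_at_top[of 1]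
 proof (eventually_elim, intro allI impI, elim conjE)
  fix t y lo
  assume small: "((1 + s) * b * (2 + K3 / (1 - s)) + K2) * Hh / dm / (\<kappa> * sqrt (ln t)) + (1 + s) * b * Hh * dp / ((1 - s) * dm) / (\<kappa> * t) < s"
   and ws: "ww t < s" and t: "1 < t" and flat: "flat \<kappa> \<eta> t y" and ylo: "lo \<le> y" "y < lo + ww t"
  define w L n where "w = ww t" and "L = ln t" and "n = nn t"
  have L: "0 < L" using t by (simp add: L_def)
  have w0: "0 < w" using t by (simp add: w_def)
  let ?I = "{lo..<lo + w}"
  have near: "\<bar>x - y\<bar> \<le> w" if "x \<in> ?I" for x using that ylo unfolding w_def by (auto simp: abs_le_iff)
  have dist: "\<bar>x' - x\<bar> \<le> w" if "x \<in> ?I" "x' \<in> ?I" for x x' using that by (auto simp: abs_le_iff)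
  have yI: "y \<in> ?I" using ylo by (simp add: w_def)
  have I01: "x \<in> {0..<1}" and tr: "\<And>k. k \<le> n \<Longrightarrow> (T ^^ k) x = (T ^^ k) y + (x - y)" and low: "Sn (nat \<lceil>\<kappa> * t\<rceil>) x \<le> t"
   if "x \<in> ?I" for x
   using flat near[OF that] unfolding flat_def w_def n_def by blast+
  have var: "dm * (real r * L) * \<bar>x' - x\<bar> \<le> \<bar>Sn r x' - Sn r x\<bar>" "\<bar>Sn r x' - Sn r x\<bar> \<le> dp * (real r * L) * \<bar>x' - x\<bar>"
   if "x \<in> ?I" "x' \<in> ?I" "\<kappa> * t \<le> real r" "r \<le> n" for x x' r
   using flat near[OF that(1)] near[OF that(2)] that(3,4) unfolding flat_def w_def n_def L_def dm_def dp_def by blast+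
  define lev where "lev x r \<longleftrightarrow> Sn r x \<le> t \<and> t < Sn (r + 1) x" for x r
  have "\<forall>x\<in>?I. \<exists>r. lev x r" using level_ex I01 t unfolding lev_def by (meson less_imp_le less_trans zero_less_one)
  then obtain \<nu> where \<nu>: "\<And>x. x \<in> ?I \<Longrightarrow> lev x (\<nu> x)" by metis
  have lev_b: "\<kappa> * t \<le> real r" "r < n" if x: "x \<in> ?I" and r: "lev x r" for x r
  proof -
   have "nat \<lceil>\<kappa> * t\<rceil> \<le> r" using level_bounds(2)[OF I01[OF x]] r low[OF x] unfolding lev_def by blast
   then show "\<kappa> * t \<le> real r" by linarith
   show "r < n" using level_bounds(1)[OF I01[OF x]] r unfolding lev_def n_def by blast
  qed
  define R where "R = {r. \<exists>x\<in>?I. lev x r}"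
  have R: "finite R" "R \<noteq> {}"
  proof -
   show "finite R" by (rule finite_subset[of _ "{..<n}"]) (auto simp: R_def dest: lev_b(2))
   show "R \<noteq> {}" unfolding R_def using \<nu>[OF yI] yI by blast
  qed
  define rm rp where "rm = Min R" and "rp = Max R"
  have mem: "rm \<in> R" "rp \<in> R" using R by (simp_all add: rm_def rp_def)
  have bnd: "rm \<le> r" "r \<le> rp" if "r \<in> R" for r using that R by (simp_all add: rm_def rp_def)
  from mem obtain x1 x2 where x1: "x1 \<in> ?I" "lev x1 rm" and x2: "x2 \<in> ?I" "lev x2 rp" unfolding R_def by blast
  have rm: "\<kappa> * t \<le> real rm" "rm < n" using lev_b[OF x1] by auto
  have rm0: "0 < real rm" using rm(1) \<kappa> t by (meson less_le_trans less_trans mult_pos_pos zero_less_one)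
  define N where "N = rp - rm + 1"
  have rprm: "rm \<le> rp" using bnd(1)[OF mem(2)] .
  \<comment> \<open>The levels strictly between the lowest and the highest are crossed completely,
    which explains the 2. Their heights add up to at most the variation of
    \<open>Sn (rm + 1)\<close> over the window, and \<open>Sn_lower\<close> converts this into a
    bound for their number.\<close>
  have N1: "(1 - s) * (real N - 2) - K3 \<le> dp * ((real rm + 1) * L) * w"
  proof (cases "N \<le> 2")
   case True
   then have "(1 - s) * (real N - 2) \<le> 0" using s by (intro mult_nonneg_nonpos) auto
   moreover have "0 \<le> dp * ((real rm + 1) * L) * w" using pos L w0 by simp
   ultimately show ?thesis using K3 by linarith
  next
   case False
   then have rp: "rp = (rm + 1) + (N - 2)" using rprm by (simp add: N_def)
   have z: "(T ^^ (rm + 1)) x2 \<in> {0..<1}" using pow_in[OF I01[OF x2(1)]] .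
   have "Sn rp x2 = Sn (rm + 1) x2 + Sn (N - 2) ((T ^^ (rm + 1)) x2)" unfolding rp by (rule Sn_add)
   moreover have "Sn rp x2 \<le> t" "t < Sn (rm + 1) x1" using x1(2) x2(2) unfolding lev_def by auto
   ultimately have "Sn (N - 2) ((T ^^ (rm + 1)) x2) \<le> \<bar>Sn (rm + 1) x1 - Sn (rm + 1) x2\<bar>" by linarith
   also have "\<dots> \<le> dp * (real (rm + 1) * L) * \<bar>x1 - x2\<bar>"
    by (rule var(2)[OF x2(1) x1(1)]) (use rm in auto)
   also have "\<dots> \<le> dp * (real (rm + 1) * L) * w" using dist[OF x2(1) x1(1)] pos L by (intro mult_left_mono) auto
   finally have "Sn (N - 2) ((T ^^ (rm + 1)) x2) \<le> dp * (real (rm + 1) * L) * w" .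
   moreover have "real (N - 2) = real N - 2" using False by simp
   ultimately show ?thesis using lb[OF z, of "N - 2"] by (simp add: add.commute)
  qed
  define \<delta> where "\<delta> = Hh / (dm * (real rm * L))"
  have den: "0 < dm * (real rm * L)" using pos rm0 L by simp
  have \<delta>0: "0 \<le> \<delta>" using pos den by (simp add: \<delta>_def)
  define A where "A r = {x \<in> ?I. h1 \<le> t - Sn r x \<and> t - Sn r x \<le> h2}" for r
  \<comment> \<open>While the height stays in a range of size \<open>Hh\<close>, it changes with
    slope at least \<open>dm * (real rm * L)\<close>, so it can do so only on a set of small
    diameter.\<close>
  have Ac: "\<exists>a. A r \<subseteq> {a..a + \<delta>}" if r: "rm \<le> r" "r \<le> rp" for r
  proof (rule diameter_cover)
   fix x x' assume x: "x \<in> A r" "x' \<in> A r"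
   have rr: "\<kappa> * t \<le> real r" "r \<le> n" using rm r lev_b(2)[OF x2] by auto
   have "dm * (real rm * L) * \<bar>x' - x\<bar> \<le> dm * (real r * L) * \<bar>x' - x\<bar>"
    using r pos L by (intro mult_right_mono mult_left_mono) auto
   also have "\<dots> \<le> \<bar>Sn r x' - Sn r x\<bar>" by (rule var(1)) (use x rr in \<open>auto simp: A_def\<close>)
   also have "\<dots> \<le> Hh" using x unfolding A_def Hh_def by (auto simp: abs_le_iff)
   finally show "\<bar>x' - x\<bar> \<le> \<delta>" using den unfolding \<delta>_def by (simp add: field_simps)
  qed
  then obtain \<alpha> where \<alpha>: "\<And>r. rm \<le> r \<Longrightarrow> r \<le> rp \<Longrightarrow> A r \<subseteq> {\<alpha> r..\<alpha> r + \<delta>}" by metis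
  define y' where "y' = (T ^^ rm) y"
  have y': "y' \<in> {0..<1}" unfolding y'_def using pow_in[OF I01[OF yI]] .
  \<comment> \<open>Up to the displacement from \<open>y\<close>, which is below \<open>s\<close>,
    the bases of the levels form the orbit of \<open>y'\<close>. So the levels that can meet the
    rectangle are counted by visits to the interval enlarged by \<open>s\<close>.\<close>
  define Q where "Q = {k. k < N \<and> (T ^^ k) y' \<in> {j1 - s..<j2 + s}}"
  have finQ: "finite Q" by (simp add: Q_def)
  have cQ: "real (card Q) \<le> (1 + s) * real N * b + K2"
  proof -
   have "real (card Q) = visits T {j1 - s..<j2 + s} N y'"
    unfolding visits_def Q_def by (simp add: of_bool_def sum.If_cases Int_def)
   also have "\<dots> \<le> (1 + s) * real N * b + K2"
    using vb[OF y', of N] unfolding b_def by (simp add: algebra_simps)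
   finally show ?thesis .
  qed
  have cover: "hits j1 j2 h1 h2 t \<inter> ?I \<subseteq> (\<Union>k\<in>Q. {\<alpha> (rm + k)..\<alpha> (rm + k) + \<delta>})"
  proof
   fix x assume x: "x \<in> hits j1 j2 h1 h2 t \<inter> ?I"
   then obtain r where r: "lev x r" "j1 \<le> (T ^^ r) x" "(T ^^ r) x \<le> j2" "h1 \<le> t - Sn r x" "t - Sn r x \<le> h2"
    unfolding hits_def lev_def by blast
   have xI: "x \<in> ?I" using x by blast
   then have "r \<in> R" using r(1) unfolding R_def by blast
   note rb = bnd[OF this]
   have rn: "r \<le> n" using lev_b(2)[OF xI r(1)] by simp
   have "(T ^^ (r - rm)) y' = (T ^^ r) y" unfolding y'_def using rb by (simp flip: funpow_add_apply)
   moreover have "\<bar>x - y\<bar> < s" using near[OF xI] ws by (simp add: w_def)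
   ultimately have "(T ^^ (r - rm)) y' \<in> {j1 - s..<j2 + s}"
    using r(2,3) tr[OF xI rn] by (auto simp: abs_less_iff)
   then have "r - rm \<in> Q" unfolding Q_def N_def using rb by auto
   moreover have "x \<in> {\<alpha> r..\<alpha> r + \<delta>}" using \<alpha>[OF rb] xI r unfolding A_def by blast
   ultimately show "x \<in> (\<Union>k\<in>Q. {\<alpha> (rm + k)..\<alpha> (rm + k) + \<delta>})" using rb by (intro UN_I[of "r - rm"]) auto
  qed
  have "emeasure lborel (hits j1 j2 h1 h2 t \<inter> ?I) \<le> emeasure lborel (\<Union>k\<in>Q. {\<alpha> (rm + k)..\<alpha> (rm + k) + \<delta>})"
   by (rule emeasure_mono[OF cover]) auto
  also have "\<dots> \<le> (\<Sum>k\<in>Q. emeasure lborel {\<alpha> (rm + k)..\<alpha> (rm + k) + \<delta>})"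
   using finQ by (intro emeasure_subadditive_finite) auto
  also have "\<dots> = ennreal (real (card Q) * \<delta>)"
   using \<delta>0 by (simp add: ennreal_mult ennreal_of_nat_eq_real_of_nat)
  finally have "measure lborel (hits j1 j2 h1 h2 t \<inter> ?I) \<le> real (card Q) * \<delta>"
   using \<delta>0 by (simp add: measure_def enn2real_leI)
  also have "\<dots> \<le> ((1 + s) * real N * b + K2) * \<delta>" using cQ \<delta>0 by (rule mult_right_mono)
  also have "\<dots> \<le> w * ((1 + s) * b * Hh * dp / ((1 - s) * dm) + s)"
   unfolding \<delta>_def
   by (rule level_count_arith[OF N1 s pos(1,2,3,4) K2 K3 \<kappa> t L _ rm(1)]) (use small in \<open>simp_all add: w_def L_def\<close>)
  finally show "measure lborel (hits j1 j2 h1 h2 t \<inter> {lo..<lo + ww t}) \<le>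
   ww t * ((1 + s) * (j2 - j1 + 2 * s) * (h2 - h1) * (\<bar>\<Delta>\<bar> + \<eta>) / ((1 - s) * (\<bar>\<Delta>\<bar> - \<eta>)) + s)"
   unfolding b_def Hh_def dp_def dm_def w_def .
 qed
qed

end

lemma unit_leb_fmeasurable: "A \<in> sets unit_leb \<Longrightarrow> A \<in> fmeasurable lborel"
proof -
 assume "A \<in> sets unit_leb"
 then have A: "A \<in> sets borel" "A \<subseteq> {0..<1}" by (auto simp: sets_restrict_space_iff)
 moreover have "emeasure lborel A \<le> emeasure lborel {0..<1::real}" using A by (intro emeasure_mono) auto
 ultimately show ?thesis by (auto simp: fmeasurable_def intro: le_less_trans)
qed

context asym_flow
begin

text \<open>The interval is cut into windows of length \<open>ww t\<close>. Points that are not good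
  have small measure; windows with a good point obey \<open>interval_estimate\<close>, whose factor
  tends to the area of the rectangle as \<open>s\<close> tends to 0. Two more windows account for
  the ends.\<close>

lemma hits_bound:
 assumes J: "0 < j1" "j1 \<le> j2" "j2 < 1" and H: "h1 \<le> h2" and K: "0 \<le> k1" "k1 \<le> k2" "k2 \<le> 1" and e: "0 < e"
 shows "eventually (\<lambda>t. measure lborel (hits j1 j2 h1 h2 t \<inter> {k1..k2}) \<le> (k2 - k1) * (j2 - j1) * (h2 - h1) + e) at_top"
proof -
 have \<Delta>: "0 < \<bar>\<Delta>\<bar>" using Cpm by simp
 define c where "c s = (1 + s) * (j2 - j1 + 2 * s) * (h2 - h1) * (\<bar>\<Delta>\<bar> + s) / ((1 - s) * (\<bar>\<Delta>\<bar> - s)) + s" for s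
 have "(c \<longlongrightarrow> (1 + 0) * (j2 - j1 + 2 * 0) * (h2 - h1) * (\<bar>\<Delta>\<bar> + 0) / ((1 - 0) * (\<bar>\<Delta>\<bar> - 0)) + 0) (at_right 0)"
  unfolding c_def by (intro tendsto_intros) (use \<Delta> in auto)
 then have "(c \<longlongrightarrow> (j2 - j1) * (h2 - h1)) (at_right 0)" using \<Delta> by simp
 then have "eventually (\<lambda>s. c s < (j2 - j1) * (h2 - h1) + e / 4) (at_right 0)"
  using e by (intro order_tendstoD(2)) auto
 moreover have "eventually (\<lambda>s. s \<in> {0<..<min (min 1 \<bar>\<Delta>\<bar>) (min j1 (1 - j2))}) (at_right 0)"
  using J \<Delta> by (intro eventually_at_right_real) auto
 ultimately have "eventually (\<lambda>s. c s < (j2 - j1) * (h2 - h1) + e / 4 \<and> s \<in> {0<..<min (min 1 \<bar>\<Delta>\<bar>) (min j1 (1 - j2))}) (at_right 0)"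
  by (rule eventually_conj)
 then obtain s where cs: "c s < (j2 - j1) * (h2 - h1) + e / 4"
  and s: "0 < s" "s < 1" "s < \<bar>\<Delta>\<bar>" "s \<le> j1" "j2 + s \<le> 1"
  using eventually_happens' trivial_limit_at_right_real by (auto dest!: eventually_happens)
 \<comment> \<open>The second bound keeps \<open>\<kappa> * t\<close> passages within the horizon
   \<open>nn t\<close>; the first limits the measure of the points whose first
   \<open>\<kappa> * t\<close> passages take too long.\<close>
 define \<kappa> where "\<kappa> = min (e / 4 / 16) (1 / (2 * m))"
 have \<kappa>: "0 < \<kappa>" "\<kappa> \<le> e / 4 / 16" using e m_pos by (auto simp: \<kappa>_def)
 have "\<kappa> \<le> 1 / (2 * m)" by (simp add: \<kappa>_def)
 then have \<kappa>m: "\<kappa> * m \<le> 1 / 2" using m_pos by (simp add: field_simps)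
 obtain \<sigma> where \<sigma>: "0 < \<sigma>" and gf: "\<forall>\<epsilon> \<theta>. 0 < \<epsilon> \<and> \<epsilon> < 1 \<and> \<epsilon> \<le> \<sigma> \<and> 0 < \<theta> \<and> \<theta> \<le> \<sigma> \<longrightarrow>
  eventually (\<lambda>t. \<forall>y\<in>good \<kappa> \<epsilon> \<theta> t. flat \<kappa> s t y) at_top"
  using good_flat[OF s(1) \<kappa>(1) \<kappa>m] by (elim exE conjE) (rule that; assumption)
 define \<epsilon> where "\<epsilon> = min (min \<sigma> (1 / 2)) (e / 4 * m * \<sigma> / 16)"
 have \<epsilon>: "0 < \<epsilon>" "\<epsilon> < 1" "\<epsilon> \<le> \<sigma>" "\<epsilon> \<le> e / 4 * m * \<sigma> / 16" using \<sigma> e m_pos by (auto simp: \<epsilon>_def)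
 have e4: "0 < e / 4" using e by simp
 note gm = good_measure[OF \<kappa> \<epsilon>(1,4) \<sigma> e4]
 have gfl: "eventually (\<lambda>t. \<forall>y\<in>good \<kappa> \<epsilon> \<sigma> t. flat \<kappa> s t y) at_top" using gf \<epsilon> \<sigma> by blast
 note ie = interval_estimate[OF s(4) J(2) s(5) H s(1,2) s(1,3) \<kappa>(1), folded c_def]
 have "((\<lambda>t. 2 * ww t * c s) \<longlongrightarrow> 2 * 0 * c s) at_top" by (intro tendsto_mult tendsto_const) real_asymp
 then have "eventually (\<lambda>t. 2 * ww t * c s < e / 4) at_top" using e by (intro order_tendstoD(2)) auto
 with gm gfl ie eventually_gt_at_top[of 1] show ?thesis
 proof eventually_elim
  case (elim t)
  define G w where "G = good \<kappa> \<epsilon> \<sigma> t" and "w = ww t"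
  let ?E = "hits j1 j2 h1 h2 t"
  have G: "G \<in> sets unit_leb" "measure lborel ({0..<1} - G) \<le> e / 4" and Gf: "\<And>y. y \<in> G \<Longrightarrow> flat \<kappa> s t y"
   using elim(1,2) unfolding G_def good_def by blast+
  have w: "0 < w" using elim by (simp add: w_def)
  have c0: "0 \<le> c s" unfolding c_def using s J H by simp
  define i1 i2 where "i1 = nat \<lfloor>k1 / w\<rfloor>" and "i2 = nat \<lfloor>k2 / w\<rfloor>"
  have kw: "0 \<le> k1 / w" "k1 / w \<le> k2 / w" using K w by (simp_all add: divide_right_mono)
  have ib: "real i2 \<le> k2 / w" "k1 / w - 1 \<le> real i1" "i1 \<le> i2"
  proof -
   show "real i2 \<le> k2 / w" "k1 / w - 1 \<le> real i1" using kw unfolding i1_def i2_def by linarith+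
   show "i1 \<le> i2" unfolding i1_def i2_def by (intro nat_mono floor_mono kw)
  qed
  define Q where "Q = {i \<in> {i1..i2}. G \<inter> {real i * w..<real i * w + w} \<noteq> {}}"
  have finQ: "finite Q" by (simp add: Q_def)
  have em: "?E \<in> sets borel" using hits_meas by (auto simp: sets_restrict_space_iff)
  have Gb: "G \<in> sets borel" using G(1) by (auto simp: sets_restrict_space_iff)
  have cover: "?E \<inter> {k1..k2} \<subseteq> ({0..<1} - G) \<union> (\<Union>i\<in>Q. ?E \<inter> {real i * w..<real i * w + w})"
  proof
   fix x assume x: "x \<in> ?E \<inter> {k1..k2}"
   show "x \<in> ({0..<1} - G) \<union> (\<Union>i\<in>Q. ?E \<inter> {real i * w..<real i * w + w})"
   proof (cases "x \<in> G")
    case False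
    then show ?thesis using x unfolding hits_def by blast
   next
    case True
    define i where "i = nat \<lfloor>x / w\<rfloor>"
    have xk: "k1 / w \<le> x / w" "x / w \<le> k2 / w" using x w by (auto intro: divide_right_mono)
    have "0 \<le> x / w" using xk kw by linarith
    then have "real i \<le> x / w" "x / w < real i + 1" unfolding i_def by linarith+
    then have xi: "x \<in> {real i * w..<real i * w + w}" using w by (simp add: field_simps)
    have "i1 \<le> i" "i \<le> i2" unfolding i1_def i2_def i_def by (intro nat_mono floor_mono xk)+
    then have "i \<in> Q" unfolding Q_def using xi True by auto
    then show ?thesis using x xi by blast
   qed
  qed
  have piece: "measure lborel (?E \<inter> {real i * w..<real i * w + w}) \<le> w * c s" if i: "i \<in> Q" for i
  proof -
   obtain y where y: "y \<in> G" "real i * w \<le> y" "y < real i * w + w" using i unfolding Q_def by auto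
   show ?thesis using elim(3) Gf[OF y(1)] y(2,3) unfolding w_def by blast
  qed
  have ef: "?E \<inter> A \<in> fmeasurable lborel" if "A \<in> sets borel" for A
   using unit_leb_fmeasurable[OF hits_meas] that by (intro fmeasurable_Int_fmeasurable) auto
  have bad: "{0..<1} - G \<in> fmeasurable lborel"
   using Gb by (intro fmeasurable_Diff) (auto simp: fmeasurable_def)
  have "measure lborel (?E \<inter> {k1..k2}) \<le> measure lborel (({0..<1} - G) \<union> (\<Union>i\<in>Q. ?E \<inter> {real i * w..<real i * w + w}))"
   using em by (intro measure_mono_fmeasurable[OF cover] fmeasurable.Un bad fmeasurable.finite_UN finQ ef) auto
  also have "\<dots> \<le> measure lborel ({0..<1} - G) + measure lborel (\<Union>i\<in>Q. ?E \<inter> {real i * w..<real i * w + w})"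
   using em Gb finQ by (intro measure_Un_le) auto
  also have "measure lborel (\<Union>i\<in>Q. ?E \<inter> {real i * w..<real i * w + w}) \<le> (\<Sum>i\<in>Q. measure lborel (?E \<inter> {real i * w..<real i * w + w}))"
   using em finQ by (intro measure_UNION_le) auto
  also have "\<dots> \<le> (\<Sum>i\<in>Q. w * c s)" by (rule sum_mono) (rule piece)
  also have "\<dots> = real (card Q) * (w * c s)" by simp
  also have "\<dots> \<le> (k2 / w - k1 / w + 2) * (w * c s)"
  proof (rule mult_right_mono)
   have "card Q \<le> card {i1..i2}" unfolding Q_def by (intro card_mono) auto
   then have "real (card Q) \<le> real (Suc i2 - i1)" by simp
   also have "\<dots> = real i2 + 1 - real i1" using ib(3) by simp
   also have "\<dots> \<le> k2 / w - k1 / w + 2" using ib by linarith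
   finally show "real (card Q) \<le> k2 / w - k1 / w + 2" .
  qed (use w c0 in simp)
  also have "\<dots> = (k2 - k1) * c s + 2 * w * c s" using w by (simp add: field_simps)
  also have "\<dots> \<le> (k2 - k1) * ((j2 - j1) * (h2 - h1) + e / 4) + e / 4"
   using K cs elim(5) unfolding w_def by (intro add_mono mult_left_mono) auto
  finally have "measure lborel (?E \<inter> {k1..k2}) \<le> e / 4 + ((k2 - k1) * ((j2 - j1) * (h2 - h1) + e / 4) + e / 4)"
   using G(2) by linarith
  moreover have "(k2 - k1) * (e / 4) \<le> 1 * (e / 4)" using K e by (intro mult_right_mono) auto
  moreover have "(k2 - k1) * ((j2 - j1) * (h2 - h1) + e / 4) = (k2 - k1) * (j2 - j1) * (h2 - h1) + (k2 - k1) * (e / 4)"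
   by (simp only: distrib_left mult.assoc)
  ultimately show ?case using e by linarith
 qed
qed

end

section \<open>The suspension flow preserves the measure\<close>

lemma emeasure_lborel_shift:
 fixes B :: "real set"
 assumes "B \<in> sets borel"
 shows "emeasure lborel {y. y + c \<in> B} = emeasure lborel B"
proof -
 have "emeasure lborel B = emeasure (distr lborel borel ((+) c)) B" by (simp add: lborel_distr_plus)
 also have "\<dots> = emeasure lborel {y. y + c \<in> B}"
  using assms by (subst emeasure_distr) (auto simp: vimage_def add.commute)
 finally show ?thesis by simp
qed

context asym_flow
begin

abbreviation "X \<equiv> suspension_space f"
abbreviation "\<phi> \<equiv> suspension_flow T f"

text \<open>\<open>F\<close>, \<open>T'\<close> and \<open>Ti'\<close> are extensions by zero, so
  that measurability can be checked in the Borel plane.\<close>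

definition F :: "real \<Rightarrow> real" where "F x = indicator {0..<1} x * f x"
definition T' :: "real \<Rightarrow> real" where "T' x = (if x \<in> {0..<1} then T x else 0)"
definition Ti' :: "real \<Rightarrow> real" where "Ti' x = (if x \<in> {0..<1} then Ti x else 0)"

lemma F_meas [measurable]: "F \<in> borel_measurable borel"
 using f_ind_borel unfolding F_def by simp

lemma F_eq: "x \<in> {0..<1} \<Longrightarrow> F x = f x"
 by (simp add: F_def)

lemma unit_extend_meas:
 assumes "g \<in> unit_leb \<rightarrow>\<^sub>M unit_leb"
 shows "(\<lambda>x. if x \<in> {0..<1} then g x else 0) \<in> borel_measurable borel"
proof -
 have "g \<in> borel_measurable (restrict_space borel {0..<1::real})"
 proof -
  have "g \<in> borel_measurable unit_leb"
   by (rule measurable_compose[OF assms, of "\<lambda>x. x"]) (simp add: measurable_restrict_space1)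
  moreover have "sets unit_leb = sets (restrict_space borel {0..<1::real})" by (intro sets_restrict_space_cong) simp
  ultimately show ?thesis by (simp cong: measurable_cong_sets)
 qed
 moreover have "{x. x \<in> {0..<1}} = {0..<1::real}" by (rule Collect_mem_eq)
 ultimately show ?thesis by (subst measurable_If_restrict_space_iff) (simp_all only: Collect_mem_eq, simp_all)
qed

lemma T'_meas [measurable]: "T' \<in> borel_measurable borel" and Ti'_meas [measurable]: "Ti' \<in> borel_measurable borel"
 using unit_extend_meas[OF T_meas] unit_extend_meas[OF Ti_meas] unfolding T'_def[abs_def] Ti'_def[abs_def] by simp_all

lemma X_eq: "X = {p. fst p \<in> {0..<1} \<and> 0 \<le> snd p \<and> snd p < F (fst p)}"
 unfolding suspension_space_def by (auto simp: F_eq)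

lemma X_meas [measurable]: "X \<in> sets borel"
proof -
 have "{p \<in> space (borel \<Otimes>\<^sub>M borel :: (real \<times> real) measure). fst p \<in> {0..<1} \<and> 0 \<le> snd p \<and> snd p < F (fst p)} \<in> sets (borel \<Otimes>\<^sub>M borel)"
  by measurable
 then show ?thesis unfolding X_eq borel_prod by simp
qed

lemma flow_small:
 assumes p: "(x, y) \<in> X" and s: "0 \<le> s" "s < m"
 shows "\<phi> s (x, y) = (if y + s < f x then (x, y + s) else (T x, y + s - f x))"
proof -
 have x: "x \<in> {0..<1}" "0 \<le> y" "y < f x" using p by (auto simp: suspension_space_def)
 have e: "It 1 x = T x" "S 1 x = f x" "S (1 + 1) x = f x + f (T x)"
  using It_step[OF x(1), of 0] S_step[of 0 x] S_step[of 1 x] by (simp_all add: It_0 S_0)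
 show ?thesis
 proof (cases "y + s < f x")
  case True
  then show ?thesis using suspension_flow_vertical[OF p, of s] x s by simp
 next
  case False
  have "y + s < S (1 + 1) x" unfolding e using f_ge[OF T_in[OF x(1)]] x s by linarith
  then show ?thesis using flow_eq[OF x(1), of 1 y s] False by (simp add: e(1,2))
 qed
qed

lemma flow_small_neg:
 assumes p: "(x, y) \<in> X" and s: "0 \<le> s" "s < m"
 shows "\<phi> (- s) (x, y) = (if s \<le> y then (x, y - s) else (Ti x, y - s + f (Ti x)))"
proof -
 have x: "x \<in> {0..<1}" "0 \<le> y" "y < f x" using p by (auto simp: suspension_space_def)
 have e: "It (- 1) x = Ti x" by (simp add: int_iterate_def)
 have S1: "S (- 1) x = - f (Ti x)" using S_step[of "- 1" x] by (simp add: S_0 e)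
 show ?thesis
 proof (cases "s \<le> y")
  case True
  then show ?thesis using suspension_flow_vertical[OF p, of "- s"] x s by simp
 next
  case False
  have "S (- 1) x \<le> y + - s" unfolding S1 using f_ge[OF Ti_in[OF x(1)]] x s by linarith
  then show ?thesis using flow_eq[OF x(1), of "- 1" y "- s"] False by (simp add: e S1 S_0)
 qed
qed

definition pre :: "real \<Rightarrow> (real \<times> real) set \<Rightarrow> (real \<times> real) set" where
 "pre t E = {p \<in> X. \<phi> t p \<in> E}"

definition preserves :: "real \<Rightarrow> bool" where
 "preserves t \<longleftrightarrow> (\<forall>E\<in>sets borel. E \<subseteq> X \<longrightarrow> pre t E \<in> sets borel \<and> emeasure lborel (pre t E) = emeasure lborel E)"

lemma pre_add: "E \<subseteq> X \<Longrightarrow> pre (s + t) E = pre t (pre s E)"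
 unfolding pre_def using suspension_flow_add suspension_flow_in by auto

lemma pre_neg: "E \<subseteq> X \<Longrightarrow> pre t (pre (- t) E) = E"
proof -
 assume E: "E \<subseteq> X"
 have "\<phi> (- t) (\<phi> t p) = p" if "p \<in> X" for p
  using suspension_flow_add[OF that, of "- t" t] suspension_flow_zero[OF that] by simp
 then show ?thesis using E suspension_flow_in unfolding pre_def by auto
qed

lemma pre_small_meas:
 assumes s: "0 \<le> s" "s < m" and E: "E \<in> sets borel"
 shows "pre s E \<in> sets borel" "pre (- s) E \<in> sets borel"
proof -
 have [measurable]: "E \<in> sets (borel \<Otimes>\<^sub>M borel)" "X \<in> sets (borel \<Otimes>\<^sub>M borel)"
  using E X_meas by (simp_all only: borel_prod)
 have 1: "pre s E = {p. p \<in> X \<and> (if snd p + s < F (fst p) then (fst p, snd p + s) else (T' (fst p), snd p + s - F (fst p))) \<in> E}"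
  unfolding pre_def by (rule Collect_cong, rule conj_cong[OF refl]) (auto simp: flow_small s suspension_space_def F_eq T'_def split: prod.split)
 have "{p \<in> space (borel \<Otimes>\<^sub>M borel). p \<in> X \<and> (if snd p + s < F (fst p) then (fst p, snd p + s) else (T' (fst p), snd p + s - F (fst p))) \<in> E} \<in> sets (borel \<Otimes>\<^sub>M borel)"
  by measurable
 then show "pre s E \<in> sets borel" unfolding 1 borel_prod by simp
 have FT: "F (Ti a) = f (Ti a)" if "0 \<le> a" "a < 1" for a using Ti_in[of a] that by (intro F_eq) simp
 have 2: "pre (- s) E = {p. p \<in> X \<and> (if s \<le> snd p then (fst p, snd p - s) else (Ti' (fst p), snd p - s + F (Ti' (fst p)))) \<in> E}"
  unfolding pre_def by (rule Collect_cong, rule conj_cong[OF refl]) (auto simp: flow_small_neg s suspension_space_def F_eq FT Ti'_def split: prod.split)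
 have "{p \<in> space (borel \<Otimes>\<^sub>M borel). p \<in> X \<and> (if s \<le> snd p then (fst p, snd p - s) else (Ti' (fst p), snd p - s + F (Ti' (fst p)))) \<in> E} \<in> sets (borel \<Otimes>\<^sub>M borel)"
  by measurable
 then show "pre (- s) E \<in> sets borel" unfolding 2 borel_prod by simp
qed

lemma emeasure_sections:
 assumes "E \<in> sets (borel :: (real \<times> real) measure)"
 shows "emeasure lborel E = (\<integral>\<^sup>+x. emeasure lborel (Pair x -` E) \<partial>lborel)"
proof -
 have E: "E \<in> sets (lborel \<Otimes>\<^sub>M lborel)" unfolding lborel_prod using assms by simp
 have "emeasure lborel E = emeasure (lborel \<Otimes>\<^sub>M lborel) E" unfolding lborel_prod ..
 also have "\<dots> = (\<integral>\<^sup>+x. emeasure lborel (Pair x -` E) \<partial>lborel)"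
  by (rule lborel.emeasure_pair_measure_alt[OF E])
 finally show ?thesis .
qed

lemma section_meas:
 assumes "E \<in> sets (borel :: (real \<times> real) measure)"
 shows "(\<lambda>x. emeasure lborel (Pair x -` E)) \<in> borel_measurable borel" and "Pair x -` E \<in> sets borel"
proof -
 have E: "E \<in> sets (lborel \<Otimes>\<^sub>M lborel)" unfolding lborel_prod using assms by simp
 show "(\<lambda>x. emeasure lborel (Pair x -` E)) \<in> borel_measurable borel"
  using lborel.measurable_emeasure_Pair[OF E] by simp
 show "Pair x -` E \<in> sets borel" using sets_Pair1[OF E] by simp
qed

text \<open>In a time shorter than the lower bound \<open>m\<close> of the roof at most one passage
  occurs. A vertical section of the preimage then consists of one shifted piece from over
  \<open>x\<close> and one from over \<open>T x\<close>; invariance on the base recombines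
  them.\<close>

lemma preserves_small:
 assumes s: "0 \<le> s" "s < m"
 shows "preserves s"
 unfolding preserves_def
proof (intro ballI impI conjI)
 fix E :: "(real \<times> real) set" assume E: "E \<in> sets borel" "E \<subseteq> X"
 show P: "pre s E \<in> sets borel" by (rule pre_small_meas(1)[OF s E(1)])
 define E1 E2 where "E1 = E \<inter> {p. s \<le> snd p}" and "E2 = E \<inter> {p. snd p < s}"
 have "{p \<in> space (borel \<Otimes>\<^sub>M borel :: (real \<times> real) measure). s \<le> snd p} \<in> sets (borel \<Otimes>\<^sub>M borel)"
  "{p \<in> space (borel \<Otimes>\<^sub>M borel :: (real \<times> real) measure). snd p < s} \<in> sets (borel \<Otimes>\<^sub>M borel)" by measurable
 then have Em: "E1 \<in> sets borel" "E2 \<in> sets borel" unfolding E1_def E2_def borel_prod using E by auto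
 define g1 g2 where "g1 x = emeasure lborel (Pair x -` E1)" and "g2 x = emeasure lborel (Pair x -` E2)" for x
 have gm: "g1 \<in> borel_measurable borel" "g2 \<in> borel_measurable borel"
  unfolding g1_def[abs_def] g2_def[abs_def] by (rule section_meas(1)[OF Em(1)], rule section_meas(1)[OF Em(2)])
 then have gm': "g1 \<in> borel_measurable unit_leb" "g2 \<in> borel_measurable unit_leb" by (simp_all add: measurable_restrict_space1)
 have sec: "emeasure lborel (Pair x -` pre s E) = g1 x + g2 (T x)" if x: "x \<in> {0..<1}" for x
 proof -
  have split: "Pair x -` pre s E = {y. y + s \<in> Pair x -` E1} \<union> {y. y + (s - f x) \<in> Pair (T x) -` E2}"
  proof (intro set_eqI iffI)
   fix y assume "y \<in> Pair x -` pre s E"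
   then have xy: "(x, y) \<in> X" "\<phi> s (x, y) \<in> E" by (auto simp: pre_def)
   then have "0 \<le> y" "y < f x" by (auto simp: suspension_space_def)
   with xy show "y \<in> {y. y + s \<in> Pair x -` E1} \<union> {y. y + (s - f x) \<in> Pair (T x) -` E2}"
    unfolding flow_small[OF xy(1) s] E1_def E2_def by (auto simp: algebra_simps split: if_splits)
  next
   fix y assume "y \<in> {y. y + s \<in> Pair x -` E1} \<union> {y. y + (s - f x) \<in> Pair (T x) -` E2}"
   then show "y \<in> Pair x -` pre s E"
   proof
    assume "y \<in> {y. y + s \<in> Pair x -` E1}"
    then have h: "(x, y + s) \<in> E" "0 \<le> y" by (auto simp: E1_def)
    then have "y + s < f x" using E(2) by (auto simp: suspension_space_def)
    moreover from this have X: "(x, y) \<in> X" using h x s by (auto simp: suspension_space_def)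
    ultimately show ?thesis using flow_small[OF X s] h X by (simp add: pre_def)
   next
    assume "y \<in> {y. y + (s - f x) \<in> Pair (T x) -` E2}"
    then have h: "(T x, y + (s - f x)) \<in> E" "y + (s - f x) < s" by (auto simp: E2_def)
    then have "0 \<le> y + (s - f x)" using E(2) by (auto simp: suspension_space_def)
    then have yf: "\<not> y + s < f x" "0 \<le> y" using f_ge[OF x] s by linarith+
    then have X: "(x, y) \<in> X" using h x by (auto simp: suspension_space_def)
    have "(T x, y + s - f x) \<in> E" using h(1) by (simp add: add_diff_eq)
    then show ?thesis using flow_small[OF X s] X yf by (simp add: pre_def)
   qed
  qed
  have m1: "{y. y + c \<in> Pair z -` E'} \<in> sets borel" if "E' \<in> sets borel" for c z and E' :: "(real \<times> real) set"
  proof -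
   have "(\<lambda>y. y + c) -` (Pair z -` E') \<inter> space borel \<in> sets borel"
    by (rule measurable_sets[OF _ section_meas(2)[OF that]]) simp
   then show ?thesis by (simp add: vimage_def)
  qed
  have disj: "{y. y + s \<in> Pair x -` E1} \<inter> {y. y + (s - f x) \<in> Pair (T x) -` E2} = {}"
  proof -
   have False if "(x, y + s) \<in> E" "(T x, y + (s - f x)) \<in> E" for y
   proof -
    have "y + s < f x" "0 \<le> y + (s - f x)" using that E(2) by (auto simp: suspension_space_def)
    then show False by linarith
   qed
   then show ?thesis by (auto simp: E1_def E2_def)
  qed
  have "emeasure lborel (Pair x -` pre s E) = emeasure lborel {y. y + s \<in> Pair x -` E1} + emeasure lborel {y. y + (s - f x) \<in> Pair (T x) -` E2}"
   unfolding split using disj m1 Em by (intro plus_emeasure[symmetric]) auto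
  also have "\<dots> = g1 x + g2 (T x)"
   unfolding g1_def g2_def by (simp only: emeasure_lborel_shift section_meas(2)[OF Em(1)] section_meas(2)[OF Em(2)])
  finally show ?thesis .
 qed
 have out: "Pair x -` A = {}" if "A \<subseteq> X" "x \<notin> {0..<1}" for x A using that by (auto simp: suspension_space_def)
 have int: "emeasure lborel A = (\<integral>\<^sup>+x. emeasure lborel (Pair x -` A) \<partial>unit_leb)" if A: "A \<in> sets borel" "A \<subseteq> X" for A
 proof -
  have "emeasure lborel A = (\<integral>\<^sup>+x. emeasure lborel (Pair x -` A) * indicator {0..<1} x \<partial>lborel)"
   unfolding emeasure_sections[OF A(1)] using out[OF A(2)] by (intro nn_integral_cong) (auto simp: indicator_def)
  then show ?thesis by (subst nn_integral_restrict_space) auto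
 qed
 have "emeasure lborel (pre s E) = (\<integral>\<^sup>+x. emeasure lborel (Pair x -` pre s E) \<partial>unit_leb)"
  by (rule int[OF P]) (auto simp: pre_def)
 also have "\<dots> = (\<integral>\<^sup>+x. g1 x + g2 (T x) \<partial>unit_leb)"
  by (rule nn_integral_cong) (use sec in \<open>simp only: space_unit\<close>)
 also have "\<dots> = (\<integral>\<^sup>+x. g1 x \<partial>unit_leb) + (\<integral>\<^sup>+x. g2 (T x) \<partial>unit_leb)"
  by (rule nn_integral_add[OF gm'(1)]) (rule measurable_compose[OF T_meas gm'(2)])
 also have "(\<integral>\<^sup>+x. g2 (T x) \<partial>unit_leb) = (\<integral>\<^sup>+x. g2 x \<partial>unit_leb)"
  using nn_integral_pow[OF gm'(2), of 1] by simp
 also have "(\<integral>\<^sup>+x. g1 x \<partial>unit_leb) + (\<integral>\<^sup>+x. g2 x \<partial>unit_leb) = (\<integral>\<^sup>+x. g1 x + g2 x \<partial>unit_leb)"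
  by (rule nn_integral_add[symmetric, OF gm'])
 also have "\<dots> = (\<integral>\<^sup>+x. emeasure lborel (Pair x -` E) \<partial>unit_leb)"
 proof (rule nn_integral_cong)
  fix x
  have "Pair x -` E = Pair x -` E1 \<union> Pair x -` E2" "Pair x -` E1 \<inter> Pair x -` E2 = {}" by (auto simp: E1_def E2_def)
  then show "g1 x + g2 x = emeasure lborel (Pair x -` E)"
   unfolding g1_def g2_def using section_meas(2)[OF Em(1)] section_meas(2)[OF Em(2)] by (subst plus_emeasure) auto
 qed
 also have "\<dots> = emeasure lborel E" by (rule int[OF E, symmetric])
 finally show "emeasure lborel (pre s E) = emeasure lborel E" .
qed

lemma preserves_small_neg:
 assumes s: "0 \<le> s" "s < m"
 shows "preserves (- s)"
 unfolding preserves_def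
proof (intro ballI impI conjI)
 fix E :: "(real \<times> real) set" assume E: "E \<in> sets borel" "E \<subseteq> X"
 show P: "pre (- s) E \<in> sets borel" by (rule pre_small_meas(2)[OF s E(1)])
 have "emeasure lborel (pre s (pre (- s) E)) = emeasure lborel (pre (- s) E)"
  using preserves_small[OF s] P unfolding preserves_def by (auto simp: pre_def)
 then show "emeasure lborel (pre (- s) E) = emeasure lborel E" by (simp add: pre_neg[OF E(2)])
qed

lemma preserves_add: "preserves s \<Longrightarrow> preserves t \<Longrightarrow> preserves (s + t)"
 unfolding preserves_def
proof (intro ballI impI)
 fix E :: "(real \<times> real) set"
 assume s: "\<forall>E\<in>sets borel. E \<subseteq> X \<longrightarrow> pre s E \<in> sets borel \<and> emeasure lborel (pre s E) = emeasure lborel E"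
  and t: "\<forall>E\<in>sets borel. E \<subseteq> X \<longrightarrow> pre t E \<in> sets borel \<and> emeasure lborel (pre t E) = emeasure lborel E"
  and E: "E \<in> sets borel" "E \<subseteq> X"
 have 1: "pre s E \<in> sets borel" "emeasure lborel (pre s E) = emeasure lborel E" using s E by blast+
 have "pre s E \<subseteq> X" by (auto simp: pre_def)
 then show "pre (s + t) E \<in> sets borel \<and> emeasure lborel (pre (s + t) E) = emeasure lborel E"
  using t 1 unfolding pre_add[OF E(2)] by simp
qed

text \<open>Every time is a multiple of one that is shorter than \<open>m\<close> in absolute
  value.\<close>

lemma preserves_all: "preserves t"
proof -
 obtain n :: nat where n: "\<bar>t\<bar> / m < real n" using reals_Archimedean2 by blast
 have "0 \<le> \<bar>t\<bar> / m" using m_pos by simp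
 with n have n0: "0 < n" using of_nat_0_less_iff[of n, where ?'a = real] by linarith
 define s where "s = t / real n"
 have "\<bar>s\<bar> < m" using n n0 m_pos by (simp add: s_def field_simps abs_divide)
 then have ps: "preserves s"
  using preserves_small[of s] preserves_small_neg[of "- s"] by (cases "0 \<le> s") auto
 have "preserves (real k * s)" for k
 proof (induction k)
  case 0
  then show ?case using preserves_small[of 0] m_pos by simp
 next
  case (Suc k)
  then show ?case using preserves_add[OF ps Suc] by (simp add: algebra_simps)
 qed
 from this[of n] show ?thesis using n0 by (simp add: s_def)
qed

text \<open>A Lebesgue set differs from a Borel set by part of a Borel null set, whose preimage is
  again null.\<close>

lemma pre_lebesgue:
 assumes E: "E \<in> sets lebesgue" "E \<subseteq> X"
 shows "pre t E \<in> sets lebesgue" "emeasure lebesgue (pre t E) = emeasure lebesgue E"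
proof -
 obtain A N N' where d: "E = A \<union> N" "N \<subseteq> N'" "N' \<in> null_sets lborel" "A \<in> sets lborel"
  using E(1) by (rule sets_completionE)
 have A: "A \<in> sets borel" "A \<subseteq> X" using d E by auto
 have N': "N' \<inter> X \<in> null_sets lborel" using d(3) by (intro null_set_Int2) auto
 have pA: "pre t A \<in> sets borel" "emeasure lborel (pre t A) = emeasure lborel A"
  using preserves_all[of t] A unfolding preserves_def by auto
 have pN: "pre t (N' \<inter> X) \<in> null_sets lborel"
  using preserves_all[of t] N' unfolding preserves_def null_sets_def by auto
 have u: "pre t E = pre t A \<union> pre t N" using d(1) by (auto simp: pre_def)
 have sub: "pre t N \<subseteq> pre t (N' \<inter> X)" using d E by (auto simp: pre_def)
 show L: "pre t E \<in> sets lebesgue" unfolding u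
  by (rule sets_completionI[OF refl sub pN]) (use pA in simp)
 have e: "emeasure lebesgue (A' \<union> M) = emeasure lborel A'" if "A' \<in> sets borel" "M \<subseteq> M'" "M' \<in> null_sets lborel" for A' M M' :: "(real \<times> real) set"
 proof -
  have M: "M \<in> null_sets lebesgue" using that(2,3) by (metis completion.complete2 null_sets_completionI)
  have "emeasure lebesgue (A' \<union> M) = emeasure lebesgue A'"
   using M that(1) by (intro emeasure_Un_null_set) auto
  then show ?thesis using that(1) by simp
 qed
 show "emeasure lebesgue (pre t E) = emeasure lebesgue E"
  unfolding u e[OF pA(1) sub pN] pA(2) unfolding d(1) by (rule e[symmetric, OF A(1) d(2,3)])
qed

end

section \<open>Mixing\<close>

abbreviation vol :: "'a::euclidean_space set \<Rightarrow> real" where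
 "vol \<equiv> measure lebesgue"

lemma measure_incseq_approx:
 fixes A :: "nat \<Rightarrow> 'a set"
 assumes "range A \<subseteq> sets M" "incseq A" "emeasure M (\<Union>i. A i) \<noteq> \<infinity>" "0 < e"
 shows "\<exists>n. measure M ((\<Union>i. A i) - A n) < e"
proof -
 have fin: "emeasure M (A i) \<noteq> \<infinity>" for i
 proof -
  have "(\<Union>i. A i) \<in> sets M" using assms(1) by auto
  then have "emeasure M (A i) \<le> emeasure M (\<Union>i. A i)" by (intro emeasure_mono) blast
  then show ?thesis using assms(3) by (auto simp: top_unique)
 qed
 have "(\<lambda>i. measure M (A i)) \<longlonglongrightarrow> measure M (\<Union>i. A i)" by (rule Lim_measure_incseq[OF assms(1-3)])
 then have "eventually (\<lambda>n. measure M (\<Union>i. A i) - e < measure M (A n)) sequentially"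
  using assms(4) by (intro order_tendstoD(1)) auto
 then obtain n where "measure M (\<Union>i. A i) - e < measure M (A n)" by (auto dest: eventually_happens)
 moreover have "measure M ((\<Union>i. A i) - A n) = measure M (\<Union>i. A i) - measure M (A n)"
  using assms fin by (intro measure_Diff) auto
 ultimately show ?thesis by (intro exI[of _ n]) linarith
qed

lemma negligible_Int_cbox:
 fixes a b c d :: "'a::euclidean_space"
 assumes "interior (cbox a b) \<inter> interior (cbox c d) = {}"
 shows "negligible (cbox a b \<inter> cbox c d)"
proof -
 have "cbox a b \<inter> cbox c d \<subseteq> (cbox a b - box a b) \<union> (cbox c d - box c d)" using assms by auto
 moreover have "negligible ((cbox a b - box a b) \<union> (cbox c d - box c d))"
  by (intro negligible_Un negligible_frontier_interval)
 ultimately show ?thesis by (rule negligible_subset[rotated])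
qed

text \<open>A bounded part of the open set is filled by countably many nonoverlapping boxes from the
  covering lemma, and finitely many of them carry almost all the volume.\<close>

lemma open_box_approx:
 fixes U :: "'a::euclidean_space set"
 assumes U: "open U" "U \<in> lmeasurable" and e: "0 < e"
 shows "\<exists>F. finite F \<and> (\<forall>K\<in>F. K \<subseteq> U \<and> (\<exists>a b. K = cbox a b)) \<and>
  pairwise (\<lambda>K K'. negligible (K \<inter> K')) F \<and> vol (U - \<Union>F) < e"
proof -
 define V where "V n = U \<inter> cbox (- (real (Suc n) *\<^sub>R One)) (real (Suc n) *\<^sub>R (One :: 'a))" for n
 have UV: "(\<Union>n. V n) = U"
 proof -
  have "\<exists>n. x \<in> cbox (- (real (Suc n) *\<^sub>R One)) (real (Suc n) *\<^sub>R (One :: 'a))" for x :: 'a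
  proof -
   obtain n where n: "norm x < real n" using reals_Archimedean2 by blast
   have "- real (Suc n) \<le> x \<bullet> i \<and> x \<bullet> i \<le> real (Suc n)" if "i \<in> Basis" for i
    using Basis_le_norm[OF that, of x] n by (simp add: abs_le_iff)
   then show ?thesis by (intro exI[of _ n]) (simp add: mem_box del: of_nat_Suc)
  qed
  then show ?thesis unfolding V_def by blast
 qed
 have inc: "incseq V" unfolding V_def
 proof (rule incseq_SucI)
  fix n :: nat
  have "cbox (- (real (Suc n) *\<^sub>R One)) (real (Suc n) *\<^sub>R (One :: 'a)) \<subseteq> cbox (- (real (Suc (Suc n)) *\<^sub>R One)) (real (Suc (Suc n)) *\<^sub>R One)"
   by (rule subset_box_imp) auto
  then show "U \<inter> cbox (- (real (Suc n) *\<^sub>R One)) (real (Suc n) *\<^sub>R (One :: 'a)) \<le> U \<inter> cbox (- (real (Suc (Suc n)) *\<^sub>R One)) (real (Suc (Suc n)) *\<^sub>R One)" by blast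
 qed
 have Vm: "range V \<subseteq> sets lebesgue" using U unfolding V_def by auto
 have Uf: "emeasure lebesgue U \<noteq> \<infinity>" using U(2) by (auto simp: fmeasurable_def)
 from measure_incseq_approx[OF Vm inc, of "e / 2"] Uf e UV obtain n where n: "vol (U - V n) < e / 2" by auto
 \<comment> \<open>This gauge confines every box of the covering to \<open>U\<close>.\<close>
 define g where "g x = (if x \<in> U then U else UNIV)" for x
 have g: "gauge g" using U(1) by (auto simp: g_def gauge_def)
 have ne: "box (- (real (Suc n) *\<^sub>R One)) (real (Suc n) *\<^sub>R (One :: 'a)) \<noteq> {}" by (simp add: box_ne_empty)
 have "V n \<subseteq> cbox (- (real (Suc n) *\<^sub>R One)) (real (Suc n) *\<^sub>R (One :: 'a))" by (auto simp: V_def)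
 from covering_lemma[OF this ne g] obtain \<D> where \<D>: "countable \<D>"
   "\<And>K. K \<in> \<D> \<Longrightarrow> interior K \<noteq> {} \<and> (\<exists>c d. K = cbox c d)"
   "pairwise (\<lambda>A B. interior A \<inter> interior B = {}) \<D>" "\<And>K. K \<in> \<D> \<Longrightarrow> \<exists>x\<in>V n \<inter> K. K \<subseteq> g x" "V n \<subseteq> \<Union>\<D>"
  by metis
 have KU: "K \<subseteq> U" if "K \<in> \<D>" for K using \<D>(4)[OF that] by (auto simp: g_def V_def)
 have pn: "pairwise (\<lambda>K K'. negligible (K \<inter> K')) \<D>"
 proof (rule pairwiseI)
  fix K K' assume K: "K \<in> \<D>" "K' \<in> \<D>" "K \<noteq> K'"
  obtain a b c d where "K = cbox a b" "K' = cbox c d" using \<D>(2)[OF K(1)] \<D>(2)[OF K(2)] by blast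
  moreover have "interior K \<inter> interior K' = {}" using pairwiseD[OF \<D>(3) K(1,2)] K(3) by simp
  ultimately show "negligible (K \<inter> K')" using negligible_Int_cbox by metis
 qed
 have Dm: "K \<in> sets lebesgue" if "K \<in> \<D>" for K using \<D>(2)[OF that] by auto
 have UD: "\<Union>\<D> \<in> sets lebesgue" using Dm \<D>(1) by (intro sets.countable_Union) auto
 have "\<exists>F. finite F \<and> F \<subseteq> \<D> \<and> vol (\<Union>\<D> - \<Union>F) < e / 2"
 proof (cases "\<D> = {}")
  case True
  then show ?thesis using e by (intro exI[of _ "{}"]) auto
 next
  case False
  define A where "A k = \<Union>(from_nat_into \<D> ` {..<k})" for k
  have mem: "from_nat_into \<D> i \<in> \<D>" for i using False by (rule from_nat_into)
  have UA: "(\<Union>k. A k) = \<Union>\<D>"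
  proof -
   have "(\<Union>k. A k) = \<Union>(range (from_nat_into \<D>))" unfolding A_def by blast
   then show ?thesis using range_from_nat_into[OF False \<D>(1)] by simp
  qed
  have "range A \<subseteq> sets lebesgue" unfolding A_def using Dm mem by (auto intro!: sets.finite_UN)
  moreover have "incseq A" unfolding A_def incseq_def by fastforce
  moreover have "emeasure lebesgue (\<Union>k. A k) \<noteq> \<infinity>"
  proof -
   have "emeasure lebesgue (\<Union>\<D>) \<le> emeasure lebesgue U" using KU U(2) by (intro emeasure_mono) auto
   then show ?thesis using Uf unfolding UA by (auto simp: top_unique)
  qed
  ultimately obtain k where "vol (\<Union>\<D> - A k) < e / 2"
   using measure_incseq_approx[of A lebesgue "e / 2"] e UA by auto
  then show ?thesis using mem by (intro exI[of _ "from_nat_into \<D> ` {..<k}"]) (auto simp: A_def)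
 qed
 then obtain F where F: "finite F" "F \<subseteq> \<D>" "vol (\<Union>\<D> - \<Union>F) < e / 2" by blast
 have UF: "\<Union>F \<in> sets lebesgue" using Dm F by (intro sets.finite_Union) auto
 have "vol (U - \<Union>F) \<le> vol ((U - V n) \<union> (\<Union>\<D> - \<Union>F))"
 proof (rule measure_mono_fmeasurable)
  show "U - \<Union>F \<subseteq> (U - V n) \<union> (\<Union>\<D> - \<Union>F)" using \<D>(5) by blast
  have "(U - V n) \<union> (\<Union>\<D> - \<Union>F) \<subseteq> U" using KU by blast
  then show "(U - V n) \<union> (\<Union>\<D> - \<Union>F) \<in> lmeasurable"
   using U(2) Vm UD UF by (intro fmeasurableI2[OF U(2)]) auto
 qed (use U(2) UF in auto)
 also have "\<dots> \<le> vol (U - V n) + vol (\<Union>\<D> - \<Union>F)"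
  using U(2) Vm UD UF by (intro measure_Un_le) auto
 also have "\<dots> < e" using n F(3) by linarith
 finally have "vol (U - \<Union>F) < e" .
 moreover have "pairwise (\<lambda>K K'. negligible (K \<inter> K')) F" using pn F(2) by (rule pairwise_subset)
 ultimately show ?thesis using F KU \<D>(2) by (intro exI[of _ F]) blast
qed

text \<open>For an upper bound subadditivity suffices: the set is covered by finitely many boxes of
  almost the same total volume and a remainder that contributes at most its own volume.\<close>

lemma limsup_from_boxes:
 fixes mm :: "real \<Rightarrow> 'a::euclidean_space set \<Rightarrow> real"
 assumes Om: "open Om" "Om \<in> lmeasurable"
  and le: "\<And>t A. A \<in> sets lebesgue \<Longrightarrow> A \<subseteq> Om \<Longrightarrow> mm t A \<le> vol A"
  and mono: "\<And>t A B. A \<in> sets lebesgue \<Longrightarrow> B \<in> sets lebesgue \<Longrightarrow> A \<subseteq> B \<Longrightarrow> B \<subseteq> Om \<Longrightarrow> mm t A \<le> mm t B"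
  and sub: "\<And>t A B. A \<in> sets lebesgue \<Longrightarrow> B \<in> sets lebesgue \<Longrightarrow> A \<subseteq> Om \<Longrightarrow> B \<subseteq> Om \<Longrightarrow> mm t (A \<union> B) \<le> mm t A + mm t B"
  and box: "\<And>a b e. cbox a b \<subseteq> Om \<Longrightarrow> 0 < e \<Longrightarrow> eventually (\<lambda>t. mm t (cbox a b) \<le> c * vol (cbox a b) + e) at_top"
  and c: "0 \<le> c" and S: "S \<in> sets lebesgue" "S \<subseteq> Om" and e: "0 < e"
 shows "eventually (\<lambda>t. mm t S \<le> c * vol S + e) at_top"
proof -
 define e1 where "e1 = e / (c + 2)"
 have e1: "0 < e1" using e c by (simp add: e1_def)
 have Sl: "S \<in> lmeasurable" by (rule fmeasurableI2[OF Om(2) S(2,1)])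
 obtain W where W: "open W" "S \<subseteq> W" "W - S \<in> lmeasurable" "emeasure lebesgue (W - S) < ennreal e1"
  using sets_lebesgue_outer_open[OF S(1) e1] by blast
 define U where "U = W \<inter> Om"
 have U: "open U" "U \<in> lmeasurable" "U \<subseteq> Om" "S \<subseteq> U"
  using W Om S fmeasurableI2[OF Om(2), of U] unfolding U_def by auto
 have mU: "vol U \<le> vol S + e1"
 proof -
  have "vol U \<le> vol (S \<union> (W - S))"
   using Sl W(2,3) U(1) by (intro measure_mono_fmeasurable fmeasurable.Un) (auto simp: U_def)
  also have "\<dots> \<le> vol S + vol (W - S)" using S W by (intro measure_Un_le) auto
  also have "vol (W - S) \<le> e1" using W(4) e1 by (simp add: measure_def enn2real_leI less_imp_le)
  finally show ?thesis by simp
 qed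
 obtain F where F0: "finite F \<and> (\<forall>K\<in>F. K \<subseteq> U \<and> (\<exists>a b. K = cbox a b)) \<and>
  pairwise (\<lambda>K K'. negligible (K \<inter> K')) F \<and> vol (U - \<Union>F) < e1"
  using open_box_approx[OF U(1,2) e1] by (rule exE)
 then have F: "finite F" "\<And>K. K \<in> F \<Longrightarrow> K \<subseteq> U" "\<And>K. K \<in> F \<Longrightarrow> \<exists>a b. K = cbox a b"
  "pairwise (\<lambda>K K'. negligible (K \<inter> K')) F" "vol (U - \<Union>F) < e1"
  by simp_all
 have Fm: "K \<in> lmeasurable" if "K \<in> F" for K using F(3)[OF that] by auto
 have UF: "\<Union>F \<in> sets lebesgue" using Fm F(1) by (intro sets.finite_Union) auto
 have FO: "\<Union>F \<subseteq> U" "\<Union>F \<subseteq> Om" "U - \<Union>F \<subseteq> Om" "U - \<Union>F \<in> sets lebesgue" "S \<subseteq> \<Union>F \<union> (U - \<Union>F)" "\<Union>F \<union> (U - \<Union>F) \<subseteq> Om" "\<Union>F \<union> (U - \<Union>F) \<in> sets lebesgue"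
  using F(2) U UF by blast+
 have sumF: "(\<Sum>K\<in>F. vol K) \<le> vol S + e1"
 proof -
  have "(\<Sum>K\<in>F. vol K) = vol (\<Union>F)"
   using measure_negligible_finite_Union[OF F(1) Fm F(4)] by simp
  also have "\<dots> \<le> vol U" using F(2) U(2) UF by (intro measure_mono_fmeasurable) auto
  finally show ?thesis using mU by linarith
 qed
 have fin_sub: "mm t (\<Union>G) \<le> (\<Sum>K\<in>G. mm t K) + mm t {}" if "finite G" "G \<subseteq> F" for G t
  using that
 proof (induction G rule: finite_induct)
  case (insert K G)
  have "mm t (K \<union> \<Union>G) \<le> mm t K + mm t (\<Union>G)"
  proof (rule sub)
   show "\<Union>G \<in> sets lebesgue" using insert Fm by (intro sets.finite_Union) auto
   show "K \<in> sets lebesgue" using insert Fm by auto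
   show "K \<subseteq> Om" "\<Union>G \<subseteq> Om" using insert F(2) U(3) by blast+
  qed
  then show ?case using insert by simp
 qed simp
 have m0: "mm t {} \<le> 0" for t using le[of "{}" t] by simp
 define e2 where "e2 = e1 / (real (card F) + 1)"
 have e2: "0 < e2" using e1 by (simp add: e2_def)
 have "\<forall>K\<in>F. eventually (\<lambda>t. mm t K \<le> c * vol K + e2) at_top"
  using box[OF _ e2] F(2,3) U(3) by (metis order_trans)
 then have "eventually (\<lambda>t. \<forall>K\<in>F. mm t K \<le> c * vol K + e2) at_top"
  using F(1) by (simp add: eventually_ball_finite_distrib)
 then show ?thesis
 proof eventually_elim
  case (elim t)
  have "mm t S \<le> mm t (\<Union>F \<union> (U - \<Union>F))"
   by (rule mono[OF S(1) FO(7,5,6)])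
  also have "\<dots> \<le> mm t (\<Union>F) + mm t (U - \<Union>F)" by (rule sub[OF UF FO(4,2,3)])
  also have "mm t (U - \<Union>F) \<le> e1" using le[OF FO(4,3), of t] F(5) by linarith
  also have "mm t (\<Union>F) \<le> (\<Sum>K\<in>F. mm t K)" using fin_sub[OF F(1) subset_refl, of t] m0[of t] by linarith
  also have "\<dots> \<le> (\<Sum>K\<in>F. c * vol K + e2)" using elim by (intro sum_mono) blast
  also have "\<dots> = c * (\<Sum>K\<in>F. vol K) + real (card F) * e2" by (simp add: sum.distrib sum_distrib_left)
  also have "\<dots> \<le> c * (vol S + e1) + e1"
  proof (intro add_mono mult_left_mono sumF c)
   show "real (card F) * e2 \<le> e1" using e1 by (simp add: e2_def field_simps)
  qed
  finally have "mm t S \<le> c * vol S + (c + 2) * e1" by (simp add: algebra_simps)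
  also have "(c + 2) * e1 = e" using c by (simp add: e1_def)
  finally show ?case by simp
 qed
qed

section \<open>From rectangles to measurable sets\<close>

context asym_flow
begin

lemma birkhoff_nat: "S (int n) x = Sn n x"
proof (induction n)
 case 0 then show ?case by (simp add: S_0 Sn_def)
next
 case (Suc n)
 have "S (int (Suc n)) x = S (int n + 1) x" by (simp add: add.commute)
 also have "\<dots> = Sn (Suc n) x" using Suc by (simp only: S_step) (simp add: Sn_def int_iterate_def)
 finally show ?case .
qed

lemma flow_hits:
 assumes x: "x \<in> {0..<1}" and t: "0 \<le> t" and B: "\<phi> t (x, 0) \<in> cbox (j1, h1) (j2, h2)"
 shows "x \<in> hits j1 j2 h1 h2 t"
proof -
 obtain r where r: "Sn r x \<le> t" "t < Sn (r + 1) x" using level_ex[OF x t] by blast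
 have "S (int r + 1) x = Sn (r + 1) x" using birkhoff_nat[of "r + 1" x] by (simp add: add.commute)
 then have "\<phi> t (x, 0) = ((T ^^ r) x, t - Sn r x)"
  using flow_eq[OF x, of "int r" 0 t] r by (simp add: birkhoff_nat int_iterate_def)
 then show ?thesis using B r x unfolding hits_def by (auto simp: cbox_Pair_eq)
qed

text \<open>An open subset of full measure, in which sets can be approximated by boxes.\<close>

definition Om :: "(real \<times> real) set" where
 "Om = {(x, y). 0 < x \<and> x < 1 \<and> 0 < y \<and> y < f x}"

lemma Om_sub: "Om \<subseteq> X"
 by (auto simp: Om_def suspension_space_def)

lemma Om_open: "open Om"
proof -
 have "continuous_on ({0<..<1} \<times> UNIV) (\<lambda>p :: real \<times> real. f (fst p) - snd p)"
  by (intro continuous_intros continuous_on_compose2[OF f_cont]) auto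
 then have o1: "open ((\<lambda>p. f (fst p) - snd p) -` {0<..} \<inter> ({0<..<1} \<times> UNIV :: (real \<times> real) set))"
  by (rule continuous_on_open_vimage[THEN iffD1, rule_format, rotated]) (auto intro: open_Times)
 have o2: "open (UNIV \<times> {0<..} :: (real \<times> real) set)" by (intro open_Times) auto
 have e: "Om = ((\<lambda>p. f (fst p) - snd p) -` {0<..} \<inter> ({0<..<1} \<times> UNIV)) \<inter> (UNIV \<times> {0<..})"
  by (auto simp: Om_def)
 show ?thesis unfolding e by (rule open_Int[OF o1 o2])
qed

lemma X_measure: "emeasure lborel X = 1"
proof -
 have "emeasure lborel X = (\<integral>\<^sup>+x. emeasure lborel (Pair x -` X) \<partial>lborel)" by (rule emeasure_sections[OF X_meas])
 also have "\<dots> = (\<integral>\<^sup>+x. ennreal (f x) * indicator {0..<1} x \<partial>lborel)"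
 proof (rule nn_integral_cong)
  fix x :: real
  have "Pair x -` X = (if x \<in> {0..<1} then {0..<f x} else {})" by (auto simp: suspension_space_def)
  then show "emeasure lborel (Pair x -` X) = ennreal (f x) * indicator {0..<1} x"
   using f_pos[of x] by (auto simp: indicator_def less_imp_le)
 qed
 also have "\<dots> = (\<integral>\<^sup>+x. ennreal (f x) \<partial>unit_leb)" by (subst nn_integral_restrict_space) auto
 finally show ?thesis using nn_integral_f by simp
qed

lemma X_lmeasurable: "X \<in> lmeasurable" and X_one: "vol X = 1"
proof -
 have e: "emeasure lebesgue X = 1" using X_measure X_meas by simp
 show "X \<in> lmeasurable" by (rule fmeasurableI) (use e X_meas in \<open>simp_all del: emeasure_completion\<close>)
 show "vol X = 1" unfolding measure_def e by simp
qed

lemma sub_X: "A \<in> sets lebesgue \<Longrightarrow> A \<subseteq> X \<Longrightarrow> A \<in> lmeasurable"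
 by (rule fmeasurableI2[OF X_lmeasurable])

lemma pre_sub: "pre t E \<subseteq> X" by (auto simp: pre_def)

lemma pre_lmeasurable: "E \<in> sets lebesgue \<Longrightarrow> E \<subseteq> X \<Longrightarrow> pre t E \<in> lmeasurable"
 by (rule sub_X[OF pre_lebesgue(1) pre_sub])

lemma pre_measure: "E \<in> sets lebesgue \<Longrightarrow> E \<subseteq> X \<Longrightarrow> vol (pre t E) = vol E"
 using pre_lebesgue(2) by (simp add: measure_def)

lemma boundary_null: "X - Om \<in> null_sets lebesgue"
proof -
 have "negligible {p :: real \<times> real. p \<bullet> (1, 0) = 0}" "negligible {p :: real \<times> real. p \<bullet> (0, 1) = 0}"
  by (rule negligible_standard_hyperplane; simp add: Basis_prod_def)+
 moreover have "X - Om \<subseteq> {p. p \<bullet> (1, 0) = 0} \<union> {p. p \<bullet> (0, 1) = 0}"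
  by (auto simp: Om_def suspension_space_def)
 ultimately have "negligible (X - Om)" by (meson negligible_Un negligible_subset)
 then show ?thesis by (simp add: negligible_iff_null_sets)
qed

text \<open>A point at height \<open>y\<close> is, after time \<open>t\<close>, where the base point
  below it is after time \<open>t + y\<close>. So the horizontal section at height \<open>y\<close>
  is bounded by \<open>hits\<close> at time \<open>t + y\<close>, uniformly for large
  \<open>t\<close>, and Fubini gives the area.\<close>

lemma box_bound:
 assumes A: "cbox (k1, y1) (k2, y2) \<subseteq> Om" "k1 \<le> k2" "y1 \<le> y2"
  and B: "cbox (j1, h1) (j2, h2) \<subseteq> Om" "j1 \<le> j2" "h1 \<le> h2" and e: "0 < e"
 shows "eventually (\<lambda>t. vol (cbox (k1, y1) (k2, y2) \<inter> pre t (cbox (j1, h1) (j2, h2))) \<le>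
  ((k2 - k1) * (y2 - y1)) * ((j2 - j1) * (h2 - h1)) + e) at_top"
proof -
 have "(j1, h1) \<in> Om" "(j2, h1) \<in> Om" "(k1, y1) \<in> Om" "(k2, y1) \<in> Om"
  using A B by (auto simp: cbox_Pair_eq)
 then have p: "0 < j1" "j2 < 1" "0 < k1" "k2 < 1" "0 < y1" by (auto simp: Om_def)
 define e' where "e' = e / (y2 - y1 + 1)"
 have e': "0 < e'" "(y2 - y1) * e' \<le> e" using e A by (simp_all add: e'_def field_simps)
 define c where "c = (k2 - k1) * (j2 - j1) * (h2 - h1) + e'"
 have c0: "0 \<le> c" using A B e' by (simp add: c_def)
 have "eventually (\<lambda>t. measure lborel (hits j1 j2 h1 h2 t \<inter> {k1..k2}) \<le> c) at_top"
  unfolding c_def by (rule hits_bound) (use p A B e' in auto)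
 then obtain t0 where t0: "\<And>t. t0 \<le> t \<Longrightarrow> measure lborel (hits j1 j2 h1 h2 t \<inter> {k1..k2}) \<le> c"
  unfolding eventually_at_top_linorder by blast
 show ?thesis
  using eventually_ge_at_top[of "max t0 0"]
 proof eventually_elim
  case (elim t)
  let ?A = "cbox (k1, y1) (k2, y2)" and ?B = "cbox (j1, h1) (j2, h2)"
  define Z where "Z = ?A \<inter> pre t ?B"
  have BX: "?B \<subseteq> X" using B Om_sub by blast
  have "pre t ?B \<in> sets borel" using preserves_all[of t] BX unfolding preserves_def by auto
  then have Z: "Z \<in> sets borel" unfolding Z_def by auto
  then have Zp: "Z \<in> sets (lborel \<Otimes>\<^sub>M lborel)" unfolding lborel_prod by simp
  have sec: "(\<lambda>x. (x, y)) -` Z \<subseteq> (if y \<in> {y1..y2} then hits j1 j2 h1 h2 (t + y) \<inter> {k1..k2} else {})" for y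
  proof
   fix x assume "x \<in> (\<lambda>x. (x, y)) -` Z"
   then have z: "x \<in> {k1..k2}" "y \<in> {y1..y2}" "(x, y) \<in> X" "\<phi> t (x, y) \<in> ?B"
    by (auto simp: Z_def cbox_Pair_eq pre_def split: if_splits)
   then have x: "x \<in> {0..<1}" "0 \<le> y" "y < f x" by (auto simp: suspension_space_def)
   have b: "(x, 0) \<in> X" using x by (auto simp: suspension_space_def)
   have "\<phi> (t + y) (x, 0) = \<phi> t (\<phi> y (x, 0))" by (rule suspension_flow_add[OF b])
   also have "\<phi> y (x, 0) = (x, y)" using suspension_flow_vertical[OF b, of y] x by simp
   finally have "\<phi> (t + y) (x, 0) \<in> ?B" using z by simp
   then have "x \<in> hits j1 j2 h1 h2 (t + y)" using flow_hits[OF x(1)] elim x(2) by simp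
   then show "x \<in> (if y \<in> {y1..y2} then hits j1 j2 h1 h2 (t + y) \<inter> {k1..k2} else {})" using z by auto
  qed
  have "emeasure lborel Z = emeasure (lborel \<Otimes>\<^sub>M lborel) Z" unfolding lborel_prod ..
  also have "\<dots> = (\<integral>\<^sup>+y. emeasure lborel ((\<lambda>x. (x, y)) -` Z) \<partial>lborel)"
   by (rule lborel_pair.emeasure_pair_measure_alt2[OF Zp])
  also have "\<dots> \<le> (\<integral>\<^sup>+y. ennreal c * indicator {y1..y2} y \<partial>lborel)"
  proof (rule nn_integral_mono)
   fix y :: real
   show "emeasure lborel ((\<lambda>x. (x, y)) -` Z) \<le> ennreal c * indicator {y1..y2} y"
   proof (cases "y \<in> {y1..y2}")
    case True
    have h: "hits j1 j2 h1 h2 (t + y) \<inter> {k1..k2} \<in> fmeasurable lborel"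
     using unit_leb_fmeasurable[OF hits_meas] by (intro fmeasurable_Int_fmeasurable) auto
    have "emeasure lborel ((\<lambda>x. (x, y)) -` Z) \<le> emeasure lborel (hits j1 j2 h1 h2 (t + y) \<inter> {k1..k2})"
     using sec[of y] True h by (intro emeasure_mono) auto
    also have "\<dots> = ennreal (measure lborel (hits j1 j2 h1 h2 (t + y) \<inter> {k1..k2}))"
     using h by (intro emeasure_eq_ennreal_measure) (auto simp: fmeasurable_def)
    also have "\<dots> \<le> ennreal c" by (intro ennreal_leI t0) (use elim True p in auto)
    finally show ?thesis using True by simp
   next
    case False
    then have "(\<lambda>x. (x, y)) -` Z = {}" using sec[of y] by auto
    then show ?thesis by simp
   qed
  qed
  also have "\<dots> = ennreal (c * (y2 - y1))" using c0 A by (simp add: nn_integral_cmult_indicator ennreal_mult)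
  finally have "measure lborel Z \<le> c * (y2 - y1)" using c0 A by (simp add: measure_def enn2real_leI)
  moreover have "vol Z = measure lborel Z" using Z by simp
  ultimately have "vol Z \<le> c * (y2 - y1)" by simp
  also have "\<dots> = ((k2 - k1) * (y2 - y1)) * ((j2 - j1) * (h2 - h1)) + (y2 - y1) * e'"
   by (simp add: c_def algebra_simps)
  finally show ?case using e'(2) unfolding Z_def by linarith
 qed
qed

lemma cbox_cases:
 fixes a b :: "real \<times> real"
 obtains "cbox a b = {}" | k1 y1 k2 y2 where "cbox a b = cbox (k1, y1) (k2, y2)" "k1 \<le> k2" "y1 \<le> y2"
  "vol (cbox a b) = (k2 - k1) * (y2 - y1)"
proof (cases "fst a \<le> fst b \<and> snd a \<le> snd b")
 case True
 obtain k1 y1 k2 y2 where ab: "a = (k1, y1)" "b = (k2, y2)" by (cases a, cases b) blast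
 have le: "k1 \<le> k2" "y1 \<le> y2" using True ab by auto
 have "emeasure lebesgue (cbox a b) = emeasure lborel (cbox a b)" by simp
 also have "\<dots> = emeasure (lborel \<Otimes>\<^sub>M lborel) ({k1..k2} \<times> {y1..y2})"
  unfolding ab lborel_prod by (simp add: cbox_Pair_eq)
 also have "\<dots> = ennreal ((k2 - k1) * (y2 - y1))"
  using le by (subst lborel.emeasure_pair_measure_Times) (auto simp: ennreal_mult)
 finally have "vol (cbox a b) = (k2 - k1) * (y2 - y1)" using le by (simp add: measure_def)
 then show ?thesis using that(2) ab le by blast
next
 case False
 then have "cbox a b = {}" by (cases a, cases b) (auto simp: cbox_Pair_eq)
 then show ?thesis by (rule that(1))
qed

text \<open>First \<open>A\<close> is generalised with a box in the second place, where the trivial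
  bound by volume is enough; generalising the second set in \<open>limsup_sets\<close> uses
  invariance of the measure instead.\<close>

lemma limsup_set_box:
 assumes A: "A \<in> sets lebesgue" "A \<subseteq> Om" and B: "cbox a b \<subseteq> Om" and e: "0 < e"
 shows "eventually (\<lambda>t. vol (A \<inter> pre t (cbox a b)) \<le> vol (cbox a b) * vol A + e) at_top"
proof (rule limsup_from_boxes[where mm = "\<lambda>t A. vol (A \<inter> pre t (cbox a b))", OF Om_open _ _ _ _ _ _ A e])
 have BX: "cbox a b \<subseteq> X" using B Om_sub by blast
 have P: "pre t (cbox a b) \<in> sets lebesgue" for t using pre_lebesgue(1)[OF _ BX] by simp
 have fm: "C \<inter> pre t (cbox a b) \<in> lmeasurable" if "C \<in> sets lebesgue" "C \<subseteq> Om" for C t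
  by (rule sub_X) (use that P Om_sub in auto)
 show "Om \<in> lmeasurable" by (rule sub_X) (use Om_open Om_sub in auto)
 show "vol (C \<inter> pre t (cbox a b)) \<le> vol C" if "C \<in> sets lebesgue" "C \<subseteq> Om" for t C
  by (rule measure_mono_fmeasurable[OF Int_lower1 sets.Int[OF that(1) P] sub_X[OF that(1) order_trans[OF that(2) Om_sub]]])
 show "vol (C \<inter> pre t (cbox a b)) \<le> vol (C' \<inter> pre t (cbox a b))"
  if "C \<in> sets lebesgue" "C' \<in> sets lebesgue" "C \<subseteq> C'" "C' \<subseteq> Om" for t C C'
 proof (rule measure_mono_fmeasurable)
  show "C \<inter> pre t (cbox a b) \<subseteq> C' \<inter> pre t (cbox a b)" using that(3) by blast
 qed (rule sets.Int[OF that(1) P], rule fm[OF that(2,4)])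
 show "vol ((C \<union> C') \<inter> pre t (cbox a b)) \<le> vol (C \<inter> pre t (cbox a b)) + vol (C' \<inter> pre t (cbox a b))"
  if "C \<in> sets lebesgue" "C' \<in> sets lebesgue" for t C C'
  unfolding Int_Un_distrib2 by (rule measure_Un_le[OF sets.Int[OF that(1) P] sets.Int[OF that(2) P]])
 show "eventually (\<lambda>t. vol (cbox u v \<inter> pre t (cbox a b)) \<le> vol (cbox a b) * vol (cbox u v) + e) at_top"
  if uv: "cbox u v \<subseteq> Om" and e: "0 < e" for u v e
 proof (cases rule: cbox_cases[of u v])
  case 1
  then show ?thesis using e by simp
 next
  case U: (2 k1 y1 k2 y2)
  show ?thesis
  proof (cases rule: cbox_cases[of a b])
   case 1
   then show ?thesis using e by (simp add: pre_def)
  next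
   case V: (2 j1 h1 j2 h2)
   have "eventually (\<lambda>t. vol (cbox (k1, y1) (k2, y2) \<inter> pre t (cbox (j1, h1) (j2, h2))) \<le>
    ((k2 - k1) * (y2 - y1)) * ((j2 - j1) * (h2 - h1)) + e) at_top"
    by (rule box_bound) (use U V uv B e in auto)
   then show ?thesis unfolding U(4) V(4) unfolding U(1) V(1) by (simp only: mult.commute)
  qed
 qed
qed simp

lemma limsup_sets:
 assumes A: "A \<in> sets lebesgue" "A \<subseteq> Om" and B: "B \<in> sets lebesgue" "B \<subseteq> Om" and e: "0 < e"
 shows "eventually (\<lambda>t. vol (A \<inter> pre t B) \<le> vol A * vol B + e) at_top"
proof (rule limsup_from_boxes[where mm = "\<lambda>t B. vol (A \<inter> pre t B)", OF Om_open _ _ _ _ _ _ B e])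
 have P: "pre t C \<in> sets lebesgue" "pre t C \<in> lmeasurable" "vol (pre t C) = vol C" "A \<inter> pre t C \<in> lmeasurable"
  if "C \<in> sets lebesgue" "C \<subseteq> Om" for t C
 proof -
  have "C \<subseteq> X" using that Om_sub by blast
  then show "pre t C \<in> sets lebesgue" "pre t C \<in> lmeasurable" "vol (pre t C) = vol C"
   using pre_lebesgue(1)[OF that(1)] pre_lmeasurable[OF that(1)] pre_measure[OF that(1)] by simp_all
  then show "A \<inter> pre t C \<in> lmeasurable" using A(1) by (intro fmeasurableI2[of "pre t C" _ "A \<inter> pre t C"]) auto
 qed
 show "Om \<in> lmeasurable" by (rule sub_X) (use Om_open Om_sub in auto)
 show "vol (A \<inter> pre t C) \<le> vol C" if "C \<in> sets lebesgue" "C \<subseteq> Om" for t C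
  unfolding P(3)[OF that, of t, symmetric]
  by (rule measure_mono_fmeasurable[OF Int_lower2 sets.Int[OF A(1) P(1)[OF that]] P(2)[OF that]])
 show "vol (A \<inter> pre t C) \<le> vol (A \<inter> pre t C')"
  if "C \<in> sets lebesgue" "C' \<in> sets lebesgue" "C \<subseteq> C'" "C' \<subseteq> Om" for t C C'
 proof (rule measure_mono_fmeasurable)
  show "A \<inter> pre t C \<subseteq> A \<inter> pre t C'" using that by (auto simp: pre_def)
  show "A \<inter> pre t C \<in> sets lebesgue" by (rule sets.Int[OF A(1) P(1)[OF that(1) order_trans[OF that(3,4)]]])
  show "A \<inter> pre t C' \<in> lmeasurable" by (rule P(4)[OF that(2,4)])
 qed
 show "vol (A \<inter> pre t (C \<union> C')) \<le> vol (A \<inter> pre t C) + vol (A \<inter> pre t C')"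
  if "C \<in> sets lebesgue" "C' \<in> sets lebesgue" "C \<subseteq> Om" "C' \<subseteq> Om" for t C C'
 proof -
  have "A \<inter> pre t (C \<union> C') = (A \<inter> pre t C) \<union> (A \<inter> pre t C')" by (auto simp: pre_def)
  then show ?thesis using measure_Un_le[OF sets.Int[OF A(1) P(1)[OF that(1,3), of t]] sets.Int[OF A(1) P(1)[OF that(2,4), of t]]] by simp
 qed
 show "eventually (\<lambda>t. vol (A \<inter> pre t (cbox u v)) \<le> vol A * vol (cbox u v) + e) at_top"
  if uv: "cbox u v \<subseteq> Om" and e: "0 < e" for u v e
  using limsup_set_box[OF A uv e] by (simp only: mult.commute)
qed simp

lemma limsup_all:
 assumes A: "A \<in> sets lebesgue" "A \<subseteq> X" and B: "B \<in> sets lebesgue" "B \<subseteq> X" and e: "0 < e"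
 shows "eventually (\<lambda>t. vol (A \<inter> pre t B) \<le> vol A * vol B + e) at_top"
proof -
 have OmL: "Om \<in> sets lebesgue" using Om_open by auto
 have null: "vol (C - Om) = 0" "C - Om \<in> sets lebesgue" if "C \<in> sets lebesgue" "C \<subseteq> X" for C
 proof -
  show "C - Om \<in> sets lebesgue" using that OmL by auto
  have "C - Om \<in> null_sets lebesgue"
   by (rule null_sets_subset[OF boundary_null]) (use that OmL in auto)
  then show "vol (C - Om) = 0" by (simp add: measure_eq_0_null_sets)
 qed
 have eq: "vol (C \<inter> Om) = vol C" if "C \<in> sets lebesgue" "C \<subseteq> X" for C
 proof -
  have CU: "(C \<inter> Om) \<union> (C - Om) = C" by blast
  have "vol C = vol ((C \<inter> Om) \<union> (C - Om))" by (simp only: CU)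
  also have "\<dots> \<le> vol (C \<inter> Om) + vol (C - Om)" using that OmL by (intro measure_Un_le) auto
  finally have "vol C \<le> vol (C \<inter> Om)" using null(1)[OF that] by simp
  moreover have "vol (C \<inter> Om) \<le> vol C"
   by (rule measure_mono_fmeasurable[OF Int_lower1 sets.Int[OF that(1) OmL] sub_X[OF that]])
  ultimately show ?thesis by simp
 qed
 have AO: "A \<inter> Om \<in> sets lebesgue" "B \<inter> Om \<in> sets lebesgue" using A B OmL by auto
 from limsup_sets[OF AO(1) _ AO(2) _ e]
 have "eventually (\<lambda>t. vol (A \<inter> Om \<inter> pre t (B \<inter> Om)) \<le> vol A * vol B + e) at_top"
  unfolding eq[OF A] eq[OF B] by blast
 then show ?thesis
 proof eventually_elim
  case (elim t)
  have PB: "pre t (B \<inter> Om) \<in> sets lebesgue" "pre t (B - Om) \<in> sets lebesgue" "vol (pre t (B - Om)) = 0" "pre t B \<in> lmeasurable"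
  proof -
   have s: "B \<inter> Om \<subseteq> X" "B - Om \<subseteq> X" using B by blast+
   show "pre t (B \<inter> Om) \<in> sets lebesgue" by (rule pre_lebesgue(1)[OF AO(2) s(1)])
   show "pre t (B - Om) \<in> sets lebesgue" by (rule pre_lebesgue(1)[OF null(2)[OF B] s(2)])
   show "vol (pre t (B - Om)) = 0" using pre_measure[OF null(2)[OF B] s(2)] null(1)[OF B] by simp
   show "pre t B \<in> lmeasurable" by (rule pre_lmeasurable[OF B])
  qed
  have "vol (A \<inter> pre t B) \<le> vol ((A \<inter> Om \<inter> pre t (B \<inter> Om)) \<union> ((A - Om) \<union> pre t (B - Om)))"
  proof (rule measure_mono_fmeasurable)
   show "A \<inter> pre t B \<subseteq> (A \<inter> Om \<inter> pre t (B \<inter> Om)) \<union> ((A - Om) \<union> pre t (B - Om))" by (auto simp: pre_def)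
   show "(A \<inter> Om \<inter> pre t (B \<inter> Om)) \<union> ((A - Om) \<union> pre t (B - Om)) \<in> lmeasurable"
    by (rule sub_X) (use A AO PB null[OF A] pre_sub in auto)
  qed (use A PB in auto)
  also have "\<dots> \<le> vol (A \<inter> Om \<inter> pre t (B \<inter> Om)) + vol ((A - Om) \<union> pre t (B - Om))"
   using AO PB null(2)[OF A] by (intro measure_Un_le) auto
  also have "vol ((A - Om) \<union> pre t (B - Om)) \<le> vol (A - Om) + vol (pre t (B - Om))"
   using PB null(2)[OF A] by (intro measure_Un_le) auto
  finally show ?case using elim null(1)[OF A] PB(3) by linarith
 qed
qed

text \<open>The upper bound suffices, since it also holds for the complement of \<open>B\<close>.\<close>

lemma mixing: "mixing_flow (suspension_measure f) \<phi>"
 unfolding mixing_flow_def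
proof (intro ballI)
 fix A B assume AB: "A \<in> sets (suspension_measure f)" "B \<in> sets (suspension_measure f)"
 have XL: "X \<in> sets lebesgue" using X_lmeasurable by auto
 have A: "A \<in> sets lebesgue" "A \<subseteq> X" and B: "B \<in> sets lebesgue" "B \<subseteq> X"
  using AB XL by (auto simp: suspension_measure_def sets_restrict_space_iff)
 have mX: "measure (suspension_measure f) C = vol C" if "C \<subseteq> X" for C
  unfolding suspension_measure_def using XL that by (intro measure_restrict_space) auto
 \<comment> \<open>Written as a preimage under the reversed flow, the image has by invariance the
   measure of \<open>A \<inter> pre t B\<close>.\<close>
 have img: "\<phi> t ` A \<inter> B = pre (- t) (A \<inter> pre t B)" for t
 proof -
  have inv: "\<phi> t (\<phi> (- t) p) = p" "\<phi> (- t) (\<phi> t p) = p" if "p \<in> X" for p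
   using suspension_flow_add[OF that, of t "- t"] suspension_flow_add[OF that, of "- t" t] suspension_flow_zero[OF that] by simp_all
  show ?thesis
  proof (intro set_eqI iffI)
   fix p assume "p \<in> \<phi> t ` A \<inter> B"
   then obtain a where a: "a \<in> A" "p = \<phi> t a" "p \<in> B" by blast
   then show "p \<in> pre (- t) (A \<inter> pre t B)" using A B inv(2)[of a] unfolding pre_def by auto
  next
   fix p assume "p \<in> pre (- t) (A \<inter> pre t B)"
   then have p: "p \<in> X" "\<phi> (- t) p \<in> A" "\<phi> t (\<phi> (- t) p) \<in> B" unfolding pre_def by auto
   then show "p \<in> \<phi> t ` A \<inter> B" using inv(1)[OF p(1)] by (metis IntI image_eqI)
  qed
 qed
 have APB: "A \<inter> pre t C \<in> lmeasurable" if "C \<in> sets lebesgue" "C \<subseteq> X" for t C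
  by (rule sub_X) (use A pre_lebesgue(1)[OF that] in auto)
 have mi: "measure (suspension_measure f) (\<phi> t ` A \<inter> B) = vol (A \<inter> pre t B)" for t
 proof -
  have "A \<inter> pre t B \<subseteq> X" using A by blast
  then show ?thesis unfolding img using mX[OF pre_sub] pre_measure APB[OF B] by auto
 qed
 define C where "C = X - B"
 have C: "C \<in> sets lebesgue" "C \<subseteq> X" using B XL by (auto simp: C_def)
 have mC: "vol C = 1 - vol B"
  unfolding C_def using measure_Diff[of lebesgue X B] X_lmeasurable X_one B by (auto simp: fmeasurable_def)
 have split: "vol (A \<inter> pre t B) + vol (A \<inter> pre t C) = vol A" for t
 proof -
  have "A = (A \<inter> pre t B) \<union> (A \<inter> pre t C)"
   using A(2) suspension_flow_in by (auto simp: pre_def C_def)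
  moreover have "vol ((A \<inter> pre t B) \<union> (A \<inter> pre t C)) = vol (A \<inter> pre t B) + vol (A \<inter> pre t C)"
  proof -
   have "(A \<inter> pre t B) \<inter> (A \<inter> pre t C) = {}" by (auto simp: pre_def C_def)
   then show ?thesis using measure_Un3[OF APB[OF B] APB[OF C], of t t] by simp
  qed
  ultimately show ?thesis by simp
 qed
 have "((\<lambda>t. vol (A \<inter> pre t B)) \<longlongrightarrow> vol A * vol B) at_top"
 proof (rule tendstoI)
  fix e :: real assume e: "0 < e"
  then have "0 < e / 2" by simp
  from limsup_all[OF A B this] limsup_all[OF A C this]
  show "eventually (\<lambda>t. dist (vol (A \<inter> pre t B)) (vol A * vol B) < e) at_top"
  proof eventually_elim
   case (elim t)
   have "vol A * vol C = vol A - vol A * vol B"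
    unfolding mC by (simp add: algebra_simps)
   then show ?case using elim split[of t] e by (simp add: dist_real_def abs_less_iff)
  qed
 qed
 then show "((\<lambda>t. measure (suspension_measure f) (\<phi> t ` A \<inter> B)) \<longlongrightarrow> measure (suspension_measure f) A * measure (suspension_measure f) B) at_top"
  unfolding mi mX[OF A(2)] mX[OF B(2)] .
qed

end

theorem theorem1:
 fixes d :: nat and \<pi> :: "nat \<Rightarrow> nat"
 assumes "d \<ge> 2"
  and "\<pi> permutes {1..d}"
  and "irreducible_perm d \<pi>"
 shows "AE l in simplex_lebesgue d.
      \<forall>f. roof_function f \<and> asym_log_singularity f \<longrightarrow>
        mixing_flow (suspension_measure f) (suspension_flow (iet d l \<pi>) f)"
 using AE_admissible[OF assms]
proof (rule AE_mp, intro AE_I2 impI allI)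
 fix l f
 assume "\<exists>D. admissible (iet d l \<pi>) D" and f: "roof_function f \<and> asym_log_singularity f"
 then obtain D where D: "admissible (iet d l \<pi>) D" by blast
 obtain m where m: "m > 0" "\<forall>x\<in>{0..<1}. f x \<ge> m" and int: "set_integrable lebesgue {0..<1} f" "(LINT x:{0..<1}|lebesgue. f x) = 1"
  using f unfolding roof_function_def by blast
 obtain Cp Cm where C: "C2_on f {0<..<1}" "Cp > 0" "Cm > 0" "Cp \<noteq> Cm"
  "((\<lambda>x. x\<^sup>2 * deriv (deriv f) x) \<longlongrightarrow> Cp) (at_right 0)"
  "((\<lambda>x. (1 - x)\<^sup>2 * deriv (deriv f) x) \<longlongrightarrow> Cm) (at_left 1)"
  using f unfolding asym_log_singularity_def by blast
 interpret asym_flow "iet d l \<pi>" f m D Cp Cm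
  by unfold_locales (use D m int C in \<open>auto simp: admissible_def\<close>)
 show "mixing_flow (suspension_measure f) (suspension_flow (iet d l \<pi>) f)" by (rule mixing)
qed

end
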